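(* Let $p$ be an odd prime. The $E(2)$-based Adams $E_2$-term $E_2^0(T(1)/(v_1))$ is isomorphic to $\mathbb{Z}_{(p)}$, and $E_2^1(T(1)/(v_1))$ is the direct sum of the cyclic $\mathbb{Z}_{(p)}$-modules generated by (the images under the connecting homomorphism of) $$v_2^{sp^i}v_3^{tp^j}/p^{1+\min(i,j)}$$ of order $p^{1+\min(i,j)}$, one for each pair of integers $(a,b)=(sp^i,tp^j)\ne(0,0)$ with $a\in\mathbb{Z}$, $b\ge0$, $i=\nu(a)$, $j=\nu(b)$.
   Context: $\nu(\ell)$ is the exponent of the maximal power of $p$ dividing $\ell$, with $\nu(0)=\infty$. $E(2)$ is the Johnson--Wilson spectrum with $E(2)_*=\mathbb{Z}_{(p)}[v_1,v_2^{\pm1}]$. $T(1)$ is the Ravenel spectrum, an associative commutative ring spectrum with $BP_*(T(1))=BP_*[t_1]\subset BP_*(BP)$; $T(1)/(v_1)$ is the cofiber of the self map of $T(1)$ given by $v_1$, so $BP_*(T(1)/(v_1))=BP_*/(v_1)[t_1]$. $E_2^s(X)=\mathrm{Ext}^s_{E(2)_*(E(2))}(E(2)_*,E(2)_*(X))$ is the $E_2$-term of the $E(2)$-based Adams spectral sequence. For $X=T(1)/(v_1)$ this is isomorphic to $\mathrm{Ext}^s_{\Sigma(2,2)}(E_1(2)_*,E_1(2)_*/(v_1))$, where $E_1(2)_*=\mathbb{Z}_{(p)}[v_1,v_2^{\pm1},v_3]$ (a $BP_*$-algebra with $v_k\mapsto0$ for $k>3$) and $\Sigma(2,2)=E_1(2)_*\otimes_{BP_*}BP_*[t_2,t_3,\ldots]\otimes_{BP_*}E_1(2)_*$,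 with Hopf algebroid structure induced from $(BP_*,BP_*(BP)/(t_1))$. The fractions are elements of $\mathrm{Ext}^0_{\Sigma(2,2)}(E_1(2)_*,E_1(2)_*/(p^\infty,v_1))$, where $E_1(2)_*/(p^\infty,v_1)$ is the cokernel of $E_1(2)_*/(v_1)\to p^{-1}E_1(2)_*/(v_1)$, and the connecting homomorphism is that of the short exact sequence $0\to E_1(2)_*/(v_1)\to p^{-1}E_1(2)_*/(v_1)\to E_1(2)_*/(p^\infty,v_1)\to0$. *)

theory Defs
  imports
    "HOL-Algebra.Module"
    "HOL-Library.Poly_Mapping"
    "HOL-Library.Extended_Nat"
    "HOL-Library.FuncSet"
    "HOL-Computational_Algebra.Primes"
begin

section \<open>Modules over the integers localized at p\<close>

definition Zp :: "nat \<Rightarrow> rat set" where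
  "Zp p = {of_int a / of_int b |a b :: int. \<not> int p dvd b}"

definition Zloc :: "nat \<Rightarrow> (rat, rat) module" where
  "Zloc p = \<lparr>carrier = Zp p, monoid.mult = (*), one = 1, zero = 0, add = (+), smult = (*)\<rparr>"

definition mod_iso ::
  "('r, 'k) ring_scheme \<Rightarrow> ('r, 'a, 'm) module_scheme \<Rightarrow> ('r, 'b, 'n) module_scheme \<Rightarrow> ('a \<Rightarrow> 'b) set"
  where
  "mod_iso R M N = {f \<in> iso (add_monoid M) (add_monoid N).
     \<forall>c\<in>carrier R. \<forall>x\<in>carrier M. f (c \<odot>\<^bsub>M\<^esub> x) = c \<odot>\<^bsub>N\<^esub> f x}"

definition cyclic_submodule ::
  "('r, 'k) ring_scheme \<Rightarrow> ('r, 'a, 'm) module_scheme \<Rightarrow> 'a \<Rightarrow> 'a set" where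
  "cyclic_submodule R M g = {c \<odot>\<^bsub>M\<^esub> g |c. c \<in> carrier R}"

definition is_direct_sum ::
  "('r, 'k) ring_scheme \<Rightarrow> ('r, 'a, 'm) module_scheme \<Rightarrow> 'i set \<Rightarrow> ('i \<Rightarrow> 'a set) \<Rightarrow> bool" where
  "is_direct_sum R M I H \<longleftrightarrow>
     (\<forall>i\<in>I. submodule (H i) R M) \<and>
     (\<forall>x\<in>carrier M. \<exists>!f. f \<in> (\<Pi>\<^sub>E i\<in>I. H i) \<and> finite {i\<in>I. f i \<noteq> \<zero>\<^bsub>M\<^esub>} \<and>
        x = finsum M f {i\<in>I. f i \<noteq> \<zero>\<^bsub>M\<^esub>})"

text \<open>The \<open>p\<close>-adic valuation with value \<open>\<infinity>\<close> at \<open>0\<close>.\<close>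

definition nu :: "nat \<Rightarrow> int \<Rightarrow> enat" where
  "nu p l = (if l = 0 then \<infinity> else enat (multiplicity (int p) l))"


section \<open>Polynomial rings\<close>

text \<open>
  The generators of the rings in the cobar complexes below: \<open>V i k\<close> is the \<open>i\<close>-th copy of \<open>v\<^sub>k\<close>,
  \<open>W i\<close> is the inverse of the \<open>i\<close>-th copy of \<open>v\<^sub>2\<close>, and \<open>T i k\<close> is \<open>t\<^sub>k\<close> in the \<open>i\<close>-th tensor factor.
  Polynomials have rational coefficients; coefficient rings are cut out by \<open>polys\<close>.
\<close>

datatype gen = V nat nat | W nat | T nat nat

type_synonym pol = "(gen \<Rightarrow>\<^sub>0 nat) \<Rightarrow>\<^sub>0 rat"

definition cst :: "rat \<Rightarrow> pol" where
  "cst c = Poly_Mapping.single 0 c"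

definition Var :: "gen \<Rightarrow> pol" where
  "Var g = Poly_Mapping.single (Poly_Mapping.single g 1) 1"

definition polys :: "rat set \<Rightarrow> gen set \<Rightarrow> pol set" where
  "polys K G = {f. \<forall>m\<in>Poly_Mapping.keys f. Poly_Mapping.lookup f m \<in> K \<and> Poly_Mapping.keys m \<subseteq> G}"

definition subst :: "(gen \<Rightarrow> pol) \<Rightarrow> pol \<Rightarrow> pol" where
  "subst \<sigma> f = (\<Sum>m\<in>Poly_Mapping.keys f. cst (Poly_Mapping.lookup f m) *
      (\<Prod>g\<in>Poly_Mapping.keys m. \<sigma> g ^ Poly_Mapping.lookup m g))"

definition ideal_of :: "pol set \<Rightarrow> pol set \<Rightarrow> pol set" where
  "ideal_of R S = {\<Sum>g\<in>F. c g * g |F c. finite F \<and> F \<subseteq> S \<and> (\<forall>g\<in>F. c g \<in> R)}"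


section \<open>The structure maps of \<open>BP\<^sub>*(BP)\<close>\<close>

text \<open>
  \<open>BP\<^sub>* = \<int>\<^sub>(\<^sub>p\<^sub>)[v\<^sub>1, v\<^sub>2, \<dots>]\<close> on the Hazewinkel generators and \<open>BP\<^sub>*(BP) = BP\<^sub>*[t\<^sub>1, t\<^sub>2, \<dots>]\<close>. The logarithm
  coefficients \<open>\<ell>\<^sub>n\<close> satisfy \<open>p \<ell>\<^sub>n = \<Sum>\<^bsub>i<n\<^esub> \<ell>\<^sub>i v\<^bsub>n-i\<^esub>^(p^i)\<close>, and the right unit and the coproduct are
  determined by
    \<open>\<eta>\<^sub>R(\<ell>\<^sub>n) = \<Sum>\<^bsub>i\<le>n\<^esub> \<ell>\<^sub>i t\<^bsub>n-i\<^esub>^(p^i)\<close> and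
    \<open>\<Sum>\<^bsub>a+b=n\<^esub> \<ell>\<^sub>a \<Delta>(t\<^sub>b)^(p^a) = \<Sum>\<^bsub>a+b+c=n\<^esub> \<ell>\<^sub>a t\<^sub>b^(p^a) \<otimes> t\<^sub>c^(p^(a+b))\<close>, with \<open>t\<^sub>0 = 1\<close>.
  Here \<open>v\<close>, \<open>t\<close> and \<open>t'\<close> are the polynomials put in place of the generators (\<open>t'\<close> being those of the
  second tensor factor), and \<open>t 0 = t' 0 = 1\<close>.
\<close>

fun ell :: "nat \<Rightarrow> (nat \<Rightarrow> pol) \<Rightarrow> nat \<Rightarrow> pol" where
  "ell p v n = (if n = 0 then 1
     else cst (1 / of_nat p) * (\<Sum>i<n. ell p v i * v (n - i) ^ (p ^ i)))"

declare ell.simps [simp del]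

definition etaR_ell :: "nat \<Rightarrow> (nat \<Rightarrow> pol) \<Rightarrow> (nat \<Rightarrow> pol) \<Rightarrow> nat \<Rightarrow> pol" where
  "etaR_ell p v t n = (\<Sum>i\<le>n. ell p v i * t (n - i) ^ (p ^ i))"

text \<open>\<open>etaR p v t n\<close> is \<open>\<eta>\<^sub>R(v\<^sub>n)\<close> for \<open>n \<ge> 1\<close>.\<close>

fun etaR :: "nat \<Rightarrow> (nat \<Rightarrow> pol) \<Rightarrow> (nat \<Rightarrow> pol) \<Rightarrow> nat \<Rightarrow> pol" where
  "etaR p v t n = cst (of_nat p) * etaR_ell p v t n -
     (\<Sum>i\<in>{1..<n}. etaR_ell p v t i * etaR p v t (n - i) ^ (p ^ i))"

declare etaR.simps [simp del]

fun Delta :: "nat \<Rightarrow> (nat \<Rightarrow> pol) \<Rightarrow> (nat \<Rightarrow> pol) \<Rightarrow> (nat \<Rightarrow> pol) \<Rightarrow> nat \<Rightarrow> pol" where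
  "Delta p v t t' n =
     (\<Sum>a\<le>n. \<Sum>b\<le>n - a. ell p v a * t b ^ (p ^ a) * t' (n - a - b) ^ (p ^ (a + b))) -
     (\<Sum>a\<in>{1..n}. ell p v a * Delta p v t t' (n - a) ^ (p ^ a))"

declare Delta.simps [simp del]


section \<open>Cobar complexes\<close>

text \<open>
  Let \<open>B = \<int>\<^sub>(\<^sub>p\<^sub>)[v\<^sub>1, v\<^sub>2\<^sup>\<plusminus>\<^sup>1, v\<^sub>3, \<dots>, v\<^sub>N]\<close>, a \<open>BP\<^sub>*\<close>-algebra with \<open>v\<^sub>k \<mapsto> 0\<close> for \<open>k > N\<close>, and
    \<open>\<Gamma> = B \<otimes> BP\<^sub>*(BP)/(t\<^sub>1, \<dots>, t\<^sub>r) \<otimes> B\<close> (tensor products over \<open>BP\<^sub>*\<close>),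
  a Hopf algebroid over \<open>B\<close> with structure induced from \<open>(BP\<^sub>*, BP\<^sub>*(BP)/(t\<^sub>1, \<dots>, t\<^sub>r))\<close>. Then
  \<open>N = 2, r = 0\<close> gives \<open>(E(2)\<^sub>*, E(2)\<^sub>*(E(2)))\<close>, and \<open>N = 3, r = 1\<close> gives \<open>(E\<^sub>1(2)\<^sub>*, \<Sigma>(2,2))\<close>.

  Let \<open>M = B \<otimes> BP\<^sub>*[t\<^sub>1, \<dots>, t\<^sub>m]/(\<eta>\<^sub>R(v\<^sub>1))\<close>, a left \<open>\<Gamma>\<close>-comodule by the coproduct on the \<open>t\<^sub>k\<close>.
  For \<open>m = 0\<close> (and \<open>r \<ge> 1\<close>) this is \<open>B/(v\<^sub>1)\<close>.
  For \<open>m = 1\<close> and \<open>r = 0\<close> it is \<open>B \<otimes> BP\<^sub>*(T(1)/(v\<^sub>1))\<close>: the class \<open>v\<^sub>1 \<in> \<pi>\<^sub>*(T(1))\<close> acts on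
  \<open>BP\<^sub>*(T(1)) = BP\<^sub>*[t\<^sub>1] \<subset> BP\<^sub>*(BP)\<close> by multiplication with its Hurewicz image, the primitive element
  \<open>\<eta>\<^sub>R(v\<^sub>1) = v\<^sub>1 + p t\<^sub>1\<close> (multiplication by the coefficient \<open>v\<^sub>1\<close> is not a comodule map).

  The \<open>s\<close>-th cobar module \<open>\<Gamma> \<otimes>\<^sub>B \<dots> \<otimes>\<^sub>B \<Gamma> \<otimes>\<^sub>B M\<close> (\<open>s\<close> factors \<open>\<Gamma>\<close>) is presented as a quotient ring
  \<open>cochains/null\<close>. The copies of \<open>B\<close> are numbered \<open>0, \<dots>, s\<close>: the \<open>i\<close>-th factor \<open>\<Gamma>\<close> (\<open>1 \<le> i \<le> s\<close>) has
  \<open>V (i - 1) k\<close> as its left \<open>v\<^sub>k\<close>, \<open>V i k\<close> as its right \<open>v\<^sub>k\<close>, and \<open>T i k\<close> as its \<open>t\<^sub>k\<close>;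
  the generators of \<open>M\<close> are \<open>V s k\<close> and \<open>T (s + 1) k\<close>. Forming \<open>\<dots> \<otimes> B\<close> over \<open>BP\<^sub>*\<close>
  identifies \<open>\<eta>\<^sub>R(v\<^sub>k)\<close> with the right copy of \<open>v\<^sub>k\<close>, for all \<open>k \<ge> 1\<close>.
\<close>

definition vgen :: "nat \<Rightarrow> nat \<Rightarrow> nat \<Rightarrow> pol" where
  "vgen N i k = (if 1 \<le> k \<and> k \<le> N then Var (V i k) else 0)"

definition tgen :: "nat \<Rightarrow> nat \<Rightarrow> nat \<Rightarrow> pol" where
  "tgen r i k = (if k = 0 then 1 else if k \<le> r then 0 else Var (T i k))"

definition mgen :: "nat \<Rightarrow> nat \<Rightarrow> nat \<Rightarrow> pol" where
  "mgen m i k = (if k = 0 then 1 else if k \<le> m then Var (T i k) else 0)"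

definition gens :: "nat \<Rightarrow> nat \<Rightarrow> nat \<Rightarrow> nat \<Rightarrow> gen set" where
  "gens N r m s = {V i k |i k. i \<le> s \<and> 1 \<le> k \<and> k \<le> N} \<union> {W i |i. i \<le> s} \<union>
     {T i k |i k. 1 \<le> i \<and> i \<le> s \<and> r < k} \<union> {T (s + 1) k |k. 1 \<le> k \<and> k \<le> m}"

definition rels :: "nat \<Rightarrow> nat \<Rightarrow> nat \<Rightarrow> nat \<Rightarrow> nat \<Rightarrow> pol set" where
  "rels p N r m s =
     {Var (W i) * Var (V i 2) - 1 |i. i \<le> s} \<union>
     {etaR p (vgen N i) (tgen r (i + 1)) k - vgen N (i + 1) k |i k. i < s \<and> 1 \<le> k} \<union>
     {etaR p (vgen N s) (mgen m (s + 1)) 1}"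

text \<open>\<open>K = \<int>\<^sub>(\<^sub>p\<^sub>)\<close> gives the cobar complex of \<open>M\<close>, and \<open>K = \<rat>\<close> that of \<open>p\<^sup>-\<^sup>1M\<close>.\<close>

definition cochains :: "rat set \<Rightarrow> nat \<Rightarrow> nat \<Rightarrow> nat \<Rightarrow> nat \<Rightarrow> pol set" where
  "cochains K N r m s = polys K (gens N r m s)"

definition null :: "rat set \<Rightarrow> nat \<Rightarrow> nat \<Rightarrow> nat \<Rightarrow> nat \<Rightarrow> nat \<Rightarrow> pol set" where
  "null K p N r m s = ideal_of (cochains K N r m s) (rels p N r m s)"

text \<open>
  The \<open>i\<close>-th coface from degree \<open>s\<close> to degree \<open>s + 1\<close>: for \<open>i = 0\<close> it is \<open>x \<mapsto> 1 \<otimes> x\<close>, for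
  \<open>1 \<le> i \<le> s\<close> it applies the coproduct to the \<open>i\<close>-th factor \<open>\<Gamma>\<close>, and for \<open>i = s + 1\<close> it applies the
  coaction to \<open>M\<close>.
\<close>

fun coface_gen :: "nat \<Rightarrow> nat \<Rightarrow> nat \<Rightarrow> nat \<Rightarrow> nat \<Rightarrow> nat \<Rightarrow> gen \<Rightarrow> pol" where
  "coface_gen p N r m s i (V a k) = Var (V (if a < i then a else a + 1) k)"
| "coface_gen p N r m s i (W a) = Var (W (if a < i then a else a + 1))"
| "coface_gen p N r m s i (T a k) =
     (if a < i then Var (T a k)
      else if a > i then Var (T (a + 1) k)
      else Delta p (vgen N (i - 1)) (tgen r i)
             (if i \<le> s then tgen r (i + 1) else mgen m (i + 1)) k)"

definition cobar_d :: "nat \<Rightarrow> nat \<Rightarrow> nat \<Rightarrow> nat \<Rightarrow> nat \<Rightarrow> pol \<Rightarrow> pol" where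
  "cobar_d p N r m s f = (\<Sum>i\<le>s + 1. (- 1) ^ i * subst (coface_gen p N r m s i) f)"


section \<open>Cohomology\<close>

definition coset :: "pol set \<Rightarrow> pol \<Rightarrow> pol set" where
  "coset B x = {x + b |b. b \<in> B}"

text \<open>The module \<open>Z/B\<close>, for \<open>B \<subseteq> Z\<close>; its multiplicative structure is irrelevant.\<close>

definition quot :: "pol set \<Rightarrow> pol set \<Rightarrow> (rat, pol set) module" where
  "quot Z B = \<lparr>carrier = coset B ` Z, monoid.mult = undefined, one = undefined, zero = B,
     add = (\<lambda>S S'. {x + y |x y. x \<in> S \<and> y \<in> S'}),
     smult = (\<lambda>c S. {cst c * x + b |x b. x \<in> S \<and> b \<in> B})\<rparr>"

text \<open>
  The \<open>s\<close>-th cohomology of the complex with terms \<open>C n/I n\<close> and differential induced by \<open>d n\<close>.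
\<close>

definition cohomology ::
  "(nat \<Rightarrow> pol set) \<Rightarrow> (nat \<Rightarrow> pol set) \<Rightarrow> (nat \<Rightarrow> pol \<Rightarrow> pol) \<Rightarrow> nat \<Rightarrow> (rat, pol set) module" where
  "cohomology C I d s = quot {f \<in> C s. d s f \<in> I (s + 1)}
     {g + h |g h. g \<in> I s \<and> h \<in> (if s = 0 then {0} else d (s - 1) ` C (s - 1))}"

text \<open>\<open>Ext\<^sup>s\<^sub>\<Gamma>(B, M)\<close>, as the cohomology of the cobar complex of \<open>M\<close>.\<close>

definition Ext :: "nat \<Rightarrow> nat \<Rightarrow> nat \<Rightarrow> nat \<Rightarrow> nat \<Rightarrow> (rat, pol set) module" where
  "Ext p N r m s = cohomology (cochains (Zp p) N r m) (null (Zp p) p N r m) (cobar_d p N r m) s"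

text \<open>
  \<open>Ext\<^sup>s\<^sub>\<Gamma>(B, M/(p\<^sup>\<infinity>))\<close>, where \<open>M/(p\<^sup>\<infinity>)\<close> is the cokernel of \<open>M \<rightarrow> p\<^sup>-\<^sup>1M\<close>; by right exactness, its cobar
  modules are the cokernels of the maps from the cobar modules of \<open>M\<close> to those of \<open>p\<^sup>-\<^sup>1M\<close>.
\<close>

definition Ext_pinf :: "nat \<Rightarrow> nat \<Rightarrow> nat \<Rightarrow> nat \<Rightarrow> nat \<Rightarrow> (rat, pol set) module" where
  "Ext_pinf p N r m s = cohomology (cochains UNIV N r m)
     (\<lambda>n. {f + g |f g. f \<in> null UNIV p N r m n \<and> g \<in> cochains (Zp p) N r m n})
     (cobar_d p N r m) s"

text \<open>
  The connecting homomorphism from \<open>Ext\<^sup>s(M/(p\<^sup>\<infinity>))\<close> to \<open>Ext\<^sup>s\<^sup>+\<^sup>1(M)\<close>: the cochains \<open>y\<close> over \<open>M\<close> whose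
  image over \<open>p\<^sup>-\<^sup>1M\<close> is the coboundary of a representative \<open>x\<close> of the given class. By exactness
  they form a single cohomology class.
\<close>

definition connecting :: "nat \<Rightarrow> nat \<Rightarrow> nat \<Rightarrow> nat \<Rightarrow> nat \<Rightarrow> pol set \<Rightarrow> pol set" where
  "connecting p N r m s S = {y \<in> cochains (Zp p) N r m (s + 1).
     \<exists>x\<in>S. cobar_d p N r m s x - y \<in> null UNIV p N r m (s + 1)}"

text \<open>\<open>E\<^sub>2\<^sup>s(T(1)/(v\<^sub>1)) = Ext\<^sup>s(E(2)\<^sub>*, E(2)\<^sub>*(T(1)/(v\<^sub>1)))\<close> over \<open>E(2)\<^sub>*(E(2))\<close>.\<close>

definition E2_term :: "nat \<Rightarrow> nat \<Rightarrow> (rat, pol set) module" where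
  "E2_term p s = Ext p 2 0 1 s"

text \<open>\<open>Ext\<^sup>s(E\<^sub>1(2)\<^sub>*, E\<^sub>1(2)\<^sub>*/(v\<^sub>1))\<close> and \<open>Ext\<^sup>s(E\<^sub>1(2)\<^sub>*, E\<^sub>1(2)\<^sub>*/(p\<^sup>\<infinity>, v\<^sub>1))\<close> over \<open>\<Sigma>(2,2)\<close>.\<close>

definition Ext_Sigma :: "nat \<Rightarrow> nat \<Rightarrow> (rat, pol set) module" where
  "Ext_Sigma p s = Ext p 3 1 0 s"

definition Ext_Sigma_pinf :: "nat \<Rightarrow> nat \<Rightarrow> (rat, pol set) module" where
  "Ext_Sigma_pinf p s = Ext_pinf p 3 1 0 s"

definition delta_Sigma :: "nat \<Rightarrow> pol set \<Rightarrow> pol set" where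
  "delta_Sigma p = connecting p 3 1 0 0"

text \<open>The exponent \<open>1 + min(i, j)\<close> for \<open>a = sp\<^sup>i\<close> and \<open>b = tp\<^sup>j\<close>.\<close>

definition expo :: "nat \<Rightarrow> int \<Rightarrow> nat \<Rightarrow> nat" where
  "expo p a b = the_enat (1 + min (nu p a) (nu p (int b)))"

text \<open>The class of \<open>v\<^sub>2\<^sup>a v\<^sub>3\<^sup>b / p^(1 + min(i, j))\<close> in \<open>E\<^sub>1(2)\<^sub>*/(p\<^sup>\<infinity>, v\<^sub>1)\<close>.\<close>

definition vfrac :: "nat \<Rightarrow> int \<Rightarrow> nat \<Rightarrow> pol set" where
  "vfrac p a b = coset (zero (Ext_Sigma_pinf p 0))
     (cst (1 / of_nat p ^ expo p a b) *
      (if 0 \<le> a then Var (V 0 2) ^ nat a else Var (W 0) ^ nat (- a)) * Var (V 0 3) ^ b)"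

end

theory Submission
  imports Defs "HOL-Computational_Algebra.Polynomial"
begin

text \<open>
  Both sides are the cohomology of a cobar complex, with \<open>(N, r, m) = (2, 0, 1)\<close> for \<open>T(1)/(v\<^sub>1)\<close> and
  \<open>(3, 1, 0)\<close> for \<open>\<Sigma>(2,2)\<close>, and one argument computes both. After inverting \<open>p\<close> the complex is acyclic
  with \<open>H\<^sup>0 = \<rat>\<close>, because all formal group laws become strictly isomorphic. Integrally the cobar rings
  are \<open>p\<close>-torsion free, and modulo \<open>p\<close> they are iterated monic extensions of a Laurent polynomial
  ring, so that divisibility by \<open>p\<close> can be read off from coefficients.

  Besides \<open>v\<^sub>2\<close> there is a second element \<open>\<omega>\<close> that is invariant modulo \<open>p\<close>: it is \<open>v\<^sub>3\<close> for \<open>\<Sigma>(2,2)\<close> and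
  \<open>v\<^sub>2 t\<^sub>1^(p\<^sup>2) - v\<^sub>2^p t\<^sub>1\<close> for \<open>T(1)/(v\<^sub>1)\<close>. One has \<open>d v\<^sub>2 = p \<tau>\<^sub>2\<close> and \<open>d \<omega> = p \<tau>\<^sub>3\<close>, where \<open>\<tau>\<^sub>k\<close> is
  \<open>t\<^sub>k\<close> plus terms in lower variables. For odd \<open>p\<close> the binomial theorem therefore gives
  \<open>d (v\<^sub>2^a \<omega>^b) = p^e y\<close> with \<open>e = 1 + min(\<nu>(a), \<nu>(b))\<close> and
  \<open>y \<equiv> a' v\<^sub>2^(a-1) \<omega>^b \<tau>\<^sub>2 + b' v\<^sub>2^a \<omega>^(b-1) \<tau>\<^sub>3\<close> modulo \<open>p\<close>, where \<open>a'\<close> and \<open>b'\<close> are \<open>a\<close> and \<open>b\<close> divided by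
  \<open>p^(e-1)\<close>, not both divisible by \<open>p\<close>. Comparing the coefficients of \<open>t\<^sub>3\<close> and \<open>t\<^sub>2\<close> shows that the cocycles \<open>y\<close>
  are linearly independent modulo \<open>p\<close> and coboundaries. As the \<open>v\<^sub>2^a \<omega>^b\<close> span the invariants modulo \<open>p\<close>,
  a Bockstein argument shows that \<open>H\<^sup>1\<close> is the direct sum of the cyclic modules generated by the \<open>y\<close>,
  of order \<open>p^e\<close>. This presentation is the same in both cases, and for \<open>\<Sigma>(2,2)\<close> the class of \<open>y\<close> is the
  image of \<open>v\<^sub>2^a v\<^sub>3^b / p^e\<close> under the connecting homomorphism.
\<close>

section \<open>Polynomial rings and ideals\<close>

text \<open>The structure maps are recursions with denominators, and each cobar ring in positive
  degree has infinitely many relations. The proof separates these difficulties. Identities are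
  verified over the rationals, where the logarithm turns the right unit and the coproduct into
  explicit sums, and they return to \<open>Z_(p)\<close> by torsion-freeness. Beyond
  \<open>v_3\<close> only the leading term of \<open>eta_R(v_n)\<close> modulo \<open>p\<close>
  enters. The element \<open>v_2 t_1^(p^2) - v_2^p t_1\<close> is what \<open>eta_R(v_3)\<close>
  becomes in \<open>BP_*[t_1]\<close> modulo \<open>p\<close> and \<open>v_1\<close> once
  \<open>v_3\<close> is set to 0; hence it does for \<open>T(1)/(v_1)\<close> what
  \<open>v_3\<close> does for \<open>\<Sigma>(2,2)\<close>. Comparing the two presentations then
  takes the place of a change-of-rings argument. Oddness of \<open>p\<close> enters twice:
  \<open>p^(k-2)/k\<close> lies in \<open>Z_(p)\<close> for \<open>k >= 2\<close>, so the terms of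
  order at least 2 in the binomial expansion of \<open>(x + p \<tau>)^n\<close> are divisible by
  \<open>n p^2\<close>; and \<open>(- x)^(p+1) = x^(p+1)\<close> fixes signs in
  \<open>eta_R(v_2)\<close> and \<open>eta_R(v_3)\<close>. The summand 1 in the exponent
  \<open>e\<close> is the factor \<open>p\<close> in \<open>d v_2\<close> and
  \<open>d \<omega>\<close>.\<close>

definition geval :: "(rat \<Rightarrow> 'a::comm_ring_1) \<Rightarrow> (gen \<Rightarrow> 'a) \<Rightarrow> pol \<Rightarrow> 'a" where
  "geval h \<sigma> f = (\<Sum>m\<in>Poly_Mapping.keys f. h (Poly_Mapping.lookup f m) *
      (\<Prod>g\<in>Poly_Mapping.keys m. \<sigma> g ^ Poly_Mapping.lookup m g))"

definition mon :: "(gen \<Rightarrow> 'a::comm_ring_1) \<Rightarrow> (gen \<Rightarrow>\<^sub>0 nat) \<Rightarrow> 'a" where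
  "mon \<sigma> m = (\<Prod>g\<in>Poly_Mapping.keys m. \<sigma> g ^ Poly_Mapping.lookup m g)"

locale ring_hom_on =
  fixes h :: "'a::comm_ring_1 \<Rightarrow> 'b::comm_ring_1"
  assumes hom_add: "h (x + y) = h x + h y" and hom_mult: "h (x * y) = h x * h y" and hom_one: "h 1 = 1"
begin

lemma hom_zero: "h 0 = 0"
  using hom_add[of 0 0] by simp

lemma hom_uminus: "h (- x) = - h x"
  using hom_add[of x "- x"] hom_zero by (simp add: eq_neg_iff_add_eq_0 add.commute)

lemma hom_diff: "h (x - y) = h x - h y"
  using hom_add[of x "- y"] hom_uminus by simp

lemma hom_sum: "h (sum f A) = (\<Sum>a\<in>A. h (f a))"
  by (induction A rule: infinite_finite_induct) (auto simp: hom_zero hom_add)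

lemma hom_prod: "h (prod f A) = (\<Prod>a\<in>A. h (f a))"
  by (induction A rule: infinite_finite_induct) (auto simp: hom_one hom_mult)

lemma hom_power: "h (x ^ n) = h x ^ n"
  by (induction n) (auto simp: hom_one hom_mult)

lemma hom_of_nat: "h (of_nat n) = of_nat n"
  by (induction n) (auto simp: hom_zero hom_add hom_one)

lemmas hom_simps = hom_add hom_mult hom_one hom_zero hom_uminus hom_diff hom_sum hom_prod hom_power hom_of_nat

end

lemma mon_superset:
  assumes "finite A" "Poly_Mapping.keys m \<subseteq> A"
  shows "mon \<sigma> m = (\<Prod>g\<in>A. \<sigma> g ^ Poly_Mapping.lookup m g)"
  unfolding mon_def
  by (rule prod.mono_neutral_left) (use assms in \<open>auto simp: in_keys_iff\<close>)

lemma mon_add: "mon \<sigma> (m + m') = mon \<sigma> m * mon \<sigma> m'"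
proof -
  let ?A = "Poly_Mapping.keys m \<union> Poly_Mapping.keys m'"
  have "mon \<sigma> (m + m') = (\<Prod>g\<in>?A. \<sigma> g ^ Poly_Mapping.lookup (m + m') g)"
    by (rule mon_superset) (auto dest: set_mp[OF Poly_Mapping.keys_add])
  also have "\<dots> = (\<Prod>g\<in>?A. \<sigma> g ^ Poly_Mapping.lookup m g) * (\<Prod>g\<in>?A. \<sigma> g ^ Poly_Mapping.lookup m' g)"
    by (simp add: lookup_add power_add prod.distrib)
  also have "\<dots> = mon \<sigma> m * mon \<sigma> m'"
    by (simp add: mon_superset[of ?A])
  finally show ?thesis .
qed

lemma mon_zero [simp]: "mon \<sigma> 0 = 1"
  by (simp add: mon_def)

lemma mon_single [simp]: "mon \<sigma> (Poly_Mapping.single g n) = \<sigma> g ^ n"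
  by (cases "n = 0") (auto simp: mon_def)

lemma geval_superset:
  assumes "h 0 = 0" "finite A" "Poly_Mapping.keys f \<subseteq> A"
  shows "geval h \<sigma> f = (\<Sum>m\<in>A. h (Poly_Mapping.lookup f m) * mon \<sigma> m)"
  unfolding geval_def mon_def
  by (rule sum.mono_neutral_left) (use assms in \<open>auto simp: in_keys_iff\<close>)

lemma geval_single:
  assumes "h 0 = 0"
  shows "geval h \<sigma> (Poly_Mapping.single m c) = h c * mon \<sigma> m"
  using geval_superset[of h "{m}" "Poly_Mapping.single m c" \<sigma>] assms by simp

lemma pol_single_sum: "f = (\<Sum>m\<in>Poly_Mapping.keys f. Poly_Mapping.single m (Poly_Mapping.lookup f m))"
  by (rule poly_mapping_eqI)
    (simp add: lookup_sum lookup_single when_def in_keys_iff)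

lemma pol_induct [case_names zero single add]:
  fixes f :: "'a \<Rightarrow>\<^sub>0 'b::comm_monoid_add"
  assumes "P 0" "\<And>m c. P (Poly_Mapping.single m c)" "\<And>f g. P f \<Longrightarrow> P g \<Longrightarrow> P (f + g)"
  shows "P f"
proof -
  have "P (\<Sum>m\<in>A. Poly_Mapping.single m (Poly_Mapping.lookup f m))" if "finite A" for A
    using that by (induction A rule: finite_induct) (auto intro: assms)
  from this[of "Poly_Mapping.keys f"] show ?thesis
    by (subst pol_single_sum) simp
qed

lemma geval_add:
  assumes "ring_hom_on h"
  shows "geval h \<sigma> (f + g) = geval h \<sigma> f + geval h \<sigma> g"
proof -
  interpret ring_hom_on h by fact
  let ?A = "Poly_Mapping.keys f \<union> Poly_Mapping.keys g"
  have sub: "Poly_Mapping.keys (f + g) \<subseteq> ?A"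
    by (rule Poly_Mapping.keys_add)
  show ?thesis
    using geval_superset[of h ?A f \<sigma>] geval_superset[of h ?A g \<sigma>] geval_superset[of h ?A "f + g" \<sigma>] sub
    by (simp add: hom_zero hom_add lookup_add distrib_right sum.distrib)
qed

text \<open>The coefficient homomorphism \<open>h\<close> is arbitrary so that substitution, the
  expansion in one variable (\<open>coeffs_in\<close>) and the evaluation in Laurent polynomials
  (\<open>Phi\<close>) are all instances.\<close>

lemma ring_hom_geval:
  assumes "ring_hom_on h"
  shows "ring_hom_on (geval h \<sigma>)"
proof (rule ring_hom_on.intro)
  interpret ring_hom_on h by fact
  have s: "geval h \<sigma> (Poly_Mapping.single m c) = h c * mon \<sigma> m" for m c
    by (rule geval_single) (rule hom_zero)
  show a: "geval h \<sigma> (x + y) = geval h \<sigma> x + geval h \<sigma> y" for x y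
    by (rule geval_add[OF assms])
  show "geval h \<sigma> 1 = 1"
    using s[of 0 1] by (simp add: hom_one)
  have z: "geval h \<sigma> 0 = 0"
    by (simp add: geval_def)
  have ss: "geval h \<sigma> (Poly_Mapping.single m c * y) = geval h \<sigma> (Poly_Mapping.single m c) * geval h \<sigma> y" for m c y
    by (induction y rule: pol_induct)
      (simp_all add: z s mult_single hom_mult mon_add a distrib_left mult.assoc mult.left_commute)
  show "geval h \<sigma> (x * y) = geval h \<sigma> x * geval h \<sigma> y" for x y
    by (induction x rule: pol_induct) (simp_all add: z ss a distrib_right)
qed

lemma geval_cst: "ring_hom_on h \<Longrightarrow> geval h \<sigma> (cst c) = h c"
  by (simp add: cst_def geval_single ring_hom_on.hom_zero)

lemma geval_Var: "ring_hom_on h \<Longrightarrow> geval h \<sigma> (Var g) = \<sigma> g"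
  by (simp add: Var_def geval_single ring_hom_on.hom_zero ring_hom_on.hom_one)

lemma single_eq_mon: "Poly_Mapping.single m c = cst c * mon Var m"
proof -
  have "mon Var m = Poly_Mapping.single m 1" for m
  proof -
    have p: "Var g ^ n = Poly_Mapping.single (Poly_Mapping.single g n) 1" for g n
      by (induction n) (auto simp: Var_def mult_single single_add[symmetric])
    have q: "(\<Prod>g\<in>A. Poly_Mapping.single (Poly_Mapping.single g (Poly_Mapping.lookup m g)) 1) =
          (Poly_Mapping.single (\<Sum>g\<in>A. Poly_Mapping.single g (Poly_Mapping.lookup m g)) 1 :: pol)"
      if "finite A" for A
      using that by (induction A rule: finite_induct) (auto simp: mult_single)
    show ?thesis
      unfolding mon_def p q[OF finite_keys] by (rule arg_cong[where f = "\<lambda>m. Poly_Mapping.single m 1", OF pol_single_sum[symmetric]])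
  qed
  then show ?thesis
    by (simp add: cst_def mult_single)
qed

lemma pol_gen_induct [case_names cst Var add mult]:
  assumes "\<And>c. P (cst c)" "\<And>g. P (Var g)" "\<And>f g. P f \<Longrightarrow> P g \<Longrightarrow> P (f + g)"
    "\<And>f g. P f \<Longrightarrow> P g \<Longrightarrow> P (f * g)"
  shows "P f"
proof (induction f rule: pol_induct)
  case zero
  then show ?case using assms(1)[of 0] by (simp add: cst_def)
next
  case (single m c)
  have 1: "P 1" using assms(1)[of 1] by (simp add: cst_def)
  have pw: "P (Var g ^ n)" for g n
    by (induction n) (auto intro: 1 assms)
  have "P (\<Prod>g\<in>A. Var g ^ Poly_Mapping.lookup m g)" if "finite A" for A
    using that by (induction A rule: finite_induct) (auto intro: 1 assms pw)
  then have "P (mon Var m)" by (simp add: mon_def)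
  then show ?case by (simp add: single_eq_mon assms)
next
  case (add f g)
  then show ?case by (rule assms)
qed

interpretation cst: ring_hom_on cst
  by standard (auto simp: cst_def single_add mult_single)

lemma subst_geval: "subst \<sigma> = geval cst \<sigma>"
  by (simp add: subst_def geval_def fun_eq_iff)

interpretation subst: ring_hom_on "subst \<sigma>" for \<sigma>
  unfolding subst_geval by (rule ring_hom_geval) (rule cst.ring_hom_on_axioms)

lemma subst_cst [simp]: "subst \<sigma> (cst c) = cst c"
  by (simp add: subst_geval geval_cst cst.ring_hom_on_axioms)

lemma subst_Var [simp]: "subst \<sigma> (Var g) = \<sigma> g"
  by (simp add: subst_geval geval_Var cst.ring_hom_on_axioms)

lemma ring_hom_eqI:
  assumes "ring_hom_on h" "ring_hom_on k" "\<And>c. h (cst c) = k (cst c)" "\<And>g. h (Var g) = k (Var g)"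
  shows "h f = k f"
proof -
  interpret h: ring_hom_on h by fact
  interpret k: ring_hom_on k by fact
  show ?thesis
    by (induction f rule: pol_gen_induct) (auto simp: assms(3,4) h.hom_simps k.hom_simps)
qed

lemma ring_hom_comp:
  assumes "ring_hom_on h" "ring_hom_on k" shows "ring_hom_on (\<lambda>x. h (k x))"
proof -
  interpret h: ring_hom_on h by fact
  interpret k: ring_hom_on k by fact
  show ?thesis by standard (auto simp: h.hom_simps k.hom_simps)
qed

lemma subst_subst: "subst \<sigma> (subst \<tau> f) = subst (\<lambda>g. subst \<sigma> (\<tau> g)) f"
  by (rule ring_hom_eqI[where h = "\<lambda>f. subst \<sigma> (subst \<tau> f)"])
    (simp_all add: ring_hom_comp[OF subst.ring_hom_on_axioms subst.ring_hom_on_axioms]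
      subst.ring_hom_on_axioms)

lemma subst_Var_id [simp]: "subst Var f = f"
  by (induction f rule: pol_gen_induct) (auto simp: subst.hom_simps)

lemma geval_hom:
  assumes "ring_hom_on h" "ring_hom_on k"
  shows "k (geval h \<sigma> f) = geval (\<lambda>c. k (h c)) (\<lambda>g. k (\<sigma> g)) f"
proof -
  interpret k: ring_hom_on k by fact
  show ?thesis by (simp add: geval_def k.hom_simps)
qed

section \<open>Subrings, ideals and congruences of polynomials\<close>

locale subring_on =
  fixes R :: "'a::comm_ring_1 set"
  assumes one_mem: "1 \<in> R" and diff_mem: "x \<in> R \<Longrightarrow> y \<in> R \<Longrightarrow> x - y \<in> R"
    and mult_mem: "x \<in> R \<Longrightarrow> y \<in> R \<Longrightarrow> x * y \<in> R"
begin

lemma zero_mem: "0 \<in> R"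
  using diff_mem[OF one_mem one_mem] by simp

lemma uminus_mem: "x \<in> R \<Longrightarrow> - x \<in> R"
  using diff_mem[OF zero_mem, of x] by simp

lemma add_mem: "x \<in> R \<Longrightarrow> y \<in> R \<Longrightarrow> x + y \<in> R"
  using diff_mem[of x "- y"] uminus_mem by simp

lemma sum_mem: "(\<And>a. a \<in> A \<Longrightarrow> f a \<in> R) \<Longrightarrow> sum f A \<in> R"
  by (induction A rule: infinite_finite_induct) (auto intro: zero_mem add_mem)

lemma prod_mem: "(\<And>a. a \<in> A \<Longrightarrow> f a \<in> R) \<Longrightarrow> prod f A \<in> R"
  by (induction A rule: infinite_finite_induct) (auto intro: one_mem mult_mem)

lemma power_mem: "x \<in> R \<Longrightarrow> x ^ n \<in> R"
  by (induction n) (auto intro: one_mem mult_mem)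

lemma of_nat_mem: "of_nat n \<in> R"
  by (induction n) (auto intro: zero_mem one_mem add_mem)

lemma of_int_mem: "of_int n \<in> R"
  by (cases n) (auto intro: of_nat_mem uminus_mem simp del: of_nat_Suc)

lemmas mems = one_mem diff_mem mult_mem zero_mem uminus_mem add_mem sum_mem prod_mem power_mem
  of_nat_mem of_int_mem

end

lemma subring_UNIV: "subring_on UNIV"
  by standard auto

lemma polys_keysD: "f \<in> polys K G \<Longrightarrow> m \<in> Poly_Mapping.keys f \<Longrightarrow> g \<in> Poly_Mapping.keys m \<Longrightarrow> g \<in> G"
  by (auto simp: polys_def)

lemma polys_coeffD: "f \<in> polys K G \<Longrightarrow> m \<in> Poly_Mapping.keys f \<Longrightarrow> Poly_Mapping.lookup f m \<in> K"
  by (auto simp: polys_def)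

lemma geval_mem:
  assumes "subring_on R" "f \<in> polys K G" "\<And>c. c \<in> K \<Longrightarrow> h c \<in> R" "\<And>g. g \<in> G \<Longrightarrow> \<sigma> g \<in> R"
  shows "geval h \<sigma> f \<in> R"
proof -
  interpret subring_on R by fact
  show ?thesis
    unfolding geval_def using assms(2-4)
    by (intro sum_mem mult_mem prod_mem power_mem) (auto simp: polys_def)
qed

lemma subst_mem:
  assumes "subring_on R" "f \<in> polys K G" "\<And>c. c \<in> K \<Longrightarrow> cst c \<in> R" "\<And>g. g \<in> G \<Longrightarrow> \<sigma> g \<in> R"
  shows "subst \<sigma> f \<in> R"
  unfolding subst_geval using assms by (rule geval_mem)

lemma subst_cong:
  assumes "f \<in> polys K G" "\<And>g. g \<in> G \<Longrightarrow> \<sigma> g = \<tau> g"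
  shows "subst \<sigma> f = subst \<tau> f"
  unfolding subst_def using assms
  by (intro sum.cong prod.cong refl arg_cong2[where f = "(*)"]) (auto dest!: polys_keysD)

lemma polys_add:
  assumes "subring_on K" "f \<in> polys K G" "g \<in> polys K G"
  shows "f + g \<in> polys K G"
proof -
  interpret subring_on K by fact
  have l: "Poly_Mapping.lookup f m \<in> K" if "f \<in> polys K G" for f m
    using that zero_mem by (cases "m \<in> Poly_Mapping.keys f") (auto simp: polys_def in_keys_iff)
  show ?thesis
    using assms(2,3) Poly_Mapping.keys_add[of f g]
    by (auto simp: polys_def lookup_add intro!: add_mem l[OF assms(2)] l[OF assms(3)])
qed

lemma polys_single:
  assumes "c \<in> K" "Poly_Mapping.keys m \<subseteq> G" shows "Poly_Mapping.single m c \<in> polys K G"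
  using assms by (auto simp: polys_def)

lemma polys_lookup: "subring_on K \<Longrightarrow> f \<in> polys K G \<Longrightarrow> Poly_Mapping.lookup f m \<in> K"
  by (cases "m \<in> Poly_Mapping.keys f") (auto simp: polys_def in_keys_iff subring_on.zero_mem)

lemma polys_keys: "f \<in> polys K G \<Longrightarrow> m \<in> Poly_Mapping.keys f \<Longrightarrow> Poly_Mapping.keys m \<subseteq> G"
  by (auto simp: polys_def)

lemma polys_sum:
  assumes "subring_on K" "\<And>a. a \<in> A \<Longrightarrow> f a \<in> polys K G"
  shows "sum f A \<in> polys K G"
proof -
  have "0 \<in> polys K G" by (simp add: polys_def)
  then show ?thesis
    using assms(2) by (induction A rule: infinite_finite_induct) (auto intro: polys_add[OF assms(1)])
qed

lemma subring_polys:
  assumes "subring_on K"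
  shows "subring_on (polys K G)"
proof
  interpret subring_on K by fact
  show "1 \<in> polys K G"
    using polys_single[of 1 K 0 G] one_mem by simp
  have m: "f * g \<in> polys K G" if "f \<in> polys K G" "g \<in> polys K G" for f g
  proof -
    have "f * g = (\<Sum>m\<in>Poly_Mapping.keys f. \<Sum>m'\<in>Poly_Mapping.keys g.
       Poly_Mapping.single (m + m') (Poly_Mapping.lookup f m * Poly_Mapping.lookup g m'))"
      by (subst pol_single_sum[of f], subst pol_single_sum[of g]) (simp add: sum_product mult_single)
    also have "\<dots> \<in> polys K G"
    proof (intro polys_sum[OF assms] polys_single)
      fix m m' assume "m \<in> Poly_Mapping.keys f" "m' \<in> Poly_Mapping.keys g"
      then show "Poly_Mapping.keys (m + m') \<subseteq> G"
        using Poly_Mapping.keys_add[of m m'] polys_keys[OF that(1)] polys_keys[OF that(2)] by blast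
    next
      fix m m'
      show "Poly_Mapping.lookup f m * Poly_Mapping.lookup g m' \<in> K"
        by (rule mult_mem[OF polys_lookup[OF assms that(1)] polys_lookup[OF assms that(2)]])
    qed
    finally show ?thesis .
  qed
  have "cst (- 1) \<in> polys K G"
    unfolding cst_def by (rule polys_single) (auto intro: uminus_mem one_mem)
  then show "f - g \<in> polys K G" if "f \<in> polys K G" "g \<in> polys K G" for f g
    using polys_add[OF assms that(1) m[OF _ that(2)], of "cst (- 1)"] by (simp add: cst.hom_simps)
  show "f * g \<in> polys K G" if "f \<in> polys K G" "g \<in> polys K G" for f g
    using that by (rule m)
qed

lemma cst_mem_polys: "c \<in> K \<Longrightarrow> cst c \<in> polys K G"
  unfolding cst_def by (rule polys_single) auto

lemma Var_mem_polys: "subring_on K \<Longrightarrow> g \<in> G \<Longrightarrow> Var g \<in> polys K G"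
  unfolding Var_def by (rule polys_single) (auto simp: subring_on.one_mem)

lemma polys_mono: "K \<subseteq> K' \<Longrightarrow> G \<subseteq> G' \<Longrightarrow> polys K G \<subseteq> polys K' G'"
  by (force simp: polys_def)

lemma polys_UNIV [simp]: "polys UNIV UNIV = UNIV"
  by (auto simp: polys_def)

lemma polys_Int: "f \<in> polys K G \<Longrightarrow> f \<in> polys K' G' \<Longrightarrow> f \<in> polys (K \<inter> K') (G \<inter> G')"
  by (auto simp: polys_def)

locale ideal_on = subring_on R for R :: "'a::comm_ring_1 set" +
  fixes I :: "'a set"
  assumes izero: "0 \<in> I" and iadd: "x \<in> I \<Longrightarrow> y \<in> I \<Longrightarrow> x + y \<in> I"
    and imult: "r \<in> R \<Longrightarrow> x \<in> I \<Longrightarrow> r * x \<in> I"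
begin

lemma imult2: "r \<in> R \<Longrightarrow> x \<in> I \<Longrightarrow> x * r \<in> I"
  using imult[of r x] by (simp add: mult.commute)

lemma iuminus: "x \<in> I \<Longrightarrow> - x \<in> I"
  using imult[of "- 1" x] uminus_mem one_mem by simp

lemma idiff: "x \<in> I \<Longrightarrow> y \<in> I \<Longrightarrow> x - y \<in> I"
  using iadd[of x "- y"] iuminus by simp

lemma isum: "(\<And>a. a \<in> A \<Longrightarrow> f a \<in> I) \<Longrightarrow> sum f A \<in> I"
  by (induction A rule: infinite_finite_induct) (auto intro: izero iadd)

definition eqv where "eqv x y \<longleftrightarrow> x - y \<in> I"

lemma eqv_refl [simp]: "eqv x x"
  by (simp add: eqv_def izero)

lemma eqv_sym: "eqv x y \<Longrightarrow> eqv y x"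
  using iuminus[of "x - y"] by (simp add: eqv_def)

lemma eqv_trans [trans]: "eqv x y \<Longrightarrow> eqv y z \<Longrightarrow> eqv x z"
  using iadd[of "x - y" "y - z"] by (simp add: eqv_def)

lemma eqv_add: "eqv x y \<Longrightarrow> eqv x' y' \<Longrightarrow> eqv (x + x') (y + y')"
  using iadd[of "x - y" "x' - y'"] by (simp add: eqv_def algebra_simps)

lemma eqv_diff: "eqv x y \<Longrightarrow> eqv x' y' \<Longrightarrow> eqv (x - x') (y - y')"
  using idiff[of "x - y" "x' - y'"] by (simp add: eqv_def algebra_simps)

lemma eqv_mult: "eqv x y \<Longrightarrow> eqv x' y' \<Longrightarrow> x' \<in> R \<Longrightarrow> y \<in> R \<Longrightarrow> eqv (x * x') (y * y')"
  using iadd[OF imult[of x' "x - y"] imult[of y "x' - y'"]] by (simp add: eqv_def algebra_simps)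

lemma eqv_sum: "(\<And>a. a \<in> A \<Longrightarrow> eqv (f a) (g a)) \<Longrightarrow> eqv (sum f A) (sum g A)"
  by (induction A rule: infinite_finite_induct) (auto intro: eqv_add)

lemma eqv_prod: "(\<And>a. a \<in> A \<Longrightarrow> eqv (f a) (g a)) \<Longrightarrow> (\<And>a. a \<in> A \<Longrightarrow> f a \<in> R) \<Longrightarrow>
    (\<And>a. a \<in> A \<Longrightarrow> g a \<in> R) \<Longrightarrow> eqv (prod f A) (prod g A)"
  by (induction A rule: infinite_finite_induct) (auto intro!: eqv_mult prod_mem)

lemma eqv_power: "eqv x y \<Longrightarrow> x \<in> R \<Longrightarrow> y \<in> R \<Longrightarrow> eqv (x ^ n) (y ^ n)"
  by (induction n) (auto intro!: eqv_mult power_mem)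

end

text \<open>Serves to replace a generator by the value that the relations force on it, for instance
  \<open>v_1\<close> by 0, before a structure formula is evaluated.\<close>

lemma subst_eqv:
  assumes "ideal_on R I" "f \<in> polys K G" "\<And>c. c \<in> K \<Longrightarrow> cst c \<in> R"
    "\<And>g. g \<in> G \<Longrightarrow> \<sigma> g \<in> R" "\<And>g. g \<in> G \<Longrightarrow> \<tau> g \<in> R" "\<And>g. g \<in> G \<Longrightarrow> \<sigma> g - \<tau> g \<in> I"
  shows "subst \<sigma> f - subst \<tau> f \<in> I"
proof -
  interpret ideal_on R I by fact
  have "eqv (subst \<sigma> f) (subst \<tau> f)"
    unfolding subst_def using assms(2-)
    by (intro eqv_sum eqv_mult eqv_prod eqv_power prod_mem power_mem)
      (auto simp: eqv_def izero dest: polys_keysD polys_coeffD)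
  then show ?thesis by (simp add: eqv_def)
qed

lemma ideal_of_gen: "subring_on R \<Longrightarrow> s \<in> S \<Longrightarrow> s \<in> ideal_of R S"
  unfolding ideal_of_def by (rule CollectI, rule exI[of _ "{s}"], rule exI[of _ "\<lambda>_. 1"])
    (auto simp: subring_on.one_mem)

lemma ideal_on_ideal_of:
  assumes "subring_on R" shows "ideal_on R (ideal_of R S)"
proof -
  interpret subring_on R by fact
  show ?thesis
  proof
    show "0 \<in> ideal_of R S"
      unfolding ideal_of_def by (rule CollectI, rule exI[of _ "{}"]) auto
    fix x assume x: "x \<in> ideal_of R S"
    then obtain F c where F: "x = (\<Sum>g\<in>F. c g * g)" "finite F" "F \<subseteq> S" "\<forall>g\<in>F. c g \<in> R"
      by (auto simp: ideal_of_def)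
    {
      fix y assume "y \<in> ideal_of R S"
      then obtain F' c' where F': "y = (\<Sum>g\<in>F'. c' g * g)" "finite F'" "F' \<subseteq> S" "\<forall>g\<in>F'. c' g \<in> R"
        by (auto simp: ideal_of_def)
      have "x = (\<Sum>g\<in>F \<union> F'. (if g \<in> F then c g else 0) * g)"
        unfolding F by (rule sum.mono_neutral_cong_left) (use F F' in auto)
      moreover have "y = (\<Sum>g\<in>F \<union> F'. (if g \<in> F' then c' g else 0) * g)"
        unfolding F' by (rule sum.mono_neutral_cong_left) (use F F' in auto)
      ultimately have "x + y = (\<Sum>g\<in>F \<union> F'. ((if g \<in> F then c g else 0) + (if g \<in> F' then c' g else 0)) * g)"
        by (simp add: sum.distrib distrib_right)
      then show "x + y \<in> ideal_of R S"
        unfolding ideal_of_def using F F'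
        by (intro CollectI exI[of _ "F \<union> F'"] exI[of _ "\<lambda>g. (if g \<in> F then c g else 0) + (if g \<in> F' then c' g else 0)"])
          (auto intro!: mems)
    }
    fix r assume "r \<in> R"
    then show "r * x \<in> ideal_of R S"
      unfolding ideal_of_def using F
      by (intro CollectI exI[of _ F] exI[of _ "\<lambda>g. r * c g"]) (auto simp: sum_distrib_left mult.assoc intro!: mems)
  qed
qed

lemma ideal_of_least:
  assumes "ideal_on R' J" "R \<subseteq> R'" "S \<subseteq> J"
  shows "ideal_of R S \<subseteq> J"
proof -
  interpret ideal_on R' J by fact
  show ?thesis
    using assms(2,3) by (auto simp: ideal_of_def intro!: isum imult)
qed

lemma ideal_of_hom:
  assumes "ring_hom_on h" "ideal_on R' J" "\<And>x. x \<in> R \<Longrightarrow> h x \<in> R'" "\<And>x. x \<in> S \<Longrightarrow> h x \<in> J" "f \<in> ideal_of R S"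
  shows "h f \<in> J"
proof -
  interpret h: ring_hom_on h by fact
  interpret ideal_on R' J by fact
  show ?thesis
    using assms(3-) by (force simp: ideal_of_def h.hom_simps intro!: isum imult)
qed

lemma ideal_of_mono: "R \<subseteq> R' \<Longrightarrow> S \<subseteq> S' \<Longrightarrow> ideal_of R S \<subseteq> ideal_of R' S'"
  by (fastforce simp: ideal_of_def)

text \<open>A member of the ideal involves only finitely many generators. This reduces the infinite
  set of relations of a cobar ring to a finite stage.\<close>

lemma ideal_of_UN:
  assumes "incseq S" "f \<in> ideal_of R (\<Union>n. S n)"
  shows "\<exists>n. f \<in> ideal_of R (S n)"
proof -
  obtain F c where F: "f = (\<Sum>g\<in>F. c g * g)" "finite F" "F \<subseteq> (\<Union>n. S n)" "\<forall>g\<in>F. c g \<in> R"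
    using assms(2) by (auto simp: ideal_of_def)
  have "\<exists>n. F \<subseteq> S n"
    using F(2,3)
  proof (induction F rule: finite_induct)
    case (insert x F)
    then obtain n k where "F \<subseteq> S n" "x \<in> S k" by auto
    then have "insert x F \<subseteq> S (max n k)"
      using incseqD[OF assms(1), of n "max n k"] incseqD[OF assms(1), of k "max n k"] by auto
    then show ?case ..
  qed auto
  then show ?thesis using F by (auto simp: ideal_of_def)
qed

section \<open>Modules over the integers localized at \<open>p\<close>\<close>

lemma Zp_iff: "x \<in> Zp p \<longleftrightarrow> (\<exists>a b. x = of_int a / of_int b \<and> \<not> int p dvd b)"
  by (auto simp: Zp_def)

lemma Zp_of_int: "prime p \<Longrightarrow> of_int n \<in> Zp p"
  unfolding Zp_iff by (rule exI[of _ n], rule exI[of _ 1]) (auto simp: prime_nat_iff)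

lemma Zp_inverse_int: "\<not> int p dvd n \<Longrightarrow> 1 / of_int n \<in> Zp p"
  unfolding Zp_iff by (rule exI[of _ 1], rule exI[of _ n]) auto

lemma subring_Zp:
  assumes "prime p" shows "subring_on (Zp p)"
proof
  have pp: "prime (int p)" using assms by simp
  show "1 \<in> Zp p" using Zp_of_int[OF assms, of 1] by simp
  fix x y assume "x \<in> Zp p" "y \<in> Zp p"
  then obtain a b c d where xy: "x = of_int a / of_int b" "\<not> int p dvd b"
    "y = of_int c / of_int d" "\<not> int p dvd d"
    by (auto simp: Zp_iff)
  have nz: "b \<noteq> 0" "d \<noteq> 0" using xy by auto
  have nd: "\<not> int p dvd b * d" using xy pp by (simp add: prime_dvd_mult_iff)
  show "x * y \<in> Zp p"
    unfolding Zp_iff by (rule exI[of _ "a * c"], rule exI[of _ "b * d"]) (use xy nd in auto)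
  show "x - y \<in> Zp p"
    unfolding Zp_iff by (rule exI[of _ "a * d - c * b"], rule exI[of _ "b * d"])
      (use xy(2,4) nd nz in \<open>auto simp: xy(1,3) field_simps\<close>)
qed

text \<open>This is \<open>Z_(p)/p^e = Z/p^e\<close>: a Bezout inverse \<open>u\<close> of the
  denominator modulo \<open>p^e\<close> turns the fraction into the integer
  \<open>a * u\<close>.\<close>

lemma Zp_mod_power:
  assumes "prime p" "c \<in> Zp p"
  shows "\<exists>n < p ^ e. (c - of_nat n) / of_nat p ^ e \<in> Zp p"
proof -
  obtain a b where ab: "c = of_int a / of_int b" "\<not> int p dvd b"
    using assms by (auto simp: Zp_iff)
  have b0: "b \<noteq> 0" using ab by auto
  have p0: "p > 0" using assms by (simp add: prime_gt_0_nat)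
  have pp: "prime (int p)" using assms by simp
  have "coprime b (int p ^ e)"
    using prime_imp_coprime[OF pp ab(2)] by (simp add: coprime_commute)
  then obtain u v where uv: "u * b + v * int p ^ e = 1"
    using bezout_int[of b "int p ^ e"] by auto
  define n where "n = nat ((a * u) mod int p ^ e)"
  have n: "int n = (a * u) mod int p ^ e" using p0 by (simp add: n_def)
  have "n < p ^ e" using n p0 by (metis of_nat_less_iff of_nat_power pos_mod_bound zero_less_power of_nat_0_less_iff)
  moreover have "(c - of_nat n) / of_nat p ^ e \<in> Zp p"
  proof -
    have "int p ^ e dvd a * u - int n" unfolding n by (simp add: dvd_minus_mod)
    then obtain k where k: "a * u - int n = int p ^ e * k" by auto
    have "a - int n * b = a * (u * b + v * int p ^ e) - int n * b" by (simp add: uv)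
    also have "\<dots> = (a * u - int n) * b + a * v * int p ^ e" by (simp add: algebra_simps)
    also have "\<dots> = int p ^ e * (k * b + a * v)" by (simp add: k algebra_simps)
    finally have eq: "a - int n * b = int p ^ e * (k * b + a * v)" .
    have "c - of_nat n = of_int (a - int n * b) / of_int b" using b0 by (simp add: ab field_simps)
    then have "(c - of_nat n) / of_nat p ^ e = of_int (k * b + a * v) / of_int b"
      using b0 p0 unfolding eq by simp
    then show ?thesis unfolding Zp_iff using ab(2) by blast
  qed
  ultimately show ?thesis by blast
qed

lemma cring_Zloc:
  assumes "prime p" shows "cring (Zloc p)"
proof -
  interpret subring_on "Zp p" by (rule subring_Zp[OF assms])
  show ?thesis
  proof (rule cringI)
    show "abelian_group (Zloc p)"
      by (rule abelian_groupI) (auto simp: Zloc_def add_mem zero_mem intro!: bexI[of _ "- x" for x] uminus_mem)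
    show "Group.comm_monoid (Zloc p)"
      by (rule comm_monoidI) (auto simp: Zloc_def mult_mem one_mem)
  qed (auto simp: Zloc_def algebra_simps)
qed

lemma carrier_Zloc [simp]: "carrier (Zloc p) = Zp p"
  by (simp add: Zloc_def)

section \<open>Quotient modules and their presentations\<close>

locale Zp_submodule =
  fixes p :: nat and B :: "pol set"
  assumes prime_p: "prime p"
    and B_zero: "0 \<in> B" and B_add: "x \<in> B \<Longrightarrow> y \<in> B \<Longrightarrow> x + y \<in> B"
    and B_smult: "c \<in> Zp p \<Longrightarrow> x \<in> B \<Longrightarrow> cst c * x \<in> B"
begin

sublocale Zp: subring_on "Zp p" by (rule subring_Zp[OF prime_p])

lemma B_uminus: "x \<in> B \<Longrightarrow> - x \<in> B"
  using B_smult[of "- 1" x] by (simp add: cst.hom_simps Zp.mems)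

lemma B_diff: "x \<in> B \<Longrightarrow> y \<in> B \<Longrightarrow> x - y \<in> B"
  using B_add[of x "- y"] B_uminus by simp

lemma B_sum: "(\<And>a. a \<in> A \<Longrightarrow> f a \<in> B) \<Longrightarrow> sum f A \<in> B"
  by (induction A rule: infinite_finite_induct) (auto intro: B_zero B_add)

lemma coset_eq_iff: "coset B x = coset B y \<longleftrightarrow> x - y \<in> B"
proof
  assume "coset B x = coset B y"
  moreover have "x \<in> coset B x" using B_zero by (auto simp: coset_def intro: exI[of _ 0])
  ultimately show "x - y \<in> B" by (auto simp: coset_def)
next
  assume a: "x - y \<in> B"
  have "x + b = y + (x - y + b) \<and> x - y + b \<in> B" if "b \<in> B" for b
    using B_add[OF a that] by simp
  moreover have "y + b = x + (b - (x - y)) \<and> b - (x - y) \<in> B" if "b \<in> B" for b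
    using B_diff[OF that a] by simp
  ultimately show "coset B x = coset B y" unfolding coset_def by blast
qed

lemma coset_zero: "coset B 0 = B"
  by (auto simp: coset_def)

lemma add_coset: "{u + v |u v. u \<in> coset B x \<and> v \<in> coset B y} = coset B (x + y)"
proof -
  have "\<exists>u v. x + y + b = u + v \<and> u \<in> coset B x \<and> v \<in> coset B y" if "b \<in> B" for b
    by (rule exI[of _ "x + b"], rule exI[of _ y]) (use that B_zero in \<open>auto simp: coset_def intro: exI[of _ 0]\<close>)
  moreover have "x + b + (y + b') = x + y + (b + b')" for b b' by simp
  ultimately show ?thesis
    by (auto simp: coset_def) (metis B_add add.commute add.left_commute)+
qed

lemma smult_coset:
  assumes "c \<in> Zp p"
  shows "{cst c * u + b |u b. u \<in> coset B x \<and> b \<in> B} = coset B (cst c * x)"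
proof -
  have "cst c * (x + b) + b' \<in> coset B (cst c * x)" if "b \<in> B" "b' \<in> B" for b b'
    using B_add[OF B_smult[OF assms that(1)] that(2)] by (auto simp: coset_def algebra_simps)
  moreover have "\<exists>u b'. cst c * x + b = cst c * u + b' \<and> u \<in> coset B x \<and> b' \<in> B" if "b \<in> B" for b
    by (rule exI[of _ x], rule exI[of _ b]) (use that B_zero in \<open>auto simp: coset_def intro: exI[of _ 0]\<close>)
  ultimately show ?thesis by (auto simp: coset_def)
qed

end

locale quot_module = Z: Zp_submodule p Z + Zp_submodule p B for p Z B
begin

abbreviation "M \<equiv> quot Z B"

lemma carrier_M: "carrier M = coset B ` Z" by (simp add: quot_def)

lemma zero_M [simp]: "\<zero>\<^bsub>M\<^esub> = B" by (simp add: quot_def)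

lemma add_M: "coset B x \<oplus>\<^bsub>M\<^esub> coset B y = coset B (x + y)"
  by (simp add: quot_def add_coset)

lemma smult_M: "c \<in> Zp p \<Longrightarrow> c \<odot>\<^bsub>M\<^esub> coset B x = coset B (cst c * x)"
  by (simp add: quot_def smult_coset)

lemma module_M: "Module.module (Zloc p) M"
proof (rule Module.moduleI)
  show "cring (Zloc p)" by (rule cring_Zloc[OF prime_p])
  show "abelian_group M"
  proof (rule abelian_groupI)
    show "\<exists>y\<in>carrier M. y \<oplus>\<^bsub>M\<^esub> x = \<zero>\<^bsub>M\<^esub>" if x: "x \<in> carrier M" for x
    proof -
      obtain z where z: "z \<in> Z" "x = coset B z" using x unfolding carrier_M by blast
      show ?thesis
        by (rule bexI[of _ "coset B (- z)"]) (use z Z.B_uminus in \<open>auto simp: carrier_M add_M coset_zero\<close>)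
    qed
    show "\<zero>\<^bsub>M\<^esub> \<in> carrier M"
      unfolding zero_M carrier_M by (rule image_eqI[of _ _ 0]) (simp_all add: coset_zero Z.B_zero)
    show "\<zero>\<^bsub>M\<^esub> \<oplus>\<^bsub>M\<^esub> x = x" if x: "x \<in> carrier M" for x
    proof -
      obtain z where z: "z \<in> Z" "x = coset B z" using x unfolding carrier_M by blast
      show ?thesis using add_M[of 0 z] by (simp add: z coset_zero)
    qed
  qed (auto simp: carrier_M add_M algebra_simps Z.B_add)
qed (auto simp: Zloc_def carrier_M add_M smult_M Z.Zp.mems Z.B_smult distrib_left distrib_right mult.assoc cst.hom_simps)

sublocale Module.module "Zloc p" M by (rule module_M)

lemma finsum_coset:
  assumes "\<And>i. i \<in> F \<Longrightarrow> f i \<in> Z" "finite F"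
  shows "finsum M (\<lambda>i. coset B (f i)) F = coset B (\<Sum>i\<in>F. f i)"
  using assms(2,1)
proof (induction F rule: finite_induct)
  case empty
  then show ?case by (simp add: coset_zero)
next
  case (insert x F)
  then show ?case by (subst finsum_insert) (auto simp: carrier_M add_M)
qed

end

text \<open>Elementwise form of "direct sum of cyclic modules \<open>Z_(p)/p^(e i)\<close> on the
  generators \<open>g i\<close>": \<open>ann\<close> bounds the orders from above, and
  \<open>rel\<close> says that every relation is a consequence of \<open>ann\<close>. Both first
  cohomology modules are instances with the same \<open>I\<close> and \<open>e\<close>.\<close>

locale presented = quot_module p Z B for p Z B +
  fixes I :: "'i set" and g :: "'i \<Rightarrow> pol" and e :: "'i \<Rightarrow> nat"
  assumes g_mem: "i \<in> I \<Longrightarrow> g i \<in> Z"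
    and span: "x \<in> Z \<Longrightarrow> \<exists>F c. finite F \<and> F \<subseteq> I \<and> (\<forall>i. c i \<in> Zp p) \<and> x - (\<Sum>i\<in>F. cst (c i) * g i) \<in> B"
    and rel: "finite F \<Longrightarrow> F \<subseteq> I \<Longrightarrow> (\<And>i. c i \<in> Zp p) \<Longrightarrow> (\<Sum>i\<in>F. cst (c i) * g i) \<in> B \<Longrightarrow> i \<in> F \<Longrightarrow>
        c i / of_nat p ^ e i \<in> Zp p"
    and ann: "i \<in> I \<Longrightarrow> cst (of_nat p ^ e i) * g i \<in> B"
begin

definition cyc :: "'i \<Rightarrow> pol set set" where
  "cyc i = cyclic_submodule (Zloc p) M (coset B (g i))"

lemma cyc_eq: "cyc i = {coset B (cst c * g i) |c. c \<in> Zp p}"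
  unfolding cyc_def cyclic_submodule_def carrier_Zloc by (rule Collect_cong) (metis smult_M)

lemma ann': 
  assumes "i \<in> I" "c / of_nat p ^ e i \<in> Zp p" shows "cst c * g i \<in> B"
proof -
  have "c = c / of_nat p ^ e i * of_nat p ^ e i"
    using prime_gt_0_nat[OF prime_p] by simp
  then have "cst c = cst (c / of_nat p ^ e i) * cst (of_nat p ^ e i)"
    by (metis cst.hom_mult)
  then show ?thesis using B_smult[OF assms(2) ann[OF assms(1)]] by (simp add: mult.assoc)
qed

lemma cst_g_mem_iff:
  assumes "i \<in> I" "c \<in> Zp p" shows "cst c * g i \<in> B \<longleftrightarrow> c / of_nat p ^ e i \<in> Zp p"
  using ann'[OF assms(1)] rel[of "{i}" "\<lambda>_. c" i] assms by auto

lemma card_cyc: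
  assumes i: "i \<in> I" shows "card (cyc i) = p ^ e i"
proof -
  have p0: "p > 0" using prime_p by (simp add: prime_gt_0_nat)
  define h where "h n = coset B (cst (of_nat n) * g i)" for n
  have "inj_on h {..<p ^ e i}"
  proof (rule inj_onI)
    fix n n' assume n: "n \<in> {..<p ^ e i}" "n' \<in> {..<p ^ e i}" "h n = h n'"
    then have "cst (of_nat n - of_nat n') * g i \<in> B"
      by (simp add: h_def coset_eq_iff cst.hom_diff algebra_simps)
    then have "(of_nat n - of_nat n') / of_nat p ^ e i \<in> Zp p"
      by (subst (asm) cst_g_mem_iff[OF i]) (auto intro: Z.Zp.mems)
    then obtain a b where ab: "(of_nat n - of_nat n') / of_nat p ^ e i = (of_int a / of_int b :: rat)" "\<not> int p dvd b"
      by (auto simp: Zp_iff)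
    have "b \<noteq> 0" using ab by auto
    then have "(of_int ((int n - int n') * b) :: rat) = of_int (a * int p ^ e i)"
      using ab(1) p0 by (simp add: field_simps)
    then have eq: "(int n - int n') * b = a * int p ^ e i" by (simp only: of_int_eq_iff)
    have "coprime (int p ^ e i) b"
      using prime_imp_coprime[of "int p" b] ab(2) prime_p by simp
    moreover have "int p ^ e i dvd (int n - int n') * b" by (simp add: eq)
    ultimately have d: "int p ^ e i dvd int n - int n'" by (simp add: coprime_dvd_mult_left_iff)
    have "\<bar>int n - int n'\<bar> < int p ^ e i"
    proof -
      have "int n < int p ^ e i" "int n' < int p ^ e i" using n by (simp_all flip: of_nat_power)
      then show ?thesis by linarith
    qed
    then have "int n - int n' = 0" using d zdvd_not_zless[of "\<bar>int n - int n'\<bar>" "int p ^ e i"] by auto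
    then show "n = n'" by simp
  qed
  moreover have "h ` {..<p ^ e i} = cyc i"
  proof (intro equalityI subsetI)
    fix x assume "x \<in> h ` {..<p ^ e i}"
    then show "x \<in> cyc i" unfolding cyc_eq h_def using Z.Zp.of_nat_mem by blast
  next
    fix x assume "x \<in> cyc i"
    then obtain c where c: "c \<in> Zp p" "x = coset B (cst c * g i)" by (auto simp: cyc_eq)
    then obtain n where n: "n < p ^ e i" "(c - of_nat n) / of_nat p ^ e i \<in> Zp p"
      using Zp_mod_power[OF prime_p] by blast
    have "x = h n"
      unfolding c h_def coset_eq_iff using ann'[OF i n(2)] by (simp add: cst.hom_diff algebra_simps)
    then show "x \<in> h ` {..<p ^ e i}" using n by auto
  qed
  ultimately show ?thesis by (metis card_image card_lessThan)
qed

lemma submodule_cyc: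
  assumes i: "i \<in> I" shows "submodule (cyc i) (Zloc p) M"
proof (rule submoduleI)
  show "cyc i \<subseteq> carrier M"
    using g_mem[OF i] by (auto simp: cyc_eq carrier_M Z.B_smult)
  show "\<zero>\<^bsub>M\<^esub> \<in> cyc i"
    by (auto simp: cyc_eq intro!: exI[of _ 0] simp: cst.hom_zero coset_zero Z.Zp.zero_mem)
  fix a assume "a \<in> cyc i"
  then obtain c where c: "c \<in> Zp p" "a = coset B (cst c * g i)" by (auto simp: cyc_eq)
  {
    fix b assume "b \<in> carrier (Zloc p)"
    then show "b \<odot>\<^bsub>M\<^esub> a \<in> cyc i"
      by (auto simp: c cyc_eq smult_M cst.hom_mult mult.assoc intro!: exI[of _ "b * c"] Z.Zp.mult_mem)
  } note sm = this
  {
    fix b assume "b \<in> cyc i"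
    then obtain d where d: "d \<in> Zp p" "b = coset B (cst d * g i)" by (auto simp: cyc_eq)
    then show "a \<oplus>\<^bsub>M\<^esub> b \<in> cyc i"
      using c by (auto simp: cyc_eq add_M cst.hom_add distrib_right intro!: exI[of _ "c + d"] Z.Zp.add_mem)
  }
  have "a \<in> carrier M" using c g_mem[OF i] by (auto simp: carrier_M Z.B_smult)
  moreover have "coset B (cst (- c) * g i) \<oplus>\<^bsub>M\<^esub> a = \<zero>\<^bsub>M\<^esub>"
    by (simp add: c add_M cst.hom_uminus coset_zero)
  moreover have "coset B (cst (- c) * g i) \<in> carrier M"
    using c g_mem[OF i] by (auto simp: carrier_M intro!: Z.B_smult Z.Zp.uminus_mem)
  ultimately have "\<ominus>\<^bsub>M\<^esub> a = coset B (cst (- c) * g i)"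
    by (metis minus_equality)
  then show "\<ominus>\<^bsub>M\<^esub> a \<in> cyc i" using c Z.Zp.uminus_mem by (auto simp: cyc_eq)
qed

lemma sum_superset:
  assumes "finite F" "F' \<subseteq> F" "\<And>i. i \<in> F - F' \<Longrightarrow> f i \<in> B"
  shows "(\<Sum>i\<in>F. f i) - (\<Sum>i\<in>F'. f i) \<in> B"
proof -
  have "(\<Sum>i\<in>F. f i) - (\<Sum>i\<in>F'. f i) = (\<Sum>i\<in>F - F'. f i)"
    using assms by (simp add: sum_diff finite_subset)
  also have "\<dots> \<in> B" using assms by (intro B_sum) auto
  finally show ?thesis .
qed

lemma direct_sum: "is_direct_sum (Zloc p) M I cyc"
  unfolding is_direct_sum_def
proof (intro conjI ballI)
  show "submodule (cyc i) (Zloc p) M" if "i \<in> I" for i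
    using that by (rule submodule_cyc)
  fix x assume "x \<in> carrier M"
  then obtain z where z: "z \<in> Z" "x = coset B z" by (auto simp: carrier_M)
  obtain F c where Fc: "finite F" "F \<subseteq> I" "\<And>i. c i \<in> Zp p" "z - (\<Sum>i\<in>F. cst (c i) * g i) \<in> B"
    using span[OF z(1)] by blast
  have fin: "x = finsum M f {i\<in>I. f i \<noteq> \<zero>\<^bsub>M\<^esub>} \<longleftrightarrow> z - (\<Sum>i\<in>S. cst (d i) * g i) \<in> B"
    if "\<And>i. i \<in> I \<Longrightarrow> f i = coset B (cst (d i) * g i)" "\<And>i. i \<in> I \<Longrightarrow> d i \<in> Zp p" "finite S"
      "{i\<in>I. f i \<noteq> \<zero>\<^bsub>M\<^esub>} \<subseteq> S" "S \<subseteq> I" for f d S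
  proof -
    let ?T = "{i\<in>I. f i \<noteq> \<zero>\<^bsub>M\<^esub>}"
    have T: "finite ?T" "?T \<subseteq> I" using that finite_subset by auto
    have "finsum M f ?T = finsum M (\<lambda>i. coset B (cst (d i) * g i)) ?T"
      using that(1,2) g_mem by (intro finsum_cong') (auto simp: carrier_M Z.B_smult)
    also have "\<dots> = coset B (\<Sum>i\<in>?T. cst (d i) * g i)"
      using that(1,2) T g_mem by (intro finsum_coset) (auto simp: Z.B_smult)
    also have "\<dots> = coset B (\<Sum>i\<in>S. cst (d i) * g i)"
      unfolding coset_eq_iff
    proof -
      have "(\<Sum>i\<in>S. cst (d i) * g i) - (\<Sum>i\<in>?T. cst (d i) * g i) \<in> B"
      proof (rule sum_superset)
        fix i assume "i \<in> S - ?T"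
        then have "i \<in> I" "f i = B" using that by auto
        then show "cst (d i) * g i \<in> B" using that(1)[of i] coset_eq_iff[of "cst (d i) * g i" 0] by (simp add: coset_zero)
      qed (use that in auto)
      from B_uminus[OF this] show "(\<Sum>i\<in>?T. cst (d i) * g i) - (\<Sum>i\<in>S. cst (d i) * g i) \<in> B" by simp
    qed
    finally show ?thesis by (simp add: z coset_eq_iff)
  qed
  show "\<exists>!f. f \<in> Pi\<^sub>E I cyc \<and> finite {i\<in>I. f i \<noteq> \<zero>\<^bsub>M\<^esub>} \<and> x = finsum M f {i\<in>I. f i \<noteq> \<zero>\<^bsub>M\<^esub>}"
  proof (rule ex_ex1I)
    \<comment> \<open>The coefficients supplied by \<open>span\<close> are arbitrary outside
      \<open>F\<close>, whereas a component function lives on all of \<open>I\<close>; they are cut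
      off to 0 there.\<close>
    define d where "d i = (if i \<in> F then c i else 0)" for i
    define f where "f = (\<lambda>i\<in>I. coset B (cst (d i) * g i))"
    have d: "d i \<in> Zp p" for i by (auto simp: d_def Fc Z.Zp.zero_mem)
    have sub: "{i\<in>I. f i \<noteq> \<zero>\<^bsub>M\<^esub>} \<subseteq> F"
      by (auto simp: f_def d_def cst.hom_zero coset_zero split: if_splits)
    have "x = finsum M f {i\<in>I. f i \<noteq> \<zero>\<^bsub>M\<^esub>} \<longleftrightarrow> z - (\<Sum>i\<in>F. cst (d i) * g i) \<in> B"
      by (rule fin) (use d Fc sub in \<open>auto simp: f_def\<close>)
    moreover have "(\<Sum>i\<in>F. cst (d i) * g i) = (\<Sum>i\<in>F. cst (c i) * g i)" by (simp add: d_def)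
    moreover have "f \<in> Pi\<^sub>E I cyc" using d unfolding f_def cyc_eq by fastforce
    ultimately show "\<exists>f. f \<in> Pi\<^sub>E I cyc \<and> finite {i\<in>I. f i \<noteq> \<zero>\<^bsub>M\<^esub>} \<and> x = finsum M f {i\<in>I. f i \<noteq> \<zero>\<^bsub>M\<^esub>}"
      using sub Fc finite_subset by (intro exI[of _ f]) auto
  next
    fix f f'
    assume f: "f \<in> Pi\<^sub>E I cyc \<and> finite {i\<in>I. f i \<noteq> \<zero>\<^bsub>M\<^esub>} \<and> x = finsum M f {i\<in>I. f i \<noteq> \<zero>\<^bsub>M\<^esub>}"
      and f': "f' \<in> Pi\<^sub>E I cyc \<and> finite {i\<in>I. f' i \<noteq> \<zero>\<^bsub>M\<^esub>} \<and> x = finsum M f' {i\<in>I. f' i \<noteq> \<zero>\<^bsub>M\<^esub>}"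
    have "\<exists>d. \<forall>i. d i \<in> Zp p \<and> (i \<in> I \<longrightarrow> f i = coset B (cst (d i) * g i))" if "f \<in> Pi\<^sub>E I cyc" for f
    proof (rule choice, rule allI)
      fix i show "\<exists>c. c \<in> Zp p \<and> (i \<in> I \<longrightarrow> f i = coset B (cst c * g i))"
        using that Z.Zp.zero_mem by (cases "i \<in> I") (auto simp: cyc_eq PiE_iff)
    qed
    then obtain d d' where d: "\<And>i. d i \<in> Zp p" "\<And>i. i \<in> I \<Longrightarrow> f i = coset B (cst (d i) * g i)"
      and d': "\<And>i. d' i \<in> Zp p" "\<And>i. i \<in> I \<Longrightarrow> f' i = coset B (cst (d' i) * g i)"
      using f f' by meson
    define S where "S = {i\<in>I. f i \<noteq> \<zero>\<^bsub>M\<^esub>} \<union> {i\<in>I. f' i \<noteq> \<zero>\<^bsub>M\<^esub>}"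
    have S: "finite S" "S \<subseteq> I" using f f' by (auto simp: S_def)
    have "z - (\<Sum>i\<in>S. cst (d i) * g i) \<in> B"
      using f by (subst fin[symmetric, of f]) (use d S in \<open>auto simp: S_def\<close>)
    moreover have "z - (\<Sum>i\<in>S. cst (d' i) * g i) \<in> B"
      using f' by (subst fin[symmetric, of f']) (use d' S in \<open>auto simp: S_def\<close>)
    ultimately have "(z - (\<Sum>i\<in>S. cst (d' i) * g i)) - (z - (\<Sum>i\<in>S. cst (d i) * g i)) \<in> B"
      by (rule B_diff[rotated])
    then have "(\<Sum>i\<in>S. cst (d i - d' i) * g i) \<in> B"
      by (simp add: cst.hom_diff left_diff_distrib sum_subtractf)
    then have r: "(d i - d' i) / of_nat p ^ e i \<in> Zp p" if "i \<in> S" for i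
      using rel[OF S, of "\<lambda>i. d i - d' i" i] that d d' Z.Zp.diff_mem by auto
    show "f = f'"
    proof (rule PiE_ext)
      show "f \<in> Pi\<^sub>E I cyc" "f' \<in> Pi\<^sub>E I cyc" using f f' by auto
      fix i assume i: "i \<in> I"
      show "f i = f' i"
      proof (cases "i \<in> S")
        case True
        show ?thesis
          unfolding d(2)[OF i] d'(2)[OF i] coset_eq_iff
          using ann'[OF i r[OF True]] by (simp add: cst.hom_diff left_diff_distrib)
      next
        case False
        then show ?thesis using i by (auto simp: S_def)
      qed
    qed
  qed
qed

text \<open>By \<open>rel\<close>, two combinations of the \<open>g i\<close> agree only if
  corresponding coefficients differ by multiples of \<open>p^(e i)\<close>, and these kill
  \<open>h i\<close>. Hence \<open>g i \<mapsto> h i\<close> is well defined for any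
  \<open>h\<close> with the same annihilators.\<close>

lemma rel_transfer:
  assumes B': "Zp_submodule p B'" and ann2: "\<And>i. i \<in> I \<Longrightarrow> cst (of_nat p ^ e i) * h i \<in> B'"
    and F: "finite F" "F \<subseteq> I" "\<And>i. c i \<in> Zp p" and F': "finite F'" "F' \<subseteq> I" "\<And>i. c' i \<in> Zp p"
    and eq: "(\<Sum>i\<in>F. cst (c i) * g i) - (\<Sum>i\<in>F'. cst (c' i) * g i) \<in> B"
  shows "(\<Sum>i\<in>F. cst (c i) * h i) - (\<Sum>i\<in>F'. cst (c' i) * h i) \<in> B'"
proof -
  interpret B': Zp_submodule p B' by fact
  define d where "d i = (if i \<in> F then c i else 0) - (if i \<in> F' then c' i else 0)" for i
  have s: "(\<Sum>i\<in>F. cst (c i) * k i) - (\<Sum>i\<in>F'. cst (c' i) * k i) = (\<Sum>i\<in>F \<union> F'. cst (d i) * k i)" for k :: "'i \<Rightarrow> pol"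
  proof -
    have "(\<Sum>i\<in>F. cst (c i) * k i) = (\<Sum>i\<in>F \<union> F'. cst (if i \<in> F then c i else 0) * k i)"
      by (rule sum.mono_neutral_cong_left) (use F F' in \<open>auto simp: cst.hom_zero\<close>)
    moreover have "(\<Sum>i\<in>F'. cst (c' i) * k i) = (\<Sum>i\<in>F \<union> F'. cst (if i \<in> F' then c' i else 0) * k i)"
      by (rule sum.mono_neutral_cong_left) (use F F' in \<open>auto simp: cst.hom_zero\<close>)
    ultimately show ?thesis by (simp add: d_def cst.hom_diff left_diff_distrib sum_subtractf)
  qed
  have d: "d i \<in> Zp p" for i using F F' by (auto simp: d_def Z.Zp.zero_mem Z.Zp.diff_mem)
  have r: "d i / of_nat p ^ e i \<in> Zp p" if "i \<in> F \<union> F'" for i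
    by (rule rel[of "F \<union> F'" d]) (use F F' d eq s[of g] that in auto)
  have "(\<Sum>i\<in>F \<union> F'. cst (d i) * h i) \<in> B'"
  proof (rule B'.B_sum)
    fix i assume i: "i \<in> F \<union> F'"
    have "cst (d i) * h i = cst (d i / of_nat p ^ e i) * (cst (of_nat p ^ e i) * h i)"
      using prime_gt_0_nat[OF prime_p] by (simp add: mult.assoc[symmetric] cst.hom_mult[symmetric])
    also have "\<dots> \<in> B'" using B'.B_smult[OF r[OF i] ann2] i F F' by auto
    finally show "cst (d i) * h i \<in> B'" .
  qed
  then show ?thesis by (simp add: s)
qed

end

text \<open>The map carries a combination of the \<open>g i\<close> to the combination of the
  \<open>g' i\<close> with the same coefficients. Transfer of relations in one direction makes it
  well defined, in the other injective.\<close>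

lemma presented_iso:
  fixes I :: "'i set"
  assumes "presented p Z B I g e" "presented p Z' B' I g' e"
  shows "\<exists>\<phi>\<in>mod_iso (Zloc p) (quot Z B) (quot Z' B'). \<forall>i\<in>I. \<phi> (coset B (g i)) = coset B' (g' i)"
proof -
  interpret A: presented p Z B I g e by fact
  interpret A': presented p Z' B' I g' e by fact
  define ok where "ok F c \<longleftrightarrow> finite F \<and> F \<subseteq> I \<and> (\<forall>i. c i \<in> Zp p)" for F :: "'i set" and c :: "'i \<Rightarrow> rat"
  define lc where "lc h F c = (\<Sum>i\<in>F. cst (c i) * h i)" for h :: "'i \<Rightarrow> pol" and F c
  have tr: "coset B (lc g F c) = coset B (lc g F' c') \<longleftrightarrow> coset B' (lc g' F c) = coset B' (lc g' F' c')"
    if "ok F c" "ok F' c'" for F c F' c'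
    unfolding A.coset_eq_iff A'.coset_eq_iff lc_def
    using A.rel_transfer[OF A'.Zp_submodule_axioms A'.ann, where F = F and F' = F' and c = c and c' = c']
      A'.rel_transfer[OF A.Zp_submodule_axioms A.ann, where F = F and F' = F' and c = c and c' = c'] that
    unfolding ok_def by blast
  have spA: "\<exists>F c. ok F c \<and> X = coset B (lc g F c)" if "X \<in> carrier (quot Z B)" for X
    using that A.span unfolding A.carrier_M ok_def lc_def by (auto simp: A.coset_eq_iff)
  have spA': "\<exists>F c. ok F c \<and> X = coset B' (lc g' F c)" if "X \<in> carrier (quot Z' B')" for X
    using that A'.span unfolding A'.carrier_M ok_def lc_def by (auto simp: A'.coset_eq_iff)
  have memA: "lc g F c \<in> Z" if "ok F c" for F c
    unfolding lc_def using that by (intro A.Z.B_sum A.Z.B_smult A.g_mem) (auto simp: ok_def)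
  have memA': "lc g' F c \<in> Z'" if "ok F c" for F c
    unfolding lc_def using that by (intro A'.Z.B_sum A'.Z.B_smult A'.g_mem) (auto simp: ok_def)
  \<comment> \<open>All combinations representing \<open>X\<close> give the same \<open>Y\<close>,
    by \<open>tr\<close>, so the choice is immaterial.\<close>
  define \<phi> where "\<phi> X = (SOME Y. \<exists>F c. ok F c \<and> X = coset B (lc g F c) \<and> Y = coset B' (lc g' F c))" for X
  have \<phi>: "\<phi> (coset B (lc g F c)) = coset B' (lc g' F c)" if "ok F c" for F c
  proof -
    have "\<exists>F' c'. ok F' c' \<and> coset B (lc g F c) = coset B (lc g F' c') \<and> \<phi> (coset B (lc g F c)) = coset B' (lc g' F' c')"
      unfolding \<phi>_def by (rule someI_ex) (use that in auto)
    then show ?thesis using tr that by metis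
  qed
  have add: "\<exists>F'' c''. ok F'' c'' \<and> (\<forall>h. lc h F c + lc h F' c' = lc h F'' c'')" if "ok F c" "ok F' c'" for F c F' c'
  proof -
    define d where "d i = (if i \<in> F then c i else 0) + (if i \<in> F' then c' i else 0)" for i
    have "ok (F \<union> F') d" using that by (auto simp: ok_def d_def intro: A.Z.Zp.mems)
    moreover have "lc h F c + lc h F' c' = lc h (F \<union> F') d" for h
    proof -
      have "lc h F c = (\<Sum>i\<in>F \<union> F'. cst (if i \<in> F then c i else 0) * h i)"
        unfolding lc_def by (rule sum.mono_neutral_cong_left) (use that in \<open>auto simp: ok_def cst.hom_zero\<close>)
      moreover have "lc h F' c' = (\<Sum>i\<in>F \<union> F'. cst (if i \<in> F' then c' i else 0) * h i)"
        unfolding lc_def by (rule sum.mono_neutral_cong_left) (use that in \<open>auto simp: ok_def cst.hom_zero\<close>)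
      ultimately show ?thesis by (simp add: lc_def d_def cst.hom_add distrib_right sum.distrib)
    qed
    ultimately show ?thesis by blast
  qed
  have sm: "ok F (\<lambda>i. a * c i) \<and> cst a * lc h F c = lc h F (\<lambda>i. a * c i)" if "ok F c" "a \<in> Zp p" for h F c a
    using that by (auto simp: ok_def lc_def sum_distrib_left cst.hom_mult mult.assoc A.Z.Zp.mult_mem)
  have "\<phi> \<in> mod_iso (Zloc p) (quot Z B) (quot Z' B')"
    unfolding mod_iso_def
  proof (intro CollectI conjI ballI)
    fix a X assume "a \<in> carrier (Zloc p)" "X \<in> carrier (quot Z B)"
    then obtain F c where Fc: "a \<in> Zp p" "ok F c" "X = coset B (lc g F c)" using spA[of X] by auto
    then show "\<phi> (a \<odot>\<^bsub>quot Z B\<^esub> X) = a \<odot>\<^bsub>quot Z' B'\<^esub> \<phi> X"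
      using sm[OF Fc(2,1)] by (simp add: A.smult_M A'.smult_M \<phi>)
  next
    show "\<phi> \<in> iso (add_monoid (quot Z B)) (add_monoid (quot Z' B'))"
    proof (rule isoI)
      show "\<phi> \<in> hom (add_monoid (quot Z B)) (add_monoid (quot Z' B'))"
      proof (rule homI)
        fix X assume "X \<in> carrier (add_monoid (quot Z B))"
        then obtain F c where Fc: "ok F c" "X = coset B (lc g F c)" using spA[of X] by auto
        then show "\<phi> X \<in> carrier (add_monoid (quot Z' B'))"
          using memA' by (simp add: \<phi> A'.carrier_M)
        fix Y assume "Y \<in> carrier (add_monoid (quot Z B))"
        then obtain F' c' where Fc': "ok F' c'" "Y = coset B (lc g F' c')" using spA[of Y] by auto
        obtain F'' c'' where "ok F'' c''" "\<And>h. lc h F c + lc h F' c' = lc h F'' c''"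
          using add[OF Fc(1) Fc'(1)] by blast
        then show "\<phi> (X \<otimes>\<^bsub>add_monoid (quot Z B)\<^esub> Y) = \<phi> X \<otimes>\<^bsub>add_monoid (quot Z' B')\<^esub> \<phi> Y"
          by (simp add: Fc Fc' \<phi> A.add_M A'.add_M)
      qed
      show "bij_betw \<phi> (carrier (add_monoid (quot Z B))) (carrier (add_monoid (quot Z' B')))"
        unfolding bij_betw_def
      proof
        show "inj_on \<phi> (carrier (add_monoid (quot Z B)))"
        proof (rule inj_onI)
          fix X Y assume XY: "X \<in> carrier (add_monoid (quot Z B))" "Y \<in> carrier (add_monoid (quot Z B))" "\<phi> X = \<phi> Y"
          then obtain F c F' c' where "ok F c" "X = coset B (lc g F c)" "ok F' c'" "Y = coset B (lc g F' c')"
            using spA[of X] spA[of Y] by auto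
          then show "X = Y" using XY(3) tr by (simp add: \<phi>)
        qed
        show "\<phi> ` carrier (add_monoid (quot Z B)) = carrier (add_monoid (quot Z' B'))"
        proof (intro equalityI subsetI)
          fix Y assume "Y \<in> \<phi> ` carrier (add_monoid (quot Z B))"
          then obtain X where X: "X \<in> carrier (quot Z B)" "Y = \<phi> X" by auto
          then obtain F c where "ok F c" "X = coset B (lc g F c)" using spA[of X] by auto
          then show "Y \<in> carrier (add_monoid (quot Z' B'))" using memA' X by (simp add: \<phi> A'.carrier_M)
        next
          fix Y assume "Y \<in> carrier (add_monoid (quot Z' B'))"
          then obtain F c where "ok F c" "Y = coset B' (lc g' F c)" using spA'[of Y] by auto
          then show "Y \<in> \<phi> ` carrier (add_monoid (quot Z B))"
            using memA by (intro image_eqI[of _ _ "coset B (lc g F c)"]) (auto simp: \<phi> A.carrier_M)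
        qed
      qed
    qed
  qed
  moreover have "\<phi> (coset B (g i)) = coset B' (g' i)" if "i \<in> I" for i
  proof -
    have "ok {i} (\<lambda>_. 1)" using that A.Z.Zp.one_mem by (auto simp: ok_def)
    from \<phi>[OF this] show ?thesis by (simp add: lc_def cst.hom_one)
  qed
  ultimately show ?thesis by blast
qed

section \<open>Integrality of the structure maps\<close>

lemma sum_triangle_le:
  "(\<Sum>j\<in>{1..n}. \<Sum>i\<in>{1..j}. f i j) = (\<Sum>i\<in>{1..n::nat}. \<Sum>k\<le>n - i. f i (i + k) :: 'a::comm_monoid_add)"
  unfolding sum.Sigma[OF finite_atLeastAtMost ballI[OF finite_atLeastAtMost]]
    sum.Sigma[OF finite_atLeastAtMost ballI[OF finite_atMost]]
  by (rule sum.reindex_bij_witness[of _ "\<lambda>(i, k). (i + k, i)" "\<lambda>(j, i). (i, j - i)"]) auto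

lemma sum_triangle_less:
  "(\<Sum>j\<in>{1..<n}. \<Sum>i\<in>{1..j}. f i j) = (\<Sum>i\<in>{1..<n::nat}. \<Sum>k<n - i. f i (i + k) :: 'a::comm_monoid_add)"
  unfolding sum.Sigma[OF finite_atLeastLessThan ballI[OF finite_atLeastAtMost]]
    sum.Sigma[OF finite_atLeastLessThan ballI[OF finite_lessThan]]
  by (rule sum.reindex_bij_witness[of _ "\<lambda>(i, k). (i + k, i)" "\<lambda>(j, i). (i, j - i)"]) auto

lemma sum_atMost_shift1: "(\<Sum>j\<le>n. f j) = f 0 + (\<Sum>j\<in>{1..n::nat}. f j :: 'a::comm_monoid_add)"
  by (simp add: atMost_atLeast0 sum.atLeast_Suc_atMost)

lemma sum_lessThan_shift1: "0 < n \<Longrightarrow> (\<Sum>j<n. f j) = f 0 + (\<Sum>j\<in>{1..<n::nat}. f j :: 'a::comm_monoid_add)"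
  by (simp add: lessThan_atLeast0 sum.atLeast_Suc_lessThan)

lemma polys_gen_induct [consumes 2, case_names cst Var add mult]:
  assumes "subring_on K" "f \<in> polys K G" "\<And>c. c \<in> K \<Longrightarrow> P (cst c)" "\<And>g. g \<in> G \<Longrightarrow> P (Var g)"
    "\<And>f g. f \<in> polys K G \<Longrightarrow> g \<in> polys K G \<Longrightarrow> P f \<Longrightarrow> P g \<Longrightarrow> P (f + g)"
    "\<And>f g. f \<in> polys K G \<Longrightarrow> g \<in> polys K G \<Longrightarrow> P f \<Longrightarrow> P g \<Longrightarrow> P (f * g)"
  shows "P f"
proof -
  interpret K: subring_on K by fact
  interpret R: subring_on "polys K G" by (rule subring_polys) fact
  have 1: "P 1" using assms(3)[OF K.one_mem] by (simp add: cst.hom_one)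
  have 0: "P 0" using assms(3)[OF K.zero_mem] by (simp add: cst.hom_zero)
  note V = Var_mem_polys[OF assms(1)]
  have pw: "P (Var g ^ n)" if "g \<in> G" for g n
    by (induction n) (auto intro!: 1 assms(4,6) that V R.power_mem)
  have pr: "P (\<Prod>g\<in>A. Var g ^ Poly_Mapping.lookup m g)" if "finite A" "A \<subseteq> G" for A m
    using that by (induction A rule: finite_induct) (auto intro!: 1 assms(6) pw R.power_mem R.prod_mem V)
  have mem: "(\<Prod>g\<in>A. Var g ^ Poly_Mapping.lookup m g) \<in> polys K G" if "A \<subseteq> G" for A m
    using that by (intro R.prod_mem R.power_mem V) auto
  have s: "P (\<Sum>m\<in>A. cst (Poly_Mapping.lookup f m) * mon Var m)" if "finite A" "A \<subseteq> Poly_Mapping.keys f" for A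
    using that
  proof (induction A rule: finite_induct)
    case (insert m A)
    have m: "m \<in> Poly_Mapping.keys f" using insert by auto
    have k: "Poly_Mapping.keys m \<subseteq> G" "Poly_Mapping.lookup f m \<in> K"
      using polys_keys[OF assms(2) m] polys_coeffD[OF assms(2) m] by auto
    have t: "P (cst (Poly_Mapping.lookup f m) * mon Var m)"
      unfolding mon_def by (intro assms(3,6) pr k finite_keys cst_mem_polys mem)
    have "cst (Poly_Mapping.lookup f m) * mon Var m \<in> polys K G" if "m \<in> Poly_Mapping.keys f" for m
      unfolding mon_def
      by (intro R.mult_mem cst_mem_polys mem polys_keys[OF assms(2)] polys_coeffD[OF assms(2)] that)
    then show ?case using insert by (auto intro!: assms(5) t R.sum_mem)
  qed (simp add: 0)
  have "f = (\<Sum>m\<in>Poly_Mapping.keys f. cst (Poly_Mapping.lookup f m) * mon Var m)"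
    by (subst pol_single_sum) (simp add: single_eq_mon)
  then show ?thesis using s[OF finite_keys order_refl] by simp
qed

lemma ell_0 [simp]: "ell p v 0 = 1"
  by (subst ell.simps) simp

lemma Delta_eq:
  "(\<Sum>a\<le>n. ell p v a * Delta p v t t' (n - a) ^ (p ^ a)) =
   (\<Sum>a\<le>n. \<Sum>b\<le>n - a. ell p v a * t b ^ (p ^ a) * t' (n - a - b) ^ (p ^ (a + b)))"
  by (subst sum_atMost_shift1) (subst Delta.simps, simp)

lemma p_etaR_ell:
  assumes "n > 0" "t 0 = 1"
  shows "cst (of_nat p) * etaR_ell p v t n = (\<Sum>i<n. etaR_ell p v t i * etaR p v t (n - i) ^ (p ^ i))"
  using assms(1) etaR.simps[of p v t n] by (simp add: sum_lessThan_shift1 etaR_ell_def assms(2))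

section \<open>The p-adic filtration and the lift of Frobenius\<close>

locale prime_local =
  fixes p :: nat
  assumes prime_p: "prime p"
begin

definition RZ :: "pol set" where "RZ = polys (Zp p) UNIV"

sublocale Zp: subring_on "Zp p" by (rule subring_Zp[OF prime_p])

sublocale RZ: subring_on RZ unfolding RZ_def by (rule subring_polys) (rule Zp.subring_on_axioms)

lemma p_gt_0: "p > 0" using prime_p by (rule prime_gt_0_nat)

lemma p_gt_1: "p > 1" using prime_p by (rule prime_gt_1_nat)

lemma cst_RZ: "c \<in> Zp p \<Longrightarrow> cst c \<in> RZ"
  unfolding RZ_def by (rule cst_mem_polys)

lemma Var_RZ: "Var g \<in> RZ"
  unfolding RZ_def by (rule Var_mem_polys) (auto intro: Zp.subring_on_axioms)

lemma polys_RZ: "f \<in> polys (Zp p) G \<Longrightarrow> f \<in> RZ"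
  unfolding RZ_def using polys_mono[of "Zp p" "Zp p" G UNIV] by auto

text \<open>\<open>fil k\<close> is \<open>p^(-k) RZ\<close>: a larger index allows more
  denominators, and \<open>fil (- 1)\<close> consists of the multiples of \<open>p\<close>.\<close>

definition fil :: "int \<Rightarrow> pol set" where
  "fil k = {x. cst (of_nat p powi k) * x \<in> RZ}"

lemma fil_0: "fil 0 = RZ" by (simp add: fil_def cst.hom_one)

lemma RZ_fil: "x \<in> RZ \<Longrightarrow> x \<in> fil 0" by (simp add: fil_0)

lemma fil_zero: "0 \<in> fil k" by (simp add: fil_def RZ.zero_mem)

lemma fil_add: "x \<in> fil k \<Longrightarrow> y \<in> fil k \<Longrightarrow> x + y \<in> fil k"
  by (simp add: fil_def distrib_left RZ.add_mem)

lemma fil_diff: "x \<in> fil k \<Longrightarrow> y \<in> fil k \<Longrightarrow> x - y \<in> fil k"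
  by (simp add: fil_def right_diff_distrib RZ.diff_mem)

lemma fil_uminus: "x \<in> fil k \<Longrightarrow> - x \<in> fil k"
  using fil_diff[OF fil_zero, of x k] by simp

lemma fil_sum: "(\<And>a. a \<in> A \<Longrightarrow> f a \<in> fil k) \<Longrightarrow> sum f A \<in> fil k"
  by (induction A rule: infinite_finite_induct) (auto intro: fil_zero fil_add)

lemma fil_mult: "x \<in> fil k \<Longrightarrow> y \<in> fil l \<Longrightarrow> x * y \<in> fil (k + l)"
proof -
  assume "x \<in> fil k" "y \<in> fil l"
  then have "(cst (of_nat p powi k) * x) * (cst (of_nat p powi l) * y) \<in> RZ"
    unfolding fil_def by (auto intro: RZ.mult_mem)
  also have "(cst (of_nat p powi k) * x) * (cst (of_nat p powi l) * y) = cst (of_nat p powi (k + l)) * (x * y)"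
    using p_gt_0 by (simp add: power_int_add cst.hom_mult mult_ac)
  finally show ?thesis by (simp add: fil_def)
qed

lemma fil_mono: "x \<in> fil k \<Longrightarrow> k \<le> l \<Longrightarrow> x \<in> fil l"
proof -
  assume x: "x \<in> fil k" and "k \<le> l"
  then obtain n where n: "l = k + int n" using zle_iff_zadd by auto
  have "cst (of_nat p powi int n) \<in> RZ"
    by (rule cst_RZ) (simp add: Zp.power_mem Zp.of_nat_mem)
  then have "cst (of_nat p powi int n) * (cst (of_nat p powi k) * x) \<in> RZ"
    using x unfolding fil_def by (auto intro: RZ.mult_mem)
  then show ?thesis
    using p_gt_0 by (simp add: fil_def n power_int_add cst.hom_mult mult_ac)
qed

lemma fil_mult0: "x \<in> RZ \<Longrightarrow> y \<in> fil l \<Longrightarrow> x * y \<in> fil l"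
  using fil_mult[of x 0 y l] by (simp add: fil_0)

lemma fil_power: "x \<in> fil k \<Longrightarrow> x ^ n \<in> fil (int n * k)"
proof (induction n)
  case 0
  then show ?case by (simp add: fil_0 RZ.one_mem)
next
  case (Suc n)
  then show ?case using fil_mult[of x k "x ^ n" "int n * k"] by (simp add: algebra_simps)
qed

lemma cst_fil: "c * of_nat p powi k \<in> Zp p \<Longrightarrow> cst c \<in> fil k"
  unfolding fil_def by (simp add: cst.hom_mult[symmetric] cst_RZ mult.commute)

lemma cst_p_inv_fil: "cst (1 / of_nat p) \<in> fil 1"
  using p_gt_0 by (intro cst_fil) (simp add: Zp.one_mem)

lemma fil_neg_iff: "x \<in> fil (- int n) \<longleftrightarrow> (\<exists>y\<in>RZ. x = cst (of_nat p ^ n) * y)"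
proof
  assume "x \<in> fil (- int n)"
  then have "cst (of_nat p powi (- int n)) * x \<in> RZ" by (simp add: fil_def)
  moreover have "x = cst (of_nat p ^ n) * (cst (of_nat p powi (- int n)) * x)"
    using p_gt_0 by (simp add: mult.assoc[symmetric] cst.hom_mult[symmetric] power_int_minus cst.hom_one)
  ultimately show "\<exists>y\<in>RZ. x = cst (of_nat p ^ n) * y" by blast
next
  assume "\<exists>y\<in>RZ. x = cst (of_nat p ^ n) * y"
  then obtain y where "y \<in> RZ" "x = cst (of_nat p ^ n) * y" by blast
  then show "x \<in> fil (- int n)"
    using p_gt_0 by (simp add: fil_def mult.assoc[symmetric] cst.hom_mult[symmetric] power_int_minus cst.hom_one)
qed

lemma fil_neg1_iff: "x \<in> fil (- 1) \<longleftrightarrow> (\<exists>y\<in>RZ. x = cst (of_nat p) * y)"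
  using fil_neg_iff[of x 1] by simp

text \<open>The cofactor of \<open>x - y\<close> in \<open>x^p - y^p\<close> is congruent to
  \<open>p * y^(p-1)\<close> modulo \<open>p\<close>, so it supplies one more factor
  \<open>p\<close>.\<close>

lemma fil_power_diff_step:
  assumes "x \<in> RZ" "y \<in> RZ" "x - y \<in> fil (- int k)" "k \<ge> 1"
  shows "x ^ p - y ^ p \<in> fil (- int (Suc k))"
proof -
  have pw: "x ^ n - y ^ n \<in> fil (- int k)" for n
  proof (induction n)
    case (Suc n)
    have "x ^ Suc n - y ^ Suc n = x * (x ^ n - y ^ n) + y ^ n * (x - y)"
      by (simp add: algebra_simps)
    also have "\<dots> \<in> fil (- int k)"
      by (intro fil_add fil_mult0 RZ.power_mem assms Suc)
    finally show ?case .
  qed (simp add: fil_zero)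
  have "x ^ p - y ^ p = (x - y) * (\<Sum>i<p. y ^ (p - Suc i) * x ^ i)"
    by (rule power_diff_sumr2)
  also have "\<dots> \<in> fil (- int k + (- 1))"
  proof (rule fil_mult[OF assms(3)])
    have "(\<Sum>i<p. y ^ (p - Suc i) * x ^ i) = (\<Sum>i<p. y ^ (p - Suc i) * (x ^ i - y ^ i)) + (\<Sum>i<p. y ^ (p - Suc i) * y ^ i)"
      by (simp add: sum.distrib[symmetric] algebra_simps)
    also have "(\<Sum>i<p. y ^ (p - Suc i) * y ^ i) = (\<Sum>i<p. y ^ (p - 1))"
      by (intro sum.cong refl) (auto simp: power_add[symmetric])
    also have "\<dots> = cst (of_nat p) * y ^ (p - 1)"
      by (simp add: cst.hom_of_nat)
    also have "(\<Sum>i<p. y ^ (p - Suc i) * (x ^ i - y ^ i)) + cst (of_nat p) * y ^ (p - 1) \<in> fil (- 1)"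
    proof (rule fil_add)
      show "(\<Sum>i<p. y ^ (p - Suc i) * (x ^ i - y ^ i)) \<in> fil (- 1)"
        by (intro fil_sum fil_mult0 RZ.power_mem assms fil_mono[OF pw]) (use assms(4) in auto)
      show "cst (of_nat p) * y ^ (p - 1) \<in> fil (- 1)"
        unfolding fil_neg1_iff using RZ.power_mem[OF assms(2)] by blast
    qed
    finally show "(\<Sum>i<p. y ^ (p - Suc i) * x ^ i) \<in> fil (- 1)" .
  qed
  finally show ?thesis by (simp add: algebra_simps)
qed

lemma fil_power_diff:
  assumes "x \<in> RZ" "y \<in> RZ" "x - y \<in> fil (- 1)"
  shows "x ^ (p ^ n) - y ^ (p ^ n) \<in> fil (- int (Suc n))"
proof (induction n)
  case 0
  then show ?case using assms by simp
next
  case (Suc n)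
  have "(x ^ (p ^ n)) ^ p - (y ^ (p ^ n)) ^ p \<in> fil (- int (Suc (Suc n)))"
    by (rule fil_power_diff_step) (use Suc assms in \<open>auto intro: RZ.power_mem\<close>)
  then show ?case by (simp add: power_mult[symmetric] mult.commute)
qed

text \<open>The endomorphism lifting the Frobenius that Hazewinkel's functional equation requires:
  it fixes the coefficients, and \<open>frob_cong\<close> shows that it agrees with the
  \<open>p\<close>-th power modulo \<open>p\<close>.\<close>

definition frob :: "pol \<Rightarrow> pol" where "frob = subst (\<lambda>g. Var g ^ p)"

sublocale frob: ring_hom_on frob
  unfolding frob_def by (rule subst.ring_hom_on_axioms)

lemma frob_cst [simp]: "frob (cst c) = cst c" by (simp add: frob_def)

lemma frob_Var [simp]: "frob (Var g) = Var g ^ p" by (simp add: frob_def)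

lemma add_power_p:
  assumes "x \<in> RZ" "y \<in> RZ"
  shows "(x + y) ^ p - x ^ p - y ^ p \<in> fil (- 1)"
proof -
  have "(x + y) ^ p = (\<Sum>k\<le>p. of_nat (p choose k) * x ^ k * y ^ (p - k))" by (rule binomial_ring)
  also have "{..p} = insert 0 (insert p {1..<p})" using p_gt_0 by auto
  also have "(\<Sum>k\<in>insert 0 (insert p {1..<p}). of_nat (p choose k) * x ^ k * y ^ (p - k)) =
      y ^ p + (x ^ p + (\<Sum>k\<in>{1..<p}. of_nat (p choose k) * x ^ k * y ^ (p - k)))"
    using p_gt_0 by (subst sum.insert; simp)+
  finally have "(x + y) ^ p - x ^ p - y ^ p = (\<Sum>k\<in>{1..<p}. of_nat (p choose k) * x ^ k * y ^ (p - k))"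
    by simp
  also have "\<dots> \<in> fil (- 1)"
  proof (rule fil_sum)
    fix k assume k: "k \<in> {1..<p}"
    then have "p dvd (p choose k)" using prime_p by (intro dvd_choose_prime) auto
    then obtain m where m: "p choose k = p * m" by auto
    show "of_nat (p choose k) * x ^ k * y ^ (p - k) \<in> fil (- 1)"
      unfolding fil_neg1_iff using assms
      by (intro bexI[of _ "of_nat m * x ^ k * y ^ (p - k)"] RZ.mems)
        (auto simp: m cst.hom_of_nat mult.assoc)
  qed
  finally show ?thesis .
qed

lemma fermat_Zp:
  assumes "c \<in> Zp p" shows "cst c - cst c ^ p \<in> fil (- 1)"
proof -
  have n: "(cst (of_nat n) :: pol) - cst (of_nat n) ^ p \<in> fil (- 1)" for n
  proof (induction n)
    case 0
    then show ?case using p_gt_0 by (simp add: cst.hom_zero fil_zero zero_power)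
  next
    case (Suc n)
    have "cst (of_nat (Suc n)) - cst (of_nat (Suc n)) ^ p =
       (cst (of_nat n) - cst (of_nat n) ^ p) - ((cst (of_nat n) + 1) ^ p - cst (of_nat n) ^ p - 1 ^ p)"
      by (simp add: cst.hom_add cst.hom_one add.commute)
    also have "\<dots> \<in> fil (- 1)"
      by (rule fil_diff[OF Suc add_power_p[OF cst_RZ[OF Zp.of_nat_mem] RZ.one_mem]])
    finally show ?case .
  qed
  \<comment> \<open>Every element of \<open>Z_(p)\<close> is congruent to a natural number modulo
    \<open>p\<close>, and their \<open>p\<close>-th powers are then congruent as well.\<close>
  obtain m where m: "(c - of_nat m) / of_nat p ^ 1 \<in> Zp p"
    using Zp_mod_power[OF prime_p assms] by blast
  have d: "cst c - cst (of_nat m) \<in> fil (- 1)"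
    unfolding cst.hom_diff[symmetric] using m by (intro cst_fil) (simp add: power_int_minus divide_inverse)
  have "cst c ^ p ^ 1 - cst (of_nat m) ^ p ^ 1 \<in> fil (- int (Suc 1))"
    by (rule fil_power_diff[OF cst_RZ[OF assms] cst_RZ[OF Zp.of_nat_mem] d])
  then have "cst c ^ p - cst (of_nat m) ^ p \<in> fil (- 1)" by (auto elim!: fil_mono)
  from fil_diff[OF fil_add[OF d n[of m]] this] show ?thesis by simp
qed

lemma frob_RZ: "x \<in> RZ \<Longrightarrow> frob x \<in> RZ"
  unfolding frob_def
  by (rule subst_mem[OF RZ.subring_on_axioms, of _ "Zp p" UNIV])
    (auto simp: RZ_def[symmetric] intro: cst_RZ RZ.power_mem Var_RZ)

lemma frob_cong:
  assumes "x \<in> RZ" shows "frob x - x ^ p \<in> fil (- 1)"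
proof -
  have "x \<in> polys (Zp p) UNIV" using assms by (simp add: RZ_def)
  from Zp.subring_on_axioms this show ?thesis
  proof (induction x rule: polys_gen_induct)
    case (cst c)
    then show ?case by (simp add: fermat_Zp)
  next
    case (Var g)
    then show ?case by (simp add: fil_zero)
  next
    case (add f g)
    have "frob (f + g) - (f + g) ^ p = (frob f - f ^ p) + (frob g - g ^ p) - ((f + g) ^ p - f ^ p - g ^ p)"
      by (simp add: frob.hom_add)
    also have "\<dots> \<in> fil (- 1)"
      by (rule fil_diff[OF fil_add[OF add(3,4)] add_power_p]) (use add in \<open>auto simp: RZ_def\<close>)
    finally show ?case .
  next
    case (mult f g)
    then have m: "f \<in> RZ" "g \<in> RZ" by (auto simp: RZ_def)
    have "frob (f * g) - (f * g) ^ p = frob g * (frob f - f ^ p) + f ^ p * (frob g - g ^ p)"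
      by (simp add: frob.hom_mult power_mult_distrib algebra_simps)
    also have "\<dots> \<in> fil (- 1)"
      by (intro fil_add fil_mult0 mult frob_RZ RZ.power_mem m)
    finally show ?case .
  qed
qed

abbreviation frobs :: "nat \<Rightarrow> pol \<Rightarrow> pol" where "frobs i \<equiv> frob ^^ i"

lemma frobs_hom: "ring_hom_on (frobs i)"
  by (induction i) (auto simp: ring_hom_on_def frob.hom_add frob.hom_mult frob.hom_one)

sublocale frobs: ring_hom_on "frobs i" for i by (rule frobs_hom)

lemma frobs_cst [simp]: "frobs i (cst c) = cst c" by (induction i) auto

lemma frobs_RZ: "x \<in> RZ \<Longrightarrow> frobs i x \<in> RZ" by (induction i) (auto intro: frob_RZ)

lemma frobs_fil: "x \<in> fil k \<Longrightarrow> frobs i x \<in> fil k"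
  using frobs_RZ[of "cst (of_nat p powi k) * x" i] by (simp add: fil_def frobs.hom_mult)

lemma frobs_cong: "x \<in> RZ \<Longrightarrow> x ^ (p ^ i) - frobs i x \<in> fil (- 1)"
proof (induction i)
  case 0
  then show ?case by (simp add: fil_zero)
next
  case (Suc i)
  have "(x ^ p ^ i) ^ p ^ 1 - frobs i x ^ p ^ 1 \<in> fil (- int (Suc 1))"
    by (intro fil_power_diff RZ.power_mem frobs_RZ Suc)
  then have "x ^ p ^ Suc i - frobs i x ^ p \<in> fil (- 1)"
    by (auto simp: power_mult[symmetric] mult.commute elim!: fil_mono)
  from fil_diff[OF this frob_cong[OF frobs_RZ[OF Suc(2), of i]]] show ?case by simp
qed

text \<open>The exponent \<open>k + 1\<close> is exactly what cancels the denominator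
  \<open>p^k\<close> of \<open>ell_k\<close> together with the factor \<open>1/p\<close> of the
  functional equation.\<close>

lemma frobs_cong_power:
  assumes "x \<in> RZ" shows "x ^ (p ^ (i + k)) - frobs i x ^ (p ^ k) \<in> fil (- int (Suc k))"
  using fil_power_diff[OF RZ.power_mem[OF assms] frobs_RZ[OF assms] frobs_cong[OF assms], of i k]
  by (simp add: power_mult[symmetric] power_add)

lemma p_ell: "n > 0 \<Longrightarrow> cst (of_nat p) * ell p v n = (\<Sum>i<n. ell p v i * v (n - i) ^ (p ^ i))"
  using p_gt_0 by (subst ell.simps) (simp add: mult.assoc[symmetric] cst.hom_mult[symmetric] cst.hom_one)

lemma ell_eq: "n > 0 \<Longrightarrow> ell p v n = cst (1 / of_nat p) * (\<Sum>i<n. ell p v i * v (n - i) ^ (p ^ i))"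
  by (subst ell.simps) simp

lemma p_inv_p: "cst (1 / of_nat p) * (cst (of_nat p) * x) = x"
  using p_gt_0 by (simp add: mult.assoc[symmetric] cst.hom_mult[symmetric] cst.hom_one)

lemma p_p_inv: "cst (of_nat p) * (cst (1 / of_nat p) * x) = x"
  using p_gt_0 by (simp add: mult.assoc[symmetric] cst.hom_mult[symmetric] cst.hom_one)

lemma ell_fil:
  assumes "\<And>k. v k \<in> RZ" shows "ell p v n \<in> fil (int n)"
proof (induction n rule: less_induct)
  case (less n)
  show ?case
  proof (cases "n = 0")
    case True
    then show ?thesis by (simp add: fil_0 RZ.one_mem)
  next
    case False
    have "(\<Sum>i<n. ell p v i * v (n - i) ^ (p ^ i)) \<in> fil (int n - 1)"
    proof (rule fil_sum)
      fix i assume "i \<in> {..<n}"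
      then have "ell p v i \<in> fil (int n - 1)" using fil_mono[OF less[of i], of "int n - 1"] by auto
      then show "ell p v i * v (n - i) ^ (p ^ i) \<in> fil (int n - 1)"
        using fil_mult0[OF RZ.power_mem[OF assms]] by (simp add: mult.commute)
    qed
    from fil_mult[OF cst_p_inv_fil this] show ?thesis using False by (simp add: ell_eq)
  qed
qed

end

section \<open>Hazewinkel's functional equation lemma and integrality of right unit and
  coproduct\<close>

locale hazewinkel = prime_local p for p +
  fixes v :: "nat \<Rightarrow> pol"
  assumes v_RZ: "v k \<in> RZ" and frob_v: "frob (v k) = v k ^ p"
begin

lemma frobs_v: "frobs i (v k) = v k ^ (p ^ i)"
  by (induction i) (auto simp: frob.hom_power frob_v power_mult)

text \<open>The functional equation of the logarithm. The defining recursion splits off the last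
  \<open>v\<close>, this one the first; inserting the claim for smaller indices and interchanging
  the two summations passes from one to the other.\<close>

lemma p_ell_frob:
  "n > 0 \<Longrightarrow> cst (of_nat p) * ell p v n = (\<Sum>i\<in>{1..n}. v i * frobs i (ell p v (n - i)))"
proof (induction n rule: less_induct)
  case (less n)
  have e: "ell p v k = (\<Sum>i\<in>{1..k}. cst (1 / of_nat p) * (v i * frobs i (ell p v (k - i))))"
    if "k \<in> {1..<n}" for k
    using p_inv_p[of "ell p v k"] less.IH[of k] that by (simp add: sum_distrib_left)
  have "cst (of_nat p) * ell p v n = v n + (\<Sum>k\<in>{1..<n}. ell p v k * v (n - k) ^ (p ^ k))"
    using less.prems by (simp add: p_ell sum_lessThan_shift1)
  also have "(\<Sum>k\<in>{1..<n}. ell p v k * v (n - k) ^ (p ^ k)) =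
     (\<Sum>k\<in>{1..<n}. \<Sum>i\<in>{1..k}. cst (1 / of_nat p) * (v i * frobs i (ell p v (k - i))) * v (n - k) ^ (p ^ k))"
    by (intro sum.cong refl, subst e) (simp_all add: sum_distrib_right)
  also have "\<dots> = (\<Sum>i\<in>{1..<n}. \<Sum>k<n - i.
      cst (1 / of_nat p) * (v i * frobs i (ell p v k)) * v (n - i - k) ^ (p ^ (i + k)))"
    by (subst sum_triangle_less) simp
  also have "\<dots> = (\<Sum>i\<in>{1..<n}. v i * frobs i (ell p v (n - i)))"
  proof (rule sum.cong[OF refl])
    fix i assume i: "i \<in> {1..<n}"
    have "(\<Sum>k<n - i. cst (1 / of_nat p) * (v i * frobs i (ell p v k)) * v (n - i - k) ^ (p ^ (i + k))) =
      v i * (frobs i (cst (1 / of_nat p) * (\<Sum>k<n - i. ell p v k * v (n - i - k) ^ (p ^ k))))"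
      by (simp add: frobs.hom_simps frobs_v sum_distrib_left power_mult[symmetric] power_add mult_ac)
    also have "\<dots> = v i * frobs i (ell p v (n - i))"
      using i by (simp add: ell_eq[of "n - i"])
    finally show "(\<Sum>k<n - i. cst (1 / of_nat p) * (v i * frobs i (ell p v k)) * v (n - i - k) ^ (p ^ (i + k))) =
        v i * frobs i (ell p v (n - i))" .
  qed
  also have "v n + \<dots> = (\<Sum>i\<in>{1..n}. v i * frobs i (ell p v (n - i)))"
  proof -
    have "{1..n} = insert n {1..<n}" using less.prems by auto
    then show ?thesis by (simp add: frobs.hom_one)
  qed
  finally show ?case .
qed

lemma ell_frob:
  "n > 0 \<Longrightarrow> ell p v n = (\<Sum>i\<in>{1..n}. cst (1 / of_nat p) * v i * frobs i (ell p v (n - i)))"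
  using p_inv_p[of "ell p v n"] p_ell_frob[of n] by (simp add: sum_distrib_left mult.assoc)

text \<open>
  Hazewinkel's functional equation lemma: a sequence \<open>Y\<^sub>n = \<Sum>\<^bsub>j\<le>n\<^esub> \<ell>\<^sub>j a\<^bsub>n-j\<^esub>^(p^j)\<close> has integral components
  \<open>a\<^sub>j\<close> if and only if its deviation \<open>fdef Y\<close> from the functional equation is integral.
\<close>

definition fdef :: "(nat \<Rightarrow> pol) \<Rightarrow> nat \<Rightarrow> pol" where
  "fdef Y n = Y n - (\<Sum>i\<in>{1..n}. cst (1 / of_nat p) * v i * frobs i (Y (n - i)))"

lemma fdef_cong: "(\<And>m. m \<le> n \<Longrightarrow> Y m = Y' m) \<Longrightarrow> fdef Y n = fdef Y' n"
  by (simp add: fdef_def)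

lemma fdef_sum: "fdef (\<lambda>n. \<Sum>b\<in>S. Y b n) n = (\<Sum>b\<in>S. fdef (Y b) n)"
proof -
  have "(\<Sum>i\<in>{1..n}. cst (1 / of_nat p) * v i * frobs i (\<Sum>b\<in>S. Y b (n - i))) =
     (\<Sum>b\<in>S. \<Sum>i\<in>{1..n}. cst (1 / of_nat p) * v i * frobs i (Y b (n - i)))"
    by (subst sum.swap) (simp add: frobs.hom_sum sum_distrib_left)
  then show ?thesis by (simp add: fdef_def sum_subtractf)
qed

text \<open>After \<open>ell_frob\<close> is inserted, the terms pair up as \<open>ell_k\<close>
  times \<open>a^(p^(i+k)) - frob^i(a)^(p^k)\<close>. The difference is divisible by
  \<open>p^(k+1)\<close>, which absorbs \<open>1/p\<close> and the denominator of
  \<open>ell_k\<close>.\<close>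

lemma fdef_witt:
  assumes a: "\<And>m. a m \<in> RZ"
  shows "fdef (\<lambda>n. \<Sum>j\<le>n. ell p v j * a (n - j) ^ (p ^ j)) n \<in> RZ"
proof -
  let ?Y = "\<lambda>n. \<Sum>j\<le>n. ell p v j * a (n - j) ^ (p ^ j)"
  have "?Y n = a n + (\<Sum>j\<in>{1..n}. ell p v j * a (n - j) ^ (p ^ j))"
    by (simp add: sum_atMost_shift1)
  also have "(\<Sum>j\<in>{1..n}. ell p v j * a (n - j) ^ (p ^ j)) =
     (\<Sum>j\<in>{1..n}. \<Sum>i\<in>{1..j}. cst (1 / of_nat p) * v i * frobs i (ell p v (j - i)) * a (n - j) ^ (p ^ j))"
    by (intro sum.cong refl, subst ell_frob) (auto simp: sum_distrib_right)
  also have "\<dots> = (\<Sum>i\<in>{1..n}. \<Sum>k\<le>n - i. cst (1 / of_nat p) * v i * frobs i (ell p v k) * a (n - i - k) ^ (p ^ (i + k)))"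
    by (subst sum_triangle_le) simp
  finally have "fdef ?Y n = a n + (\<Sum>i\<in>{1..n}. \<Sum>k\<le>n - i. cst (1 / of_nat p) * v i *
      (frobs i (ell p v k) * (a (n - i - k) ^ (p ^ (i + k)) - frobs i (a (n - i - k)) ^ (p ^ k))))"
    by (simp add: fdef_def frobs.hom_simps sum_distrib_left sum_subtractf[symmetric] right_diff_distrib mult.assoc)
  also have "\<dots> \<in> fil 0"
  proof (rule fil_add[OF RZ_fil[OF a]], intro fil_sum)
    fix i k
    have "v i * (frobs i (ell p v k) * (a (n - i - k) ^ (p ^ (i + k)) - frobs i (a (n - i - k)) ^ (p ^ k)))
        \<in> fil (int k + - int (Suc k))"
      by (intro fil_mult0 v_RZ fil_mult frobs_fil ell_fil frobs_cong_power a)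
    from fil_mult[OF cst_p_inv_fil this]
    show "cst (1 / of_nat p) * v i *
      (frobs i (ell p v k) * (a (n - i - k) ^ (p ^ (i + k)) - frobs i (a (n - i - k)) ^ (p ^ k))) \<in> fil 0"
      by (simp add: mult.assoc)
  qed
  finally show ?thesis by (simp add: fil_0)
qed

text \<open>Induction on the index: once the earlier components are integral, truncation isolates
  \<open>a n\<close> as the difference of two integral deviations.\<close>

lemma witt_integral:
  assumes Y: "\<And>n. Y n = (\<Sum>j\<le>n. ell p v j * a (n - j) ^ (p ^ j))" and d: "\<And>n. fdef Y n \<in> RZ"
  shows "a n \<in> RZ"
proof (induction n rule: less_induct)
  case (less n)
  \<comment> \<open>With the components from \<open>n\<close> on set to 0, the truncated sequence
    \<open>X\<close> agrees with \<open>Y\<close> below \<open>n\<close> and lacks exactly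
    \<open>a n\<close> at \<open>n\<close>.\<close>
  define a' where "a' m = (if m < n then a m else 0)" for m
  define X where "X n = (\<Sum>j\<le>n. ell p v j * a' (n - j) ^ (p ^ j))" for n
  have a': "a' m \<in> RZ" for m by (auto simp: a'_def less RZ.zero_mem)
  have X: "X m = Y m" if "m < n" for m unfolding X_def Y using that by (intro sum.cong refl) (auto simp: a'_def)
  have Xn: "X n = Y n - a n"
  proof -
    have "X n = a' n + (\<Sum>j\<in>{1..n}. ell p v j * a' (n - j) ^ (p ^ j))"
      by (simp add: X_def sum_atMost_shift1)
    also have "\<dots> = (\<Sum>j\<in>{1..n}. ell p v j * a (n - j) ^ (p ^ j))"
      by (auto simp: a'_def intro!: sum.cong)
    also have "\<dots> = Y n - a n" by (simp add: Y sum_atMost_shift1)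
    finally show ?thesis .
  qed
  have "fdef X n = fdef Y n - a n"
    using X by (simp add: fdef_def Xn)
  moreover have "fdef X n \<in> RZ" unfolding X_def using a' by (rule fdef_witt)
  ultimately have "fdef Y n - fdef X n = a n" by simp
  then show ?case using RZ.diff_mem[OF d \<open>fdef X n \<in> RZ\<close>, of n] by simp
qed

end

locale hazewinkel_t = hazewinkel p v for p v +
  fixes t :: "nat \<Rightarrow> pol"
  assumes t_RZ: "t k \<in> RZ" and t_0: "t 0 = 1"
begin

text \<open>The right-hand side of the equation defining \<open>Delta\<close> is a finite sum of
  Witt sequences with integral components. Deviations add up, so the sum has integral components
  too.\<close>

lemma Delta_RZ:
  assumes t': "\<And>k. t' k \<in> RZ"
  shows "Delta p v t t' n \<in> RZ"
proof (rule witt_integral[OF refl])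
  fix n
  \<comment> \<open>For fixed \<open>b\<close>, \<open>A b\<close> is the component sequence of the
    terms \<open>t_b t'_c^(p^b)\<close>, shifted so that degree \<open>b + c\<close> is respected
    and padded by 0 below \<open>b\<close>.\<close>
  define A where "A b m = (if b \<le> m then t b * t' (m - b) ^ (p ^ b) else 0)" for b m
  have "(\<Sum>j\<le>m. ell p v j * Delta p v t t' (m - j) ^ (p ^ j)) =
      (\<Sum>b\<le>n. \<Sum>j\<le>m. ell p v j * A b (m - j) ^ (p ^ j))" if "m \<le> n" for m
  proof -
    have "(\<Sum>j\<le>m. ell p v j * Delta p v t t' (m - j) ^ (p ^ j)) =
      (\<Sum>j\<le>m. \<Sum>b\<le>m - j. ell p v j * A b (m - j) ^ (p ^ j))"
      unfolding Delta_eq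
      by (intro sum.cong refl) (auto simp: A_def power_mult_distrib power_mult[symmetric] power_add mult_ac)
    also have "\<dots> = (\<Sum>j\<le>m. \<Sum>b\<le>n. ell p v j * A b (m - j) ^ (p ^ j))"
      by (rule sum.cong[OF refl], rule sum.mono_neutral_left) (use that p_gt_0 in \<open>auto simp: A_def zero_power\<close>)
    also have "\<dots> = (\<Sum>b\<le>n. \<Sum>j\<le>m. ell p v j * A b (m - j) ^ (p ^ j))" by (rule sum.swap)
    finally show ?thesis .
  qed
  then have "fdef (\<lambda>n. \<Sum>j\<le>n. ell p v j * Delta p v t t' (n - j) ^ p ^ j) n =
      fdef (\<lambda>m. \<Sum>b\<le>n. \<Sum>j\<le>m. ell p v j * A b (m - j) ^ (p ^ j)) n"
    by (rule fdef_cong)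
  also have "\<dots> = (\<Sum>b\<le>n. fdef (\<lambda>m. \<Sum>j\<le>m. ell p v j * A b (m - j) ^ (p ^ j)) n)"
    by (rule fdef_sum)
  also have "\<dots> \<in> RZ"
    by (intro RZ.sum_mem fdef_witt) (auto simp: A_def intro!: RZ.mems t_RZ t')
  finally show "fdef (\<lambda>n. \<Sum>j\<le>n. ell p v j * Delta p v t t' (n - j) ^ p ^ j) n \<in> RZ" .
qed

lemma etaR_ell_0 [simp]: "etaR_ell p v t 0 = 1" by (simp add: etaR_ell_def t_0)

lemma etaR_ell_fil: "etaR_ell p v t n \<in> fil (int n)"
  unfolding etaR_ell_def
proof (rule fil_sum)
  fix i assume "i \<in> {..n}"
  then have "ell p v i \<in> fil (int n)" using fil_mono[OF ell_fil[where v = v and n = i], of "int n"] v_RZ by auto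
  then show "ell p v i * t (n - i) ^ (p ^ i) \<in> fil (int n)"
    using fil_mult0[OF RZ.power_mem[OF t_RZ]] by (simp add: mult.commute)
qed

lemma fdef_etaR_ell: "fdef (etaR_ell p v t) n \<in> RZ"
  unfolding etaR_ell_def by (rule fdef_witt) (rule t_RZ)

text \<open>In the recursion for \<open>eta_R(v_n)\<close> the logarithm is replaced by
  \<open>etaR_ell\<close>, which satisfies the functional equation only up to the integral error
  \<open>fdef\<close>. Substituting this equation both in \<open>p * etaR_ell n\<close> and in the
  convolution makes the sums of \<open>v_j * frob^j(etaR_ell (n - j))\<close> cancel; the remaining
  terms are integral by induction.\<close>

lemma etaR_RZ: "n > 0 \<Longrightarrow> etaR p v t n \<in> RZ"
proof (induction n rule: less_induct)
  case (less n)
  let ?Y = "etaR_ell p v t" and ?w = "etaR p v t" and ?q = "cst (1 / of_nat p)"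
  have Yeq: "?Y m = fdef ?Y m + (\<Sum>i\<in>{1..m}. ?q * v i * frobs i (?Y (m - i)))" for m
    by (simp add: fdef_def)
  have "(\<Sum>i\<in>{1..<n}. ?Y i * ?w (n - i) ^ (p ^ i)) =
    (\<Sum>i\<in>{1..<n}. fdef ?Y i * ?w (n - i) ^ (p ^ i)) +
    (\<Sum>i\<in>{1..<n}. \<Sum>j\<in>{1..i}. ?q * v j * frobs j (?Y (i - j)) * ?w (n - i) ^ (p ^ i))"
    by (subst Yeq) (simp add: distrib_right sum.distrib sum_distrib_right)
  also have "(\<Sum>i\<in>{1..<n}. \<Sum>j\<in>{1..i}. ?q * v j * frobs j (?Y (i - j)) * ?w (n - i) ^ (p ^ i)) =
    (\<Sum>j\<in>{1..<n}. \<Sum>k<n - j. ?q * v j * frobs j (?Y k) * ?w (n - j - k) ^ (p ^ (j + k)))"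
    by (subst sum_triangle_less) simp
  also have "\<dots> = (\<Sum>j\<in>{1..<n}. \<Sum>k<n - j. ?q * v j * (frobs j (?Y k) *
       (?w (n - j - k) ^ (p ^ (j + k)) - frobs j (?w (n - j - k)) ^ (p ^ k)))) +
    (\<Sum>j\<in>{1..<n}. ?q * v j * frobs j (\<Sum>k<n - j. ?Y k * ?w (n - j - k) ^ (p ^ k)))"
    by (simp add: frobs.hom_simps sum_distrib_left sum.distrib[symmetric] algebra_simps)
  also have "(\<Sum>j\<in>{1..<n}. ?q * v j * frobs j (\<Sum>k<n - j. ?Y k * ?w (n - j - k) ^ (p ^ k))) =
     (\<Sum>j\<in>{1..<n}. v j * frobs j (?Y (n - j)))"
  proof (rule sum.cong[OF refl])
    fix j assume "j \<in> {1..<n}"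
    then have "(\<Sum>k<n - j. ?Y k * ?w (n - j - k) ^ (p ^ k)) = cst (of_nat p) * ?Y (n - j)"
      by (simp add: p_etaR_ell[where t = t, OF _ t_0])
    then have "frobs j (\<Sum>k<n - j. ?Y k * ?w (n - j - k) ^ (p ^ k)) = cst (of_nat p) * frobs j (?Y (n - j))"
      by (simp only: frobs.hom_mult frobs_cst)
    then show "?q * v j * frobs j (\<Sum>k<n - j. ?Y k * ?w (n - j - k) ^ (p ^ k)) = v j * frobs j (?Y (n - j))"
      by (simp only: mult.assoc mult.left_commute[of ?q] p_inv_p p_p_inv)
  qed
  finally have s: "(\<Sum>i\<in>{1..<n}. ?Y i * ?w (n - i) ^ (p ^ i)) =
    (\<Sum>i\<in>{1..<n}. fdef ?Y i * ?w (n - i) ^ (p ^ i)) +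
    ((\<Sum>j\<in>{1..<n}. \<Sum>k<n - j. ?q * v j * (frobs j (?Y k) *
       (?w (n - j - k) ^ (p ^ (j + k)) - frobs j (?w (n - j - k)) ^ (p ^ k)))) +
     (\<Sum>j\<in>{1..<n}. v j * frobs j (?Y (n - j))))" .
  have "cst (of_nat p) * ?Y n = cst (of_nat p) * fdef ?Y n + (\<Sum>i\<in>{1..n}. v i * frobs i (?Y (n - i)))"
    by (subst Yeq) (simp add: distrib_left sum_distrib_left p_p_inv mult.assoc)
  also have "{1..n} = insert n {1..<n}" using less.prems by auto
  also have "(\<Sum>i\<in>insert n {1..<n}. v i * frobs i (?Y (n - i))) = v n + (\<Sum>j\<in>{1..<n}. v j * frobs j (?Y (n - j)))"
    by (simp add: frobs.hom_one)
  finally have c: "cst (of_nat p) * ?Y n =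
    cst (of_nat p) * fdef ?Y n + (v n + (\<Sum>j\<in>{1..<n}. v j * frobs j (?Y (n - j))))" .
  have e: "?w n = cst (of_nat p) * ?Y n - (\<Sum>i\<in>{1..<n}. ?Y i * ?w (n - i) ^ (p ^ i))"
    by (rule etaR.simps)
  have "?w n = cst (of_nat p) * fdef ?Y n + v n - (\<Sum>i\<in>{1..<n}. fdef ?Y i * ?w (n - i) ^ (p ^ i)) -
    (\<Sum>j\<in>{1..<n}. \<Sum>k<n - j. ?q * v j * (frobs j (?Y k) *
       (?w (n - j - k) ^ (p ^ (j + k)) - frobs j (?w (n - j - k)) ^ (p ^ k))))"
    unfolding e s c by (simp only: diff_diff_eq add.assoc add_diff_cancel_right add.commute[of _ "\<Sum>j\<in>{1..<n}. v j * frobs j (?Y (n - j))"] add.left_commute[of _ "\<Sum>j\<in>{1..<n}. v j * frobs j (?Y (n - j))"] add_diff_cancel_left)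
  also have "\<dots> \<in> fil 0"
  proof (intro fil_diff)
    show "cst (of_nat p) * fdef ?Y n + v n \<in> fil 0"
      by (intro RZ_fil RZ.mems cst_RZ Zp.of_nat_mem fdef_etaR_ell v_RZ)
    show "(\<Sum>i\<in>{1..<n}. fdef ?Y i * ?w (n - i) ^ (p ^ i)) \<in> fil 0"
      by (intro RZ_fil RZ.sum_mem RZ.mult_mem RZ.power_mem fdef_etaR_ell less.IH) auto
    show "(\<Sum>j\<in>{1..<n}. \<Sum>k<n - j. ?q * v j * (frobs j (?Y k) *
       (?w (n - j - k) ^ (p ^ (j + k)) - frobs j (?w (n - j - k)) ^ (p ^ k)))) \<in> fil 0"
    proof (intro fil_sum)
      fix j k assume jk: "j \<in> {1..<n}" "k \<in> {..<n - j}"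
      have "v j * (frobs j (?Y k) * (?w (n - j - k) ^ (p ^ (j + k)) - frobs j (?w (n - j - k)) ^ (p ^ k)))
        \<in> fil (int k + - int (Suc k))"
        by (intro fil_mult0 v_RZ fil_mult frobs_fil etaR_ell_fil frobs_cong_power less.IH) (use jk in auto)
      from fil_mult[OF cst_p_inv_fil this]
      show "?q * v j * (frobs j (?Y k) * (?w (n - j - k) ^ (p ^ (j + k)) - frobs j (?w (n - j - k)) ^ (p ^ k))) \<in> fil 0"
        by (simp add: mult.assoc)
    qed
  qed
  finally show ?case by (simp add: fil_0)
qed

end

section \<open>Leading terms of the right unit modulo p when v_1 = 0\<close>

locale hazewinkel_t_mod = hazewinkel_t p v t for p v t +
  fixes P :: "nat \<Rightarrow> gen set"
  assumes v_1: "v 1 = 0" and P_mono: "k \<le> l \<Longrightarrow> P k \<subseteq> P l"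
    and v_P: "v k \<in> polys (Zp p) (P 0)" and t_P: "t k \<in> polys (Zp p) (P k)"
begin

abbreviation "PQ k \<equiv> polys UNIV (P k)"

sublocale PQ: subring_on "PQ k" for k by (rule subring_polys[OF subring_UNIV])

lemma PQ_mono: "x \<in> PQ k \<Longrightarrow> k \<le> l \<Longrightarrow> x \<in> PQ l"
  using polys_mono[OF order_refl P_mono] by blast

lemma Zp_PQ: "x \<in> polys (Zp p) (P k) \<Longrightarrow> x \<in> PQ k"
  using polys_mono[of "Zp p" UNIV "P k" "P k"] by auto

lemma ell_PQ: "ell p v n \<in> PQ k"
proof (induction n rule: less_induct)
  case (less n)
  have "v m \<in> PQ k" for m using PQ_mono[OF Zp_PQ[OF v_P]] by auto
  with less show ?case
    by (cases "n = 0") (auto simp: ell_eq intro!: PQ.mems cst_mem_polys)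
qed

lemma ell_1: "ell p v 1 = 0" using v_1 by (simp add: ell_eq)

lemma p_ell_2: "cst (of_nat p) * ell p v 2 = v 2"
  using v_1 p_gt_0 by (simp add: p_ell numeral_2_eq_2 zero_power ell_1[simplified])

text \<open>In the application \<open>P k\<close> holds the variables from the \<open>v\<close>'s
  together with \<open>t_1, ..., t_k\<close>. Since \<open>ell_1 = 0\<close>, the first term after
  the leading \<open>t_i\<close> involves only \<open>t_(i-2)\<close>.\<close>

lemma Y_t: "etaR_ell p v t i - t i \<in> PQ (i - 2)"
proof -
  have "etaR_ell p v t i - t i = (\<Sum>j\<in>{1..i}. ell p v j * t (i - j) ^ (p ^ j))"
    by (simp add: etaR_ell_def sum_atMost_shift1)
  also have "\<dots> \<in> PQ (i - 2)"
  proof (rule PQ.sum_mem)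
    fix j assume j: "j \<in> {1..i}"
    show "ell p v j * t (i - j) ^ (p ^ j) \<in> PQ (i - 2)"
    proof (cases "j = 1")
      case True
      then show ?thesis by (simp add: ell_1[simplified] PQ.zero_mem)
    next
      case False
      then have "t (i - j) \<in> PQ (i - 2)" using j by (intro PQ_mono[OF Zp_PQ[OF t_P]]) auto
      then show ?thesis by (intro PQ.mems ell_PQ)
    qed
  qed
  finally show ?thesis .
qed

lemma Y_PQ: "etaR_ell p v t i \<in> PQ i"
  using PQ.add_mem[OF PQ_mono[OF Y_t] Zp_PQ[OF t_P], of i i] by simp

text \<open>Lower terms are expressed with denominators. Congruence to an integral polynomial makes
  them integral without following the cancellations.\<close>

lemma PQ_lift:
  assumes "x \<in> RZ" "x - y \<in> fil (- 1)" "y \<in> PQ k" shows "y \<in> polys (Zp p) (P k)"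
proof -
  have "x - y \<in> RZ" using fil_mono[OF assms(2), of 0] by (simp add: fil_0)
  from RZ.diff_mem[OF assms(1) this] have "y \<in> polys (Zp p) UNIV" by (simp add: RZ_def)
  from polys_Int[OF this assms(3)] show ?thesis by simp
qed

lemma etaR_1: "etaR p v t 1 = cst (of_nat p) * t 1"
  by (subst etaR.simps) (simp add: etaR_ell_def ell_1[simplified] t_0)

lemma etaR_2: "etaR p v t 2 - v 2 \<in> fil (- 1)"
proof -
  have "etaR p v t 2 - v 2 = cst (of_nat p) * t 2 - etaR_ell p v t 1 * etaR p v t 1 ^ p"
    using p_ell_2
    by (subst etaR.simps) (simp add: etaR_ell_def numeral_2_eq_2 ell_1[simplified] t_0 distrib_left atLeastLessThanSuc)
  also have "\<dots> \<in> fil (- 1)"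
  proof (rule fil_diff)
    show "cst (of_nat p) * t 2 \<in> fil (- 1)" unfolding fil_neg1_iff using t_RZ by blast
    have "etaR_ell p v t 1 \<in> RZ" by (simp add: etaR_ell_def ell_1[simplified] t_0 t_RZ)
    moreover have "etaR p v t 1 ^ p \<in> fil (int p * - 1)"
      by (rule fil_power) (unfold etaR_1 fil_neg1_iff, use t_RZ in blast)
    ultimately show "etaR_ell p v t 1 * etaR p v t 1 ^ p \<in> fil (- 1)"
      by (intro fil_mult0) (use p_gt_0 in \<open>auto elim!: fil_mono\<close>)
  qed
  finally show ?thesis .
qed

text \<open>The variable \<open>t_n\<close> occurs with coefficient \<open>p\<close>, and
  \<open>t_(n-1)\<close> is suppressed because \<open>ell_1 = 0\<close> and
  \<open>eta_R(v_1) = p t_1\<close>. The two terms in \<open>t_(n-2)\<close> come from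
  \<open>p ell_2 = v_2\<close> and from the summand of the recursion containing
  \<open>eta_R(v_2)\<close>, which is \<open>v_2\<close> modulo \<open>p\<close>.\<close>

lemma etaR_mod_p_step:
  assumes n: "n \<ge> 3" and IH: "\<And>m. 1 \<le> m \<Longrightarrow> m < n \<Longrightarrow> \<exists>f\<in>polys (Zp p) (P (m - 2)). etaR p v t m - f \<in> fil (- 1)"
  shows "\<exists>q\<in>polys (Zp p) (P (n - 3)).
    etaR p v t n - (v 2 * t (n - 2) ^ (p\<^sup>2) - v 2 ^ (p ^ (n - 2)) * t (n - 2) + q) \<in> fil (- 1)"
proof -
  let ?Y = "etaR_ell p v t" and ?w = "etaR p v t"
  have "\<forall>m. \<exists>f. 1 \<le> m \<and> m < n \<longrightarrow> f \<in> polys (Zp p) (P (m - 2)) \<and> ?w m - f \<in> fil (- 1)"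
    using IH by blast
  then obtain f where f: "\<And>m. 1 \<le> m \<Longrightarrow> m < n \<Longrightarrow> f m \<in> polys (Zp p) (P (m - 2))"
    "\<And>m. 1 \<le> m \<Longrightarrow> m < n \<Longrightarrow> ?w m - f m \<in> fil (- 1)" by metis
  have Yw: "?Y i * (x ^ (p ^ i) - y ^ (p ^ i)) \<in> fil (- 1)" if "x \<in> RZ" "y \<in> RZ" "x - y \<in> fil (- 1)" for i x y
    using fil_mult[OF etaR_ell_fil fil_power_diff[OF that], of i i] by simp
  define q1 where "q1 = (\<Sum>j\<in>{3..n}. cst (of_nat p) * ell p v j * t (n - j) ^ (p ^ j))"
  define q2 where "q2 = (\<Sum>i\<in>{1..<n - 2}. ?Y i * f (n - i) ^ (p ^ i))"
  define q where "q = q1 - q2 - (?Y (n - 2) - t (n - 2)) * v 2 ^ (p ^ (n - 2))"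
  have s1: "cst (of_nat p) * ?Y n = cst (of_nat p) * t n + v 2 * t (n - 2) ^ (p\<^sup>2) + q1"
  proof -
    have "{..n} = insert 0 (insert 1 (insert 2 {3..n}))" using n by auto
    then have "?Y n = t n + (ell p v 2 * t (n - 2) ^ (p\<^sup>2) + (\<Sum>j\<in>{3..n}. ell p v j * t (n - j) ^ (p ^ j)))"
      by (simp add: etaR_ell_def ell_1[simplified])
    then show ?thesis
      by (simp add: distrib_left mult.assoc[symmetric] p_ell_2 q1_def sum_distrib_left)
  qed
  have s2: "(\<Sum>i\<in>{1..<n}. ?Y i * ?w (n - i) ^ (p ^ i)) =
    (\<Sum>i\<in>{1..<n - 2}. ?Y i * ?w (n - i) ^ (p ^ i)) + ?Y (n - 2) * ?w 2 ^ (p ^ (n - 2)) + ?Y (n - 1) * ?w 1 ^ (p ^ (n - 1))"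
  proof -
    have s: "{1..<n} = insert (n - 1) (insert (n - 2) {1..<n - 2})" "n - 1 \<noteq> n - 2" "n - (n - 1) = 1" "n - (n - 2) = 2"
      using n by auto
    have "n - 1 \<notin> insert (n - 2) {1..<n - 2}" "n - 2 \<notin> {1..<n - 2}" using n by auto
    then show ?thesis unfolding s(1) by (simp only: sum.insert finite_insert finite_atLeastLessThan s(3,4) ac_simps not_False_eq_True)
  qed
  have "?w n - (v 2 * t (n - 2) ^ (p\<^sup>2) - v 2 ^ (p ^ (n - 2)) * t (n - 2) + q) =
     cst (of_nat p) * t n - (\<Sum>i\<in>{1..<n - 2}. ?Y i * (?w (n - i) ^ (p ^ i) - f (n - i) ^ (p ^ i)))
      - ?Y (n - 2) * (?w 2 ^ (p ^ (n - 2)) - v 2 ^ (p ^ (n - 2))) - ?Y (n - 1) * ?w 1 ^ (p ^ (n - 1))"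
    by (subst etaR.simps) (unfold s1 s2 q_def q2_def, simp add: algebra_simps sum_subtractf)
  also have "\<dots> \<in> fil (- 1)"
  proof (intro fil_diff)
    show "cst (of_nat p) * t n \<in> fil (- 1)" unfolding fil_neg1_iff using t_RZ by blast
    show "(\<Sum>i\<in>{1..<n - 2}. ?Y i * (?w (n - i) ^ (p ^ i) - f (n - i) ^ (p ^ i))) \<in> fil (- 1)"
      by (intro fil_sum Yw etaR_RZ polys_RZ[OF f(1)] f(2)) auto
    show "?Y (n - 2) * (?w 2 ^ (p ^ (n - 2)) - v 2 ^ (p ^ (n - 2))) \<in> fil (- 1)"
      by (intro Yw etaR_RZ v_RZ etaR_2) auto
    \<comment> \<open>The denominator \<open>p^(n-1)\<close> of the right logarithm is outweighed by
      the \<open>p^(n-1)\<close>-th power of \<open>p t_1\<close>, since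
      \<open>n - 1 < p^(n-1)\<close>.\<close>
    have "?Y (n - 1) * ?w 1 ^ (p ^ (n - 1)) \<in> fil (int (n - 1) + int (p ^ (n - 1)) * - 1)"
      by (intro fil_mult etaR_ell_fil fil_power) (unfold etaR_1 fil_neg1_iff, use t_RZ in blast)
    moreover have "n - 1 < p ^ (n - 1)" using p_gt_1 by (intro power_gt_expt) simp
    then have "int (n - 1) + int (p ^ (n - 1)) * - 1 \<le> - 1"
      by (simp only: of_nat_less_iff[symmetric, where 'a = int])
    ultimately show "?Y (n - 1) * ?w 1 ^ (p ^ (n - 1)) \<in> fil (- 1)" by (rule fil_mono)
  qed
  finally have d: "?w n - (v 2 * t (n - 2) ^ (p\<^sup>2) - v 2 ^ (p ^ (n - 2)) * t (n - 2) + q) \<in> fil (- 1)" .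
  have vq: "v 2 \<in> PQ (n - 3)" using PQ_mono[OF Zp_PQ[OF v_P]] by auto
  have "q1 \<in> PQ (n - 3)"
    unfolding q1_def
    by (intro PQ.sum_mem PQ.mult_mem PQ.power_mem ell_PQ cst_mem_polys PQ_mono[OF Zp_PQ[OF t_P]]) auto
  moreover have "q2 \<in> PQ (n - 3)"
    unfolding q2_def
    by (intro PQ.sum_mem PQ.mult_mem PQ.power_mem PQ_mono[OF Y_PQ] PQ_mono[OF Zp_PQ[OF f(1)]]) auto
  ultimately have "q \<in> PQ (n - 3)"
    unfolding q_def by (intro PQ.diff_mem PQ.mult_mem PQ.power_mem vq PQ_mono[OF Y_t]) auto
  moreover have "?w n - (v 2 * t (n - 2) ^ (p\<^sup>2) - v 2 ^ (p ^ (n - 2)) * t (n - 2)) \<in> RZ"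
    using n by (intro RZ.mems etaR_RZ v_RZ t_RZ) auto
  ultimately have "q \<in> polys (Zp p) (P (n - 3))"
    using d by (intro PQ_lift[of "?w n - (v 2 * t (n - 2) ^ (p\<^sup>2) - v 2 ^ (p ^ (n - 2)) * t (n - 2))"])
      (auto simp: algebra_simps)
  then show ?thesis using d by blast
qed

lemma etaR_mod_p_weak: "1 \<le> n \<Longrightarrow> \<exists>f\<in>polys (Zp p) (P (n - 2)). etaR p v t n - f \<in> fil (- 1)"
proof (induction n rule: less_induct)
  case (less n)
  consider "n = 1" | "n = 2" | "n \<ge> 3" using less.prems by linarith
  then show ?case
  proof cases
    case 1
    have "etaR p v t 1 - 0 \<in> fil (- 1)" unfolding diff_zero etaR_1 fil_neg1_iff using t_RZ by blast
    then show ?thesis unfolding 1 by (intro bexI[of _ 0]) (auto simp: polys_def)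
  next
    case 2
    then show ?thesis using etaR_2 v_P[of 2] by auto
  next
    case 3
    then obtain q where q: "q \<in> polys (Zp p) (P (n - 3))"
      "etaR p v t n - (v 2 * t (n - 2) ^ (p\<^sup>2) - v 2 ^ (p ^ (n - 2)) * t (n - 2) + q) \<in> fil (- 1)"
      using etaR_mod_p_step[OF 3 less.IH] by auto
    interpret S: subring_on "polys (Zp p) (P (n - 2))" by (rule subring_polys) (rule Zp.subring_on_axioms)
    have "n - 3 \<le> n - 2" by simp
    then have "q \<in> polys (Zp p) (P (n - 2))" "v 2 \<in> polys (Zp p) (P (n - 2))"
      using q(1) v_P[of 2] polys_mono[OF order_refl[of "Zp p"] P_mono[of "n - 3" "n - 2"]]
        polys_mono[OF order_refl[of "Zp p"] P_mono[of 0 "n - 2"]] by blast+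
    then have "v 2 * t (n - 2) ^ (p\<^sup>2) - v 2 ^ (p ^ (n - 2)) * t (n - 2) + q \<in> polys (Zp p) (P (n - 2))"
      by (intro S.mems t_P)
    with q(2) show ?thesis by blast
  qed
qed

lemma etaR_mod_p:
  assumes "n \<ge> 3"
  shows "\<exists>q\<in>polys (Zp p) (P (n - 3)).
    etaR p v t n - (v 2 * t (n - 2) ^ (p\<^sup>2) - v 2 ^ (p ^ (n - 2)) * t (n - 2) + q) \<in> fil (- 1)"
  using etaR_mod_p_step[OF assms etaR_mod_p_weak] by blast

end

section \<open>The cobar complex and its rational cohomology\<close>

lemma sum_diagonal:
  "(\<Sum>a\<le>n. \<Sum>b\<le>n - a. f a b) = (\<Sum>k\<le>n::nat. \<Sum>a\<le>k. f a (k - a) :: 'a::comm_monoid_add)"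
  unfolding sum.Sigma[OF finite_atMost ballI[OF finite_atMost]]
  by (rule sum.reindex_bij_witness[of _ "\<lambda>(k, a). (a, k - a)" "\<lambda>(a, b). (a + b, a)"]) auto

lemma subst_ell: "subst \<sigma> (ell p v n) = ell p (\<lambda>k. subst \<sigma> (v k)) n"
proof (induction n rule: less_induct)
  case (less n)
  show ?case
    by (subst (1 2) ell.simps) (simp add: subst.hom_simps less)
qed

lemma subst_etaR_ell: "subst \<sigma> (etaR_ell p v t n) = etaR_ell p (\<lambda>k. subst \<sigma> (v k)) (\<lambda>k. subst \<sigma> (t k)) n"
  by (simp add: etaR_ell_def subst.hom_simps subst_ell)

lemma subst_etaR: "subst \<sigma> (etaR p v t n) = etaR p (\<lambda>k. subst \<sigma> (v k)) (\<lambda>k. subst \<sigma> (t k)) n"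
proof (induction n rule: less_induct)
  case (less n)
  show ?case
    by (subst (1 2) etaR.simps) (simp add: subst.hom_simps subst_etaR_ell less)
qed

lemma subst_Delta:
  "subst \<sigma> (Delta p v t t' n) = Delta p (\<lambda>k. subst \<sigma> (v k)) (\<lambda>k. subst \<sigma> (t k)) (\<lambda>k. subst \<sigma> (t' k)) n"
proof (induction n rule: less_induct)
  case (less n)
  show ?case
    by (subst (1 2) Delta.simps) (simp add: subst.hom_simps subst_ell less)
qed

text \<open>On logarithms, the coproduct is the composition of the coordinate changes given by
  \<open>t\<close> and \<open>t'\<close>.\<close>

lemma etaR_ell_Delta:
  "etaR_ell p v (Delta p v t t') n = (\<Sum>k\<le>n. etaR_ell p v t k * t' (n - k) ^ (p ^ k))"
  unfolding etaR_ell_def Delta_eq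
  by (subst sum_diagonal) (simp add: sum_distrib_right)

lemma Delta_0: "t 0 = 1 \<Longrightarrow> t' 0 = 1 \<Longrightarrow> Delta p v t t' 0 = 1"
  by (subst Delta.simps) simp

lemma Delta_1: "t 0 = 1 \<Longrightarrow> t' 0 = 1 \<Longrightarrow> Delta p v t t' 1 = t 1 + t' 1"
  by (subst Delta.simps) (simp add: Delta_0 numeral_2_eq_2)

lemma subring_mem_structure:
  assumes "subring_on R" "\<And>c. cst c \<in> R" "\<And>k. v k \<in> R"
  shows ell_mem: "ell p v n \<in> R"
    and etaR_ell_mem: "(\<And>k. t k \<in> R) \<Longrightarrow> etaR_ell p v t n \<in> R"
    and etaR_mem: "(\<And>k. t k \<in> R) \<Longrightarrow> etaR p v t n \<in> R"
    and Delta_mem: "(\<And>k. t k \<in> R) \<Longrightarrow> (\<And>k. t' k \<in> R) \<Longrightarrow> Delta p v t t' n \<in> R"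
proof -
  interpret R: subring_on R by fact
  show e: "ell p v n \<in> R" for n
  proof (induction n rule: less_induct)
    case (less n)
    show ?case by (subst ell.simps) (auto intro!: R.mems assms less)
  qed
  show el: "etaR_ell p v t n \<in> R" if "\<And>k. t k \<in> R" for n
    unfolding etaR_ell_def by (intro R.mems e that)
  show "etaR p v t n \<in> R" if "\<And>k. t k \<in> R"
  proof (induction n rule: less_induct)
    case (less n)
    show ?case by (subst etaR.simps) (auto intro!: R.mems assms el that less)
  qed
  show "Delta p v t t' n \<in> R" if "\<And>k. t k \<in> R" "\<And>k. t' k \<in> R"
  proof (induction n rule: less_induct)
    case (less n)
    show ?case by (subst Delta.simps) (auto intro!: R.mems assms e that less)
  qed
qed

text \<open>The parameters \<open>t\<close> that carry the logarithm of \<open>v\<close> to that of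
  \<open>v'\<close>, solved for degree by degree. They always exist rationally but need not be
  integral.\<close>

fun strict_iso :: "nat \<Rightarrow> (nat \<Rightarrow> pol) \<Rightarrow> (nat \<Rightarrow> pol) \<Rightarrow> nat \<Rightarrow> pol" where
  "strict_iso p v v' n = ell p v' n - (\<Sum>i\<in>{1..n}. ell p v i * strict_iso p v v' (n - i) ^ (p ^ i))"

declare strict_iso.simps [simp del]

lemma strict_iso_0 [simp]: "strict_iso p v v' 0 = 1"
  by (subst strict_iso.simps) simp

lemma etaR_ell_strict_iso: "etaR_ell p v (strict_iso p v v') n = ell p v' n"
  unfolding etaR_ell_def by (subst sum_atMost_shift1) (subst strict_iso.simps, simp)

lemma subst_strict_iso: "subst \<sigma> (strict_iso p v v' n) = strict_iso p (\<lambda>k. subst \<sigma> (v k)) (\<lambda>k. subst \<sigma> (v' k)) n"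
proof (induction n rule: less_induct)
  case (less n)
  show ?case
    by (subst (1 2) strict_iso.simps) (simp add: subst.hom_simps subst_ell less)
qed

lemma strict_iso_mem:
  assumes "subring_on R" "\<And>c. cst c \<in> R" "\<And>k. v k \<in> R" "\<And>k. v' k \<in> R"
  shows "strict_iso p v v' n \<in> R"
proof (induction n rule: less_induct)
  case (less n)
  interpret R: subring_on R by fact
  show ?case
    by (subst strict_iso.simps) (auto intro!: R.mems ell_mem[OF assms(1-3)] ell_mem[OF assms(1,2,4)] less)
qed

context prime_local begin

lemma ell_1_eq: "ell p v 1 = cst (1 / of_nat p) * v 1"
  by (simp add: ell_eq)

lemma strict_iso_1: "strict_iso p v v' 1 = cst (1 / of_nat p) * (v' 1 - v 1)"
  by (subst strict_iso.simps) (simp add: ell_1_eq[simplified] right_diff_distrib)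

lemma etaR_1_eq: "t 0 = 1 \<Longrightarrow> etaR p v t 1 = v 1 + cst (of_nat p) * t 1"
  by (subst etaR.simps) (simp add: etaR_ell_def ell_1_eq[simplified] distrib_left p_p_inv)

end

section \<open>Right unit and logarithm modulo rational ideals\<close>

locale rational_ideal = prime_local p + ideal_on UNIV I for p and I :: "pol set"
begin

lemma eqv_mult': "eqv x y \<Longrightarrow> eqv x' y' \<Longrightarrow> eqv (x * x') (y * y')"
  by (rule eqv_mult) auto

lemma eqv_power': "eqv x y \<Longrightarrow> eqv (x ^ n) (y ^ n)"
  by (rule eqv_power) auto

lemma eqv_cst_cancel: "c \<noteq> 0 \<Longrightarrow> eqv (cst c * x) (cst c * y) \<Longrightarrow> eqv x y"
  using eqv_mult'[of "cst (1 / c)" "cst (1 / c)" "cst c * x" "cst c * y"]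
  by (simp add: mult.assoc[symmetric] cst.hom_mult[symmetric] cst.hom_one)

lemma ell_eqv: "(\<And>k. eqv (v k) (v' k)) \<Longrightarrow> eqv (ell p v n) (ell p v' n)"
proof (induction n rule: less_induct)
  case (less n)
  show ?case
    by (subst (1 2) ell.simps) (auto intro!: eqv_mult' eqv_sum eqv_power' less)
qed

lemma etaR_ell_eqv:
  "(\<And>k. eqv (v k) (v' k)) \<Longrightarrow> (\<And>k. eqv (t k) (t' k)) \<Longrightarrow> eqv (etaR_ell p v t n) (etaR_ell p v' t' n)"
  unfolding etaR_ell_def by (intro eqv_sum eqv_mult' eqv_power' ell_eqv)

text \<open>As \<open>p\<close> is invertible, the Hazewinkel generators and the logarithm
  coefficients determine each other recursively. Relations on \<open>eta_R(v_k)\<close> thus become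
  relations on logarithms, where composition of coordinate changes is visible.\<close>

lemma etaR_ell_of_etaR:
  assumes "t 0 = 1" "\<And>k. k \<ge> 1 \<Longrightarrow> eqv (etaR p v t k) (v' k)"
  shows "eqv (etaR_ell p v t n) (ell p v' n)"
proof (induction n rule: less_induct)
  case (less n)
  show ?case
  proof (cases "n = 0")
    case True
    then show ?thesis by (simp add: etaR_ell_def assms)
  next
    case False
    then have n: "n > 0" by simp
    have "eqv (\<Sum>i<n. etaR_ell p v t i * etaR p v t (n - i) ^ (p ^ i)) (\<Sum>i<n. ell p v' i * v' (n - i) ^ (p ^ i))"
    proof (rule eqv_sum)
      fix i assume "i \<in> {..<n}"
      then show "eqv (etaR_ell p v t i * etaR p v t (n - i) ^ (p ^ i)) (ell p v' i * v' (n - i) ^ (p ^ i))"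
        by (intro eqv_mult'[OF less.IH eqv_power'[OF assms(2)]]) auto
    qed
    then have "eqv (cst (of_nat p) * etaR_ell p v t n) (cst (of_nat p) * ell p v' n)"
      by (simp only: p_etaR_ell[where t = t, OF n assms(1)] p_ell[OF n])
    then show ?thesis by (rule eqv_cst_cancel[rotated]) (use p_gt_0 in simp)
  qed
qed

lemma etaR_of_etaR_ell:
  assumes "\<And>n. eqv (etaR_ell p v t n) (ell p v' n)" "k \<ge> 1"
  shows "eqv (etaR p v t k) (v' k)"
  using assms(2)
proof (induction k rule: less_induct)
  case (less n)
  have "eqv (etaR p v t n) (cst (of_nat p) * ell p v' n - (\<Sum>i\<in>{1..<n}. ell p v' i * v' (n - i) ^ (p ^ i)))"
    unfolding etaR.simps[of p v t n]
    by (intro eqv_diff eqv_mult' eqv_sum eqv_power' assms less) auto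
  also have "cst (of_nat p) * ell p v' n - (\<Sum>i\<in>{1..<n}. ell p v' i * v' (n - i) ^ (p ^ i)) = v' n"
    using less.prems by (simp add: p_ell sum_lessThan_shift1)
  finally show ?case .
qed

lemma etaR_ell_unique:
  assumes "\<And>n. eqv (etaR_ell p v t n) (etaR_ell p v u n)"
  shows "eqv (t n) (u n)"
proof (induction n rule: less_induct)
  case (less n)
  have e: "t n = etaR_ell p v t n - (\<Sum>i\<in>{1..n}. ell p v i * t (n - i) ^ (p ^ i))" for t
    by (simp add: etaR_ell_def sum_atMost_shift1)
  show ?case
    unfolding e[of t] e[of u]
    by (intro eqv_diff[OF assms] eqv_sum eqv_mult'[OF eqv_refl] eqv_power' less) simp
qed

lemma etaR_ell_Delta_eqv:
  assumes "\<And>n. eqv (etaR_ell p v t n) (ell p v' n)"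
  shows "eqv (etaR_ell p v (Delta p v t t') n) (etaR_ell p v' t' n)"
  unfolding etaR_ell_Delta etaR_ell_def[of p v' t']
  by (intro eqv_sum eqv_mult' eqv_power' assms eqv_refl)

lemma etaR_strict_iso:
  assumes "\<And>k. eqv (t k) (strict_iso p v v' k)" "k \<ge> 1" shows "eqv (etaR p v t k) (v' k)"
proof (rule etaR_of_etaR_ell[OF _ assms(2)])
  fix n
  have "eqv (etaR_ell p v t n) (etaR_ell p v (strict_iso p v v') n)"
    by (rule etaR_ell_eqv) (auto intro: assms)
  then show "eqv (etaR_ell p v t n) (ell p v' n)" by (simp add: etaR_ell_strict_iso)
qed

end

section \<open>The cobar complex: relations, cofaces and rational contraction\<close>

locale cobar = prime_local p for p +
  fixes N r m :: nat
  assumes cases_Nrm: "(N = 2 \<and> r = 0 \<and> m = 1) \<or> (N = 3 \<and> r = 1 \<and> m = 0)"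
begin

lemma r_le_1: "r \<le> 1" and m_le_1: "m \<le> 1" and m_iff_r: "0 < m \<longleftrightarrow> \<not> 0 < r"
    and N_eq: "N = r + 2"
  using cases_Nrm by auto

lemma N_ge: "1 \<le> N" "2 \<le> N" using N_eq by auto

lemma tgen_1: "tgen r i 1 = (if 0 < r then 0 else Var (T i 1))"
  by (auto simp: tgen_def)

lemma mgen_1: "mgen m i 1 = (if 0 < m then Var (T i 1) else 0)"
  by (auto simp: mgen_def)

lemma tgen_1': "0 < m \<Longrightarrow> tgen r i 1 = Var (T i 1)"
  using m_iff_r by (simp add: tgen_def)

lemma mgen_1': "0 < m \<Longrightarrow> mgen m i 1 = Var (T i 1)"
  by (simp add: mgen_def)

text \<open>The value that \<open>tgen\<close> and \<open>mgen\<close> share in index 1, because the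
  factor \<open>\<Gamma>\<close> has a \<open>t_1\<close> exactly when \<open>M\<close> has one. It
  allows one formula for \<open>eta_R(v_1)\<close> in both complexes.\<close>

definition Tlast :: "nat \<Rightarrow> pol" where "Tlast s = (if 0 < m then Var (T (s + 1) 1) else 0)"

lemma mgen_Tlast: "mgen m (s + 1) 1 = Tlast s"
  unfolding mgen_1 Tlast_def ..

lemma tgen_Tlast: "tgen r (s + 1) 1 = Tlast s"
  unfolding tgen_1 Tlast_def m_iff_r by simp

lemma vgen_1: "vgen N i 1 = Var (V i 1)" and vgen_2: "vgen N i 2 = Var (V i 2)"
  using N_ge by (auto simp: vgen_def)

lemma V_gens: "i \<le> s \<Longrightarrow> 1 \<le> k \<Longrightarrow> k \<le> N \<Longrightarrow> V i k \<in> gens N r m s"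
  by (auto simp: gens_def)

lemma W_gens: "i \<le> s \<Longrightarrow> W i \<in> gens N r m s"
  by (auto simp: gens_def)

lemma T_gens: "1 \<le> i \<Longrightarrow> i \<le> s \<Longrightarrow> r < k \<Longrightarrow> T i k \<in> gens N r m s"
  by (auto simp: gens_def)

lemma T_gens': "1 \<le> k \<Longrightarrow> k \<le> m \<Longrightarrow> T (s + 1) k \<in> gens N r m s"
  by (auto simp: gens_def)

abbreviation G :: "nat \<Rightarrow> gen set" where "G s \<equiv> gens N r m s"
abbreviation rel :: "nat \<Rightarrow> pol set" where "rel s \<equiv> rels p N r m s"
abbreviation vg :: "nat \<Rightarrow> nat \<Rightarrow> pol" where "vg \<equiv> vgen N"
abbreviation tg :: "nat \<Rightarrow> nat \<Rightarrow> pol" where "tg \<equiv> tgen r"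
abbreviation mg :: "nat \<Rightarrow> nat \<Rightarrow> pol" where "mg \<equiv> mgen m"

text \<open>The ideals are formed in polynomials on all generators, so that elements of different
  cobar degrees live in one ring; \<open>null\<close> is recovered by intersecting with the
  cochains.\<close>

definition IQ :: "nat \<Rightarrow> pol set" where "IQ s = ideal_of UNIV (rel s)"
definition IZ :: "nat \<Rightarrow> pol set" where "IZ s = ideal_of RZ (rel s)"
definition cf :: "nat \<Rightarrow> nat \<Rightarrow> pol \<Rightarrow> pol" where "cf s i = subst (coface_gen p N r m s i)"
abbreviation d :: "nat \<Rightarrow> pol \<Rightarrow> pol" where "d \<equiv> cobar_d p N r m"

sublocale IQ: rational_ideal p "IQ s" for s
  unfolding IQ_def by (intro rational_ideal.intro prime_local_axioms ideal_on_ideal_of subring_UNIV)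

sublocale IZ: ideal_on RZ "IZ s" for s
  unfolding IZ_def by (intro ideal_on_ideal_of RZ.subring_on_axioms)

sublocale cf: ring_hom_on "cf s i" for s i
  unfolding cf_def by (rule subst.ring_hom_on_axioms)

lemma IZ_IQ: "x \<in> IZ s \<Longrightarrow> x \<in> IQ s"
  unfolding IQ_def IZ_def using ideal_of_mono[of RZ UNIV] by blast

lemma d_eq: "d s f = (\<Sum>i\<le>s + 1. (- 1) ^ i * cf s i f)"
  by (simp add: cobar_d_def cf_def)

lemma d_0: "d 0 f = cf 0 0 f - cf 0 1 f"
  by (simp add: d_eq)

lemma d_1: "d 1 f = cf 1 0 f - cf 1 1 f + cf 1 2 f"
  by (simp add: d_eq numeral_2_eq_2)

lemma d_add: "d s (f + g) = d s f + d s g"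
  by (simp add: d_eq cf.hom_add distrib_left sum.distrib)

lemma cf_cst [simp]: "cf s i (cst c) = cst c" by (simp add: cf_def)

lemma cf_Var: "cf s i (Var g) = coface_gen p N r m s i g" by (simp add: cf_def)

lemma d_smult: "d s (cst c * f) = cst c * d s f"
  unfolding d_eq cf.hom_mult sum_distrib_left by (intro sum.cong refl) (simp add: mult_ac)

lemma d_zero [simp]: "d s 0 = 0"
  using d_smult[of s 0 0] by (simp add: cst.hom_zero)

lemma d_uminus: "d s (- f) = - d s f"
  using d_smult[of s "- 1" f] by (simp add: cst.hom_simps)

lemma d_diff: "d s (f - g) = d s f - d s g"
  using d_add[of s f "- g"] by (simp add: d_uminus)

lemma d_sum: "d s (sum f A) = (\<Sum>a\<in>A. d s (f a))"
  by (induction A rule: infinite_finite_induct) (auto simp: d_add)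

lemma vg_RZ: "vg i k \<in> RZ" by (auto simp: vgen_def RZ.zero_mem Var_RZ)

lemma tg_RZ: "tg i k \<in> RZ" by (auto simp: tgen_def RZ.mems Var_RZ)

lemma mg_RZ: "mg i k \<in> RZ" by (auto simp: mgen_def RZ.mems Var_RZ)

lemma tg_0 [simp]: "tg i 0 = 1" by (simp add: tgen_def)

lemma mg_0 [simp]: "mg i 0 = 1" by (simp add: mgen_def)

lemma vg_0 [simp]: "vg i 0 = 0" by (simp add: vgen_def)

sublocale hazt: hazewinkel_t p "vg i" "tg j" for i j
  by unfold_locales (auto simp: vg_RZ tg_RZ, auto simp: vgen_def frob.hom_zero p_gt_0 zero_power)

sublocale hazm: hazewinkel_t p "vg i" "mg j" for i j
  by unfold_locales (auto simp: mg_RZ)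

lemma etaR_mg_1: "etaR p (vg s) (mg (s + 1)) 1 = Var (V s 1) + cst (of_nat p) * Tlast s"
  by (subst etaR_1_eq) (simp_all add: vgen_1[simplified] mgen_Tlast[simplified])

lemma polys_G_subring: "subring_on K \<Longrightarrow> subring_on (polys K (G s))"
  by (rule subring_polys)

lemma rel_cases [consumes 1, case_names W eta M]:
  assumes "x \<in> rel s"
  obtains i where "i \<le> s" "x = Var (W i) * Var (V i 2) - 1"
    | i k where "i < s" "1 \<le> k" "x = etaR p (vg i) (tg (i + 1)) k - vg (i + 1) k"
    | "x = etaR p (vg s) (mg (s + 1)) 1"
  using assms unfolding rels_def by blast

lemma rel_W: "i \<le> s \<Longrightarrow> Var (W i) * Var (V i 2) - 1 \<in> rel s"
  unfolding rels_def by blast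

lemma rel_eta: "i < s \<Longrightarrow> 1 \<le> k \<Longrightarrow> etaR p (vg i) (tg (i + 1)) k - vg (i + 1) k \<in> rel s"
  unfolding rels_def by blast

lemma rel_M: "etaR p (vg s) (mg (s + 1)) 1 \<in> rel s"
  unfolding rels_def by blast

lemma rel_IQ: "x \<in> rel s \<Longrightarrow> x \<in> IQ s"
  unfolding IQ_def by (rule ideal_of_gen[OF subring_UNIV])

lemma rel_IZ: "x \<in> rel s \<Longrightarrow> x \<in> IZ s"
  unfolding IZ_def by (rule ideal_of_gen[OF RZ.subring_on_axioms])

lemma rel_RZ: "x \<in> rel s \<Longrightarrow> x \<in> RZ"
  by (cases x s rule: rel_cases)
    (auto intro!: RZ.mems Var_RZ hazt.etaR_RZ hazm.etaR_RZ vg_RZ)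

lemma Var_G: "Var g \<in> polys UNIV (G s)" if "g \<in> G s"
  using that by (intro Var_mem_polys subring_UNIV)

lemma rel_polys: "x \<in> rel s \<Longrightarrow> x \<in> polys (Zp p) (G s)"
proof -
  assume x: "x \<in> rel s"
  interpret S: subring_on "polys UNIV (G s)" by (rule polys_G_subring[OF subring_UNIV])
  have v: "vg i k \<in> polys UNIV (G s)" if "i \<le> s" for i k
    using that by (auto simp: vgen_def intro!: Var_G V_gens S.zero_mem)
  have t: "tg (i + 1) k \<in> polys UNIV (G s)" if "i < s" for i k
    using that by (auto simp: tgen_def intro!: Var_G T_gens S.mems)
  have mm: "mg (s + 1) k \<in> polys UNIV (G s)" for k
    using T_gens'[of k s] by (auto simp: mgen_def intro!: Var_G S.mems)
  have c: "cst a \<in> polys UNIV (G s)" for a by (intro cst_mem_polys UNIV_I)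
  have "x \<in> polys UNIV (G s)"
    using x
  proof (cases x s rule: rel_cases)
    case (W i)
    then show ?thesis using N_ge by (auto intro!: S.mems Var_G V_gens W_gens)
  next
    case (eta i k)
    then show ?thesis
      by (auto intro!: S.diff_mem v etaR_mem[OF S.subring_on_axioms] c t[simplified])
  next
    case M
    show ?thesis unfolding M by (intro etaR_mem[OF S.subring_on_axioms] c v mm order_refl)
  qed
  with rel_RZ[OF x] show ?thesis unfolding RZ_def using polys_Int[of x "Zp p" UNIV UNIV "G s"] by simp
qed

text \<open>Sending the generators outside \<open>G s\<close> to 0 retracts the large polynomial
  ring onto the cochains and fixes every relation. Membership in the larger ideal therefore
  descends.\<close>

lemma null_iff:
  assumes K: "subring_on K" "Zp p \<subseteq> K"
  shows "f \<in> null K p N r m s \<longleftrightarrow> f \<in> polys K (G s) \<and> f \<in> ideal_of (polys K UNIV) (rel s)"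
proof
  interpret P: subring_on "polys K (G s)" by (rule polys_G_subring[OF K(1)])
  interpret PU: subring_on "polys K UNIV" by (rule subring_polys[OF K(1)])
  interpret I: ideal_on "polys K (G s)" "null K p N r m s"
    unfolding null_def cochains_def by (rule ideal_on_ideal_of[OF P.subring_on_axioms])
  have rK: "x \<in> polys K (G s)" if "x \<in> rel s" for x
    using rel_polys[OF that] polys_mono[OF K(2) order_refl] by blast
  {
    assume f: "f \<in> null K p N r m s"
    have "ideal_on (polys K (G s)) (polys K (G s))"
      by unfold_locales (auto intro: P.mems)
    then have "null K p N r m s \<subseteq> polys K (G s)"
      unfolding null_def cochains_def by (rule ideal_of_least) (use rK in auto)
    moreover have "f \<in> ideal_of (polys K UNIV) (rel s)"
      using f ideal_of_mono[OF polys_mono[OF order_refl subset_UNIV] order_refl]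
      unfolding null_def cochains_def by blast
    ultimately show "f \<in> polys K (G s) \<and> f \<in> ideal_of (polys K UNIV) (rel s)" using f by blast
  }
  assume f: "f \<in> polys K (G s) \<and> f \<in> ideal_of (polys K UNIV) (rel s)"
  define \<kappa> where "\<kappa> g = (if g \<in> G s then Var g else 0)" for g
  have id: "subst \<kappa> x = x" if "x \<in> polys K (G s)" for x
    using subst_cong[OF that, of \<kappa> Var] by (simp add: \<kappa>_def)
  have "subst \<kappa> f \<in> null K p N r m s"
  proof (rule ideal_of_hom[OF subst.ring_hom_on_axioms I.ideal_on_axioms])
    show "f \<in> ideal_of (polys K UNIV) (rel s)" using f by blast
    show "subst \<kappa> x \<in> polys K (G s)" if "x \<in> polys K UNIV" for x
      using that by (rule subst_mem[OF P.subring_on_axioms])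
        (auto simp: \<kappa>_def intro: cst_mem_polys Var_mem_polys[OF K(1)] P.zero_mem)
    show "subst \<kappa> x \<in> null K p N r m s" if "x \<in> rel s" for x
      using id[OF rK[OF that]] ideal_of_gen[OF P.subring_on_axioms that] unfolding null_def cochains_def by simp
  qed
  then show "f \<in> null K p N r m s" using id f by simp
qed

lemma null_Zp: "null (Zp p) p N r m s = polys (Zp p) (G s) \<inter> IZ s"
  using null_iff[OF Zp.subring_on_axioms order_refl] by (auto simp: IZ_def RZ_def)

lemma null_UNIV: "null UNIV p N r m s = polys UNIV (G s) \<inter> IQ s"
  using null_iff[OF subring_UNIV] by (auto simp: IQ_def)

lemma cf_vg: "cf s i (vg a k) = vg (if a < i then a else a + 1) k"
  by (auto simp: vgen_def cf_Var cf.hom_zero)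

lemma cf_tg_less: "a < i \<Longrightarrow> cf s i (tg a k) = tg a k"
  by (auto simp: tgen_def cf_Var cf.hom_simps)

lemma cf_tg_greater: "a > i \<Longrightarrow> cf s i (tg a k) = tg (a + 1) k"
  by (auto simp: tgen_def cf_Var cf.hom_simps)

lemma cf_tg_eq: "1 \<le> i \<Longrightarrow> i \<le> s \<Longrightarrow> cf s i (tg i k) = Delta p (vg (i - 1)) (tg i) (tg (i + 1)) k"
proof -
  assume i: "1 \<le> i" "i \<le> s"
  consider "k = 0" | "k = 1" "0 < r" | "k > r" using r_le_1 by linarith
  then show ?thesis
  proof cases
    case 1
    then show ?thesis by (simp add: Delta_0 cf.hom_one)
  next
    case 2
    then show ?thesis by (simp add: Delta_1[simplified] tgen_1[simplified] cf.hom_zero)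
  next
    case 3
    then show ?thesis using i by (simp add: tgen_def[of r i k] cf_Var)
  qed
qed

lemma cf_T_last: "0 < m \<Longrightarrow> cf s (s + 1) (Var (T (s + 1) 1)) = Var (T (s + 1) 1) + Var (T (s + 2) 1)"
  using tgen_1' mgen_1' by (simp add: cf_Var Delta_1[simplified])

lemma cf_Tlast: "i \<le> s \<Longrightarrow> cf s i (Tlast s) = Tlast (s + 1)"
  unfolding Tlast_def by (cases "0 < m") (simp_all only: if_True if_False cf.hom_zero, simp add: cf_Var)

lemma cf_Tlast_eq: "cf s (s + 1) (Tlast s) = Tlast s + Tlast (s + 1)"
  unfolding Tlast_def using cf_T_last[of s] by (cases "0 < m") (simp_all only: if_True if_False cf.hom_zero, simp_all)

lemma cf_etaR: "cf s i (etaR p v t k) = etaR p (\<lambda>k. cf s i (v k)) (\<lambda>k. cf s i (t k)) k"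
  by (simp add: cf_def subst_etaR)

lemma eqv_etaR_tg: "a < s \<Longrightarrow> 1 \<le> k \<Longrightarrow> IQ.eqv s (etaR p (vg a) (tg (a + 1)) k) (vg (a + 1) k)"
  using rel_IQ[OF rel_eta] by (simp add: IQ.eqv_def)

text \<open>Two cases carry content. If the coface splits the factor that the relation belongs to,
  the right unit along the coproduct passes through the new intermediate copy, which is seen on
  logarithms. For the coaction on \<open>M\<close>, the image of \<open>v_1 + p t_1\<close> is the
  sum of a relation \<open>eta_R(v_1) - v_1\<close> and the new relation of \<open>M\<close>: this
  is the primitivity of \<open>eta_R(v_1)\<close>.\<close>

lemma cf_rel:
  assumes "x \<in> rel s" "i \<le> s + 1" shows "cf s i x \<in> IQ (s + 1)"
  using assms(1)
proof (cases x s rule: rel_cases)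
  case (W a)
  then show ?thesis using rel_IQ[OF rel_W, of _ "s + 1"]
    by (auto simp: cf.hom_simps cf_Var)
next
  case (eta a k)
  consider "i \<le> a" | "i = a + 1" | "i > a + 1" by linarith
  then show ?thesis
  proof cases
    case 1
    then have "cf s i x = etaR p (vg (a + 1)) (tg (a + 1 + 1)) k - vg (a + 1 + 1) k"
      unfolding eta cf.hom_diff cf_etaR cf_vg using eta by (simp add: cf_tg_greater)
    then show ?thesis using rel_IQ[OF rel_eta, of "a + 1" "s + 1" k] eta by simp
  next
    case 2
    have *: "cf s i x = etaR p (vg a) (Delta p (vg a) (tg (a + 1)) (tg (a + 2))) k - vg (a + 2) k"
      unfolding eta cf.hom_diff cf_etaR cf_vg using eta 2 by (simp add: cf_tg_eq)
    have e1: "IQ.eqv (s + 1) (etaR_ell p (vg a) (tg (a + 1)) n) (ell p (vg (a + 1)) n)" for n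
      by (rule IQ.etaR_ell_of_etaR) (use eta in \<open>auto intro!: eqv_etaR_tg[simplified]\<close>)
    have e2: "IQ.eqv (s + 1) (etaR_ell p (vg (a + 1)) (tg (a + 2)) n) (ell p (vg (a + 2)) n)" for n
      by (rule IQ.etaR_ell_of_etaR) (use eta eqv_etaR_tg[of "a + 1" "s + 1"] in auto)
    have "IQ.eqv (s + 1) (etaR p (vg a) (Delta p (vg a) (tg (a + 1)) (tg (a + 2))) k) (vg (a + 2) k)"
      by (rule IQ.etaR_of_etaR_ell[OF _ eta(2)]) (rule IQ.eqv_trans[OF IQ.etaR_ell_Delta_eqv[OF e1] e2])
    then show ?thesis by (simp add: * IQ.eqv_def)
  next
    case 3
    then have "cf s i x = etaR p (vg a) (tg (a + 1)) k - vg (a + 1) k"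
      unfolding eta cf.hom_diff cf_etaR cf_vg using eta by (simp add: cf_tg_less)
    then show ?thesis using rel_IQ[OF rel_eta, of a "s + 1" k] eta by simp
  qed
next
  case M
  have M': "Var (V (s + 1) 1) + cst (of_nat p) * Tlast (s + 1) \<in> IQ (s + 1)"
    using rel_IQ[OF rel_M[of "s + 1"]] unfolding etaR_mg_1 .
  show ?thesis
  proof (cases "i = s + 1")
    case False
    then have i: "i \<le> s" using assms by simp
    then have "cf s i x = Var (V (s + 1) 1) + cst (of_nat p) * Tlast (s + 1)"
      unfolding M etaR_mg_1 by (simp add: cf.hom_simps cf_Tlast) (simp add: cf_Var)
    then show ?thesis using M' by simp
  next
    case True
    have "etaR p (vg s) (tg (s + 1)) 1 - vg (s + 1) 1 \<in> IQ (s + 1)"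
      using rel_IQ[OF rel_eta[of s "s + 1" 1]] by simp
    then have e: "Var (V s 1) + cst (of_nat p) * Tlast s - Var (V (s + 1) 1) \<in> IQ (s + 1)"
      by (subst (asm) etaR_1_eq) (simp_all add: vgen_1[simplified] tgen_Tlast[simplified])
    have "cf s i x = Var (V s 1) + cst (of_nat p) * (Tlast s + Tlast (s + 1))"
      unfolding M etaR_mg_1 True by (simp add: cf.hom_simps cf_Tlast_eq[simplified]) (simp add: cf_Var)
    also have "\<dots> = (Var (V s 1) + cst (of_nat p) * Tlast s - Var (V (s + 1) 1)) +
      (Var (V (s + 1) 1) + cst (of_nat p) * Tlast (s + 1))"
      by (simp add: distrib_left)
    finally show ?thesis using IQ.iadd[OF e M'] by simp
  qed
qed

lemma cf_IQ: "x \<in> IQ s \<Longrightarrow> i \<le> s + 1 \<Longrightarrow> cf s i x \<in> IQ (s + 1)"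
  unfolding IQ_def[of s]
  by (rule ideal_of_hom[OF cf.ring_hom_on_axioms IQ.ideal_on_axioms]) (auto intro: cf_rel[simplified])

lemma d_IQ: "x \<in> IQ s \<Longrightarrow> d s x \<in> IQ (s + 1)"
  unfolding d_eq by (intro IQ.isum IQ.imult UNIV_I cf_IQ) auto

lemma gens_0_cases:
  assumes "g \<in> G 0"
  obtains k where "1 \<le> k" "k \<le> N" "g = V 0 k" | "g = W 0" | "0 < m" "g = T 1 1"
proof -
  consider k where "1 \<le> k" "k \<le> N" "g = V 0 k" | "g = W 0" | k where "1 \<le> k" "k \<le> m" "g = T 1 k"
    using assms by (auto simp: gens_def)
  then show ?thesis
  proof cases
    case (3 k)
    then have "k = 1" "0 < m" using m_le_1 by auto
    with 3 that(3) show ?thesis by blast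
  qed (use that in blast)+
qed

text \<open>The cosimplicial identities hold on generators before any quotient is taken, since the
  only \<open>t\<close> in degree 0 is the primitive \<open>t_1\<close>.\<close>

lemma dd_0:
  assumes "x \<in> polys UNIV (G 0)" shows "d 1 (d 0 x) = 0"
proof -
  have e: "cf 1 i (cf 0 j x) = cf 1 i' (cf 0 j' x)" if "\<And>g. g \<in> G 0 \<Longrightarrow> cf 1 i (cf 0 j (Var g)) = cf 1 i' (cf 0 j' (Var g))" for i j i' j'
    unfolding cf_def subst_subst
    by (rule subst_cong[OF assms]) (use that in \<open>simp add: cf_def\<close>)
  have T0: "0 < m \<Longrightarrow> cf 0 1 (Var (T 1 1)) = Var (T 1 1) + Var (T 2 1)"
    using cf_T_last[of 0] by (simp add: numeral_2_eq_2)
  have T1: "0 < m \<Longrightarrow> cf 1 2 (Var (T 2 1)) = Var (T 2 1) + Var (T 3 1)"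
    using cf_T_last[of 1] by (simp add: numeral_2_eq_2 numeral_3_eq_3)
  have T2: "0 < m \<Longrightarrow> cf 1 1 (Var (T 1 1)) = Var (T 1 1) + Var (T 2 1)"
    using cf_tg_eq[of 1 1 1] tgen_1' by (simp add: Delta_1[simplified] numeral_2_eq_2)
  have gT: "cf s i (Var (T a k)) = Var (T (a + 1) k)" if "a > i" for s i a k using that by (simp add: cf_Var)
  have lT: "cf s i (Var (T a k)) = Var (T a k)" if "a < i" for s i a k using that by (simp add: cf_Var)
  have "cf 1 0 (cf 0 0 x) = cf 1 1 (cf 0 0 x)"
  proof (rule e)
    fix g assume "g \<in> G 0"
    then show "cf 1 0 (cf 0 0 (Var g)) = cf 1 1 (cf 0 0 (Var g))"
      by (cases g rule: gens_0_cases) (simp_all only: gT, simp_all add: cf_Var)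
  qed
  moreover have "cf 1 0 (cf 0 1 x) = cf 1 2 (cf 0 0 x)"
  proof (rule e)
    fix g assume "g \<in> G 0"
    then show "cf 1 0 (cf 0 1 (Var g)) = cf 1 2 (cf 0 0 (Var g))"
    proof (cases g rule: gens_0_cases)
      case 3
      have "cf 0 0 (Var (T 1 1)) = Var (T 2 1)" "cf 1 0 (Var (T 1 1)) = Var (T 2 1)" "cf 1 0 (Var (T 2 1)) = Var (T 3 1)"
        using gT[of 0 1 _ 1] gT[of 0 2 1 1] by (simp_all add: numeral_2_eq_2 numeral_3_eq_3)
      then show ?thesis using 3 T0 T1 by (simp add: cf.hom_add)
    qed (simp_all add: cf_Var)
  qed
  moreover have "cf 1 1 (cf 0 1 x) = cf 1 2 (cf 0 1 x)"
  proof (rule e)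
    fix g assume "g \<in> G 0"
    then show "cf 1 1 (cf 0 1 (Var g)) = cf 1 2 (cf 0 1 (Var g))"
    proof (cases g rule: gens_0_cases)
      case 3
      have "cf 1 1 (Var (T 2 1)) = Var (T 3 1)" "cf 1 2 (Var (T 1 1)) = Var (T 1 1)"
        using gT[of 1 2 1 1] lT[of 1 2 1 1] by (simp_all add: numeral_2_eq_2 numeral_3_eq_3)
      then show ?thesis using 3 T0 T1 T2 by (simp add: cf.hom_add add.assoc)
    qed (simp_all add: cf_Var)
  qed
  ultimately show ?thesis by (simp add: d_0 d_1[simplified] cf.hom_diff)
qed

text \<open>The last of the copies of the formal group law is specialised to the Honda-type law with
  \<open>v\<^sub>2 = 1\<close>, which over the rationals is strictly isomorphic to all others.\<close>

definition pt :: "nat \<Rightarrow> pol" where "pt k = (if k = 2 then 1 else 0)"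

text \<open>An extra codegeneracy from degree \<open>j\<close> to \<open>j - 1\<close>: copies of
  \<open>B\<close> from \<open>j\<close> on go to the rational point \<open>pt\<close>, the
  \<open>j\<close>-th factor becomes the strict isomorphism from copy \<open>j - 1\<close> to
  \<open>pt\<close>, and later \<open>t\<close>'s vanish. It contracts the rational complex.\<close>

definition spec_gen :: "nat \<Rightarrow> gen \<Rightarrow> pol" where
  "spec_gen j g = (case g of V i k \<Rightarrow> if i < j then Var (V i k) else pt k
     | W i \<Rightarrow> if i < j then Var (W i) else 1
     | T i k \<Rightarrow> if i < j then Var (T i k) else if i = j then strict_iso p (vg (j - 1)) pt k else 0)"

definition spec :: "nat \<Rightarrow> pol \<Rightarrow> pol" where "spec j = subst (spec_gen j)"

sublocale spec: ring_hom_on "spec j" for j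
  unfolding spec_def by (rule subst.ring_hom_on_axioms)

lemma spec_Var: "spec j (Var g) = spec_gen j g" by (simp add: spec_def)

lemma spec_cst [simp]: "spec j (cst c) = cst c" by (simp add: spec_def)

lemma spec_vg: "spec j (vg i k) = (if i < j then vg i k else pt k)"
  using N_ge by (auto simp: vgen_def spec_Var spec_gen_def spec.hom_zero pt_def)

lemma spec_tg_less: "i < j \<Longrightarrow> spec j (tg i k) = tg i k"
  by (auto simp: tgen_def spec_Var spec_gen_def spec.hom_simps)

lemma spec_mg: "i > j \<Longrightarrow> spec j (mg i k) = (if k = 0 then 1 else 0)"
  by (auto simp: mgen_def spec_Var spec_gen_def spec.hom_simps)

lemma V1_IQ: "\<not> 0 < m \<Longrightarrow> Var (V s 1) \<in> IQ s"
  using rel_IQ[OF rel_M[of s]] unfolding etaR_mg_1 Tlast_def by (simp only: if_False mult_zero_right add_0_right)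

lemma V1_T_IQ: "0 < m \<Longrightarrow> Var (V s 1) + cst (of_nat p) * Var (T (s + 1) 1) \<in> IQ s"
  using rel_IQ[OF rel_M[of s]] unfolding etaR_mg_1 Tlast_def by (simp only: if_True)

text \<open>If \<open>t_1\<close> has been divided out, the first coefficient
  \<open>- v_1 / p\<close> of the strict isomorphism must vanish; it does because \<open>v_1\<close>
  lies in the rational ideal.\<close>

lemma spec_tg: "IQ.eqv s (spec (s + 1) (tg (s + 1) k)) (strict_iso p (vg s) pt k)"
proof -
  consider "k = 0" | "k = 1" "0 < r" | "k > r" using r_le_1 by linarith
  then show ?thesis
  proof cases
    case 1
    then show ?thesis by (simp add: spec.hom_one)
  next
    case 2
    then have "Var (V s 1) \<in> IQ s" using V1_IQ m_iff_r by auto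
    from IQ.imult[OF UNIV_I this] have "cst (1 / of_nat p) * Var (V s 1) \<in> IQ s" .
    then show ?thesis using 2
      by (simp add: IQ.eqv_def tgen_1[simplified] spec.hom_zero strict_iso_1[simplified] pt_def vgen_1[simplified])
  next
    case 3
    then show ?thesis by (simp add: tgen_def spec_Var spec_gen_def)
  qed
qed

lemma spec_etaR: "spec j (etaR p v t k) = etaR p (\<lambda>k. spec j (v k)) (\<lambda>k. spec j (t k)) k"
  by (simp add: spec_def subst_etaR)

lemma spec_rel:
  assumes "x \<in> rel (s + 1)" shows "spec (s + 1) x \<in> IQ s"
  using assms
proof (cases x "s + 1" rule: rel_cases)
  case (W a)
  then show ?thesis using rel_IQ[OF rel_W, of a s]
    by (cases "a = s + 1") (auto simp: spec.hom_simps spec_Var spec_gen_def pt_def IQ.izero)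
next
  case (eta a k)
  show ?thesis
  proof (cases "a = s")
    case True
    have "IQ.eqv s (etaR p (vg s) (\<lambda>k. spec (s + 1) (tg (s + 1) k)) k) (pt k)"
      by (rule IQ.etaR_strict_iso[OF spec_tg eta(2)])
    then show ?thesis unfolding eta spec.hom_diff spec_etaR spec_vg True by (simp add: IQ.eqv_def)
  next
    case False
    then have "a < s" using eta by simp
    then show ?thesis using rel_IQ[OF rel_eta, of a s k] eta
      unfolding eta spec.hom_diff spec_etaR spec_vg by (simp add: spec_tg_less)
  qed
next
  case M
  have "spec (s + 1) x = etaR p pt (\<lambda>k. if k = 0 then 1 else 0) 1"
    unfolding M spec_etaR spec_vg by (simp add: spec_mg)
  also have "\<dots> = 0" by (subst etaR_1_eq) (auto simp: pt_def)
  finally show ?thesis by (simp add: IQ.izero)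
qed

lemma spec_IQ: "x \<in> IQ (s + 1) \<Longrightarrow> spec (s + 1) x \<in> IQ s"
  unfolding IQ_def[of "s + 1"]
  by (rule ideal_of_hom[OF spec.ring_hom_on_axioms IQ.ideal_on_axioms]) (auto intro: spec_rel[simplified])

lemma polys_empty: "f \<in> polys K {} \<Longrightarrow> \<exists>c. f = cst c"
proof -
  assume f: "f \<in> polys K {}"
  have "f = subst (\<lambda>_. 0) f" using subst_cong[OF f, of "\<lambda>_. 0" Var] by simp
  also have "\<dots> = (\<Sum>m\<in>Poly_Mapping.keys f. cst (Poly_Mapping.lookup f m) * (\<Prod>g\<in>Poly_Mapping.keys m. 0 ^ Poly_Mapping.lookup m g))"
    by (simp add: subst_def)
  also have "\<dots> = (\<Sum>m\<in>Poly_Mapping.keys f. cst (Poly_Mapping.lookup f m))"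
  proof (rule sum.cong[OF refl])
    fix x assume "x \<in> Poly_Mapping.keys f"
    then have "Poly_Mapping.keys x = {}" using polys_keys[OF f] by blast
    then show "cst (Poly_Mapping.lookup f x) * (\<Prod>g\<in>Poly_Mapping.keys x. 0 ^ Poly_Mapping.lookup x g) =
        cst (Poly_Mapping.lookup f x)" by (simp only: prod.empty mult_1_right)
  qed
  finally show ?thesis by (metis cst.hom_sum)
qed

text \<open>The relation \<open>v_1 + p t_1 = 0\<close> of \<open>M\<close> forces
  \<open>t_1 = - v_1 / p\<close>, the first coefficient of the strict isomorphism to
  \<open>pt\<close>.\<close>

lemma eqv_strict_iso_T:
  assumes "0 < m" shows "IQ.eqv s (strict_iso p (vg s) pt 1) (Var (T (s + 1) 1))"
proof -
  have "strict_iso p (vg s) pt 1 - Var (T (s + 1) 1) =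
      cst (- (1 / of_nat p)) * (Var (V s 1) + cst (of_nat p) * Var (T (s + 1) 1))"
    using p_inv_p[of "Var (T (s + 1) 1)"]
    by (simp add: strict_iso_1[simplified] pt_def vgen_1[simplified] cst.hom_uminus distrib_left)
  then show ?thesis using IQ.imult[OF UNIV_I V1_T_IQ[OF assms]] by (simp add: IQ.eqv_def)
qed

text \<open>The contraction is a left inverse of the coaction, while after the other coface
  everything has been specialised to \<open>pt\<close> and only a constant is left.\<close>

lemma rational_H0:
  assumes x: "x \<in> polys UNIV (G 0)" and dx: "d 0 x \<in> IQ 1"
  shows "\<exists>c. x - cst c \<in> IQ 0"
proof -
  have "spec 1 (cf 0 0 x) \<in> polys UNIV {}"
    unfolding spec_def cf_def subst_subst
  proof (rule subst_mem[OF subring_polys[OF subring_UNIV] x])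
    fix g assume "g \<in> G 0"
    then show "subst (spec_gen 1) (coface_gen p N r m 0 0 g) \<in> polys UNIV {}"
      using subring_on.mems[OF subring_polys[OF subring_UNIV, of "{}"]]
      by (elim gens_0_cases) (auto simp: spec_gen_def pt_def)
  qed (auto intro: cst_mem_polys)
  then obtain c where c: "spec 1 (cf 0 0 x) = cst c" using polys_empty by blast
  have "IQ.eqv 0 (spec 1 (cf 0 1 x)) x"
  proof -
    have "subst (\<lambda>g. spec 1 (cf 0 1 (Var g))) x - subst Var x \<in> IQ 0"
    proof (rule subst_eqv[OF IQ.ideal_on_axioms x])
      fix g assume "g \<in> G 0"
      then show "spec 1 (cf 0 1 (Var g)) - Var g \<in> IQ 0"
      proof (cases g rule: gens_0_cases)
        case 3
        then show ?thesis using cf_T_last[of 0] eqv_strict_iso_T[of 0]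
          by (simp add: spec.hom_add spec_Var spec_gen_def IQ.eqv_def numeral_2_eq_2)
      qed (auto simp: cf_Var spec_Var spec_gen_def IQ.izero)
    qed auto
    then show ?thesis by (simp add: IQ.eqv_def spec_def cf_def subst_subst)
  qed
  moreover have "spec 1 (d 0 x) \<in> IQ 0" using spec_IQ[of "d 0 x" 0] dx by simp
  ultimately have "(spec 1 (d 0 x)) + (spec 1 (cf 0 1 x) - x) \<in> IQ 0"
    by (intro IQ.iadd) (auto simp: IQ.eqv_def)
  then have "cst c - x \<in> IQ 0" by (simp add: d_0 spec.hom_diff c[simplified])
  then have "x - cst c \<in> IQ 0" using IQ.iuminus by fastforce
  then show ?thesis ..
qed

lemma gens_1_cases:
  assumes "g \<in> G 1"
  obtains k where "1 \<le> k" "k \<le> N" "g = V 0 k" | k where "1 \<le> k" "k \<le> N" "g = V 1 k" | "g = W 0" | "g = W 1" | k where "r < k" "g = T 1 k"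
    | "0 < m" "g = T 2 1"
proof -
  have "i \<le> 1 \<longleftrightarrow> i = 0 \<or> i = 1" "1 \<le> i \<and> i \<le> 1 \<longleftrightarrow> i = 1" for i :: nat by auto
  then consider k where "1 \<le> k" "k \<le> N" "g = V 0 k" | k where "1 \<le> k" "k \<le> N" "g = V 1 k" | "g = W 0" | "g = W 1"
    | k where "r < k" "g = T 1 k" | k where "1 \<le> k" "k \<le> m" "g = T 2 k"
    using assms unfolding gens_def by (auto simp: numeral_2_eq_2)
  then show ?thesis
  proof cases
    case (6 k)
    then have "k = 1" "0 < m" using m_le_1 by auto
    with 6 that(6) show ?thesis by blast
  qed (use that in blast)+
qed

text \<open>Applying the contraction to \<open>d f\<close> leaves \<open>f\<close> from the last
  coface and the coboundary of the contracted \<open>f\<close> from the others. So \<open>f\<close>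
  is the coboundary of \<open>- h\<close>.\<close>

lemma rational_H1:
  assumes f: "f \<in> polys UNIV (G 1)" and df: "d 1 f \<in> IQ 2"
  shows "\<exists>h\<in>polys UNIV (G 0). f - d 0 h \<in> IQ 1"
proof -
  define h where "h = spec 1 f"
  interpret P0: subring_on "polys UNIV (G 0)" by (rule polys_G_subring[OF subring_UNIV])
  have pt: "pt k \<in> polys UNIV (G 0)" for k by (auto simp: pt_def intro: P0.mems)
  have v0: "vg 0 k \<in> polys UNIV (G 0)" for k
    by (auto simp: vgen_def intro!: Var_G V_gens P0.zero_mem)
  have hP: "h \<in> polys UNIV (G 0)"
    unfolding h_def spec_def
  proof (rule subst_mem[OF P0.subring_on_axioms f])
    fix g assume "g \<in> G 1"
    then show "spec_gen 1 g \<in> polys UNIV (G 0)"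
      using W_gens[of 0 0] V_gens[of 0 0]
      by (elim gens_1_cases) (auto simp: spec_gen_def pt
          intro!: strict_iso_mem[OF P0.subring_on_axioms] cst_mem_polys v0 P0.mems Var_G)
  qed (auto intro: cst_mem_polys)
  have T1_2: "0 < m \<Longrightarrow> cf 1 2 (Var (T 2 1)) = Var (T 2 1) + Var (T 3 1)"
    using cf_T_last[of 1] by (simp add: numeral_2_eq_2 numeral_3_eq_3)
  have a: "IQ.eqv 1 (spec 2 (cf 1 2 f)) f"
  proof -
    have "subst (\<lambda>g. spec 2 (cf 1 2 (Var g))) f - subst Var f \<in> IQ 1"
    proof (rule subst_eqv[OF IQ.ideal_on_axioms f])
      fix g assume "g \<in> G 1"
      then show "spec 2 (cf 1 2 (Var g)) - Var g \<in> IQ 1"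
      proof (cases g rule: gens_1_cases)
        case 6
        then show ?thesis using T1_2 eqv_strict_iso_T[of 1]
          by (simp add: spec.hom_add spec_Var spec_gen_def IQ.eqv_def numeral_2_eq_2)
      qed (auto simp: cf_Var spec_Var spec_gen_def IQ.izero)
    qed auto
    then show ?thesis by (simp add: IQ.eqv_def spec_def cf_def subst_subst)
  qed
  have b: "spec 2 (cf 1 0 f) = cf 0 0 h"
    unfolding h_def spec_def cf_def subst_subst
  proof (rule subst_cong[OF f])
    fix g assume "g \<in> G 1"
    then have "spec 2 (cf 1 0 (Var g)) = cf 0 0 (spec 1 (Var g))"
    proof (cases g rule: gens_1_cases)
      case (5 k)
      have "cf 0 0 (pt k) = pt k" for k by (auto simp: pt_def cf.hom_simps)
      moreover have "cf 0 0 (vg 0 k) = vg 1 k" for k by (simp add: cf_vg)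
      ultimately show ?thesis unfolding 5
        by (simp add: cf_Var spec_Var spec_gen_def) (simp add: cf_def subst_strict_iso)
    qed (auto simp: cf_Var spec_Var spec_gen_def pt_def cf.hom_simps)
    then show "subst (spec_gen 2) (coface_gen p N r m 1 0 g) = subst (coface_gen p N r m 0 0) (spec_gen 1 g)"
      by (simp add: spec_def cf_def)
  qed
  have c: "IQ.eqv 1 (spec 2 (cf 1 1 f)) (cf 0 1 h)"
  proof -
    have "subst (\<lambda>g. spec 2 (cf 1 1 (Var g))) f - subst (\<lambda>g. cf 0 1 (spec 1 (Var g))) f \<in> IQ 1"
    proof (rule subst_eqv[OF IQ.ideal_on_axioms f])
      fix g assume "g \<in> G 1"
      then show "spec 2 (cf 1 1 (Var g)) - cf 0 1 (spec 1 (Var g)) \<in> IQ 1"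
      proof (cases g rule: gens_1_cases)
        case (5 k)
        have ptc: "cf 0 1 (pt k) = pt k" for k by (auto simp: pt_def cf.hom_simps)
        have vc: "cf 0 1 (vg 0 k) = vg 0 k" for k by (simp add: cf_vg)
        have r: "cf 0 1 (spec 1 (Var g)) = strict_iso p (vg 0) pt k"
          unfolding 5 by (simp add: spec_Var spec_gen_def, simp add: cf_def subst_strict_iso)
            (simp add: ptc[unfolded cf_def, simplified] vc[unfolded cf_def, simplified])
        have "Var g = tg 1 k" using 5 by (simp add: tgen_def)
        then have l: "spec 2 (cf 1 1 (Var g)) = Delta p (vg 0) (tg 1) (\<lambda>k. spec 2 (tg 2 k)) k"
          using cf_tg_eq[of 1 1 k] spec_vg[of 2 0] spec_tg_less[of 1 2]
          by (simp add: spec_def subst_Delta numeral_2_eq_2)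
        have e1: "IQ.eqv 1 (etaR_ell p (vg 0) (tg 1) n) (ell p (vg 1) n)" for n
          by (rule IQ.etaR_ell_of_etaR) (use eqv_etaR_tg[of 0 1] in auto)
        have e2: "IQ.eqv 1 (etaR_ell p (vg 1) (\<lambda>k. spec 2 (tg 2 k)) n) (ell p pt n)" for n
        proof -
          have "IQ.eqv 1 (etaR_ell p (vg 1) (\<lambda>k. spec 2 (tg 2 k)) n) (etaR_ell p (vg 1) (strict_iso p (vg 1) pt) n)"
            by (rule IQ.etaR_ell_eqv) (use spec_tg[of 1] in \<open>auto simp: numeral_2_eq_2\<close>)
          then show ?thesis by (simp add: etaR_ell_strict_iso)
        qed
        \<comment> \<open>Going from copy 0 to copy 1 by \<open>t\<close> and on to
          \<open>pt\<close> by the strict isomorphism is the strict isomorphism from copy 0, because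
          a coordinate change is determined by its effect on the logarithm.\<close>
        have "IQ.eqv 1 (Delta p (vg 0) (tg 1) (\<lambda>k. spec 2 (tg 2 k)) k) (strict_iso p (vg 0) pt k)"
          by (rule IQ.etaR_ell_unique[where v = "vg 0"])
            (unfold etaR_ell_strict_iso, rule IQ.eqv_trans[OF IQ.etaR_ell_Delta_eqv[OF e1] e2])
        then show ?thesis unfolding l r IQ.eqv_def .
      next
        case 6
        then show ?thesis by (simp add: cf_Var spec_Var spec_gen_def cf.hom_simps IQ.izero)
      qed (auto simp: cf_Var spec_Var spec_gen_def pt_def cf.hom_simps IQ.izero)
    qed auto
    then show ?thesis by (simp add: h_def IQ.eqv_def spec_def cf_def subst_subst)
  qed
  have "spec 2 (d 1 f) \<in> IQ 1" using spec_IQ[of "d 1 f" 1] df by (simp add: numeral_2_eq_2)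
  moreover have "spec 2 (d 1 f) = cf 0 0 h - spec 2 (cf 1 1 f) + spec 2 (cf 1 2 f)"
    unfolding d_1 spec.hom_add spec.hom_diff b ..
  ultimately have "cf 0 0 h - spec 2 (cf 1 1 f) + spec 2 (cf 1 2 f) \<in> IQ 1" by simp
  from IQ.idiff[OF IQ.iadd[OF this c[unfolded IQ.eqv_def]] a[unfolded IQ.eqv_def]]
  have "f - d 0 (- h) \<in> IQ 1" by (simp add: d_uminus d_0 algebra_simps)
  then show ?thesis using P0.uminus_mem[OF hP] by blast
qed

end

section \<open>Torsion-freeness and reduction modulo \<open>p\<close>\<close>

definition coeffs_in :: "gen \<Rightarrow> pol \<Rightarrow> pol poly" where
  "coeffs_in x = geval (\<lambda>c. [:cst c:]) (\<lambda>g. if g = x then [:0, 1:] else [:Var g:])"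

interpretation coeffs_in: ring_hom_on "coeffs_in x" for x
  unfolding coeffs_in_def
  by (rule ring_hom_geval) (standard, auto simp: cst.hom_simps one_pCons)

lemma const_poly_hom: "ring_hom_on (\<lambda>c. [:cst c:])"
  by standard (auto simp: cst.hom_simps one_pCons)

lemma coeffs_in_cst [simp]: "coeffs_in x (cst c) = [:cst c:]"
  unfolding coeffs_in_def by (rule geval_cst[OF const_poly_hom])

lemma coeffs_in_Var: "coeffs_in x (Var g) = (if g = x then [:0, 1:] else [:Var g:])"
  unfolding coeffs_in_def by (rule geval_Var[OF const_poly_hom])

lemma poly_coeffs_in: "poly (coeffs_in x f) (Var x) = f"
  by (induction f rule: pol_gen_induct)
    (auto simp: coeffs_in_Var coeffs_in.hom_add coeffs_in.hom_mult)

lemma coeffs_in_free: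
  assumes "f \<in> polys K U" "x \<notin> U" shows "coeffs_in x f = [:f:]"
proof -
  have h: "ring_hom_on (\<lambda>f :: pol. [:f:])" by standard (auto simp: one_pCons)
  have "coeffs_in x f = geval (\<lambda>c. [:cst c:]) (\<lambda>g. [:Var g:]) f"
    unfolding coeffs_in_def geval_def using assms
    by (intro sum.cong prod.cong refl arg_cong2[where f = "(*)"]) (auto dest!: polys_keysD)
  also have "\<dots> = [:geval cst Var f:]"
    by (rule geval_hom[OF cst.ring_hom_on_axioms h, symmetric])
  finally show ?thesis by (simp add: subst_geval[symmetric])
qed

lemma coeff_coeffs_in_mult_const:
  "coeffs_in x a = [:c:] \<Longrightarrow> coeff (coeffs_in x (b * a)) i = coeff (coeffs_in x b) i * c"
  by (simp add: coeffs_in.hom_mult mult.commute)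

lemma coeff_mult_mem:
  assumes "subring_on R" "\<And>i. coeff a i \<in> R" "\<And>i. coeff b i \<in> R"
  shows "coeff (a * b) i \<in> R"
proof -
  interpret subring_on R by fact
  show ?thesis unfolding coeff_mult by (intro sum_mem mult_mem assms)
qed

lemma subring_poly:
  assumes "subring_on R" shows "subring_on {a. \<forall>i. coeff a i \<in> R}"
proof -
  interpret subring_on R by fact
  show ?thesis
    by standard (auto simp: diff_mem coeff_mult_mem[OF assms] one_mem zero_mem)
qed

lemma coeff_coeffs_in_mem:
  assumes "subring_on K" "f \<in> polys K U"
  shows "coeff (coeffs_in x f) i \<in> polys K (U - {x})"
proof -
  let ?R = "polys K (U - {x})"
  interpret R: subring_on ?R by (rule subring_polys[OF assms(1)])
  have "coeffs_in x f \<in> {a. \<forall>i. coeff a i \<in> ?R}"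
    unfolding coeffs_in_def
    by (rule geval_mem[OF subring_poly[OF R.subring_on_axioms] assms(2)])
      (auto simp: coeff_pCons R.mems cst_mem_polys Var_mem_polys[OF assms(1)] split: nat.split)
  then show ?thesis by auto
qed

context prime_local begin

definition Jid :: "pol set \<Rightarrow> pol set" where "Jid S = ideal_of RZ (insert (cst (of_nat p)) S)"
definition Iid :: "pol set \<Rightarrow> pol set" where "Iid S = ideal_of RZ S"

sublocale J: ideal_on RZ "Jid S" for S
  unfolding Jid_def by (intro ideal_on_ideal_of RZ.subring_on_axioms)

sublocale I: ideal_on RZ "Iid S" for S
  unfolding Iid_def by (intro ideal_on_ideal_of RZ.subring_on_axioms)

lemma p_mem_J: "cst (of_nat p) \<in> Jid S"
  unfolding Jid_def by (rule ideal_of_gen[OF RZ.subring_on_axioms]) simp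

lemma gen_mem_J: "r \<in> S \<Longrightarrow> r \<in> Jid S"
  unfolding Jid_def by (rule ideal_of_gen[OF RZ.subring_on_axioms]) simp

lemma gen_mem_I: "r \<in> S \<Longrightarrow> r \<in> Iid S"
  unfolding Iid_def by (rule ideal_of_gen[OF RZ.subring_on_axioms]) simp

lemma J_mono: "S \<subseteq> S' \<Longrightarrow> Jid S \<subseteq> Jid S'"
  unfolding Jid_def by (rule ideal_of_mono) auto

lemma I_mono: "S \<subseteq> S' \<Longrightarrow> Iid S \<subseteq> Iid S'"
  unfolding Iid_def by (rule ideal_of_mono) auto

lemma I_J: "x \<in> Iid S \<Longrightarrow> x \<in> Jid S"
  unfolding Jid_def Iid_def using ideal_of_mono[of RZ RZ S "insert (cst (of_nat p)) S"] by auto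

lemma fil_J: "x \<in> fil (- 1) \<Longrightarrow> x \<in> Jid S"
  unfolding fil_neg1_iff using J.imult2[OF _ p_mem_J] by auto

lemma ideal_of_insert:
  assumes "f \<in> ideal_of RZ (insert r S)"
  shows "\<exists>g\<in>ideal_of RZ S. \<exists>c\<in>RZ. f = g + c * r"
proof -
  let ?L = "{f. \<exists>g\<in>ideal_of RZ S. \<exists>c\<in>RZ. f = g + c * r}"
  interpret A: ideal_on RZ "ideal_of RZ S" by (rule ideal_on_ideal_of[OF RZ.subring_on_axioms])
  have "ideal_on RZ ?L"
  proof
    show "0 \<in> ?L" by (intro CollectI bexI[of _ 0]) (auto intro: A.izero RZ.zero_mem)
    show "x + y \<in> ?L" if xy: "x \<in> ?L" "y \<in> ?L" for x y
    proof -
      obtain g c g' c' where "g \<in> ideal_of RZ S" "c \<in> RZ" "x = g + c * r" "g' \<in> ideal_of RZ S" "c' \<in> RZ" "y = g' + c' * r"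
        using xy by blast
      then show ?thesis
        by (intro CollectI bexI[of _ "g + g'"] bexI[of _ "c + c'"]) (auto intro: A.iadd RZ.add_mem simp: algebra_simps)
    qed
    show "a * x \<in> ?L" if ax: "a \<in> RZ" "x \<in> ?L" for a x
    proof -
      obtain g c where "g \<in> ideal_of RZ S" "c \<in> RZ" "x = g + c * r" using ax by blast
      then show ?thesis
        by (intro CollectI bexI[of _ "a * g"] bexI[of _ "a * c"]) (auto intro: A.imult ax RZ.mult_mem simp: algebra_simps)
    qed
  qed
  moreover have "insert r S \<subseteq> ?L"
  proof (intro subsetI)
    fix x assume "x \<in> insert r S"
    then show "x \<in> ?L"
    proof
      assume "x = r"
      then show ?thesis by (intro CollectI bexI[of _ 0] bexI[of _ 1]) (auto intro: A.izero RZ.one_mem)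
    next
      assume "x \<in> S"
      then show ?thesis
        by (intro CollectI bexI[of _ x] bexI[of _ 0]) (auto intro: ideal_of_gen[OF RZ.subring_on_axioms] RZ.zero_mem)
    qed
  qed
  ultimately have "ideal_of RZ (insert r S) \<subseteq> ?L" by (intro ideal_of_least) auto
  with assms show ?thesis by blast
qed

lemma J_decomp: "f \<in> Jid S \<Longrightarrow> \<exists>g\<in>Iid S. \<exists>c\<in>RZ. f = g + cst (of_nat p) * c"
  using ideal_of_insert[of f "cst (of_nat p)" S] by (auto simp: Jid_def Iid_def mult.commute)

lemma J_insert: "f \<in> Jid (insert r S) \<Longrightarrow> \<exists>g\<in>Jid S. \<exists>c\<in>RZ. f = g + c * r"
  using ideal_of_insert[of f r "insert (cst (of_nat p)) S"] by (simp add: Jid_def insert_commute)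

lemma I_insert: "f \<in> Iid (insert r S) \<Longrightarrow> \<exists>g\<in>Iid S. \<exists>c\<in>RZ. f = g + c * r"
  using ideal_of_insert[of f r S] by (simp add: Iid_def)

text \<open>Expresses that \<open>J\<close> comes from polynomials without \<open>x\<close>: modulo
  such a \<open>J\<close>, a polynomial in \<open>x\<close> vanishes only if each coefficient
  does.\<close>

definition coeff_closed :: "gen \<Rightarrow> pol set \<Rightarrow> bool" where
  "coeff_closed x J \<longleftrightarrow> (\<forall>f\<in>J. \<forall>i. coeff (coeffs_in x f) i \<in> J)"

definition good :: "pol set \<Rightarrow> gen set \<Rightarrow> bool" where
  "good S U \<longleftrightarrow> (\<forall>x. x \<notin> U \<longrightarrow> coeff_closed x (Jid S)) \<and>
     (\<forall>y\<in>RZ. cst (of_nat p) * y \<in> Iid S \<longrightarrow> y \<in> Iid S)"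

text \<open>Modulo \<open>p\<close> and \<open>S\<close>, the relation \<open>r\<close> is a unit times a monic polynomial of degree \<open>d\<close> in the
  new variable \<open>x\<close> over the old variables \<open>U\<close>.\<close>

definition monic_ext :: "pol set \<Rightarrow> gen set \<Rightarrow> gen \<Rightarrow> pol \<Rightarrow> nat \<Rightarrow> bool" where
  "monic_ext S U x r d \<longleftrightarrow> r \<in> RZ \<and> d \<ge> 1 \<and> x \<notin> U \<and> (\<exists>u u' q. u \<in> RZ \<and> u' \<in> RZ \<and> u * u' - 1 \<in> Jid S \<and>
     q \<in> polys (Zp p) (insert x U) \<and> degree (coeffs_in x q) < d \<and> r - u' * (Var x ^ d + q) \<in> Jid S)"

lemma J_of_coeffs:
  assumes "\<And>i. coeff (coeffs_in x f) i \<in> Jid S" shows "f \<in> Jid S"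
proof -
  have "f = (\<Sum>i\<le>degree (coeffs_in x f). coeff (coeffs_in x f) i * Var x ^ i)"
    by (subst (1) poly_coeffs_in[of x f, symmetric]) (simp add: poly_altdef)
  also have "\<dots> \<in> Jid S" by (intro J.isum J.imult2 assms RZ.power_mem Var_RZ)
  finally show ?thesis .
qed

lemma RZ_coeff: "f \<in> RZ \<Longrightarrow> coeff (coeffs_in x f) i \<in> RZ"
  unfolding RZ_def using coeff_coeffs_in_mem[OF Zp.subring_on_axioms, of f UNIV x i]
    polys_mono[of "Zp p" "Zp p" "UNIV - {x}" UNIV] by auto

text \<open>A nonzero multiple of a monic polynomial has at least its degree. The unit is absorbed
  first, in \<open>c1 = c * u'\<close>.\<close>

lemma monic_ext_division:
  assumes m: "monic_ext S U x r d" and cl: "coeff_closed x (Jid S)"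
    and c: "c \<in> RZ" and y: "degree (coeffs_in x y) < d" and eq: "y - c * r \<in> Jid S"
  shows "c \<in> Jid S"
proof -
  obtain u u' q where u: "u \<in> RZ" "u' \<in> RZ" "u * u' - 1 \<in> Jid S" "q \<in> polys (Zp p) (insert x U)"
      "degree (coeffs_in x q) < d" "r - u' * (Var x ^ d + q) \<in> Jid S"
    using m unfolding monic_ext_def by blast
  define r' where "r' = Var x ^ d + q"
  define c1 where "c1 = c * u'"
  let ?c = "coeff (coeffs_in x c1)" and ?r = "coeff (coeffs_in x r')"
  have c1: "c1 \<in> RZ" using c u by (simp add: c1_def RZ.mult_mem)
  have r': "r' \<in> RZ" unfolding r'_def by (intro RZ.mems Var_RZ polys_RZ[OF u(4)])
  have "y - c1 * r' = (y - c * r) + c * (r - u' * r')" by (simp add: c1_def algebra_simps)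
  also have "\<dots> \<in> Jid S" using eq J.imult[OF c u(6)] by (simp add: J.iadd r'_def)
  finally have yc: "coeff (coeffs_in x (y - c1 * r')) i \<in> Jid S" for i using cl by (simp add: coeff_closed_def)
  have xd: "coeffs_in x (Var x ^ d) = monom 1 d"
    by (simp add: coeffs_in.hom_power coeffs_in_Var monom_altdef)
  have rd: "?r d = 1" "\<And>b. b > d \<Longrightarrow> ?r b = 0"
    using u(5) by (auto simp: r'_def coeffs_in.hom_add xd coeff_eq_0)
  have all: "?c i \<in> Jid S" for i
  proof (rule ccontr)
    assume i: "?c i \<notin> Jid S"
    let ?B = "{i. ?c i \<notin> Jid S}"
    have "?B \<subseteq> {..degree (coeffs_in x c1)}" using J.izero by (auto intro: le_degree)
    then have fin: "finite ?B" by (rule finite_subset) simp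
    \<comment> \<open>The highest coefficient of \<open>c1\<close> not in the ideal reappears as the
      coefficient of degree \<open>k + d\<close> in \<open>c1 * r'\<close>, a degree in which
      \<open>y\<close> has no term.\<close>
    define k where "k = Max ?B"
    have k: "?c k \<notin> Jid S" using Max_in[OF fin] i unfolding k_def by blast
    have gt: "?c a \<in> Jid S" if "a > k" for a
      using Max_ge[OF fin, of a] that unfolding k_def by (auto simp: not_le)
    have "coeff (coeffs_in x (c1 * r')) (k + d) = (\<Sum>a\<le>k + d. ?c a * ?r (k + d - a))"
      by (simp add: coeffs_in.hom_mult coeff_mult)
    also have "{..k + d} = insert k ({..<k} \<union> {k<..k + d})" by auto
    also have "(\<Sum>a\<in>insert k ({..<k} \<union> {k<..k + d}). ?c a * ?r (k + d - a)) =
       ?c k + ((\<Sum>a<k. ?c a * ?r (k + d - a)) + (\<Sum>a\<in>{k<..k + d}. ?c a * ?r (k + d - a)))"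
      by (subst sum.insert, simp, simp, subst sum.union_disjoint) (auto simp: rd)
    also have "(\<Sum>a<k. ?c a * ?r (k + d - a)) = 0" by (intro sum.neutral) (auto simp: rd)
    finally have "?c k = coeff (coeffs_in x (c1 * r')) (k + d) - (\<Sum>a\<in>{k<..k + d}. ?c a * ?r (k + d - a))"
      by simp
    moreover have "(\<Sum>a\<in>{k<..k + d}. ?c a * ?r (k + d - a)) \<in> Jid S"
      by (intro J.isum J.imult2 gt RZ_coeff r') auto
    moreover have "coeff (coeffs_in x (c1 * r')) (k + d) = - coeff (coeffs_in x (y - c1 * r')) (k + d)"
      using y by (simp add: coeffs_in.hom_diff coeff_eq_0)
    ultimately have "?c k \<in> Jid S" using J.idiff[OF J.iuminus[OF yc]] by simp
    with k show False ..
  qed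
  have "c1 \<in> Jid S" by (rule J_of_coeffs[OF all])
  have "c = u * c1 - c * (u * u' - 1)" by (simp add: c1_def algebra_simps)
  also have "\<dots> \<in> Jid S" by (intro J.idiff J.imult u c \<open>c1 \<in> Jid S\<close>)
  finally show ?thesis .
qed

text \<open>The extension is free on \<open>1, x, ..., x^(d-1)\<close>, so an element of degree
  below \<open>d\<close> acquires no new reason to vanish.\<close>

lemma monic_ext_detect:
  assumes "monic_ext S U x r d" "coeff_closed x (Jid S)"
    "y \<in> Jid (insert r S)" "degree (coeffs_in x y) < d"
  shows "y \<in> Jid S"
proof -
  obtain g c where gc: "g \<in> Jid S" "c \<in> RZ" "y = g + c * r" using J_insert[OF assms(3)] by blast
  have "c \<in> Jid S" by (rule monic_ext_division[OF assms(1,2) gc(2) assms(4)]) (simp add: gc)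
  moreover have "r \<in> RZ" using assms(1) by (simp add: monic_ext_def)
  ultimately show ?thesis unfolding gc(3) by (intro J.iadd gc J.imult2)
qed

text \<open>Because \<open>r\<close> is a unit times a monic polynomial modulo \<open>p\<close> and
  \<open>S\<close>, it is a nonzerodivisor there. This is what carries
  \<open>p\<close>-torsion-freeness to the quotient by \<open>r\<close>.\<close>

lemma good_step:
  assumes g: "good S U" and m: "monic_ext S U x r d"
  shows "good (insert r S) (insert x U)"
proof -
  have xU: "x \<notin> U" and d: "d \<ge> 1" and rR: "r \<in> RZ" using m by (auto simp: monic_ext_def)
  have cl: "coeff_closed x (Jid S)" using g xU by (simp add: good_def)
  obtain u u' q where u: "u \<in> RZ" "u' \<in> RZ" "u * u' - 1 \<in> Jid S" "q \<in> polys (Zp p) (insert x U)"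
      "degree (coeffs_in x q) < d" "r - u' * (Var x ^ d + q) \<in> Jid S"
    using m unfolding monic_ext_def by blast
  define r' where "r' = Var x ^ d + q"
  interpret P: subring_on "polys (Zp p) (insert x U)" by (rule subring_polys[OF Zp.subring_on_axioms])
  have r'P: "r' \<in> polys (Zp p) (insert x U)"
    unfolding r'_def by (intro P.mems u Var_mem_polys[OF Zp.subring_on_axioms]) simp
  have r': "r' \<in> RZ" by (rule polys_RZ[OF r'P])
  have sub: "Jid S \<subseteq> Jid (insert r S)" by (rule J_mono) auto
  have r'J: "r' \<in> Jid (insert r S)"
  proof -
    have "r' = u * r - u * (r - u' * r') - r' * (u * u' - 1)" by (simp add: algebra_simps)
    also have "\<dots> \<in> Jid (insert r S)"
      by (intro J.idiff J.imult u r' gen_mem_J set_mp[OF sub] u(6)[folded r'_def]) simp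
    finally show ?thesis .
  qed
  show ?thesis
    unfolding good_def
  proof (intro conjI allI impI ballI)
    fix x' assume x': "x' \<notin> insert x U"
    have cl': "coeff_closed x' (Jid S)" using g x' by (simp add: good_def)
    show "coeff_closed x' (Jid (insert r S))"
      unfolding coeff_closed_def
    proof (intro ballI allI)
      fix f i assume "f \<in> Jid (insert r S)"
      then obtain h c where hc: "h \<in> Jid S" "c \<in> RZ" "f = h + c * r" using J_insert by blast
      define h' where "h' = h + c * (r - u' * r')"
      have h': "h' \<in> Jid S" unfolding h'_def by (intro J.iadd hc J.imult u(6)[folded r'_def])
      have "f = h' + (c * u') * r'" by (simp add: hc h'_def algebra_simps)
      then have "coeff (coeffs_in x' f) i = coeff (coeffs_in x' h') i + coeff (coeffs_in x' (c * u')) i * r'"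
        by (simp only: coeffs_in.hom_add coeff_add coeff_coeffs_in_mult_const[OF coeffs_in_free[OF r'P x']])
        also have "\<dots> \<in> Jid (insert r S)"
        using cl' h' by (intro J.iadd J.imult r'J RZ_coeff RZ.mult_mem hc u set_mp[OF sub])
          (auto simp: coeff_closed_def)
      finally show "coeff (coeffs_in x' f) i \<in> Jid (insert r S)" .
    qed
  next
    fix y assume y: "y \<in> RZ" "cst (of_nat p) * y \<in> Iid (insert r S)"
    then obtain h c where hc: "h \<in> Iid S" "c \<in> RZ" "cst (of_nat p) * y = h + c * r" using I_insert by blast
    have "c \<in> Jid S"
    proof (rule monic_ext_division[OF m cl hc(2)])
      show "degree (coeffs_in x 0) < d" using d by (simp add: coeffs_in.hom_zero)
      have "0 - c * r = h - y * cst (of_nat p)" using hc(3) by (simp add: algebra_simps)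
      also have "\<dots> \<in> Jid S" by (intro J.idiff I_J hc J.imult y p_mem_J)
      finally show "0 - c * r \<in> Jid S" .
    qed
    \<comment> \<open>Modulo \<open>S\<close> the cofactor \<open>c\<close> is now \<open>p\<close>
      times \<open>c'\<close>, so \<open>c' * r\<close> may be subtracted from \<open>y\<close> and
      the hypothesis on \<open>S\<close> applies to the rest.\<close>
    then obtain i c' where ic: "i \<in> Iid S" "c' \<in> RZ" "c = i + cst (of_nat p) * c'" using J_decomp by blast
    have "cst (of_nat p) * (y - c' * r) = h + r * i"
      using hc(3) by (simp add: ic algebra_simps)
    also have "\<dots> \<in> Iid S" by (intro I.iadd I.imult hc ic rR)
    finally have "y - c' * r \<in> Iid S"
      using g y rR ic(2) unfolding good_def by (blast intro: RZ.mems)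
    then have "y - c' * r \<in> Iid (insert r S)" using I_mono[of S "insert r S"] by blast
    from I.iadd[OF this I.imult[OF ic(2) gen_mem_I[of r "insert r S"]]]
    show "y \<in> Iid (insert r S)" by simp
  qed
qed

inductive tower :: "pol set \<Rightarrow> gen set \<Rightarrow> pol set \<Rightarrow> gen set \<Rightarrow> bool" for S0 U0 where
  tower_base: "tower S0 U0 S0 U0"
| tower_ext: "tower S0 U0 S U \<Longrightarrow> monic_ext S U x r d \<Longrightarrow> tower S0 U0 (insert r S) (insert x U)"

lemma tower_trans: "tower S1 U1 S2 U2 \<Longrightarrow> tower S0 U0 S1 U1 \<Longrightarrow> tower S0 U0 S2 U2"
  by (induction rule: tower.induct) (auto intro: tower_ext)

lemma tower_good: "tower S0 U0 S U \<Longrightarrow> good S0 U0 \<Longrightarrow> good S U"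
  by (induction rule: tower.induct) (auto intro: good_step)

lemma tower_mono: "tower S0 U0 S U \<Longrightarrow> S0 \<subseteq> S \<and> U0 \<subseteq> U"
  by (induction rule: tower.induct) auto

lemma tower_detect:
  "tower S0 U0 S U \<Longrightarrow> good S0 U0 \<Longrightarrow> y \<in> Jid S \<Longrightarrow> y \<in> polys (Zp p) U0 \<Longrightarrow> y \<in> Jid S0"
proof (induction rule: tower.induct)
  case (tower_ext S U x r d)
  have g: "good S U" by (rule tower_good[OF tower_ext(1,4)])
  have xU: "x \<notin> U" "d \<ge> 1" using tower_ext(2) by (auto simp: monic_ext_def)
  have "y \<in> Jid S"
  proof (rule monic_ext_detect[OF tower_ext(2) _ tower_ext(5)])
    show "coeff_closed x (Jid S)" using g xU by (simp add: good_def)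
    have "x \<notin> U0" using tower_mono[OF tower_ext(1)] xU by blast
    then show "degree (coeffs_in x y) < d" using coeffs_in_free[OF tower_ext(6)] xU by simp
  qed
  then show ?case by (rule tower_ext(3)[OF tower_ext(4) _ tower_ext(6)])
qed auto

text \<open>For torsion-freeness, \<open>p y = b (w v - 1)\<close> is compared coefficientwise in
  \<open>w\<close>: the coefficient of \<open>w^i\<close> gives \<open>b_i\<close> as
  \<open>v b_(i-1)\<close> minus a multiple of \<open>p\<close>, so all \<open>b_i\<close> are
  divisible by \<open>p\<close> by induction.\<close>

lemma good_base:
  assumes vw: "vv \<noteq> ww" "vv \<in> U0" "ww \<in> U0"
  shows "good {Var ww * Var vv - 1} U0"
  unfolding good_def
proof (intro conjI allI impI ballI)
  let ?r = "Var ww * Var vv - 1"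
  let ?J = "Jid {?r}"
  have rR: "?r \<in> RZ" by (intro RZ.mems Var_RZ)
  fix x assume x: "x \<notin> U0"
  have xr: "coeffs_in x ?r = [:?r:]"
    using x vw by (auto simp: coeffs_in.hom_simps coeffs_in_Var one_pCons)
  show "coeff_closed x ?J"
    unfolding coeff_closed_def
  proof (intro ballI allI)
    fix f i assume "f \<in> ?J"
    then obtain g c where g: "g \<in> Iid {?r}" "c \<in> RZ" "f = g + cst (of_nat p) * c" using J_decomp by blast
    obtain h b where h: "h \<in> Iid {}" "b \<in> RZ" "g = h + b * ?r" using I_insert[of g ?r "{}"] g by blast
    have "h = 0" using h(1) by (simp add: Iid_def ideal_of_def)
    then have "f = b * ?r + c * cst (of_nat p)" using g h by (simp add: mult.commute)
    then have "coeff (coeffs_in x f) i = coeff (coeffs_in x b) i * ?r + coeff (coeffs_in x c) i * cst (of_nat p)"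
      by (simp only: coeffs_in.hom_add coeff_add coeff_coeffs_in_mult_const[OF xr]
          coeff_coeffs_in_mult_const[OF coeffs_in_cst])
    also have "\<dots> \<in> ?J" by (intro J.iadd J.imult RZ_coeff h g gen_mem_J p_mem_J) simp
    finally show "coeff (coeffs_in x f) i \<in> ?J" .
  qed
next
  let ?r = "Var ww * Var vv - 1"
  fix y assume y: "y \<in> RZ" "cst (of_nat p) * y \<in> Iid {?r}"
  obtain h b where h: "h \<in> Iid {}" "b \<in> RZ" "cst (of_nat p) * y = h + b * ?r" using I_insert[OF y(2)] by blast
  have "h = 0" using h(1) by (simp add: Iid_def ideal_of_def)
  then have eq: "cst (of_nat p) * y = b * ?r" using h by simp
  let ?b = "coeff (coeffs_in ww b)"
  have rw: "coeffs_in ww ?r = [:- 1, Var vv:]"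
    using vw by (simp add: coeffs_in.hom_simps coeffs_in_Var one_pCons)
  have "coeff (coeffs_in ww (cst (of_nat p) * y)) i = coeff ([:- 1, Var vv:] * coeffs_in ww b) i" for i
    unfolding eq coeffs_in.hom_mult[of ww b] rw by (simp only: mult.commute)
  then have c: "cst (of_nat p) * coeff (coeffs_in ww y) i = - ?b i + (case i of 0 \<Rightarrow> 0 | Suc j \<Rightarrow> Var vv * ?b j)" for i
    by (cases i) (auto simp: coeffs_in.hom_mult)
  have b: "?b i \<in> fil (- 1)" for i
  proof (induction i)
    case 0
    have "?b 0 = - (cst (of_nat p) * coeff (coeffs_in ww y) 0)" using c[of 0] by simp
    also have "\<dots> \<in> fil (- 1)" by (intro fil_uminus) (use RZ_coeff[OF y(1)] fil_neg1_iff in blast)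
    finally show ?case .
  next
    case (Suc j)
    have "?b (Suc j) = Var vv * ?b j - cst (of_nat p) * coeff (coeffs_in ww y) (Suc j)" using c[of "Suc j"] by simp
    also have "\<dots> \<in> fil (- 1)"
    proof (rule fil_diff)
      show "Var vv * ?b j \<in> fil (- 1)" by (intro fil_mult0 Suc Var_RZ)
      show "cst (of_nat p) * coeff (coeffs_in ww y) (Suc j) \<in> fil (- 1)"
        using RZ_coeff[OF y(1)] fil_neg1_iff by blast
    qed
    finally show ?case .
  qed
  have "b = (\<Sum>i\<le>degree (coeffs_in ww b). Var ww ^ i * ?b i)"
    by (subst (1) poly_coeffs_in[of ww b, symmetric]) (simp add: poly_altdef mult.commute)
  also have "\<dots> \<in> fil (- 1)" by (intro fil_sum fil_mult0 b RZ.power_mem Var_RZ)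
  finally obtain b' where b': "b' \<in> RZ" "b = cst (of_nat p) * b'" using fil_neg1_iff by blast
  have "cst (1 / of_nat p) * (cst (of_nat p) * y) = cst (1 / of_nat p) * (cst (of_nat p) * (b' * ?r))"
    unfolding eq b'(2) by (simp only: mult.assoc)
  then have "y = b' * ?r" by (simp only: p_inv_p)
  then show "y \<in> Iid {?r}" using b' gen_mem_I[of ?r "{?r}"] by (auto intro: I.imult)
qed

lemma clear_denominators: "\<exists>k. cst (of_nat p ^ k) * f \<in> RZ"
proof (induction f rule: pol_gen_induct)
  case (cst c)
  obtain a b where ab: "c = of_int a / of_int b" "b > 0" by (metis quotient_of_div quotient_of_denom_pos surj_pair)
  define k where "k = multiplicity (int p) b"
  have np: "\<not> is_unit (int p)" using p_gt_1 by auto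
  obtain b' where b': "b = int p ^ k * b'" "\<not> int p dvd b'"
    using multiplicity_decompose'[of b "int p"] ab np unfolding k_def by auto
  have "of_nat p ^ k * c = of_int a / of_int b'"
    using p_gt_0 by (simp add: ab b')
  then have "of_nat p ^ k * c \<in> Zp p" using b'(2) by (auto simp: Zp_iff)
  then show ?case by (intro exI[of _ k]) (simp add: cst.hom_mult[symmetric] cst_RZ)
next
  case (Var g)
  show ?case by (rule exI[of _ 0]) (simp add: cst.hom_one Var_RZ)
next
  case (add f g)
  then obtain k l where k: "cst (of_nat p ^ k) * f \<in> RZ" "cst (of_nat p ^ l) * g \<in> RZ" by blast
  have c: "cst (of_nat p ^ n) \<in> RZ" for n by (intro cst_RZ Zp.mems)
  have "cst (of_nat p ^ (k + l)) * (f + g) = cst (of_nat p ^ l) * (cst (of_nat p ^ k) * f) + cst (of_nat p ^ k) * (cst (of_nat p ^ l) * g)"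
    by (simp add: power_add cst.hom_mult algebra_simps)
  also have "\<dots> \<in> RZ" by (intro RZ.add_mem RZ.mult_mem[OF c] k)
  finally show ?case ..
next
  case (mult f g)
  then obtain k l where k: "cst (of_nat p ^ k) * f \<in> RZ" "cst (of_nat p ^ l) * g \<in> RZ" by blast
  have "cst (of_nat p ^ (k + l)) * (f * g) = (cst (of_nat p ^ k) * f) * (cst (of_nat p ^ l) * g)"
    by (simp add: power_add cst.hom_mult algebra_simps)
  then show ?case using RZ.mult_mem[OF k] by metis
qed

lemma ideal_clear_denominators:
  assumes "f \<in> ideal_of UNIV S" shows "\<exists>k. cst (of_nat p ^ k) * f \<in> Iid S"
proof -
  obtain F c where F: "f = (\<Sum>g\<in>F. c g * g)" "finite F" "F \<subseteq> S" using assms by (auto simp: ideal_of_def)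
  have "\<exists>k. cst (of_nat p ^ k) * (\<Sum>g\<in>F. c g * g) \<in> Iid S"
    using F(2,3)
  proof (induction F rule: finite_induct)
    case empty
    then show ?case by (simp add: I.izero)
  next
    case (insert g F)
    then obtain k where k: "cst (of_nat p ^ k) * (\<Sum>g\<in>F. c g * g) \<in> Iid S" by auto
    obtain l where l: "cst (of_nat p ^ l) * c g \<in> RZ" using clear_denominators by blast
    have c: "cst (of_nat p ^ n) \<in> RZ" for n by (intro cst_RZ Zp.mems)
    have "cst (of_nat p ^ (k + l)) * (\<Sum>g\<in>insert g F. c g * g) =
      cst (of_nat p ^ k) * ((cst (of_nat p ^ l) * c g) * g) + cst (of_nat p ^ l) * (cst (of_nat p ^ k) * (\<Sum>g\<in>F. c g * g))"
      using insert by (simp add: power_add cst.hom_mult distrib_left mult_ac)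
    also have "\<dots> \<in> Iid S"
      by (intro I.iadd I.imult[OF c] k I.imult[OF l] gen_mem_I) (use insert in auto)
    finally show ?case ..
  qed
  then show ?thesis by (simp add: F)
qed

lemma torsion_free_rational:
  assumes "\<And>y. y \<in> RZ \<Longrightarrow> cst (of_nat p) * y \<in> Iid S \<Longrightarrow> y \<in> Iid S" "f \<in> RZ" "f \<in> ideal_of UNIV S"
  shows "f \<in> Iid S"
proof -
  obtain k where "cst (of_nat p ^ k) * f \<in> Iid S" using ideal_clear_denominators[OF assms(3)] by blast
  then show ?thesis
  proof (induction k)
    case 0
    then show ?case by (simp add: cst.hom_one)
  next
    case (Suc k)
    have "cst (of_nat p) * (cst (of_nat p ^ k) * f) \<in> Iid S"
      using Suc(2) by (simp add: cst.hom_mult mult.assoc)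
    moreover have "cst (of_nat p ^ k) * f \<in> RZ" by (intro RZ.mult_mem cst_RZ Zp.mems assms(2))
    ultimately show ?case using Suc(1) assms(1) by blast
  qed
qed

lemma degree_coeffs_in_free: "f \<in> polys K U \<Longrightarrow> x \<notin> U \<Longrightarrow> degree (coeffs_in x f) = 0"
  by (simp add: coeffs_in_free)

lemma Zp_Var: "g \<in> U \<Longrightarrow> Var g \<in> polys (Zp p) U"
  by (rule Var_mem_polys[OF Zp.subring_on_axioms])

lemma monic_ext_linear:
  assumes "r \<in> RZ" "x \<notin> U" "u \<in> RZ" "u' \<in> RZ" "u * u' - 1 \<in> Jid S" "q \<in> polys (Zp p) U"
    "r - u' * (Var x + q) \<in> Jid S"
  shows "monic_ext S U x r 1"
  unfolding monic_ext_def
proof (intro conjI exI)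
  show "q \<in> polys (Zp p) (insert x U)" using assms(6) polys_mono[OF order_refl, of U "insert x U" "Zp p"] by blast
  show "degree (coeffs_in x q) < 1" using degree_coeffs_in_free[OF assms(6,2)] by simp
  show "r - u' * (Var x ^ 1 + q) \<in> Jid S" using assms(7) by simp
qed (use assms in auto)

end

section \<open>The cobar rings as towers of monic extensions\<close>

context cobar begin

abbreviation eta :: "nat \<Rightarrow> nat \<Rightarrow> pol" where
  "eta i k \<equiv> etaR p (vg i) (tg (i + 1)) k - vg (i + 1) k"
abbreviation wrel :: "nat \<Rightarrow> pol" where "wrel i \<equiv> Var (W i) * Var (V i 2) - 1"
abbreviation mrel :: "nat \<Rightarrow> pol" where "mrel s \<equiv> etaR p (vg s) (mg (s + 1)) 1"

text \<open>
  The relations of the \<open>s\<close>-th cobar ring are imposed in an order in which each one eliminates, or is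
  monic in, a new variable: over the variables \<open>U0\<close> with \<open>v\<^sub>2\<close> invertible, first all copies of \<open>v\<^sub>1\<close>
  (\<open>S1\<close>, \<open>U1\<close>), then \<open>v\<^sub>2\<close>, \<open>v\<^sub>3\<close> and the inverse of \<open>v\<^sub>2\<close> copy by copy (\<open>S2\<close>, \<open>U2\<close>), then the \<open>t\<^sub>j\<close> by
  increasing \<open>j\<close> (\<open>S3\<close>, \<open>U3\<close>). Listing \<open>V 0 3\<close> in \<open>U0\<close> is harmless for \<open>N = 2\<close>.
\<close>

definition U0 :: "nat \<Rightarrow> gen set" where "U0 s = {V 0 2, V 0 3, W 0, T (s + 1) 1}"
definition S1 :: "nat \<Rightarrow> nat \<Rightarrow> pol set" where
  "S1 s a = insert (mrel s) {wrel 0} \<union> {eta i 1 |i. s - a \<le> i \<and> i < s}"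
definition U1 :: "nat \<Rightarrow> nat \<Rightarrow> gen set" where
  "U1 s a = insert (V s 1) (U0 s) \<union> {V i 1 |i. s - a \<le> i \<and> i < s}"
definition S2 :: "nat \<Rightarrow> nat \<Rightarrow> pol set" where
  "S2 s a = S1 s s \<union> {eta i k |i k. i < a \<and> 2 \<le> k \<and> k \<le> N} \<union> {wrel i |i. 1 \<le> i \<and> i \<le> a}"
definition U2 :: "nat \<Rightarrow> nat \<Rightarrow> gen set" where
  "U2 s a = U1 s s \<union> {V i k |i k. 1 \<le> i \<and> i \<le> a \<and> 2 \<le> k \<and> k \<le> N} \<union> {W i |i. 1 \<le> i \<and> i \<le> a}"
definition S3 :: "nat \<Rightarrow> nat \<Rightarrow> pol set" where
  "S3 s n = S2 s s \<union> {eta i k |i k. i < s \<and> N < k \<and> k \<le> N + n}"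
definition U3 :: "nat \<Rightarrow> nat \<Rightarrow> gen set" where
  "U3 s n = U2 s s \<union> {T (i + 1) j |i j. i < s \<and> r < j \<and> j \<le> r + n}"

lemma eta_RZ: "1 \<le> k \<Longrightarrow> eta i k \<in> RZ"
  by (intro RZ.diff_mem hazt.etaR_RZ vg_RZ) simp

lemma mrel_RZ: "mrel s \<in> RZ"
  by (intro hazm.etaR_RZ) simp

lemma Tlast_RZ: "Tlast s \<in> RZ"
  by (auto simp: Tlast_def RZ.zero_mem Var_RZ)

lemma eta_1: "eta i 1 = Var (V i 1) - Var (V (i + 1) 1) + cst (of_nat p) * Tlast i"
  by (subst etaR_1_eq) (simp_all add: vgen_1[simplified] tgen_Tlast[simplified])

text \<open>The copies are treated from the last to the first: \<open>M\<close> determines the last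
  \<open>v_1\<close>, and \<open>eta_R(v_1) = v_1 + p t_1\<close> then determines each preceding one
  modulo \<open>p\<close>.\<close>

lemma tower_S1: "a \<le> s \<Longrightarrow> tower {wrel 0} (U0 s) (S1 s a) (U1 s a)"
proof (induction a)
  case 0
  interpret P: subring_on "polys (Zp p) (U0 s)" by (rule subring_polys[OF Zp.subring_on_axioms])
  have m: "monic_ext {wrel 0} (U0 s) (V s 1) (mrel s) 1"
  proof (rule monic_ext_linear[of _ _ _ 1 1 _ 0])
    show "mrel s - 1 * (Var (V s 1) + 0) \<in> Jid {wrel 0}"
      unfolding etaR_mg_1 using J.imult2[OF Tlast_RZ p_mem_J] by simp
  qed (auto simp: U0_def mrel_RZ[simplified] RZ.one_mem J.izero P.zero_mem[unfolded U0_def, simplified])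
  have z: "{f i |i. s - 0 \<le> i \<and> i < s} = {}" for f :: "nat \<Rightarrow> 'b" by auto
  have e: "S1 s 0 = insert (mrel s) {wrel 0}" "U1 s 0 = insert (V s 1) (U0 s)"
    unfolding S1_def U1_def z by (rule Un_empty_right)+
  from tower_ext[OF tower_base m] show ?case unfolding e .
next
  case (Suc a)
  define i where "i = s - Suc a"
  have i: "i < s" "i + 1 = s - a" using Suc.prems by (auto simp: i_def)
  interpret P: subring_on "polys (Zp p) (U1 s a)" by (rule subring_polys[OF Zp.subring_on_axioms])
  have m: "V (i + 1) 1 \<in> U1 s a" unfolding i(2) U1_def by auto
  have "monic_ext (S1 s a) (U1 s a) (V i 1) (eta i 1) 1"
  proof (rule monic_ext_linear[of _ _ _ 1 1 _ "- Var (V (i + 1) 1)"])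
    show "eta i 1 - 1 * (Var (V i 1) + - Var (V (i + 1) 1)) \<in> Jid (S1 s a)"
      unfolding eta_1 using J.imult2[OF Tlast_RZ p_mem_J] by simp
    show "- Var (V (i + 1) 1) \<in> polys (Zp p) (U1 s a)" by (intro P.uminus_mem Zp_Var m)
    show "V i 1 \<notin> U1 s a" using i by (auto simp: U1_def U0_def)
    show "eta i 1 \<in> RZ" by (rule eta_RZ) simp
  qed (auto simp: RZ.one_mem J.izero)
  moreover have j: "s - Suc a \<le> j \<and> j < s \<longleftrightarrow> j = i \<or> s - a \<le> j \<and> j < s" for j
    using i by (auto simp: i_def)
  have "S1 s (Suc a) = insert (eta i 1) (S1 s a)" "U1 s (Suc a) = insert (V i 1) (U1 s a)"
    unfolding S1_def U1_def j by (auto simp only: insert_iff Un_iff mem_Collect_eq)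
  ultimately show ?case using tower_ext[OF Suc.IH] Suc.prems by simp
qed

lemma V1_J:
  assumes S: "S1 s s \<subseteq> S" and i: "i \<le> s" shows "Var (V i 1) \<in> Jid S"
  using i
proof (induction "s - i" arbitrary: i)
  case 0
  then have "i = s" by simp
  have "Var (V s 1) = mrel s - Tlast s * cst (of_nat p)" unfolding etaR_mg_1 by simp
  also have "\<dots> \<in> Jid S"
    by (intro J.idiff J.imult Tlast_RZ p_mem_J gen_mem_J) (use S in \<open>auto simp: S1_def\<close>)
  finally show ?case using \<open>i = s\<close> by simp
next
  case (Suc n)
  then have i: "i < s" "n = s - (i + 1)" by auto
  have IH: "Var (V (i + 1) 1) \<in> Jid S" by (rule Suc(1)[OF i(2)]) (use i in simp)
  have "eta i 1 \<in> S" using S i unfolding S1_def by auto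
  have "Var (V i 1) = eta i 1 + Var (V (i + 1) 1) - Tlast i * cst (of_nat p)" unfolding eta_1 by simp
  also have "\<dots> \<in> Jid S"
    by (intro J.idiff J.iadd IH J.imult Tlast_RZ p_mem_J gen_mem_J \<open>eta i 1 \<in> S\<close>)
  finally show ?case .
qed

definition P_gens :: "nat \<Rightarrow> nat \<Rightarrow> gen set" where
  "P_gens i n = {V i k |k. 2 \<le> k \<and> k \<le> N} \<union> {T (i + 1) j |j. r < j \<and> j \<le> n}"

text \<open>The leading terms were computed for \<open>v_1 = 0\<close>. Since \<open>v_1\<close>
  lies in the ideal, setting it to 0 changes \<open>eta_R(v_k)\<close> only by an element of the
  ideal.\<close>

lemma etaR_mod_J:
  assumes V1: "Var (V i 1) \<in> Jid S"
  shows etaR_2_J: "etaR p (vg i) (tg (i + 1)) 2 - Var (V i 2) \<in> Jid S"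
    and etaR_mod_p_J: "k \<ge> 3 \<Longrightarrow> \<exists>q\<in>polys (Zp p) (P_gens i (k - 3)). etaR p (vg i) (tg (i + 1)) k -
      (Var (V i 2) * tg (i + 1) (k - 2) ^ (p\<^sup>2) - Var (V i 2) ^ (p ^ (k - 2)) * tg (i + 1) (k - 2) + q) \<in> Jid S"
proof -
  define v0 where "v0 k = (if k = 1 then 0 else vg i k)" for k
  define kill where "kill g = (if g = V i 1 then 0 else Var g)" for g
  interpret P: subring_on "polys (Zp p) (P_gens i n)" for n by (rule subring_polys[OF Zp.subring_on_axioms])
  interpret H: hazewinkel_t_mod p v0 "tg (i + 1)" "P_gens i"
  proof
    show "v0 k \<in> RZ" for k by (auto simp: v0_def vg_RZ RZ.zero_mem)
    show "frob (v0 k) = v0 k ^ p" for k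
      using hazt.frob_v[of i k] p_gt_0 by (auto simp: v0_def frob.hom_zero zero_power)
    show "v0 k \<in> polys (Zp p) (P_gens i 0)" for k
      by (auto simp: v0_def vgen_def P_gens_def intro!: Zp_Var P.zero_mem[of 0, unfolded P_gens_def, simplified])
    show "tg (i + 1) k \<in> polys (Zp p) (P_gens i k)" for k
    proof -
      have "T (i + 1) k \<in> P_gens i k" if "r < k" using that by (auto simp: P_gens_def)
      then show ?thesis by (auto simp: tgen_def intro: Zp_Var P.mems)
    qed
  qed (auto simp: v0_def P_gens_def tg_RZ[simplified])
  have kv: "subst kill (vg i k) = v0 k" for k
    by (auto simp: vgen_def v0_def kill_def subst.hom_zero)
  have kt: "subst kill (tg (i + 1) k) = tg (i + 1) k" for k
    by (auto simp: tgen_def kill_def subst.hom_simps)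
  have e: "etaR p (vg i) (tg (i + 1)) k - etaR p v0 (tg (i + 1)) k \<in> Jid S" if "k \<ge> 1" for k
  proof -
    have "etaR p (vg i) (tg (i + 1)) k \<in> RZ" using that by (intro hazt.etaR_RZ) simp
    then have "subst Var (etaR p (vg i) (tg (i + 1)) k) - subst kill (etaR p (vg i) (tg (i + 1)) k) \<in> Jid S"
      unfolding RZ_def
      by (rule subst_eqv[OF J.ideal_on_axioms])
        (auto simp: kill_def RZ.zero_mem Var_RZ cst_RZ J.izero V1[simplified])
    then show ?thesis by (simp add: subst_etaR kv kt[simplified])
  qed
  have v2: "v0 2 = Var (V i 2)" using vgen_2 by (simp add: v0_def)
  show "etaR p (vg i) (tg (i + 1)) 2 - Var (V i 2) \<in> Jid S"
    using J.iadd[OF e[of 2] fil_J[OF H.etaR_2]] by (simp add: v2)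
  assume k: "k \<ge> 3"
  obtain q where q: "q \<in> polys (Zp p) (P_gens i (k - 3))"
    "etaR p v0 (tg (i + 1)) k - (v0 2 * tg (i + 1) (k - 2) ^ (p\<^sup>2) - v0 2 ^ (p ^ (k - 2)) * tg (i + 1) (k - 2) + q) \<in> fil (- 1)"
    using H.etaR_mod_p[OF k] by blast
  have k1: "1 \<le> k" using k by simp
  from J.iadd[OF e[OF k1] fil_J[OF q(2)]]
  have "etaR p (vg i) (tg (i + 1)) k -
    (v0 2 * tg (i + 1) (k - 2) ^ (p\<^sup>2) - v0 2 ^ (p ^ (k - 2)) * tg (i + 1) (k - 2) + q) \<in> Jid S"
    by (simp only: diff_add_cancel add_diff_eq)
  with q(1) show "\<exists>q\<in>polys (Zp p) (P_gens i (k - 3)). etaR p (vg i) (tg (i + 1)) k -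
      (Var (V i 2) * tg (i + 1) (k - 2) ^ (p\<^sup>2) - Var (V i 2) ^ (p ^ (k - 2)) * tg (i + 1) (k - 2) + q) \<in> Jid S"
    unfolding v2 by blast
qed

text \<open>Modulo \<open>p\<close> and \<open>v_1\<close>, \<open>eta_R(v_2)\<close> is
  \<open>v_2\<close>; when \<open>t_1 = 0\<close>, \<open>eta_R(v_3)\<close> involves no
  \<open>t\<close> at all. Each new copy of \<open>v_2\<close>, and of \<open>v_3\<close> if
  present, is therefore a polynomial in the preceding copy.\<close>

lemma tower_S2: "a \<le> s \<Longrightarrow> tower {wrel 0} (U0 s) (S2 s a) (U2 s a)"
proof (induction a)
  case 0
  have "S2 s 0 = S1 s s" "U2 s 0 = U1 s s" by (auto simp: S2_def U2_def)
  then show ?case using tower_S1[of s s] by simp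
next
  case (Suc a)
  then have a: "a < s" "a \<le> s" and IH: "tower {wrel 0} (U0 s) (S2 s a) (U2 s a)" by auto
  have V1: "Var (V a 1) \<in> Jid S" if "S2 s a \<subseteq> S" for S
    using that by (intro V1_J[of s]) (use a in \<open>auto simp: S2_def\<close>)
  have Va: "V a k \<in> U2 s a" if "2 \<le> k" "k \<le> N" for k
  proof (cases "a = 0")
    case True
    then have "k = 2 \<or> k = 3" using that N_eq r_le_1 by linarith
    then show ?thesis using True by (auto simp: U2_def U1_def U0_def)
  qed (use that in \<open>auto simp: U2_def\<close>)
  have Wa: "W a \<in> U2 s a" by (cases "a = 0") (auto simp: U2_def U1_def U0_def)
  have wr: "wrel a \<in> S2 s a" by (cases "a = 0") (auto simp: S2_def S1_def)
  let ?SA = "insert (eta a 2) (S2 s a)" and ?UA = "insert (V (a + 1) 2) (U2 s a)"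
  have "monic_ext (S2 s a) (U2 s a) (V (a + 1) 2) (eta a 2) 1"
  proof (rule monic_ext_linear[of _ _ _ "- 1" "- 1" _ "- Var (V a 2)"])
    show "- Var (V a 2) \<in> polys (Zp p) (U2 s a)"
      using subring_on.uminus_mem[OF subring_polys[OF Zp.subring_on_axioms]] Zp_Var[OF Va] N_ge by blast
    show "eta a 2 - - 1 * (Var (V (a + 1) 2) + - Var (V a 2)) \<in> Jid (S2 s a)"
      using etaR_2_J[OF V1[OF order_refl]] by (simp add: vgen_2)
    show "V (a + 1) 2 \<notin> U2 s a" by (auto simp: U2_def U1_def U0_def)
    show "eta a 2 \<in> RZ" by (rule eta_RZ) simp
  qed (auto simp: J.izero intro: RZ.mems)
  from tower_ext[OF IH this] have tA: "tower {wrel 0} (U0 s) ?SA ?UA" .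
  define SB where "SB = S2 s a \<union> {eta a k |k. 2 \<le> k \<and> k \<le> N}"
  define UB where "UB = U2 s a \<union> {V (a + 1) k |k. 2 \<le> k \<and> k \<le> N}"
  have tB: "tower {wrel 0} (U0 s) SB UB"
  proof (cases "0 < r")
    case False
    then have N2: "2 \<le> k \<and> k \<le> N \<longleftrightarrow> k = 2" for k using N_eq by auto
    then have "SB = ?SA" "UB = ?UA" unfolding SB_def UB_def by auto
    then show ?thesis using tA by simp
  next
    case True
    then have N3: "2 \<le> k \<and> k \<le> N \<longleftrightarrow> k = 2 \<or> k = 3" for k using N_eq r_le_1 by auto
    then have e: "SB = insert (eta a 3) ?SA" "UB = insert (V (a + 1) 3) ?UA" unfolding SB_def UB_def by auto
    have "Var (V a 1) \<in> Jid ?SA" by (rule V1) auto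
    then obtain q where q: "q \<in> polys (Zp p) (P_gens a 0)" "etaR p (vg a) (tg (a + 1)) 3 -
      (Var (V a 2) * tg (a + 1) 1 ^ (p\<^sup>2) - Var (V a 2) ^ (p ^ 1) * tg (a + 1) 1 + q) \<in> Jid ?SA"
      using etaR_mod_p_J[of a ?SA 3] by auto
    have "tg (a + 1) 1 = 0" using True tgen_1 by simp
    then have q2: "etaR p (vg a) (tg (a + 1)) 3 - q \<in> Jid ?SA"
      using q(2) p_gt_0 by (simp add: zero_power)
    have "P_gens a 0 \<subseteq> ?UA" using Va by (auto simp: P_gens_def)
    then have qU: "q \<in> polys (Zp p) ?UA" using q(1) polys_mono[OF order_refl] by blast
    have vg3: "vg (a + 1) 3 = Var (V (a + 1) 3)" using N3[of 3] by (simp add: vgen_def)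
    have "monic_ext ?SA ?UA (V (a + 1) 3) (eta a 3) 1"
    proof (rule monic_ext_linear[of _ _ _ "- 1" "- 1" _ "- q"])
      show "- q \<in> polys (Zp p) ?UA"
        using subring_on.uminus_mem[OF subring_polys[OF Zp.subring_on_axioms] qU] .
      show "eta a 3 - - 1 * (Var (V (a + 1) 3) + - q) \<in> Jid ?SA"
        unfolding vg3 using q2 by simp
      show "V (a + 1) 3 \<notin> ?UA" by (auto simp: U2_def U1_def U0_def)
      show "eta a 3 \<in> RZ" by (rule eta_RZ) simp
    qed (auto simp: J.izero intro: RZ.mems)
    from tower_ext[OF tA this] show ?thesis unfolding e .
  qed
  \<comment> \<open>With the new \<open>v_2\<close> congruent to the old one, the relation for the
    new inverse is the old \<open>v_2\<close>, a unit, times the difference of the two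
    inverses.\<close>
  have "monic_ext SB UB (W (a + 1)) (wrel (a + 1)) 1"
  proof (rule monic_ext_linear[of _ _ _ "Var (W a)" "Var (V a 2)" _ "- Var (W a)"])
    show "- Var (W a) \<in> polys (Zp p) UB"
      using subring_on.uminus_mem[OF subring_polys[OF Zp.subring_on_axioms]] Zp_Var[of "W a" UB] Wa
      by (auto simp: UB_def)
    have "2 \<le> N" using N_ge by auto
    then have "eta a 2 \<in> SB" by (auto simp: SB_def)
    have V1B: "Var (V a 1) \<in> Jid SB" by (rule V1) (auto simp: SB_def)
    have "wrel (a + 1) - Var (V a 2) * (Var (W (a + 1)) + - Var (W a)) =
      wrel a + Var (W (a + 1)) * ((etaR p (vg a) (tg (a + 1)) 2 - Var (V a 2)) - eta a 2)"
      by (simp add: vgen_2 algebra_simps)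
    also have "\<dots> \<in> Jid SB"
      by (intro J.iadd J.imult J.idiff gen_mem_J Var_RZ etaR_2_J V1B \<open>eta a 2 \<in> SB\<close>) (use wr in \<open>auto simp: SB_def\<close>)
    finally show "wrel (a + 1) - Var (V a 2) * (Var (W (a + 1)) + - Var (W a)) \<in> Jid SB" .
    show "Var (W a) * Var (V a 2) - 1 \<in> Jid SB" by (rule gen_mem_J) (use wr in \<open>auto simp: SB_def\<close>)
    show "W (a + 1) \<notin> UB" by (auto simp: UB_def U2_def U1_def U0_def)
  qed (auto simp: Var_RZ intro!: RZ.mems)
  from tower_ext[OF tB this] have "tower {wrel 0} (U0 s) (insert (wrel (a + 1)) SB) (insert (W (a + 1)) UB)" .
  moreover have "S2 s (Suc a) = insert (wrel (a + 1)) SB"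
    by (auto simp: S2_def SB_def less_Suc_eq le_Suc_eq)
  moreover have "U2 s (Suc a) = insert (W (a + 1)) UB"
    by (auto simp: U2_def UB_def less_Suc_eq le_Suc_eq)
  ultimately show ?case by simp
qed

text \<open>The index is chosen so that \<open>N + n + 1\<close> exceeds \<open>r + n + 1\<close> by
  2: the right unit relation is then \<open>v_2 t^(p^2)\<close> plus terms of degree at most 1 in
  \<open>t = t_(r+n+1)\<close>, and \<open>v_2\<close> is invertible. This is the source of the
  degree \<open>p^2\<close>.\<close>

lemma monic_ext_S3:
  assumes a: "a < s" and S: "S2 s s \<subseteq> S" and U: "U3 s n \<subseteq> U" and x: "T (a + 1) (r + n + 1) \<notin> U"
  shows "monic_ext S U (T (a + 1) (r + n + 1)) (eta a (N + n + 1)) (p\<^sup>2)"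
proof -
  let ?k = "N + n + 1" and ?x = "T (a + 1) (r + n + 1)"
  have k: "?k \<ge> 3" "?k - 2 = r + n + 1" "?k - 3 = r + n" using N_eq by auto
  have tk: "tg (a + 1) (?k - 2) = Var ?x" unfolding k by (simp add: tgen_def)
  have V1: "Var (V a 1) \<in> Jid S" by (rule V1_J[of s]) (use a S in \<open>auto simp: S2_def\<close>)
  obtain q where q: "q \<in> polys (Zp p) (P_gens a (r + n))" "etaR p (vg a) (tg (a + 1)) ?k -
      (Var (V a 2) * Var ?x ^ (p\<^sup>2) - Var (V a 2) ^ (p ^ (?k - 2)) * Var ?x + q) \<in> Jid S"
    using etaR_mod_p_J[OF V1 k(1)] unfolding tk k(3) by blast
  have Va: "V a k \<in> U2 s s" if "2 \<le> k" "k \<le> N" for k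
  proof (cases "a = 0")
    case True
    then have "k = 2 \<or> k = 3" using that N_eq r_le_1 by linarith
    then show ?thesis using True by (auto simp: U2_def U1_def U0_def)
  qed (use that a in \<open>auto simp: U2_def\<close>)
  have Wa: "W a \<in> U2 s s" using a by (cases "a = 0") (auto simp: U2_def U1_def U0_def)
  have "wrel a \<in> S2 s s" using a by (cases "a = 0") (auto simp: S2_def S1_def)
  then have wr: "wrel a \<in> S" using S by blast
  have "P_gens a (r + n) \<subseteq> U3 s n" using Va a by (auto simp: P_gens_def U3_def)
  then have qU: "q \<in> polys (Zp p) U" using q(1) U polys_mono[OF order_refl] by blast
  have sub: "U2 s s \<subseteq> U" using U by (auto simp: U3_def)
  define c where "c = Var (W a) * Var (V a 2) ^ (p ^ (?k - 2))"
  define c' where "c' = Var (W a) * q"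
  interpret P: subring_on "polys (Zp p) U" by (rule subring_polys[OF Zp.subring_on_axioms])
  interpret P': subring_on "polys (Zp p) (insert ?x U)" by (rule subring_polys[OF Zp.subring_on_axioms])
  have VU: "V a 2 \<in> U" "W a \<in> U" using sub Va Wa N_ge by auto
  have cU: "c \<in> polys (Zp p) U" "c' \<in> polys (Zp p) U"
    unfolding c_def c'_def by (intro P.mems Zp_Var VU qU)+
  have UU: "polys (Zp p) U \<subseteq> polys (Zp p) (insert ?x U)" by (rule polys_mono) auto
  have xx: "Var ?x \<in> polys (Zp p) (insert ?x U)" by (rule Zp_Var) simp
  have qp: "c' - c * Var ?x \<in> polys (Zp p) (insert ?x U)"
    using cU UU by (intro P'.mems xx) auto
  have "coeffs_in ?x (c' - c * Var ?x) = [:c', - c:]"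
    unfolding coeffs_in.hom_diff coeffs_in.hom_mult coeffs_in_free[OF cU(1) x] coeffs_in_free[OF cU(2) x]
    by (simp add: coeffs_in_Var)
  then have "degree (coeffs_in ?x (c' - c * Var ?x)) \<le> 1" by simp
  also have "1 < p\<^sup>2" using one_less_power[OF p_gt_1, of 2] by simp
  finally have deg: "degree (coeffs_in ?x (c' - c * Var ?x)) < p\<^sup>2" .
  have v0: "vg (a + 1) ?k = 0" by (simp add: vgen_def)
  have "eta a ?k - Var (V a 2) * (Var ?x ^ (p\<^sup>2) + (c' - c * Var ?x)) =
    (etaR p (vg a) (tg (a + 1)) ?k - (Var (V a 2) * Var ?x ^ (p\<^sup>2) - Var (V a 2) ^ (p ^ (?k - 2)) * Var ?x + q))
     - (q - Var (V a 2) ^ (p ^ (?k - 2)) * Var ?x) * wrel a"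
    unfolding v0 c_def c'_def by (simp add: algebra_simps)
  also have "\<dots> \<in> Jid S"
    by (intro J.idiff J.imult q(2) gen_mem_J wr RZ.mems Var_RZ polys_RZ[OF qU])
  finally have main: "eta a ?k - Var (V a 2) * (Var ?x ^ (p\<^sup>2) + (c' - c * Var ?x)) \<in> Jid S" .
  have "1 \<le> p\<^sup>2" using p_gt_0 by simp
  show ?thesis
    unfolding monic_ext_def
  proof (intro conjI exI)
    show "eta a ?k \<in> RZ" by (rule eta_RZ) simp
    show "1 \<le> p\<^sup>2" by fact
    show "Var (W a) * Var (V a 2) - 1 \<in> Jid S" by (rule gen_mem_J[OF wr])
  qed (fact x qp deg main Var_RZ)+
qed

lemma tower_S3_step: "tower (S3 s n) (U3 s n) (S3 s (Suc n)) (U3 s (Suc n))"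
proof -
  let ?k = "N + n + 1"
  define SA where "SA a = S3 s n \<union> {eta i ?k |i. i < a}" for a
  define UA where "UA a = U3 s n \<union> {T (i + 1) (r + n + 1) |i. i < a}" for a
  have t: "tower (S3 s n) (U3 s n) (SA a) (UA a)" if "a \<le> s" for a
    using that
  proof (induction a)
    case 0
    then show ?case by (simp add: SA_def UA_def tower_base)
  next
    case (Suc a)
    have m: "monic_ext (SA a) (UA a) (T (a + 1) (r + n + 1)) (eta a ?k) (p\<^sup>2)"
    proof (rule monic_ext_S3[of _ s])
      show "T (a + 1) (r + n + 1) \<notin> UA a"
        using Suc.prems by (auto simp: UA_def U3_def U2_def U1_def U0_def)
    qed (use Suc.prems in \<open>auto simp: SA_def UA_def S3_def\<close>)
    have e: "insert (eta a ?k) (SA a) = SA (Suc a)" "insert (T (a + 1) (r + n + 1)) (UA a) = UA (Suc a)"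
      unfolding SA_def UA_def by (auto simp: less_Suc_eq)
    have "tower (S3 s n) (U3 s n) (SA a) (UA a)" by (rule Suc.IH) (use Suc.prems in simp)
    from tower_ext[OF this m] show ?case unfolding e .
  qed
  have eS: "SA s = S3 s (Suc n)"
  proof -
    have "N < k \<and> k \<le> N + Suc n \<longleftrightarrow> N < k \<and> k \<le> N + n \<or> k = ?k" for k by auto
    then show ?thesis unfolding SA_def S3_def by blast
  qed
  have eU: "UA s = U3 s (Suc n)"
  proof -
    have "r < k \<and> k \<le> r + Suc n \<longleftrightarrow> r < k \<and> k \<le> r + n \<or> k = r + n + 1" for k by auto
    then show ?thesis unfolding UA_def U3_def by blast
  qed
  from t[OF order_refl] show ?thesis unfolding eS eU .
qed

lemma tower_S3: "tower {wrel 0} (U0 s) (S3 s n) (U3 s n)"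
proof (induction n)
  case 0
  have "S3 s 0 = S2 s s" "U3 s 0 = U2 s s" by (auto simp: S3_def U3_def)
  then show ?case using tower_S2[of s s] by simp
next
  case (Suc n)
  show ?case by (rule tower_trans[OF tower_S3_step Suc])
qed

lemma good_S0: "good {wrel 0} (U0 s)"
  by (rule good_base) (auto simp: U0_def)

lemma good_S3: "good (S3 s n) (U3 s n)"
  by (rule tower_good[OF tower_S3 good_S0])

lemma rel_UN: "rel s = (\<Union>n. S3 s n)"
proof (intro equalityI subsetI)
  fix x assume "x \<in> rel s"
  then show "x \<in> (\<Union>n. S3 s n)"
  proof (cases x s rule: rel_cases)
    case (W i)
    then have "x \<in> S3 s 0" by (cases "i = 0") (auto simp: S3_def S2_def S1_def)
    then show ?thesis by blast
  next
    case (eta i k)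
    consider "k = 1" | "2 \<le> k" "k \<le> N" | "N < k" using eta(2) by linarith
    then show ?thesis
    proof cases
      case 1
      then have "x \<in> S3 s 0" using eta by (auto simp: S3_def S2_def S1_def)
      then show ?thesis by blast
    next
      case 2
      then have "x \<in> S3 s 0" using eta by (auto simp: S3_def S2_def)
      then show ?thesis by blast
    next
      case 3
      then have "k \<le> N + (k - N)" by simp
      then have "x \<in> S3 s (k - N)" using 3 eta unfolding S3_def by blast
      then show ?thesis by blast
    qed
  next
    case M
    then have "x \<in> S3 s 0" by (auto simp: S3_def S2_def S1_def)
    then show ?thesis by blast
  qed
next
  fix x assume "x \<in> (\<Union>n. S3 s n)"
  then obtain n where "x \<in> S3 s n" by blast
  then show "x \<in> rel s"
    unfolding S3_def S2_def S1_def using N_ge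
    by (auto intro: rel_eta[simplified] rel_W rel_W[of 0, simplified] rel_M[simplified])
qed

lemma S3_mono: "n \<le> n' \<Longrightarrow> S3 s n \<subseteq> S3 s n'"
proof -
  assume "n \<le> n'"
  then have "k \<le> N + n \<Longrightarrow> k \<le> N + n'" for k by simp
  then show ?thesis unfolding S3_def by blast
qed

lemma U3_mono: "n \<le> n' \<Longrightarrow> U3 s n \<subseteq> U3 s n'"
  by (auto simp: U3_def)

lemma incseq_S3: "incseq (S3 s)"
  by (rule monoI) (rule S3_mono)

lemma IZ_Iid: "IZ s = Iid (rel s)"
  by (simp add: IZ_def Iid_def)

lemma IZ_torsion_free: "y \<in> RZ \<Longrightarrow> cst (of_nat p) * y \<in> IZ s \<Longrightarrow> y \<in> IZ s"
proof -
  assume y: "y \<in> RZ" "cst (of_nat p) * y \<in> IZ s"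
  then obtain n where "cst (of_nat p) * y \<in> Iid (S3 s n)"
    using ideal_of_UN[OF incseq_S3] unfolding IZ_def rel_UN Iid_def by blast
  then have "y \<in> Iid (S3 s n)" using good_S3 y(1) unfolding good_def by blast
  then show "y \<in> IZ s" unfolding IZ_Iid using I_mono[of "S3 s n" "rel s"] rel_UN by blast
qed

text \<open>The bridge from rational to integral statements: congruences between integral cochains
  may be checked after inverting \<open>p\<close>.\<close>

lemma IQ_RZ: "f \<in> RZ \<Longrightarrow> f \<in> IQ s \<Longrightarrow> f \<in> IZ s"
  unfolding IZ_Iid IQ_def
  by (rule torsion_free_rational) (use IZ_torsion_free in \<open>auto simp: IZ_Iid\<close>)

lemma IZ_divide: "f \<in> RZ \<Longrightarrow> cst (of_nat p ^ n) * f \<in> IZ s \<Longrightarrow> f \<in> IZ s"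
proof (induction n)
  case (Suc n)
  then have "cst (of_nat p) * (cst (of_nat p ^ n) * f) \<in> IZ s" by (simp add: cst.hom_mult mult.assoc)
  moreover have "cst (of_nat p ^ n) * f \<in> RZ" by (intro RZ.mult_mem cst_RZ Zp.mems Suc)
  ultimately show ?case using IZ_torsion_free Suc by blast
qed (simp add: cst.hom_one)

definition JZ :: "nat \<Rightarrow> pol set" where "JZ s = Jid (rel s)"

text \<open>Only finitely many relations are involved, so \<open>y\<close> vanishes at some stage
  \<open>k\<close>. Since \<open>y\<close> contains no variable adjoined after stage
  \<open>n\<close>, it already vanishes at stage \<open>n\<close>.\<close>

lemma JZ_S3:
  assumes "y \<in> JZ s" "y \<in> polys (Zp p) (U3 s n)" shows "y \<in> Jid (S3 s n)"
proof -
  have "incseq (\<lambda>n. insert (cst (of_nat p)) (S3 s n))"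
    using incseq_S3 by (auto simp: incseq_def)
  moreover have "y \<in> ideal_of RZ (\<Union>n. insert (cst (of_nat p)) (S3 s n))"
    using assms(1) unfolding JZ_def Jid_def rel_UN by simp
  ultimately obtain k where k: "y \<in> Jid (S3 s k)" unfolding Jid_def using ideal_of_UN by blast
  have step: "y \<in> Jid (S3 s (Suc k)) \<Longrightarrow> y \<in> Jid (S3 s k)" if "n \<le> k" for k
  proof -
    assume yk: "y \<in> Jid (S3 s (Suc k))"
    show "y \<in> Jid (S3 s k)"
      by (rule tower_detect[OF tower_S3_step good_S3 yk])
        (use assms(2) polys_mono[OF order_refl U3_mono[OF that]] in blast)
  qed
  have "y \<in> Jid (S3 s (n + l)) \<Longrightarrow> y \<in> Jid (S3 s n)" for l
    by (induction l) (auto dest: step[rotated])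
  moreover have "y \<in> Jid (S3 s (n + k))" using k J_mono[OF S3_mono[of k "n + k"]] by auto
  ultimately show ?thesis by blast
qed

text \<open>Over the preceding stage the ring is free on \<open>1, x, ..., x^(p^2-1)\<close> for
  \<open>x = t_(r+n+1)\<close>. This is the device by which coefficients of \<open>t_1\<close>,
  \<open>t_2\<close> and \<open>t_3\<close> are compared.\<close>

lemma S3_1_coeff:
  assumes "y \<in> Jid (S3 1 (Suc n))" "degree (coeffs_in (T 1 (r + n + 1)) y) < p\<^sup>2"
  shows "coeff (coeffs_in (T 1 (r + n + 1)) y) i \<in> Jid (S3 1 n)"
proof -
  let ?x = "T 1 (r + n + 1)"
  have x: "?x \<notin> U3 1 n" by (auto simp: U3_def U2_def U1_def U0_def)
  have m: "monic_ext (S3 1 n) (U3 1 n) ?x (eta 0 (N + n + 1)) (p\<^sup>2)"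
    using monic_ext_S3[of 0 1 "S3 1 n" n "U3 1 n"] x by (auto simp: S3_def)
  have cl: "coeff_closed ?x (Jid (S3 1 n))" using good_S3 x unfolding good_def by blast
  have "N < k \<and> k \<le> N + Suc n \<longleftrightarrow> N < k \<and> k \<le> N + n \<or> k = N + n + 1" for k by auto
  then have "S3 1 (Suc n) = insert (eta 0 (N + n + 1)) (S3 1 n)" unfolding S3_def by auto
  then have "y \<in> Jid (S3 1 n)" using monic_ext_detect[OF m cl] assms by simp
  then show ?thesis using cl by (simp add: coeff_closed_def)
qed

lemma S3_detect: "y \<in> Jid (S3 s n) \<Longrightarrow> y \<in> polys (Zp p) (U0 s) \<Longrightarrow> y \<in> Jid {wrel 0}"
  by (rule tower_detect[OF tower_S3 good_S0])

end

section \<open>Monomial bases\<close>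

lemma less_power_3: "k \<ge> 2 \<Longrightarrow> k < 3 ^ (k - 1)" for k :: nat
  by (induction k rule: dec_induct) (auto simp: power_eq_if)

context prime_local begin

text \<open>The valuation of \<open>k\<close> is at most \<open>k - 2\<close>, because
  \<open>p^n\<close> dividing \<open>k\<close> gives \<open>3^n \<le> k < 3^(k-1)\<close>. For
  \<open>p = 2\<close> it fails at \<open>k = 2\<close>.\<close>

lemma Zp_p_power_div:
  assumes "odd p" "k \<ge> 2" shows "of_nat p ^ (k - 2) / of_nat k \<in> Zp p"
proof -
  have p3: "p \<ge> 3" using assms(1) p_gt_1 by (cases "p = 2") auto
  define n where "n = multiplicity p k"
  have np: "\<not> is_unit p" using p_gt_1 by auto
  obtain k' where k': "k = p ^ n * k'" "\<not> p dvd k'"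
    using multiplicity_decompose'[of k p] np assms(2) unfolding n_def by auto
  have "k' > 0" using k' by (cases k') auto
  then have "p ^ n \<le> k" unfolding k'(1) by simp
  moreover have "3 ^ n \<le> p ^ n" using p3 by (rule power_mono) simp
  ultimately have "3 ^ n \<le> k" by linarith
  also have "k < 3 ^ (k - 1)" using assms(2) by (rule less_power_3)
  finally have "n < k - 1" by simp
  then have e: "k - 2 = (k - 2 - n) + n" by simp
  have "of_nat p ^ (k - 2) / of_nat k = (of_nat p ^ (k - 2 - n) * of_nat p ^ n / (of_nat p ^ n * of_nat k') :: rat)"
    by (subst e) (simp add: power_add k'(1))
  also have "\<dots> = of_int (int p ^ (k - 2 - n)) / of_int (int k')" using p_gt_0 by simp
  also have "\<dots> \<in> Zp p" using k'(2) unfolding Zp_iff by (intro exI[of _ "int p ^ (k - 2 - n)"] exI[of _ "int k'"]) simp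
  finally show ?thesis .
qed

text \<open>A derivative formula that keeps the full factor \<open>n p\<close>: from the second
  order on, the binomial terms are divisible by \<open>n p^2\<close>.\<close>

lemma power_add_p_multiple:
  assumes "odd p" "x \<in> polys (Zp p) H" "\<tau> \<in> polys (Zp p) H"
  shows "\<exists>\<rho>\<in>polys (Zp p) H. (x + cst (of_nat p) * \<tau>) ^ n =
    x ^ n + cst (of_nat n * of_nat p) * (\<tau> * x ^ (n - 1) + cst (of_nat p) * \<rho>)"
proof (cases "n = 0")
  case True
  then show ?thesis using assms(2) by (auto simp: cst.hom_zero)
next
  case False
  interpret P: subring_on "polys (Zp p) H" by (rule subring_polys[OF Zp.subring_on_axioms])
  \<comment> \<open>From \<open>k * (n choose k) = n * ((n - 1) choose (k - 1))\<close>, the number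
    \<open>(n choose k) * p^k\<close> equals \<open>n p^2\<close> times \<open>a k\<close>.\<close>
  define a where "a k = (of_nat ((n - 1) choose (k - 1)) * (of_nat p ^ (k - 2) / of_nat k) :: rat)" for k
  define \<rho> where "\<rho> = (\<Sum>k\<in>{2..n}. cst (a k) * \<tau> ^ k * x ^ (n - k))"
  have "\<rho> \<in> polys (Zp p) H"
    unfolding \<rho>_def a_def
    by (intro P.sum_mem P.mult_mem P.power_mem assms cst_mem_polys Zp.mult_mem Zp.of_nat_mem Zp_p_power_div) auto
  moreover have "(x + cst (of_nat p) * \<tau>) ^ n =
    x ^ n + cst (of_nat n * of_nat p) * (\<tau> * x ^ (n - 1) + cst (of_nat p) * \<rho>)"
  proof -
    have t: "of_nat (n choose k) * (cst (of_nat p) * \<tau>) ^ k * x ^ (n - k) =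
        cst (of_nat n * of_nat p) * (cst (of_nat p) * (cst (a k) * \<tau> ^ k * x ^ (n - k)))" if "k \<in> {2..n}" for k
    proof -
      have k: "k > 0" "k = (k - 2) + 2" using that by auto
      have "(of_nat k * of_nat (n choose k) :: rat) = of_nat n * of_nat ((n - 1) choose (k - 1))"
        unfolding of_nat_mult[symmetric] by (simp only: times_binomial_minus1_eq[OF k(1)])
      then have c: "(of_nat (n choose k) :: rat) = of_nat n * of_nat ((n - 1) choose (k - 1)) / of_nat k"
        using k(1) by (simp add: field_simps)
      have "of_nat (n choose k) * of_nat p ^ k = (of_nat n * of_nat p * (of_nat p * a k) :: rat)"
        unfolding c a_def by (subst (2) k(2)) (simp add: power2_eq_square power_add)
      then have "cst (of_nat (n choose k) * of_nat p ^ k) = cst (of_nat n * of_nat p * (of_nat p * a k))"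
        by (simp only:)
      then show ?thesis
        by (simp add: power_mult_distrib cst.hom_mult cst.hom_power cst.hom_of_nat mult_ac)
    qed
    have "(x + cst (of_nat p) * \<tau>) ^ n = (\<Sum>k\<le>n. of_nat (n choose k) * (cst (of_nat p) * \<tau>) ^ k * x ^ (n - k))"
      by (subst add.commute) (rule binomial_ring)
    also have "{..n} = insert 0 (insert 1 {2..n})" using False by auto
    also have "(\<Sum>k\<in>insert 0 (insert 1 {2..n}). of_nat (n choose k) * (cst (of_nat p) * \<tau>) ^ k * x ^ (n - k)) =
      x ^ n + (of_nat n * (cst (of_nat p) * \<tau>) * x ^ (n - 1) +
        (\<Sum>k\<in>{2..n}. of_nat (n choose k) * (cst (of_nat p) * \<tau>) ^ k * x ^ (n - k)))"
      by simp
    also have "(\<Sum>k\<in>{2..n}. of_nat (n choose k) * (cst (of_nat p) * \<tau>) ^ k * x ^ (n - k)) =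
       cst (of_nat n * of_nat p) * (cst (of_nat p) * \<rho>)"
      unfolding \<rho>_def sum_distrib_left by (rule sum.cong[OF refl t])
    finally show ?thesis by (simp add: cst.hom_mult cst.hom_of_nat algebra_simps)
  qed
  ultimately show ?thesis by blast
qed

lemma expo_exists:
  assumes "(a, b) \<noteq> (0, 0)"
  shows "\<exists>k a' b'. expo p a b = Suc k \<and> a = int p ^ k * a' \<and> b = p ^ k * b' \<and> \<not> (int p dvd a' \<and> p dvd b')"
proof -
  have np: "\<not> is_unit (int p)" using p_gt_1 by auto
  define A where "A = multiplicity (int p) a"
  define C where "C = multiplicity (int p) (int b)"
  have dec: "\<exists>x. a = int p ^ multiplicity (int p) a * x \<and> \<not> int p dvd x" if "a \<noteq> 0" for a
    using multiplicity_decompose'[of a "int p"] np that by metis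
  then have da: "\<exists>x. a = int p ^ A * x \<and> \<not> int p dvd x" if "a \<noteq> 0"
    using that by (simp add: A_def)
  have db: "\<exists>x. b = p ^ C * x \<and> \<not> p dvd x" if b: "b \<noteq> 0"
  proof -
    obtain x where x: "int b = int p ^ C * x" "\<not> int p dvd x" using dec[of "int b"] b by (auto simp: C_def)
    have "int p ^ C > 0" using p_gt_0 by simp
    moreover have "0 < int p ^ C * x" using x(1) b by simp
    ultimately have "x > 0" by (simp add: zero_less_mult_iff)
    then obtain n where n: "x = int n" using zero_less_imp_eq_int by blast
    have "int b = int (p ^ C * n)" using x(1) n by simp
    then have "b = p ^ C * n" by (simp only: of_nat_eq_iff)
    moreover have "\<not> p dvd n" using x(2) n by simp
    ultimately show ?thesis by blast
  qed
  consider "a = 0" "b \<noteq> 0" | "a \<noteq> 0" "b = 0" | "a \<noteq> 0" "b \<noteq> 0" using assms by auto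
  then show ?thesis
  proof cases
    case 1
    then have "expo p a b = Suc C" by (simp add: expo_def nu_def C_def one_enat_def)
    moreover obtain x where "b = p ^ C * x" "\<not> p dvd x" using db[OF 1(2)] by blast
    ultimately show ?thesis using 1 by (intro exI[of _ C] exI[of _ 0] exI[of _ x]) simp
  next
    case 2
    then have "expo p a b = Suc A" by (simp add: expo_def nu_def A_def one_enat_def)
    moreover obtain x where "a = int p ^ A * x" "\<not> int p dvd x" using da[OF 2(1)] by blast
    ultimately show ?thesis using 2 by (intro exI[of _ A] exI[of _ x] exI[of _ 0]) auto
  next
    case 3
    then have e: "expo p a b = Suc (min A C)" by (simp add: expo_def nu_def A_def C_def one_enat_def)
    obtain x y where xy: "a = int p ^ A * x" "\<not> int p dvd x" "b = p ^ C * y" "\<not> p dvd y"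
      using da[OF 3(1)] db[OF 3(2)] by blast
    show ?thesis
    proof (cases "A \<le> C")
      case True
      then have "b = p ^ A * (p ^ (C - A) * y)" using xy(3) by (simp add: power_add[symmetric] mult.assoc[symmetric])
      then show ?thesis using e True xy by (intro exI[of _ A] exI[of _ x] exI[of _ "p ^ (C - A) * y"]) auto
    next
      case False
      then have "a = int p ^ C * (int p ^ (A - C) * x)" using xy(1) by (simp add: power_add[symmetric] mult.assoc[symmetric])
      then show ?thesis using e False xy by (intro exI[of _ C] exI[of _ "int p ^ (A - C) * x"] exI[of _ y]) auto
    qed
  qed
qed

end

section \<open>Independence tests over Laurent polynomials in v_2\<close>

type_synonym laurent = "int \<Rightarrow>\<^sub>0 rat"

text \<open>\<open>lau a c\<close> stands for \<open>c * v_2^a\<close>.\<close>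

definition lau :: "int \<Rightarrow> rat \<Rightarrow> laurent" where "lau = Poly_Mapping.single"

lemma lau_mult: "lau a c * lau b d = lau (a + b) (c * d)"
  by (simp add: lau_def mult_single)

lemma lau_one: "lau 0 1 = 1" by (simp add: lau_def)

lemma lau_power: "lau a 1 ^ n = lau (int n * a) 1"
  by (induction n) (auto simp: lau_one lau_mult algebra_simps)

lemma lau_lookup: "Poly_Mapping.lookup (lau a c) b = (if a = b then c else 0)"
  by (simp add: lau_def lookup_single when_def)

lemma lau_const_hom: "ring_hom_on (\<lambda>c. [:lau 0 c:])"
  by standard (auto simp: lau_def single_add mult_single one_pCons mult.commute)

context prime_local begin

definition LZ1 :: "laurent set" where "LZ1 = {l. \<forall>a. Poly_Mapping.lookup l a \<in> Zp p}"
definition LZ :: "laurent poly set" where "LZ = {f. \<forall>i. coeff f i \<in> LZ1}"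

lemma lau_LZ1: "c \<in> Zp p \<Longrightarrow> lau a c \<in> LZ1"
  by (simp add: LZ1_def lau_lookup Zp.zero_mem)

lemma subring_LZ1: "subring_on LZ1"
proof
  show "1 \<in> LZ1" using lau_LZ1[OF Zp.one_mem, of 0] by (simp add: lau_one)
  show "x - y \<in> LZ1" if "x \<in> LZ1" "y \<in> LZ1" for x y
    using that by (simp add: LZ1_def lookup_minus Zp.diff_mem)
  have sum: "sum f A \<in> LZ1" if "\<And>a. a \<in> A \<Longrightarrow> f a \<in> LZ1" for f :: "int \<Rightarrow> laurent" and A
    using that by (simp add: LZ1_def lookup_sum Zp.sum_mem)
  show "x * y \<in> LZ1" if xy: "x \<in> LZ1" "y \<in> LZ1" for x y
  proof -
    have "x * y = (\<Sum>a\<in>Poly_Mapping.keys x. \<Sum>b\<in>Poly_Mapping.keys y.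
        lau (a + b) (Poly_Mapping.lookup x a * Poly_Mapping.lookup y b))"
      by (subst pol_single_sum[of x], subst pol_single_sum[of y]) (simp add: sum_product mult_single lau_def)
    also have "\<dots> \<in> LZ1"
      by (intro sum lau_LZ1 Zp.mult_mem) (use xy in \<open>auto simp: LZ1_def\<close>)
    finally show ?thesis .
  qed
qed

sublocale LZ1: subring_on LZ1 by (rule subring_LZ1)

sublocale LZ: subring_on LZ
  unfolding LZ_def by (rule subring_poly[OF subring_LZ1])

text \<open>The leading coefficient of \<open>\<Omega>\<close> is the unit \<open>v_2^n0\<close>.
  The coefficient in degree \<open>n * degree \<Omega>\<close> thus isolates the top
  \<open>C n\<close>, and induction removes it.\<close>

lemma coeff_independent:
  assumes \<Omega>: "\<Omega> \<in> LZ" "degree \<Omega> \<ge> 1" "lead_coeff \<Omega> = lau n0 1"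
  shows "(\<Sum>b<n. smult (C b) (\<Omega> ^ b)) \<in> LZ \<Longrightarrow> b < n \<Longrightarrow> C b \<in> LZ1"
proof (induction n arbitrary: b)
  case (Suc n)
  have nz: "\<Omega> \<noteq> 0" using \<Omega>(2) by auto
  have "coeff (smult (C b) (\<Omega> ^ b)) (n * degree \<Omega>) = 0" if "b < n" for b
  proof (rule coeff_eq_0)
    have "degree (smult (C b) (\<Omega> ^ b)) \<le> degree (\<Omega> ^ b)" by (rule degree_smult_le)
    also have "\<dots> \<le> degree \<Omega> * b" by (rule degree_power_le)
    also have "\<dots> < n * degree \<Omega>" using that \<Omega>(2) by (simp add: mult.commute)
    finally show "degree (smult (C b) (\<Omega> ^ b)) < n * degree \<Omega>" .
  qed
  then have z: "(\<Sum>b<n. coeff (smult (C b) (\<Omega> ^ b)) (n * degree \<Omega>)) = 0"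
    by (intro sum.neutral) blast
  have "coeff (\<Sum>b<Suc n. smult (C b) (\<Omega> ^ b)) (n * degree \<Omega>) = C n * coeff (\<Omega> ^ n) (n * degree \<Omega>)"
    unfolding sum.lessThan_Suc coeff_add coeff_sum z by simp
  also have "coeff (\<Omega> ^ n) (n * degree \<Omega>) = lead_coeff (\<Omega> ^ n)" by (simp add: degree_power_eq[OF nz])
  also have "\<dots> = lau (int n * n0) 1" by (simp add: lead_coeff_power \<Omega>(3) lau_power)
  finally have e: "coeff (\<Sum>b<Suc n. smult (C b) (\<Omega> ^ b)) (n * degree \<Omega>) = C n * lau (int n * n0) 1" .
  have "C n * lau (int n * n0) 1 \<in> LZ1"
    unfolding e[symmetric] using Suc.prems(1) by (simp only: LZ_def mem_Collect_eq)
  from LZ1.mult_mem[OF this lau_LZ1[OF Zp.one_mem, of "- (int n * n0)"]]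
  have Cn: "C n \<in> LZ1" by (simp add: mult.assoc lau_mult lau_one)
  have "smult (C n) (\<Omega> ^ n) \<in> LZ"
    using LZ.power_mem[OF \<Omega>(1), of n] Cn by (auto simp: LZ_def LZ1.mult_mem)
  from LZ.diff_mem[OF Suc.prems(1) this] have "(\<Sum>b<n. smult (C b) (\<Omega> ^ b)) \<in> LZ" by simp
  then show ?case using Suc.IH Suc.prems(2) Cn by (cases "b = n") auto
qed simp

lemma lau_independent:
  assumes \<Omega>: "\<Omega> \<in> LZ" "degree \<Omega> \<ge> 1" "lead_coeff \<Omega> = lau n0 1"
    and F: "finite F" "(\<Sum>i\<in>F. smult (lau (fst i) (q i)) (\<Omega> ^ snd i)) \<in> LZ" and i: "i \<in> F"
  shows "q i \<in> Zp p"
proof -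
  define C where "C b = (\<Sum>i\<in>{i\<in>F. snd i = b}. lau (fst i) (q i))" for b
  obtain n where n: "\<And>i. i \<in> F \<Longrightarrow> snd i < n"
    using F(1) finite_nat_set_iff_bounded[of "snd ` F"] by auto
  have "(\<Sum>i\<in>F. smult (lau (fst i) (q i)) (\<Omega> ^ snd i)) =
     (\<Sum>b\<in>{..<n}. \<Sum>i\<in>{i\<in>F. snd i = b}. smult (lau (fst i) (q i)) (\<Omega> ^ snd i))"
    by (rule sum.group[symmetric]) (use F n in auto)
  also have "\<dots> = (\<Sum>b<n. smult (C b) (\<Omega> ^ b))"
    by (simp add: C_def smult_sum)
  finally have "(\<Sum>b<n. smult (C b) (\<Omega> ^ b)) \<in> LZ" using F(2) by simp
  from coeff_independent[OF \<Omega> this] n[OF i] have "C (snd i) \<in> LZ1" by blast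
  then have "Poly_Mapping.lookup (C (snd i)) (fst i) \<in> Zp p" by (simp add: LZ1_def)
  also have "Poly_Mapping.lookup (C (snd i)) (fst i) = (\<Sum>j\<in>{j\<in>F. snd j = snd i}. if j = i then q j else 0)"
    unfolding C_def lookup_sum by (intro sum.cong refl) (auto simp: lau_lookup prod_eq_iff)
  also have "\<dots> = q i" using i F(1) by (simp add: sum.delta)
  finally show ?thesis .
qed

text \<open>
  Linear independence over the base is tested by evaluation in \<open>\<rat>[v\<^sub>2\<^sup>\<plusminus>\<^sup>1][y]\<close>; all variables other than
  \<open>y\<close> and the copy of \<open>v\<^sub>1\<close> with value \<open>c\<close> are sent to \<open>0\<close>.
\<close>

definition Phi :: "gen \<Rightarrow> laurent poly \<Rightarrow> pol \<Rightarrow> laurent poly" where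
  "Phi y c = geval (\<lambda>r. [:lau 0 r:]) (\<lambda>g. if g = V 0 2 then [:lau 1 1:] else if g = W 0 then [:lau (- 1) 1:]
     else if g = y then [:0, 1:] else if g = V 0 1 then c else 0)"

sublocale Phi: ring_hom_on "Phi y c" for y c
  unfolding Phi_def by (rule ring_hom_geval[OF lau_const_hom])

lemma Phi_cst [simp]: "Phi y c (cst r) = [:lau 0 r:]"
  unfolding Phi_def by (rule geval_cst[OF lau_const_hom])

lemma Phi_Var: "Phi y c (Var g) = (if g = V 0 2 then [:lau 1 1:] else if g = W 0 then [:lau (- 1) 1:]
     else if g = y then [:0, 1:] else if g = V 0 1 then c else 0)"
  unfolding Phi_def by (rule geval_Var[OF lau_const_hom])

lemma Phi_RZ: "c \<in> LZ \<Longrightarrow> f \<in> RZ \<Longrightarrow> Phi y c f \<in> LZ"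
  unfolding Phi_def RZ_def
  by (rule geval_mem[OF LZ.subring_on_axioms])
    (auto simp: LZ_def coeff_pCons lau_LZ1 Zp.one_mem LZ1.zero_mem LZ1.one_mem split: nat.split)

end

section \<open>Powers of v_2, spanning families and integral cochains\<close>

context cobar begin

definition Pv :: "nat \<Rightarrow> int \<Rightarrow> pol" where
  "Pv i a = (if 0 \<le> a then Var (V i 2) ^ nat a else Var (W i) ^ nat (- a))"

lemma Pv_0 [simp]: "Pv i 0 = 1" by (simp add: Pv_def)

lemma Pv_RZ: "Pv i a \<in> RZ" by (auto simp: Pv_def intro: RZ.power_mem Var_RZ)

lemma Pv_polys: "V i 2 \<in> H \<Longrightarrow> W i \<in> H \<Longrightarrow> Pv i a \<in> polys (Zp p) H"
  using subring_on.power_mem[OF subring_polys[OF Zp.subring_on_axioms]] Zp_Var by (auto simp: Pv_def)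

lemma wrel_IZ: "i \<le> s \<Longrightarrow> wrel i \<in> IZ s"
  by (rule rel_IZ[OF rel_W])

lemma Pv_W: "i \<le> s \<Longrightarrow> IZ.eqv s (Var (W i) * Pv i a) (Pv i (a - 1))"
proof -
  assume i: "i \<le> s"
  have "a = int (Suc (nat (a - 1)))" if "a > 0" using that by simp
  then consider n where "a = int (Suc n)" | "a \<le> 0" by (metis linorder_not_le)
  then show ?thesis
  proof cases
    case (1 n)
    have "Var (W i) * Pv i a - Pv i (a - 1) = Var (V i 2) ^ n * wrel i"
      by (simp add: Pv_def 1 nat_add_distrib algebra_simps)
    then show ?thesis using IZ.imult[OF RZ.power_mem[OF Var_RZ] wrel_IZ[OF i]] by (simp add: IZ.eqv_def)
  next
    case 2
    then have "Var (W i) * Pv i a = Pv i (a - 1)"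
      by (auto simp: Pv_def nat_diff_distrib' Suc_nat_eq_nat_zadd1 power_Suc[symmetric] simp del: power_Suc)
    then show ?thesis by simp
  qed
qed

lemma Pv_V: "i \<le> s \<Longrightarrow> IZ.eqv s (Var (V i 2) * Pv i a) (Pv i (a + 1))"
proof -
  assume i: "i \<le> s"
  have "a = - int (Suc (nat (- a - 1)))" if "a < 0" using that by simp
  then consider n where "a = - int (Suc n)" | "a \<ge> 0" by (metis linorder_not_le)
  then show ?thesis
  proof cases
    case (1 n)
    have "Var (V i 2) * Pv i a - Pv i (a + 1) = Var (W i) ^ n * wrel i"
      by (cases n) (simp_all add: Pv_def 1 nat_add_distrib algebra_simps)
    then show ?thesis using IZ.imult[OF RZ.power_mem[OF Var_RZ] wrel_IZ[OF i]] by (simp add: IZ.eqv_def)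
  next
    case 2
    then have "Var (V i 2) * Pv i a = Pv i (a + 1)"
      by (auto simp: Pv_def nat_add_distrib)
    then show ?thesis by simp
  qed
qed

lemma Phi_Pv: "Phi y c (Pv 0 a) = [:lau a 1:]"
  by (auto simp: Pv_def Phi.hom_power Phi_Var poly_const_pow lau_power)

definition rep :: "nat \<Rightarrow> ('i \<Rightarrow> pol) \<Rightarrow> pol \<Rightarrow> bool" where
  "rep s l f \<longleftrightarrow> (\<exists>F c. finite F \<and> (\<forall>i. c i \<in> Zp p) \<and> f - (\<Sum>i\<in>F. cst (c i) * l i) \<in> IZ s)"

lemma rep_cong: "f - g \<in> IZ s \<Longrightarrow> rep s l g \<Longrightarrow> rep s l f"
proof -
  assume fg: "f - g \<in> IZ s" and "rep s l g"
  then obtain F c where F: "finite F" "\<forall>i. c i \<in> Zp p" "g - (\<Sum>i\<in>F. cst (c i) * l i) \<in> IZ s" by (auto simp: rep_def)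
  from IZ.iadd[OF fg F(3)] have "f - (\<Sum>i\<in>F. cst (c i) * l i) \<in> IZ s" by simp
  with F show ?thesis by (auto simp: rep_def)
qed

lemma rep_zero: "rep s l 0"
  unfolding rep_def by (intro exI[of _ "{}"] exI[of _ "\<lambda>_. 0"]) (auto simp: Zp.zero_mem IZ.izero)

lemma rep_base: "rep s l (l i)"
  unfolding rep_def by (intro exI[of _ "{i}"] exI[of _ "\<lambda>_. 1"]) (auto simp: Zp.one_mem IZ.izero cst.hom_one)

lemma rep_smult: "a \<in> Zp p \<Longrightarrow> rep s l f \<Longrightarrow> rep s l (cst a * f)"
proof -
  assume a: "a \<in> Zp p" and "rep s l f"
  then obtain F c where F: "finite F" "\<forall>i. c i \<in> Zp p" "f - (\<Sum>i\<in>F. cst (c i) * l i) \<in> IZ s" by (auto simp: rep_def)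
  have "cst a * f - (\<Sum>i\<in>F. cst (a * c i) * l i) \<in> IZ s"
    using IZ.imult[OF cst_RZ[OF a] F(3)] by (simp add: sum_distrib_left cst.hom_mult mult.assoc right_diff_distrib)
  with F a show ?thesis by (auto simp: rep_def intro!: exI[of _ F] exI[of _ "\<lambda>i. a * c i"] Zp.mult_mem)
qed

lemma rep_add: "rep s l f \<Longrightarrow> rep s l g \<Longrightarrow> rep s l (f + g)"
proof -
  assume "rep s l f" "rep s l g"
  then obtain F c F' c' where F: "finite F" "\<forall>i. c i \<in> Zp p" "f - (\<Sum>i\<in>F. cst (c i) * l i) \<in> IZ s"
    and F': "finite F'" "\<forall>i. c' i \<in> Zp p" "g - (\<Sum>i\<in>F'. cst (c' i) * l i) \<in> IZ s" by (auto simp: rep_def)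
  define d where "d i = (if i \<in> F then c i else 0) + (if i \<in> F' then c' i else 0)" for i
  have "(\<Sum>i\<in>F. cst (c i) * l i) = (\<Sum>i\<in>F \<union> F'. cst (if i \<in> F then c i else 0) * l i)"
    by (rule sum.mono_neutral_cong_left) (use F F' in \<open>auto simp: cst.hom_zero\<close>)
  moreover have "(\<Sum>i\<in>F'. cst (c' i) * l i) = (\<Sum>i\<in>F \<union> F'. cst (if i \<in> F' then c' i else 0) * l i)"
    by (rule sum.mono_neutral_cong_left) (use F F' in \<open>auto simp: cst.hom_zero\<close>)
  ultimately have eq: "f + g - (\<Sum>i\<in>F \<union> F'. cst (d i) * l i) =
      (f - (\<Sum>i\<in>F. cst (c i) * l i)) + (g - (\<Sum>i\<in>F'. cst (c' i) * l i))"
    by (simp add: d_def cst.hom_add distrib_right sum.distrib)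
  have "f + g - (\<Sum>i\<in>F \<union> F'. cst (d i) * l i) \<in> IZ s" unfolding eq by (rule IZ.iadd[OF F(3) F'(3)])
  moreover have "\<forall>i. d i \<in> Zp p" using F F' by (auto simp: d_def intro: Zp.mems)
  ultimately show ?thesis using F F' unfolding rep_def by blast
qed

lemma rep_sum: "(\<And>a. a \<in> A \<Longrightarrow> rep s l (f a)) \<Longrightarrow> rep s l (sum f A)"
  by (induction A rule: infinite_finite_induct) (auto intro: rep_zero rep_add)

lemma rep_mult:
  assumes "x \<in> RZ" "\<And>i. rep s l (x * l i)" "rep s l h" shows "rep s l (x * h)"
proof -
  obtain F c where F: "finite F" "\<forall>i. c i \<in> Zp p" "h - (\<Sum>i\<in>F. cst (c i) * l i) \<in> IZ s" using assms(3) by (auto simp: rep_def)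
  have "rep s l (\<Sum>i\<in>F. cst (c i) * (x * l i))" using F by (intro rep_sum rep_smult assms) auto
  moreover have "x * h - (\<Sum>i\<in>F. cst (c i) * (x * l i)) \<in> IZ s"
    using IZ.imult[OF assms(1) F(3)] by (simp add: sum_distrib_left right_diff_distrib mult_ac)
  ultimately show ?thesis by (rule rep_cong[rotated])
qed

text \<open>A span that contains 1 and is stable under multiplication by the generators contains
  every polynomial in them.\<close>

lemma rep_all:
  assumes f: "f \<in> polys (Zp p) H" and one: "rep s l 1"
    and gen: "\<And>g i. g \<in> H \<Longrightarrow> rep s l (Var g * l i)"
  shows "rep s l f"
proof -
  have "\<forall>h. rep s l h \<longrightarrow> rep s l (f * h)"
    using Zp.subring_on_axioms f
  proof (induction f rule: polys_gen_induct)
    case (cst c)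
    then show ?case by (auto intro: rep_smult)
  next
    case (Var g)
    then show ?case by (auto intro: rep_mult Var_RZ gen)
  next
    case (add f g)
    then show ?case by (auto simp: distrib_right intro: rep_add)
  next
    case (mult f g)
    then show ?case by (auto simp: mult.assoc)
  qed
  from this[rule_format, OF one] show ?thesis by simp
qed

lemma polys_Zp_RZ: "f \<in> polys UNIV H \<Longrightarrow> f \<in> RZ \<Longrightarrow> f \<in> polys (Zp p) H"
  unfolding RZ_def using polys_Int[of f UNIV H "Zp p" UNIV] by simp

lemma polys_Zp_UNIV: "f \<in> polys (Zp p) H \<Longrightarrow> f \<in> polys UNIV H"
  using polys_mono[of "Zp p" UNIV H H] by blast

lemma cf_polys:
  assumes "f \<in> polys (Zp p) (G s)" "i \<le> s + 1" shows "cf s i f \<in> polys (Zp p) (G (s + 1))"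
proof -
  let ?R = "polys (Zp p) (G (s + 1))"
  interpret R: subring_on ?R by (rule subring_polys[OF Zp.subring_on_axioms])
  interpret Q: subring_on "polys UNIV (G (s + 1))" by (rule subring_polys[OF subring_UNIV])
  note VG = Var_mem_polys[OF Zp.subring_on_axioms]
  have D: "coface_gen p N r m s i (T i k) \<in> ?R" if "1 \<le> i" "T i k \<in> G s" for k
  proof -
    let ?t' = "if i \<le> s then tgen r (i + 1) else mgen m (i + 1)"
    have v: "vg (i - 1) k \<in> polys UNIV (G (s + 1))" for k
      using assms(2) Q.zero_mem by (auto simp: vgen_def intro!: Var_G V_gens)
    have t: "tg i k \<in> polys UNIV (G (s + 1))" for k
      using assms(2) that(1) Q.zero_mem Q.one_mem by (auto simp: tgen_def intro!: Var_G T_gens)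
    have t': "?t' k \<in> polys UNIV (G (s + 1))" for k
    proof (cases "i \<le> s")
      case True
      then show ?thesis using Q.zero_mem Q.one_mem by (auto simp: tgen_def intro!: Var_G T_gens)
    next
      case False
      then have "i = s + 1" using assms(2) by simp
      then show ?thesis using T_gens'[of k "s + 1"] Q.zero_mem Q.one_mem by (auto simp: mgen_def intro!: Var_G)
    qed
    have "Delta p (vg (i - 1)) (tg i) ?t' k \<in> polys UNIV (G (s + 1))"
      by (rule Delta_mem[OF Q.subring_on_axioms cst_mem_polys[OF UNIV_I] v t t'])
    moreover have "Delta p (vg (i - 1)) (tg i) ?t' k \<in> RZ"
      by (rule hazt.Delta_RZ) (auto simp: tg_RZ mg_RZ)
    ultimately show ?thesis by (auto intro: polys_Zp_RZ)
  qed
  show ?thesis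
    unfolding cf_def
  proof (rule subst_mem[OF R.subring_on_axioms assms(1)])
    fix g assume g: "g \<in> G s"
    show "coface_gen p N r m s i g \<in> ?R"
    proof (cases g)
      case (V a k)
      then have "a \<le> s" "1 \<le> k" "k \<le> N" using g by (auto simp: gens_def)
      then show ?thesis using V by (auto intro!: VG V_gens)
    next
      case (W a)
      then have "a \<le> s" using g by (auto simp: gens_def)
      then show ?thesis using W by (auto intro!: VG W_gens)
    next
      case (T a k)
      then have c: "1 \<le> a \<and> a \<le> s \<and> r < k \<or> a = s + 1 \<and> 1 \<le> k \<and> k \<le> m" using g by (auto simp: gens_def)
      consider "a < i" | "a > i" | "a = i" by linarith
      then show ?thesis
      proof cases
        case 1
        then have "T a k \<in> G (s + 1)" using c assms(2) by (auto intro!: T_gens)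
        then show ?thesis using T 1 by (auto intro: VG)
      next
        case 2
        have "T (a + 1) k \<in> G (s + 1)"
          using c T_gens[of "a + 1" "s + 1" k] T_gens'[of k "s + 1"] by auto
        then show ?thesis using T 2 by (auto intro: VG)
      next
        case 3
        then show ?thesis using D[of k] T g c by auto
      qed
    qed
  qed (auto intro: cst_mem_polys)
qed

lemma d_polys: "f \<in> polys (Zp p) (G s) \<Longrightarrow> d s f \<in> polys (Zp p) (G (s + 1))"
proof -
  assume f: "f \<in> polys (Zp p) (G s)"
  interpret R: subring_on "polys (Zp p) (G (s + 1))" by (rule subring_polys[OF Zp.subring_on_axioms])
  show ?thesis unfolding d_eq by (intro R.sum_mem R.mult_mem R.power_mem R.uminus_mem R.one_mem cf_polys f) auto
qed

lemma IQ_cst_cancel: "c \<noteq> 0 \<Longrightarrow> cst c * x \<in> IQ s \<Longrightarrow> x \<in> IQ s"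
  using IQ.imult[of "cst (1 / c)" "cst c * x"]
  by (simp add: mult.assoc[symmetric] cst.hom_mult[symmetric] cst.hom_one)

lemma IZ_J: "x \<in> IZ s \<Longrightarrow> x \<in> JZ s"
  unfolding JZ_def IZ_Iid by (rule I_J)

sublocale JZ: ideal_on RZ "JZ s" for s
  unfolding JZ_def by (rule J.ideal_on_axioms)

lemma p_J: "x \<in> RZ \<Longrightarrow> cst (of_nat p) * x \<in> JZ s"
  unfolding JZ_def using J.imult2[OF _ p_mem_J] by blast

definition ZZ :: "pol set" where "ZZ = {f \<in> polys (Zp p) (G 1). d 1 f \<in> IZ 2}"
definition BB :: "pol set" where
  "BB = {g + d 0 z |g z. g \<in> polys (Zp p) (G 1) \<and> g \<in> IZ 1 \<and> z \<in> polys (Zp p) (G 0)}"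

lemma Ext_1: "Ext p N r m 1 = quot ZZ BB"
proof -
  have "{f \<in> cochains (Zp p) N r m 1. cobar_d p N r m 1 f \<in> null (Zp p) p N r m (1 + 1)} = ZZ"
    using d_polys[of _ 1] by (auto simp: ZZ_def cochains_def null_Zp numeral_2_eq_2)
  moreover have "{g + h |g h. g \<in> null (Zp p) p N r m 1 \<and>
      h \<in> (if (1::nat) = 0 then {0} else cobar_d p N r m (1 - 1) ` cochains (Zp p) N r m (1 - 1))} = BB"
    by (auto simp: BB_def null_Zp cochains_def)
  ultimately show ?thesis unfolding Ext_def cohomology_def by simp
qed

lemma quot_module_1: "quot_module p ZZ BB"
proof -
  interpret P1: subring_on "polys (Zp p) (G (Suc 0))" by (rule subring_polys[OF Zp.subring_on_axioms])
  interpret P0: subring_on "polys (Zp p) (G 0)" by (rule subring_polys[OF Zp.subring_on_axioms])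
  have Z: "Zp_submodule p ZZ"
    by unfold_locales
      (auto simp: ZZ_def prime_p P1.zero_mem IZ.izero d_add[simplified] d_smult[simplified] d_zero[simplified]
        intro: P1.add_mem IZ.iadd P1.mult_mem cst_mem_polys IZ.imult cst_RZ)
  have B: "Zp_submodule p BB"
  proof
    show "0 \<in> BB" unfolding BB_def
      by (rule CollectI, rule exI[of _ 0], rule exI[of _ 0]) (auto intro: P1.zero_mem IZ.izero P0.zero_mem)
    show "x + y \<in> BB" if xy: "x \<in> BB" "y \<in> BB" for x y
    proof -
      obtain g z g' z' where "g \<in> polys (Zp p) (G 1)" "g \<in> IZ 1" "z \<in> polys (Zp p) (G 0)" "x = g + d 0 z"
        "g' \<in> polys (Zp p) (G 1)" "g' \<in> IZ 1" "z' \<in> polys (Zp p) (G 0)" "y = g' + d 0 z'"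
        using xy unfolding BB_def by blast
      then show ?thesis unfolding BB_def
        by (intro CollectI exI[of _ "g + g'"] exI[of _ "z + z'"])
          (auto simp: d_add intro: P1.add_mem IZ.iadd P0.add_mem)
    qed
    show "cst c * x \<in> BB" if cx: "c \<in> Zp p" "x \<in> BB" for c x
    proof -
      obtain g z where "g \<in> polys (Zp p) (G 1)" "g \<in> IZ 1" "z \<in> polys (Zp p) (G 0)" "x = g + d 0 z"
        using cx unfolding BB_def by blast
      then show ?thesis unfolding BB_def using cx
        by (intro CollectI exI[of _ "cst c * g"] exI[of _ "cst c * z"])
          (auto simp: d_smult distrib_left intro: P1.mult_mem IZ.imult P0.mult_mem cst_mem_polys cst_RZ)
    qed
  qed (rule prime_p)
  from Z B show ?thesis by (rule quot_module.intro)
qed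

end

section \<open>Independence of the cocycles modulo \<open>p\<close>\<close>

text \<open>
  Here \<open>\<omega>'\<close> represents the left copy of \<open>\<omega>\<close> modulo \<open>p\<close> in the variables that are not eliminated, and
  \<open>\<Omega>\<close> is the common value of \<open>\<omega>\<close> and \<open>\<omega>'\<close> as a polynomial in the variable \<open>y0\<close>, respectively \<open>y1\<close>.
\<close>

locale cobar_basis = cobar p N r m for p N r m +
  fixes \<omega> \<tau>2 \<tau>3 \<omega>' \<alpha>2 \<alpha>3 :: pol and y0 y1 :: gen and c0 \<Omega> :: "laurent poly" and n0 :: int
  assumes odd_p: "odd p"
    and \<omega>_G: "\<omega> \<in> polys (Zp p) (G 0)"
    and \<tau>2_G: "\<tau>2 \<in> polys (Zp p) (G 1)" and \<tau>3_G: "\<tau>3 \<in> polys (Zp p) (G 1)"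
    and dv: "Var (V 1 2) - Var (V 0 2) - cst (of_nat p) * \<tau>2 \<in> IZ 1"
    and dw: "cf 0 0 \<omega> - cf 0 1 \<omega> - cst (of_nat p) * \<tau>3 \<in> IZ 1"
    and Phi_M: "Phi y0 c0 (mrel 0) = 0" and c0: "c0 \<in> LZ"
    and Phi_\<omega>: "Phi y0 c0 \<omega> = \<Omega>" and \<Omega>: "\<Omega> \<in> LZ" "degree \<Omega> \<ge> 1" "lead_coeff \<Omega> = lau n0 1"
    and \<omega>'_U: "\<omega>' \<in> polys (Zp p) (U0 1)" and \<omega>'_J: "cf 0 1 \<omega> - \<omega>' \<in> JZ 1"
    and Phi_\<omega>': "Phi y1 0 \<omega>' = \<Omega>"
    and \<tau>2_J: "\<tau>2 - (Var (T 1 2) + \<alpha>2) \<in> JZ 1" and \<alpha>2: "\<alpha>2 \<in> polys (Zp p) (U3 1 (1 - r))"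
    and \<tau>3_J: "\<tau>3 - (Var (T 1 3) + \<alpha>3) \<in> JZ 1" and \<alpha>3: "\<alpha>3 \<in> polys (Zp p) (U3 1 (2 - r))"
begin

definition lam :: "int \<times> nat \<Rightarrow> pol" where "lam i = Pv 0 (fst i) * \<omega> ^ snd i"

abbreviation "\<omega>0 \<equiv> cf 0 1 \<omega>"
abbreviation "\<omega>1 \<equiv> cf 0 0 \<omega>"

sublocale P0: subring_on "polys (Zp p) (G 0)" by (rule subring_polys[OF Zp.subring_on_axioms])
sublocale P1: subring_on "polys (Zp p) (G 1)" by (rule subring_polys[OF Zp.subring_on_axioms])

lemma Phi_IQ: "f \<in> IQ 0 \<Longrightarrow> Phi y0 c0 f = 0"
proof -
  assume f: "f \<in> IQ 0"
  have i0: "ideal_on UNIV {0 :: laurent poly}" by unfold_locales auto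
  have "Phi y0 c0 f \<in> {0}"
  proof (rule ideal_of_hom[OF Phi.ring_hom_on_axioms i0 _ _ f[unfolded IQ_def]])
    fix x assume "x \<in> rel 0"
    then show "Phi y0 c0 x \<in> {0}"
      by (cases x "0 :: nat" rule: rel_cases)
        (use Phi_M in \<open>auto simp: Phi.hom_simps Phi_Var lau_mult lau_one one_pCons\<close>)
  qed auto
  then show ?thesis by simp
qed

lemma Pv0_G: "Pv 0 a \<in> polys (Zp p) (G 0)"
  using N_ge by (intro Pv_polys V_gens W_gens) auto

lemma Pv1_G: "i \<le> 1 \<Longrightarrow> Pv i a \<in> polys (Zp p) (G 1)"
  using N_ge by (intro Pv_polys V_gens W_gens) auto

lemma lam_G: "lam i \<in> polys (Zp p) (G 0)"
  unfolding lam_def by (intro P0.mult_mem P0.power_mem Pv0_G \<omega>_G)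

lemma lam_0 [simp]: "lam (0, 0) = 1"
  by (simp add: lam_def)

lemma smult_sum_right: "smult c (sum f A) = (\<Sum>a\<in>A. smult c (f a))"
  by (induction A rule: infinite_finite_induct) (auto simp: smult_add_right)

lemma smult_lau_sum:
  "(\<Sum>i\<in>F. [:lau 0 (q i):] * ([:lau (fst i) 1:] * \<Omega> ^ snd i)) = (\<Sum>i\<in>F. smult (lau (fst i) (q i)) (\<Omega> ^ snd i))"
  by (intro sum.cong[OF HOL.refl]) (simp add: lau_mult)

text \<open>The coefficients may have denominators a priori. \<open>Phi\<close> respects the degree
  0 relations and turns the \<open>lam i\<close> into monomials \<open>v_2^a \<Omega>^b\<close>,
  whose integral combinations have integral coefficients: the \<open>lam i\<close> span a
  \<open>p\<close>-pure submodule.\<close>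

lemma lam_independent:
  assumes F: "finite F" "(\<Sum>i\<in>F. cst (q i) * lam i) - z \<in> IQ 0" "z \<in> RZ" "i \<in> F"
  shows "q i \<in> Zp p"
proof (rule lau_independent[OF \<Omega> F(1) _ F(4)])
  have "Phi y0 c0 (\<Sum>i\<in>F. cst (q i) * lam i) = Phi y0 c0 z"
    using Phi_IQ[OF F(2)] by (simp add: Phi.hom_diff)
  also have "\<dots> \<in> LZ" by (rule Phi_RZ[OF c0 F(3)])
  also have "Phi y0 c0 (\<Sum>i\<in>F. cst (q i) * lam i) =
      (\<Sum>i\<in>F. [:lau 0 (q i):] * ([:lau (fst i) 1:] * \<Omega> ^ snd i))"
    by (simp only: Phi.hom_sum Phi.hom_mult Phi_cst lam_def Phi_Pv Phi.hom_power Phi_\<omega>)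
  finally show "(\<Sum>i\<in>F. smult (lau (fst i) (q i)) (\<Omega> ^ snd i)) \<in> LZ"
    unfolding smult_lau_sum .
qed

definition lc' :: "(int \<times> nat) set \<Rightarrow> (int \<times> nat \<Rightarrow> rat) \<Rightarrow> pol \<Rightarrow> pol" where
  "lc' F \<beta> w = (\<Sum>i\<in>F. cst (\<beta> i) * (Pv 0 (fst i) * w ^ snd i))"

text \<open>Modulo \<open>p\<close> the combination vanishes in the base ring; its evaluation is
  \<open>p\<close> times an integral polynomial, and dividing by \<open>p\<close> brings it under
  \<open>lau_independent\<close>.\<close>

lemma lc'_base_detect:
  assumes F: "finite F" "i \<in> F" "lc' F \<beta> \<omega>' \<in> Jid {wrel 0}"
  shows "\<beta> i / of_nat p \<in> Zp p"
proof (rule lau_independent[OF \<Omega> F(1) _ F(2)])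
  obtain g c where g: "g \<in> Iid {wrel 0}" "c \<in> RZ" "lc' F \<beta> \<omega>' = g + cst (of_nat p) * c"
    using J_decomp[OF F(3)] by blast
  have i0: "ideal_on UNIV {0 :: laurent poly}" by unfold_locales auto
  have "Phi y1 0 g \<in> {0}"
    by (rule ideal_of_hom[OF Phi.ring_hom_on_axioms i0 _ _ g(1)[unfolded Iid_def]])
      (auto simp: Phi.hom_simps Phi_Var lau_mult lau_one one_pCons)
  then have e: "Phi y1 0 (lc' F \<beta> \<omega>') = [:lau 0 (of_nat p):] * Phi y1 0 c"
    by (simp add: g(3) Phi.hom_add Phi.hom_mult)
  have "Phi y1 0 (lc' F \<beta> \<omega>') = (\<Sum>i\<in>F. [:lau 0 (\<beta> i):] * ([:lau (fst i) 1:] * \<Omega> ^ snd i))"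
    by (simp only: lc'_def Phi.hom_sum Phi.hom_mult Phi_cst Phi_Pv Phi.hom_power Phi_\<omega>')
  also have "\<dots> = (\<Sum>i\<in>F. smult (lau (fst i) (\<beta> i)) (\<Omega> ^ snd i))" by (rule smult_lau_sum)
  finally have S: "(\<Sum>i\<in>F. smult (lau (fst i) (\<beta> i)) (\<Omega> ^ snd i)) = smult (lau 0 (of_nat p)) (Phi y1 0 c)"
    using e by simp
  have "smult (lau 0 (1 / of_nat p)) (\<Sum>i\<in>F. smult (lau (fst i) (\<beta> i)) (\<Omega> ^ snd i)) = Phi y1 0 c"
    unfolding S using p_gt_0 by (simp add: lau_mult lau_one)
  moreover have "smult (lau 0 (1 / of_nat p)) (\<Sum>i\<in>F. smult (lau (fst i) (\<beta> i)) (\<Omega> ^ snd i)) =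
      (\<Sum>i\<in>F. smult (lau (fst i) (\<beta> i / of_nat p)) (\<Omega> ^ snd i))"
    by (simp add: smult_sum_right lau_mult)
  ultimately show "(\<Sum>i\<in>F. smult (lau (fst i) (\<beta> i / of_nat p)) (\<Omega> ^ snd i)) \<in> LZ"
    using Phi_RZ[OF LZ.zero_mem g(2), of y1] by simp
qed

text \<open>Coboundaries of 0-cochains contain no \<open>t_2\<close> and no \<open>t_3\<close>, so
  they leave the coefficients by which the cocycles are told apart untouched.\<close>

lemma d_U3:
  assumes "z \<in> polys (Zp p) (G 0)" shows "d 0 z \<in> polys (Zp p) (U3 1 (1 - r))"
proof -
  let ?R = "polys (Zp p) (U3 1 (1 - r))"
  interpret R: subring_on ?R by (rule subring_polys[OF Zp.subring_on_axioms])
  have V: "V i k \<in> U3 1 (1 - r)" if "i \<le> 1" "1 \<le> k" "k \<le> N" for i k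
  proof -
    have "k = 1 \<or> 2 \<le> k" "i = 0 \<or> i = 1" "k \<le> 3" using that N_eq r_le_1 by auto
    moreover have "k = 2 \<or> k = 3" if "2 \<le> k" using that \<open>k \<le> 3\<close> by auto
    ultimately show ?thesis using that(3) by (auto simp: U3_def U2_def U1_def U0_def)
  qed
  have W: "W i \<in> U3 1 (1 - r)" if "i \<le> 1" for i
    using that by (cases "i = 0") (auto simp: U3_def U2_def U1_def U0_def)
  have T2: "T 2 1 \<in> U3 1 (1 - r)" by (auto simp: U3_def U2_def U1_def U0_def numeral_2_eq_2)
  have T1: "T 1 1 \<in> U3 1 (1 - r)" if "0 < m"
  proof -
    have "r < 1 \<and> 1 \<le> r + (1 - r)" using that m_iff_r by simp
    then have "T (0 + 1) 1 \<in> {T (i + 1) j |i j. i < 1 \<and> r < j \<and> j \<le> r + (1 - r)}" by blast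
    then show ?thesis unfolding U3_def by simp
  qed
  have a: "cf 0 0 z \<in> ?R" unfolding cf_def
  proof (rule subst_mem[OF R.subring_on_axioms assms])
    fix g assume "g \<in> G 0"
    then show "coface_gen p N r m 0 0 g \<in> ?R"
      by (cases g rule: gens_0_cases) (use V W T2 in \<open>auto intro!: Zp_Var simp: numeral_2_eq_2\<close>)
  qed (auto intro: cst_mem_polys)
  have b: "cf 0 1 z \<in> ?R" unfolding cf_def
  proof (rule subst_mem[OF R.subring_on_axioms assms])
    fix g assume "g \<in> G 0"
    then show "coface_gen p N r m 0 1 g \<in> ?R"
    proof (cases g rule: gens_0_cases)
      case 3
      then have "coface_gen p N r m 0 1 g = Var (T 1 1) + Var (T 2 1)"
        using cf_T_last[of 0] unfolding cf_def by (simp add: numeral_2_eq_2)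
      then show ?thesis using R.add_mem[OF Zp_Var[OF T1[OF 3(1)]] Zp_Var[OF T2]] by simp
    qed (use V W in \<open>auto intro!: Zp_Var\<close>)
  qed (auto intro: cst_mem_polys)
  show ?thesis unfolding d_0 by (rule R.diff_mem[OF a b])
qed

lemma wrel_J: "f \<in> Jid {wrel 0} \<Longrightarrow> f \<in> JZ 1"
  unfolding JZ_def using J_mono[of "{wrel 0}" "rel 1"] rel_W[of 0 1] by auto

text \<open>The coefficient of \<open>t_3\<close> is the combination with \<open>\<gamma>\<close>.
  Once it is known to vanish, the coefficient of \<open>t_2\<close> is the combination with
  \<open>\<beta>\<close>.\<close>

lemma mod_p_independent:
  assumes F: "finite F" "\<And>i. \<beta> i \<in> Zp p" "\<And>i. \<gamma> i \<in> Zp p" and z: "z \<in> polys (Zp p) (G 0)"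
    and J: "lc' F \<beta> \<omega>0 * \<tau>2 + lc' F \<gamma> \<omega>0 * \<tau>3 + d 0 z \<in> JZ 1" and i: "i \<in> F"
  shows "\<beta> i / of_nat p \<in> Zp p \<and> \<gamma> i / of_nat p \<in> Zp p"
proof -
  let ?B = "lc' F \<beta> \<omega>'" and ?C = "lc' F \<gamma> \<omega>'"
  have U0U3: "U0 1 \<subseteq> U3 1 n" for n by (auto simp: U3_def U2_def U1_def)
  have lcU: "lc' F \<beta> \<omega>' \<in> polys (Zp p) (U0 1)" if "\<And>i. \<beta> i \<in> Zp p" for \<beta>
  proof -
    interpret R: subring_on "polys (Zp p) (U0 1)" by (rule subring_polys[OF Zp.subring_on_axioms])
    show ?thesis unfolding lc'_def
      by (intro R.sum_mem R.mult_mem R.power_mem \<omega>'_U cst_mem_polys that Pv_polys) (auto simp: U0_def)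
  qed
  have BU: "?B \<in> polys (Zp p) (U3 1 n)" and CU: "?C \<in> polys (Zp p) (U3 1 n)" for n
    using lcU F polys_mono[OF order_refl U0U3] by blast+
  have \<omega>0_RZ: "\<omega>0 \<in> RZ" using polys_RZ[OF cf_polys[OF \<omega>_G, of 1]] by simp
  have \<omega>'_RZ: "\<omega>' \<in> RZ" by (rule polys_RZ[OF \<omega>'_U])
  have lcJ: "lc' F \<beta> \<omega>0 - lc' F \<beta> \<omega>' \<in> JZ 1" if "\<And>i. \<beta> i \<in> Zp p" for \<beta>
  proof -
    have "JZ.eqv 1 (lc' F \<beta> \<omega>0) (lc' F \<beta> \<omega>')"
      unfolding lc'_def
      by (intro JZ.eqv_sum JZ.eqv_mult JZ.eqv_refl JZ.eqv_power RZ.mult_mem RZ.power_mem Pv_RZ cst_RZ that \<omega>0_RZ \<omega>'_RZ)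
        (use \<omega>'_J in \<open>simp add: JZ.eqv_def\<close>)
    then show ?thesis by (simp add: JZ.eqv_def)
  qed
  have lcR: "lc' F \<beta> w \<in> RZ" if "\<And>i. \<beta> i \<in> Zp p" "w \<in> RZ" for \<beta> w
    unfolding lc'_def by (intro RZ.sum_mem RZ.mult_mem RZ.power_mem Pv_RZ cst_RZ that)
  have \<tau>R: "\<tau>2 \<in> RZ" "\<tau>3 \<in> RZ" using polys_RZ[OF \<tau>2_G] polys_RZ[OF \<tau>3_G] by auto
  \<comment> \<open>A representative modulo \<open>p\<close> that avoids the eliminated variables in
    its coefficients and is linear in \<open>t_3\<close>.\<close>
  define Y where "Y = ?B * (Var (T 1 2) + \<alpha>2) + ?C * (Var (T 1 3) + \<alpha>3) + d 0 z"
  have YJ: "Y \<in> JZ 1"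
  proof -
    have "Y = (lc' F \<beta> \<omega>0 * \<tau>2 + lc' F \<gamma> \<omega>0 * \<tau>3 + d 0 z)
      - (lc' F \<beta> \<omega>0 - ?B) * \<tau>2 - ?B * (\<tau>2 - (Var (T 1 2) + \<alpha>2))
      - (lc' F \<gamma> \<omega>0 - ?C) * \<tau>3 - ?C * (\<tau>3 - (Var (T 1 3) + \<alpha>3))"
      by (simp add: Y_def algebra_simps)
    also have "\<dots> \<in> JZ 1"
      by (intro JZ.idiff JZ.imult JZ.imult2 J lcJ F \<tau>R \<tau>2_J \<tau>3_J lcR \<omega>'_RZ)
    finally show ?thesis .
  qed
  have rn: "r + (2 - r) + 1 = 3" "r + (1 - r) + 1 = 2" "Suc (1 - r) = 2 - r" using r_le_1 by auto
  have T3: "T 1 3 \<notin> U3 1 (2 - r)" "T 1 2 \<notin> U3 1 (1 - r)" using r_le_1 by (auto simp: U3_def U2_def U1_def U0_def)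
  have T2U: "T 1 2 \<in> U3 1 (2 - r)" using r_le_1 by (auto simp: U3_def)
  have T3U: "T 1 3 \<in> U3 1 (Suc (2 - r))" using r_le_1 by (auto simp: U3_def)
  interpret R2: subring_on "polys (Zp p) (U3 1 (2 - r))" by (rule subring_polys[OF Zp.subring_on_axioms])
  interpret R1: subring_on "polys (Zp p) (U3 1 (1 - r))" by (rule subring_polys[OF Zp.subring_on_axioms])
  interpret R3: subring_on "polys (Zp p) (U3 1 (Suc (2 - r)))" by (rule subring_polys[OF Zp.subring_on_axioms])
  have up: "f \<in> polys (Zp p) (U3 1 n) \<Longrightarrow> n \<le> k \<Longrightarrow> f \<in> polys (Zp p) (U3 1 k)" for f n k
    using polys_mono[OF order_refl U3_mono] by blast
  have rest: "?B * (Var (T 1 2) + \<alpha>2) + ?C * \<alpha>3 + d 0 z \<in> polys (Zp p) (U3 1 (2 - r))"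
    by (intro R2.add_mem R2.mult_mem BU CU Zp_Var T2U \<alpha>3 up[OF \<alpha>2] up[OF d_U3[OF z]]) auto
  have rest1: "?B * \<alpha>2 + d 0 z \<in> polys (Zp p) (U3 1 (1 - r))"
    by (intro R1.add_mem R1.mult_mem BU \<alpha>2 d_U3 z)
  have pp: "1 < p\<^sup>2" using one_less_power[OF p_gt_1, of 2] by simp
  have "Y = (?B * (Var (T 1 2) + \<alpha>2) + ?C * \<alpha>3 + d 0 z) + ?C * Var (T 1 3)"
    by (simp add: Y_def algebra_simps)
  then have Yc: "coeffs_in (T 1 3) Y = [:?B * (Var (T 1 2) + \<alpha>2) + ?C * \<alpha>3 + d 0 z, ?C:]"
    by (simp only: coeffs_in.hom_add[of _ "?B * (Var (T 1 2) + \<alpha>2) + ?C * \<alpha>3 + d 0 z"]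
        coeffs_in.hom_mult[of _ ?C] coeffs_in_free[OF rest T3(1)] coeffs_in_free[OF CU T3(1)] coeffs_in_Var if_True HOL.refl) simp
  have YU: "Y \<in> polys (Zp p) (U3 1 (Suc (2 - r)))"
    unfolding \<open>Y = _ + ?C * Var (T 1 3)\<close>
    by (intro R3.add_mem[OF up[OF rest]] R3.mult_mem CU Zp_Var T3U) auto
  have "coeff (coeffs_in (T 1 (r + (2 - r) + 1)) Y) 1 \<in> Jid (S3 1 (2 - r))"
    by (rule S3_1_coeff[OF JZ_S3[OF YJ YU]]) (unfold rn Yc, use pp p_gt_0 in simp)
  then have "?C \<in> Jid (S3 1 (2 - r))" unfolding rn Yc by simp
  then have CJ: "?C \<in> Jid {wrel 0}" by (rule S3_detect) (rule lcU, rule F)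
  \<comment> \<open>Dropping the multiple of \<open>?C\<close> also drops \<open>\<alpha>3\<close>,
    which may contain powers of \<open>t_2\<close>; what is left is linear in
    \<open>t_2\<close>.\<close>
  define X where "X = (?B * \<alpha>2 + d 0 z) + ?B * Var (T 1 2)"
  have "X = Y - ?C * (Var (T 1 3) + \<alpha>3)" by (simp add: X_def Y_def algebra_simps)
  also have "\<dots> \<in> JZ 1"
    by (intro JZ.idiff YJ JZ.imult2 wrel_J CJ RZ.add_mem Var_RZ polys_RZ[OF \<alpha>3])
  finally have XJ: "X \<in> JZ 1" .
  have XU: "X \<in> polys (Zp p) (U3 1 (Suc (1 - r)))"
    unfolding X_def rn by (intro R2.add_mem[OF up[OF rest1]] R2.mult_mem BU Zp_Var T2U) auto
  have Xc: "coeffs_in (T 1 2) X = [:?B * \<alpha>2 + d 0 z, ?B:]"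
    unfolding X_def
    by (simp only: coeffs_in.hom_add[of _ "?B * \<alpha>2 + d 0 z"]
        coeffs_in.hom_mult[of _ ?B "Var _"] coeffs_in_free[OF rest1 T3(2)] coeffs_in_free[OF BU T3(2)] coeffs_in_Var if_True HOL.refl) simp
  have "coeff (coeffs_in (T 1 (r + (1 - r) + 1)) X) 1 \<in> Jid (S3 1 (1 - r))"
    by (rule S3_1_coeff[OF JZ_S3[OF XJ XU]]) (unfold rn Xc, use pp p_gt_0 in simp)
  then have "?B \<in> Jid (S3 1 (1 - r))" unfolding rn Xc by simp
  then have BJ: "?B \<in> Jid {wrel 0}" by (rule S3_detect) (rule lcU, rule F)
  show ?thesis using lc'_base_detect[OF F(1) i BJ] lc'_base_detect[OF F(1) i CJ] by blast
qed

lemma V12_eqv: "IZ.eqv 1 (Var (V 1 2)) (Var (V 0 2) + cst (of_nat p) * \<tau>2)"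
  using dv by (simp add: IZ.eqv_def diff_diff_eq)

lemma \<omega>1_eqv: "IZ.eqv 1 \<omega>1 (\<omega>0 + cst (of_nat p) * \<tau>3)"
  using dw by (simp add: IZ.eqv_def diff_diff_eq)

lemma pRZ: "x \<in> RZ \<Longrightarrow> cst (of_nat p) * x \<in> RZ"
  by (intro RZ.mult_mem cst_RZ Zp.of_nat_mem)

lemma power_diff_eqv:
  assumes "x \<in> polys (Zp p) (G 1)" "\<tau> \<in> polys (Zp p) (G 1)" "x' \<in> RZ" "IZ.eqv 1 x' (x + cst (of_nat p) * \<tau>)"
  shows "\<exists>A\<in>polys (Zp p) (G 1). x' ^ n - x ^ n - cst (of_nat n * of_nat p) * A \<in> IZ 1 \<and> A - \<tau> * x ^ (n - 1) \<in> JZ 1"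
proof -
  obtain \<rho> where \<rho>: "\<rho> \<in> polys (Zp p) (G 1)" "(x + cst (of_nat p) * \<tau>) ^ n =
    x ^ n + cst (of_nat n * of_nat p) * (\<tau> * x ^ (n - 1) + cst (of_nat p) * \<rho>)"
    using power_add_p_multiple[OF odd_p assms(1,2)] by blast
  let ?A = "\<tau> * x ^ (n - 1) + cst (of_nat p) * \<rho>"
  have "?A \<in> polys (Zp p) (G 1)"
    by (intro P1.add_mem P1.mult_mem P1.power_mem assms \<rho> cst_mem_polys Zp.of_nat_mem)
  moreover have "x' ^ n - x ^ n - cst (of_nat n * of_nat p) * ?A \<in> IZ 1"
    using IZ.eqv_power[OF assms(4,3), of n] RZ.add_mem[OF polys_RZ[OF assms(1)] pRZ[OF polys_RZ[OF assms(2)]]]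
    unfolding IZ.eqv_def \<rho>(2) by (simp add: diff_diff_eq)
  moreover have "?A - \<tau> * x ^ (n - 1) \<in> JZ 1" using p_J[OF polys_RZ[OF \<rho>(1)], of 1] by simp
  ultimately show ?thesis by blast
qed

lemma V_G1: "i \<le> 1 \<Longrightarrow> Var (V i 2) \<in> polys (Zp p) (G 1)" and W_G1: "i \<le> 1 \<Longrightarrow> Var (W i) \<in> polys (Zp p) (G 1)"
  using N_ge by (auto intro!: Zp_Var V_gens W_gens)

text \<open>For negative exponents the derivative formula is applied to the inverse of
  \<open>v_2\<close>, whose coboundary is obtained from that of \<open>v_2\<close>.\<close>

lemma Pv_diff: "\<exists>A\<in>polys (Zp p) (G 1). Pv 1 a - Pv 0 a - cst (of_int a * of_nat p) * A \<in> IZ 1 \<and>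
    A - \<tau>2 * Pv 0 (a - 1) \<in> JZ 1"
proof -
  consider "a = 0" | n where "a = int (Suc n)" | n where "a = - int (Suc n)"
    by (metis int_cases not0_implies_Suc of_nat_0)
  then show ?thesis
  proof cases
    case 1
    then show ?thesis
      using P1.mult_mem[OF \<tau>2_G Pv1_G[of 0 "-1"]]
      by (intro bexI[of _ "\<tau>2 * Pv 0 (a - 1)"]) (auto simp: cst.hom_zero IZ.izero JZ.izero)
  next
    case (2 n)
    have e: "Pv 1 a = Var (V 1 2) ^ Suc n" "Pv 0 a = Var (V 0 2) ^ Suc n" "Pv 0 (a - 1) = Var (V 0 2) ^ n"
      unfolding Pv_def 2 by (simp_all add: nat_add_distrib)
    show ?thesis
      using power_diff_eqv[OF V_G1 \<tau>2_G Var_RZ V12_eqv, of "Suc n"] unfolding e by (simp add: 2)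
  next
    case (3 n)
    \<comment> \<open>From \<open>w' - w = w w' (v - v')\<close> for the inverses \<open>w\<close>
      and \<open>w'\<close> of the left and right copies \<open>v\<close> and \<open>v'\<close> of
      \<open>v_2\<close>, where \<open>v' - v = p \<tau>2\<close>.\<close>
    define \<tau>' where "\<tau>' = - (\<tau>2 * Var (W 0) * Var (W 1))"
    have \<tau>': "\<tau>' \<in> polys (Zp p) (G 1)"
      unfolding \<tau>'_def by (intro P1.uminus_mem P1.mult_mem \<tau>2_G W_G1) auto
    have w: "Var (W 1) - (Var (W 0) + cst (of_nat p) * \<tau>') \<in> IZ 1"
    proof -
      have "Var (W 1) - (Var (W 0) + cst (of_nat p) * \<tau>') =
        Var (W 0) * wrel 1 - Var (W 1) * wrel 0 - Var (W 0) * Var (W 1) * (Var (V 1 2) - (Var (V 0 2) + cst (of_nat p) * \<tau>2))"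
        by (simp add: \<tau>'_def algebra_simps)
      also have "\<dots> \<in> IZ 1"
        by (intro IZ.idiff IZ.imult RZ.mult_mem Var_RZ wrel_IZ V12_eqv[unfolded IZ.eqv_def]) auto
      finally show ?thesis .
    qed
    obtain A where A: "A \<in> polys (Zp p) (G 1)" "Var (W 1) ^ Suc n - Var (W 0) ^ Suc n - cst (of_nat (Suc n) * of_nat p) * A \<in> IZ 1"
      "A - \<tau>' * Var (W 0) ^ (Suc n - 1) \<in> JZ 1"
      using power_diff_eqv[OF W_G1 \<tau>' Var_RZ w[folded IZ.eqv_def], of "Suc n"] by blast
    have e: "Pv 1 a = Var (W 1) ^ Suc n" "Pv 0 a = Var (W 0) ^ Suc n" "Pv 0 (a - 1) = Var (W 0) ^ Suc (Suc n)"
      unfolding Pv_def 3 by (simp_all add: nat_add_distrib)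
    have "cst (of_int a * of_nat p) * (- A) = cst (of_nat (Suc n) * of_nat p) * A"
      unfolding 3 by (simp add: cst.hom_simps algebra_simps)
    then have "Pv 1 a - Pv 0 a - cst (of_int a * of_nat p) * (- A) \<in> IZ 1"
      using A(2) unfolding e by (simp only:)
    moreover have "- A - \<tau>2 * Pv 0 (a - 1) \<in> JZ 1"
    proof -
      have "- A - \<tau>2 * Pv 0 (a - 1) = - (A - \<tau>' * Var (W 0) ^ (Suc n - 1)) +
        \<tau>2 * Var (W 0) ^ Suc n * ((Var (W 1) - (Var (W 0) + cst (of_nat p) * \<tau>')) + cst (of_nat p) * \<tau>')"
        unfolding e by (simp add: \<tau>'_def algebra_simps)
      also have "\<dots> \<in> JZ 1"
        by (intro JZ.iadd JZ.iuminus A(3) JZ.imult RZ.mult_mem RZ.power_mem Var_RZ polys_RZ[OF \<tau>2_G] IZ_J[OF w]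
            p_J polys_RZ[OF \<tau>'])
      finally show ?thesis .
    qed
    ultimately show ?thesis using P1.uminus_mem[OF A(1)] by blast
  qed
qed

lemma \<omega>0_G: "\<omega>0 \<in> polys (Zp p) (G 1)" and \<omega>1_G: "\<omega>1 \<in> polys (Zp p) (G 1)"
  using cf_polys[OF \<omega>_G, of 1] cf_polys[OF \<omega>_G, of 0] by auto

lemma cf_lam: "cf 0 0 (lam i) = Pv 1 (fst i) * \<omega>1 ^ snd i" "cf 0 1 (lam i) = Pv 0 (fst i) * \<omega>0 ^ snd i"
  by (simp_all add: lam_def cf.hom_mult cf.hom_power Pv_def cf_Var)

definition ex :: "int \<times> nat \<Rightarrow> nat" where "ex i = expo p (fst i) (snd i)"

definition is_cocycle_for :: "int \<times> nat \<Rightarrow> pol \<Rightarrow> bool" where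
  "is_cocycle_for i y \<longleftrightarrow> y \<in> polys (Zp p) (G 1) \<and> d 0 (lam i) - cst (of_nat p ^ ex i) * y \<in> IZ 1 \<and>
    (\<exists>a' b'. fst i = int p ^ (ex i - 1) * a' \<and> snd i = p ^ (ex i - 1) * b' \<and> \<not> (int p dvd a' \<and> p dvd b') \<and>
      y - (cst (of_int a') * (Pv 0 (fst i - 1) * \<omega>0 ^ snd i) * \<tau>2 +
           cst (of_nat b') * (Pv 0 (fst i) * \<omega>0 ^ (snd i - 1)) * \<tau>3) \<in> JZ 1)"

lemma cocycle_exists:
  assumes "i \<noteq> (0, 0)" shows "\<exists>y. is_cocycle_for i y"
proof -
  obtain a b where ab: "i = (a, b)" by (cases i)
  obtain k a' b' where k: "expo p a b = Suc k" "a = int p ^ k * a'" "b = p ^ k * b'" "\<not> (int p dvd a' \<and> p dvd b')"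
    using expo_exists[of a b] assms ab by blast
  obtain A where A: "A \<in> polys (Zp p) (G 1)" "Pv 1 a - Pv 0 a - cst (of_int a * of_nat p) * A \<in> IZ 1"
    "A - \<tau>2 * Pv 0 (a - 1) \<in> JZ 1" using Pv_diff[of a] by blast
  obtain B where B: "B \<in> polys (Zp p) (G 1)" "\<omega>1 ^ b - \<omega>0 ^ b - cst (of_nat b * of_nat p) * B \<in> IZ 1"
    "B - \<tau>3 * \<omega>0 ^ (b - 1) \<in> JZ 1" using power_diff_eqv[OF \<omega>0_G \<tau>3_G polys_RZ[OF \<omega>1_G] \<omega>1_eqv, of b] by blast
  \<comment> \<open>The product rule:
    \<open>(v_2^a + a p A) * (\<omega>0^b + b p B) - v_2^a \<omega>0^b\<close>, divided by
    \<open>p^(k+1)\<close>. The last summand is the cross term, still divisible by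
    \<open>p\<close>.\<close>
  define y where "y = cst (of_int a') * (A * \<omega>0 ^ b) + cst (of_nat b') * (Pv 0 a * B) +
    cst (of_nat p) * (cst (of_int a') * cst (of_nat b) * (A * B))"
  have RR: "A \<in> RZ" "B \<in> RZ" "\<omega>0 \<in> RZ" "\<omega>1 \<in> RZ" "\<tau>2 \<in> RZ" "\<tau>3 \<in> RZ"
    using polys_RZ A(1) B(1) \<omega>0_G \<omega>1_G \<tau>2_G \<tau>3_G by blast+
  have "y \<in> polys (Zp p) (G 1)"
    unfolding y_def
    by (intro P1.add_mem P1.mult_mem P1.power_mem A B \<omega>0_G Pv1_G cst_mem_polys Zp.of_int_mem Zp.of_nat_mem) auto
  moreover have "d 0 (lam i) - cst (of_nat p ^ ex i) * y \<in> IZ 1"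
  proof -
    have c1: "cst (of_int a * of_nat p) = cst (of_nat p ^ Suc k) * cst (of_int a')"
      unfolding k(2) by (simp add: cst.hom_simps mult_ac)
    have c2: "cst (of_nat b * of_nat p) = cst (of_nat p ^ Suc k) * cst (of_nat b')"
      unfolding k(3) by (simp add: cst.hom_simps mult_ac)
    have c3: "cst (of_int a * of_nat p) * cst (of_nat b * of_nat p) =
        cst (of_nat p ^ Suc k) * (cst (of_nat p) * (cst (of_int a') * cst (of_nat b)))"
      unfolding c1 by (simp add: cst.hom_simps mult_ac)
    have "cst (of_nat p ^ ex i) * y =
      cst (of_int a * of_nat p) * A * \<omega>0 ^ b + Pv 0 a * (cst (of_nat b * of_nat p) * B) +
      (cst (of_int a * of_nat p) * cst (of_nat b * of_nat p)) * (A * B)"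
      unfolding c3 unfolding c1 c2 by (simp add: ex_def ab k(1) y_def algebra_simps)
    then have "d 0 (lam i) - cst (of_nat p ^ ex i) * y =
      (Pv 1 a - Pv 0 a - cst (of_int a * of_nat p) * A) * \<omega>1 ^ b +
      (Pv 0 a + cst (of_int a * of_nat p) * A) * (\<omega>1 ^ b - \<omega>0 ^ b - cst (of_nat b * of_nat p) * B)"
      by (simp add: d_0 cf_lam[simplified] ab algebra_simps)
    also have "\<dots> \<in> IZ 1"
      by (intro IZ.iadd IZ.imult IZ.imult2 A B RZ.add_mem RZ.mult_mem RZ.power_mem RR Pv_RZ cst_RZ Zp.mult_mem
          Zp.of_int_mem Zp.of_nat_mem)
    finally show ?thesis .
  qed
  moreover have "y - (cst (of_int a') * (Pv 0 (fst i - 1) * \<omega>0 ^ snd i) * \<tau>2 +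
           cst (of_nat b') * (Pv 0 (fst i) * \<omega>0 ^ (snd i - 1)) * \<tau>3) \<in> JZ 1"
  proof -
    have "y - (cst (of_int a') * (Pv 0 (fst i - 1) * \<omega>0 ^ snd i) * \<tau>2 +
           cst (of_nat b') * (Pv 0 (fst i) * \<omega>0 ^ (snd i - 1)) * \<tau>3) =
      cst (of_int a') * \<omega>0 ^ b * (A - \<tau>2 * Pv 0 (a - 1)) + cst (of_nat b') * Pv 0 a * (B - \<tau>3 * \<omega>0 ^ (b - 1)) +
      cst (of_nat p) * (cst (of_int a') * cst (of_nat b) * (A * B))"
      by (simp add: y_def ab algebra_simps)
    also have "\<dots> \<in> JZ 1"
      by (intro JZ.iadd JZ.imult p_J RZ.mult_mem RZ.power_mem RR Pv_RZ cst_RZ Zp.of_int_mem Zp.of_nat_mem A B)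
    finally show ?thesis .
  qed
  moreover have "ex i - 1 = k" "fst i = a" "snd i = b" by (simp_all add: ex_def ab k(1))
  ultimately show ?thesis unfolding is_cocycle_for_def using k(2-4) by metis
qed

definition yc :: "int \<times> nat \<Rightarrow> pol" where "yc i = (SOME y. is_cocycle_for i y)"

lemma yc: "i \<noteq> (0, 0) \<Longrightarrow> is_cocycle_for i (yc i)"
  unfolding yc_def using someI_ex[OF cocycle_exists] .

lemma yc_G: "i \<noteq> (0, 0) \<Longrightarrow> yc i \<in> polys (Zp p) (G 1)"
  and yc_d: "i \<noteq> (0, 0) \<Longrightarrow> d 0 (lam i) - cst (of_nat p ^ ex i) * yc i \<in> IZ 1"
  using yc[of i] by (auto simp: is_cocycle_for_def)

lemma ex_ge_1: "i \<noteq> (0, 0) \<Longrightarrow> ex i \<ge> 1"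
  using expo_exists[of "fst i" "snd i"] by (cases i) (auto simp: ex_def)

text \<open>Up to relations, \<open>p^e\<close> times the element is a coboundary. Hence its
  differential vanishes rationally, and integrally by torsion-freeness.\<close>

lemma yc_cocycle:
  assumes "i \<noteq> (0, 0)" shows "yc i \<in> ZZ"
proof -
  have 12: "d 1 x \<in> IQ 2" if "x \<in> IQ 1" for x using d_IQ[OF that] by (simp add: numeral_2_eq_2)
  have "d 1 (d 0 (lam i) - cst (of_nat p ^ ex i) * yc i) \<in> IQ 2"
    by (rule 12[OF IZ_IQ[OF yc_d[OF assms]]])
  then have "- (cst (of_nat p ^ ex i) * d 1 (yc i)) \<in> IQ 2"
    by (simp only: d_diff d_smult dd_0[OF polys_Zp_UNIV[OF lam_G]] diff_0)
  from IQ.iuminus[OF this] have "cst (of_nat p ^ ex i) * d 1 (yc i) \<in> IQ 2" by simp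
  then have "d 1 (yc i) \<in> IQ 2" by (rule IQ_cst_cancel[rotated]) (use p_gt_0 in simp)
  then have "d 1 (yc i) \<in> IZ 2"
    by (rule IQ_RZ[rotated]) (rule polys_RZ[OF d_polys[OF yc_G[OF assms]]])
  then show ?thesis using yc_G[OF assms] by (simp add: ZZ_def)
qed

text \<open>Distinct indices contribute distinct monomials to the coefficient of
  \<open>\<tau>2\<close>, and likewise to that of \<open>\<tau>3\<close>. So \<open>p\<close>
  divides both \<open>b i * a'\<close> and \<open>b i * b'\<close> for each \<open>i\<close>, while
  \<open>a'\<close> and \<open>b'\<close> are not both divisible by \<open>p\<close>.\<close>

lemma yc_independent:
  assumes F: "finite F" "(0, 0) \<notin> F" "\<And>i. b i \<in> Zp p" and z: "z \<in> polys (Zp p) (G 0)"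
    and J: "(\<Sum>i\<in>F. cst (b i) * yc i) + d 0 z \<in> JZ 1" and i: "i \<in> F"
  shows "b i / of_nat p \<in> Zp p"
proof -
  have "\<forall>i. \<exists>a' b'. i \<in> F \<longrightarrow> fst i = int p ^ (ex i - 1) * a' \<and> snd i = p ^ (ex i - 1) * b' \<and> \<not> (int p dvd a' \<and> p dvd b') \<and>
      yc i - (cst (of_int a') * (Pv 0 (fst i - 1) * \<omega>0 ^ snd i) * \<tau>2 +
           cst (of_nat b') * (Pv 0 (fst i) * \<omega>0 ^ (snd i - 1)) * \<tau>3) \<in> JZ 1"
  proof
    fix i
    show "\<exists>a' b'. i \<in> F \<longrightarrow> fst i = int p ^ (ex i - 1) * a' \<and> snd i = p ^ (ex i - 1) * b' \<and> \<not> (int p dvd a' \<and> p dvd b') \<and>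
      yc i - (cst (of_int a') * (Pv 0 (fst i - 1) * \<omega>0 ^ snd i) * \<tau>2 +
           cst (of_nat b') * (Pv 0 (fst i) * \<omega>0 ^ (snd i - 1)) * \<tau>3) \<in> JZ 1"
    proof (cases "i \<in> F")
      case True
      then have "i \<noteq> (0, 0)" using F(2) by metis
      from yc[OF this] show ?thesis unfolding is_cocycle_for_def by blast
    qed blast
  qed
  then obtain A C where AC: "\<And>i. i \<in> F \<Longrightarrow> snd i = p ^ (ex i - 1) * C i" "\<And>i. i \<in> F \<Longrightarrow> \<not> (int p dvd A i \<and> p dvd C i)"
    "\<And>i. i \<in> F \<Longrightarrow> yc i - (cst (of_int (A i)) * (Pv 0 (fst i - 1) * \<omega>0 ^ snd i) * \<tau>2 +
           cst (of_nat (C i)) * (Pv 0 (fst i) * \<omega>0 ^ (snd i - 1)) * \<tau>3) \<in> JZ 1"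
    by metis
  define F1 where "F1 = (\<lambda>i. (fst i - 1, snd i)) ` F"
  define F2 where "F2 = (\<lambda>i. (fst i, snd i - 1)) ` {i\<in>F. snd i \<ge> 1}"
  define \<beta> where "\<beta> j = (if (fst j + 1, snd j) \<in> F then b (fst j + 1, snd j) * of_int (A (fst j + 1, snd j)) else 0)" for j
  define \<gamma> where "\<gamma> j = (if (fst j, snd j + 1) \<in> F then b (fst j, snd j + 1) * of_nat (C (fst j, snd j + 1)) else 0)" for j
  have f12: "finite (F1 \<union> F2)" using F(1) by (auto simp: F1_def F2_def)
  \<comment> \<open>For exponent 0 of \<open>\<omega>\<close> the truncated \<open>snd i - 1\<close>
    is wrong, but the factor \<open>C i\<close> then vanishes, so these indices can be left out of
    \<open>F2\<close>.\<close>
  have C0: "C i = 0" if "i \<in> F" "snd i = 0" for i using AC(1)[OF that(1)] that(2) p_gt_0 by simp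
  have sB: "lc' (F1 \<union> F2) \<beta> \<omega>0 = (\<Sum>i\<in>F. cst (b i * of_int (A i)) * (Pv 0 (fst i - 1) * \<omega>0 ^ snd i))"
  proof -
    have "lc' (F1 \<union> F2) \<beta> \<omega>0 = lc' F1 \<beta> \<omega>0"
      unfolding lc'_def
    proof (rule sum.mono_neutral_right[OF f12])
      show "\<forall>j\<in>F1 \<union> F2 - F1. cst (\<beta> j) * (Pv 0 (fst j) * \<omega>0 ^ snd j) = 0"
      proof
        fix j assume j: "j \<in> F1 \<union> F2 - F1"
        have "(fst j + 1, snd j) \<notin> F"
        proof
          assume "(fst j + 1, snd j) \<in> F"
          from imageI[OF this, of "\<lambda>i. (fst i - 1, snd i)"] have "j \<in> F1" by (simp add: F1_def)
          then show False using j by blast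
        qed
        then show "cst (\<beta> j) * (Pv 0 (fst j) * \<omega>0 ^ snd j) = 0" by (simp add: \<beta>_def cst.hom_zero)
      qed
    qed auto
    also have "\<dots> = (\<Sum>i\<in>F. cst (b i * of_int (A i)) * (Pv 0 (fst i - 1) * \<omega>0 ^ snd i))"
      unfolding lc'_def F1_def
      by (subst sum.reindex) (auto simp: inj_on_def prod_eq_iff \<beta>_def intro!: sum.cong)
    finally show ?thesis .
  qed
  have sC: "lc' (F1 \<union> F2) \<gamma> \<omega>0 = (\<Sum>i\<in>F. cst (b i * of_nat (C i)) * (Pv 0 (fst i) * \<omega>0 ^ (snd i - 1)))"
  proof -
    have "lc' (F1 \<union> F2) \<gamma> \<omega>0 = lc' F2 \<gamma> \<omega>0"
      unfolding lc'_def
    proof (rule sum.mono_neutral_right[OF f12])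
      show "\<forall>j\<in>F1 \<union> F2 - F2. cst (\<gamma> j) * (Pv 0 (fst j) * \<omega>0 ^ snd j) = 0"
      proof
        fix j assume j: "j \<in> F1 \<union> F2 - F2"
        have "(fst j, snd j + 1) \<notin> F"
        proof
          assume "(fst j, snd j + 1) \<in> F"
          then have "(fst j, snd j + 1) \<in> {i\<in>F. snd i \<ge> 1}" by simp
          from imageI[OF this, of "\<lambda>i. (fst i, snd i - 1)"] have "j \<in> F2" by (simp add: F2_def)
          then show False using j by blast
        qed
        then show "cst (\<gamma> j) * (Pv 0 (fst j) * \<omega>0 ^ snd j) = 0" by (simp add: \<gamma>_def cst.hom_zero)
      qed
    qed auto
    also have "\<dots> = (\<Sum>i\<in>{i\<in>F. snd i \<ge> 1}. cst (b i * of_nat (C i)) * (Pv 0 (fst i) * \<omega>0 ^ (snd i - 1)))"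
      unfolding lc'_def F2_def
      by (subst sum.reindex) (auto simp: inj_on_def prod_eq_iff \<gamma>_def intro!: sum.cong)
    also have "\<dots> = (\<Sum>i\<in>F. cst (b i * of_nat (C i)) * (Pv 0 (fst i) * \<omega>0 ^ (snd i - 1)))"
    proof (rule sum.mono_neutral_left[OF F(1)])
      show "\<forall>i\<in>F - {i\<in>F. snd i \<ge> 1}. cst (b i * of_nat (C i)) * (Pv 0 (fst i) * \<omega>0 ^ (snd i - 1)) = 0"
      proof
        fix i assume i: "i \<in> F - {i\<in>F. snd i \<ge> 1}"
        then have "C i = 0" by (intro C0) auto
        then show "cst (b i * of_nat (C i)) * (Pv 0 (fst i) * \<omega>0 ^ (snd i - 1)) = 0" by (simp add: cst.hom_zero)
      qed
    qed auto
    finally show ?thesis .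
  qed
  have "lc' (F1 \<union> F2) \<beta> \<omega>0 * \<tau>2 + lc' (F1 \<union> F2) \<gamma> \<omega>0 * \<tau>3 =
    (\<Sum>i\<in>F. cst (b i) * (cst (of_int (A i)) * (Pv 0 (fst i - 1) * \<omega>0 ^ snd i) * \<tau>2 +
           cst (of_nat (C i)) * (Pv 0 (fst i) * \<omega>0 ^ (snd i - 1)) * \<tau>3))"
    unfolding sB sC sum_distrib_right sum.distrib[symmetric]
    by (intro sum.cong[OF HOL.refl]) (simp add: cst.hom_mult algebra_simps)
  then have "lc' (F1 \<union> F2) \<beta> \<omega>0 * \<tau>2 + lc' (F1 \<union> F2) \<gamma> \<omega>0 * \<tau>3 + d 0 z =
    ((\<Sum>i\<in>F. cst (b i) * yc i) + d 0 z) - (\<Sum>i\<in>F. cst (b i) * (yc i - (cst (of_int (A i)) * (Pv 0 (fst i - 1) * \<omega>0 ^ snd i) * \<tau>2 +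
           cst (of_nat (C i)) * (Pv 0 (fst i) * \<omega>0 ^ (snd i - 1)) * \<tau>3)))"
    by (simp add: right_diff_distrib sum_subtractf)
  also have "\<dots> \<in> JZ 1"
    by (intro JZ.idiff J JZ.isum JZ.imult cst_RZ F AC(3))
  finally have main: "lc' (F1 \<union> F2) \<beta> \<omega>0 * \<tau>2 + lc' (F1 \<union> F2) \<gamma> \<omega>0 * \<tau>3 + d 0 z \<in> JZ 1" .
  have \<beta>Z: "\<beta> j \<in> Zp p" and \<gamma>Z: "\<gamma> j \<in> Zp p" for j
    by (auto simp: \<beta>_def \<gamma>_def intro!: Zp.mult_mem F Zp.of_int_mem Zp.of_nat_mem Zp.zero_mem)
  note ind = mod_p_independent[OF f12 \<beta>Z \<gamma>Z z main]
  have "(fst i - 1, snd i) \<in> F1 \<union> F2" using i by (auto simp: F1_def)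
  from ind[OF this] have 1: "b i * of_int (A i) / of_nat p \<in> Zp p" using i by (simp add: \<beta>_def)
  have 2: "b i * of_nat (C i) / of_nat p \<in> Zp p"
  proof (cases "snd i \<ge> 1")
    case True
    then have "(fst i, snd i - 1) \<in> F1 \<union> F2" using i by (auto simp: F2_def)
    from ind[OF this] show ?thesis using i True by (simp add: \<gamma>_def)
  next
    case False
    then show ?thesis using C0[OF i] by (simp add: Zp.zero_mem)
  qed
  show ?thesis
  \<comment> \<open>Whichever of \<open>A i\<close> and \<open>C i\<close> is prime to
    \<open>p\<close> is invertible in \<open>Z_(p)\<close> and can be cancelled.\<close>
  proof (cases "int p dvd A i")
    case False
    then have "1 / of_int (A i) \<in> Zp p" by (rule Zp_inverse_int)
    moreover have "A i \<noteq> 0" using False by auto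
    ultimately show ?thesis using Zp.mult_mem[OF 1] by fastforce
  next
    case True
    then have nd: "\<not> int p dvd int (C i)" using AC(2)[OF i] by simp
    then have "1 / of_int (int (C i)) \<in> Zp p" by (rule Zp_inverse_int)
    moreover have "C i \<noteq> 0" using nd by (intro notI) simp
    ultimately show ?thesis using Zp.mult_mem[OF 2] by fastforce
  qed
qed

end

section \<open>The Bockstein argument\<close>

context cobar begin

lemma d_RZ: "x \<in> polys (Zp p) (G s) \<Longrightarrow> d s x \<in> RZ"
  using polys_RZ[OF d_polys] by blast

lemma d_IZ: "x \<in> polys (Zp p) (G s) \<Longrightarrow> x \<in> IZ s \<Longrightarrow> d s x \<in> IZ (s + 1)"
  by (rule IQ_RZ[OF d_RZ d_IQ[OF IZ_IQ]])

lemma rep_zero_off: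
  assumes "rep s l f"
  shows "\<exists>F c. finite F \<and> (\<forall>i. c i \<in> Zp p) \<and> (\<forall>i. i \<notin> F \<longrightarrow> c i = 0) \<and> f - (\<Sum>i\<in>F. cst (c i) * l i) \<in> IZ s"
proof -
  obtain F c where F: "finite F" "\<forall>i. c i \<in> Zp p" "f - (\<Sum>i\<in>F. cst (c i) * l i) \<in> IZ s"
    using assms by (auto simp: rep_def)
  have "(\<Sum>i\<in>F. cst (if i \<in> F then c i else 0) * l i) = (\<Sum>i\<in>F. cst (c i) * l i)"
    by (intro sum.cong) auto
  then show ?thesis
    using F by (intro exI[of _ F] exI[of _ "\<lambda>i. if i \<in> F then c i else 0"]) (auto simp: Zp.zero_mem)
qed

end

text \<open>\<open>H0_mod_p\<close> says that the degree 0 invariants modulo \<open>p\<close> are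
  spanned by the \<open>lam i\<close>; it is the only input of the Bockstein argument that is
  established differently for the two complexes.\<close>

locale cobar_basis_spanning = cobar_basis p N r m \<omega> \<tau>2 \<tau>3 \<omega>' \<alpha>2 \<alpha>3 y0 y1 c0 \<Omega> n0
    for p N r m \<omega> \<tau>2 \<tau>3 \<omega>' \<alpha>2 \<alpha>3 y0 y1 c0 \<Omega> n0 +
  assumes H0_mod_p: "z \<in> polys (Zp p) (G 0) \<Longrightarrow> d 0 z \<in> JZ 1 \<Longrightarrow>
      \<exists>z'\<in>polys (Zp p) (G 0). rep 0 lam (z - cst (of_nat p) * z')"
begin

lemma d_lam_0: "d 0 (lam (0, 0)) = 0"
  by (simp add: d_0 cf.hom_one)

text \<open>Taking coboundaries in \<open>y = \<Sum> c_i lam_i + p^n z\<close> gives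
  \<open>p^n\<close> times the claim. The common factor can be cancelled because the cobar ring is
  torsion-free.\<close>

lemma divide_coboundary:
  assumes y: "y \<in> polys (Zp p) (G 0)" and f: "f \<in> RZ" "d 0 y - cst (of_nat p ^ n) * f \<in> IZ 1"
    and F: "finite F" "\<And>i. c i \<in> Zp p" and z: "z \<in> polys (Zp p) (G 0)"
    and yz: "y - (\<Sum>i\<in>F. cst (c i) * lam i) - cst (of_nat p ^ n) * z \<in> IZ 0"
    and b: "\<And>i. i \<in> F \<Longrightarrow> i \<noteq> (0, 0) \<Longrightarrow> c i * of_nat p ^ ex i = of_nat p ^ n * b i"
    and bZ: "\<And>i. b i \<in> Zp p"
  shows "(\<Sum>i\<in>F - {(0, 0)}. cst (b i) * yc i) + d 0 z - f \<in> IZ 1"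
proof -
  let ?F = "F - {(0, 0)}" and ?P = "cst (of_nat p ^ n)"
  let ?S = "\<Sum>i\<in>?F. cst (b i) * yc i"
  have PZ: "of_nat p ^ n \<in> Zp p" by (intro Zp.power_mem Zp.of_nat_mem)
  have x: "y - (\<Sum>i\<in>F. cst (c i) * lam i) - ?P * z \<in> polys (Zp p) (G 0)"
    by (intro P0.diff_mem P0.sum_mem P0.mult_mem cst_mem_polys y z lam_G F PZ)
  have dF: "(\<Sum>i\<in>F. cst (c i) * d 0 (lam i)) = (\<Sum>i\<in>?F. cst (c i) * d 0 (lam i))"
    by (rule sum.mono_neutral_right) (use F(1) d_lam_0 in auto)
  have 1: "d 0 y - (\<Sum>i\<in>?F. cst (c i) * d 0 (lam i)) - ?P * d 0 z \<in> IZ 1"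
    using d_IZ[OF x yz] by (simp add: d_diff d_sum d_smult dF)
  have 2: "(\<Sum>i\<in>?F. cst (c i) * (d 0 (lam i) - cst (of_nat p ^ ex i) * yc i)) \<in> IZ 1"
    by (intro IZ.isum IZ.imult cst_RZ F yc_d) auto
  have 3: "cst (c i) * (cst (of_nat p ^ ex i) * yc i) = ?P * (cst (b i) * yc i)" if "i \<in> ?F" for i
    using b[of i] that by (simp add: mult.assoc[symmetric] cst.hom_mult[symmetric])
  have e: "(\<Sum>i\<in>?F. cst (c i) * (d 0 (lam i) - cst (of_nat p ^ ex i) * yc i)) =
      (\<Sum>i\<in>?F. cst (c i) * d 0 (lam i)) - ?P * ?S"
    unfolding right_diff_distrib sum_subtractf sum_distrib_left using 3 by simp
  have "?P * (?S + d 0 z - f) = (d 0 y - ?P * f) -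
     (d 0 y - (\<Sum>i\<in>?F. cst (c i) * d 0 (lam i)) - ?P * d 0 z) -
     (\<Sum>i\<in>?F. cst (c i) * (d 0 (lam i) - cst (of_nat p ^ ex i) * yc i))"
    unfolding e by (simp add: algebra_simps)
  also have "\<dots> \<in> IZ 1" by (intro IZ.idiff f 1 2)
  finally have "?P * (?S + d 0 z - f) \<in> IZ 1" .
  moreover have "?S + d 0 z - f \<in> RZ"
    by (intro RZ.diff_mem RZ.add_mem RZ.sum_mem RZ.mult_mem cst_RZ bZ f d_RZ z polys_RZ[OF yc_G]) auto
  ultimately show ?thesis by (rule IZ_divide[rotated])
qed

text \<open>Describes the invariants modulo \<open>p^n\<close>: only those multiples of
  \<open>lam i\<close> occur whose coboundary is divisible by \<open>p^n\<close>. The induction step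
  improves the error term \<open>z\<close> by one power of \<open>p\<close>.\<close>

lemma bockstein:
  assumes y: "y \<in> polys (Zp p) (G 0)"
  shows "f \<in> RZ \<Longrightarrow> d 0 y - cst (of_nat p ^ n) * f \<in> IZ 1 \<Longrightarrow>
    \<exists>F c z. finite F \<and> (\<forall>i. c i \<in> Zp p) \<and> (\<forall>i. i \<notin> F \<longrightarrow> c i = 0) \<and> z \<in> polys (Zp p) (G 0) \<and>
      y - (\<Sum>i\<in>F. cst (c i) * lam i) - cst (of_nat p ^ n) * z \<in> IZ 0 \<and>
      (\<forall>i. i \<noteq> (0, 0) \<longrightarrow> c i * of_nat p ^ ex i / of_nat p ^ n \<in> Zp p)"
proof (induction n arbitrary: f)
  case 0
  show ?case
    by (rule exI[of _ "{}"], rule exI[of _ "\<lambda>_. 0"], rule exI[of _ y])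
      (simp add: Zp.zero_mem y cst.hom_one IZ.izero)
next
  case (Suc n)
  have p0: "(of_nat p :: rat) \<noteq> 0" using p_gt_0 by simp
  have pf: "cst (of_nat p) * f \<in> RZ" by (rule pRZ[OF Suc.prems(1)])
  have df: "d 0 y - cst (of_nat p ^ n) * (cst (of_nat p) * f) \<in> IZ 1"
    using Suc.prems(2) by (simp add: cst.hom_mult mult_ac)
  obtain F c z where F: "finite F" "\<And>i. c i \<in> Zp p" "\<And>i. i \<notin> F \<Longrightarrow> c i = 0" and z: "z \<in> polys (Zp p) (G 0)"
    and yz: "y - (\<Sum>i\<in>F. cst (c i) * lam i) - cst (of_nat p ^ n) * z \<in> IZ 0"
    and cb: "\<And>i. i \<noteq> (0, 0) \<Longrightarrow> c i * of_nat p ^ ex i / of_nat p ^ n \<in> Zp p"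
    using Suc.IH[OF pf df] by blast
  define b where "b i = (if i = (0, 0) then 0 else c i * of_nat p ^ ex i / of_nat p ^ n)" for i
  have bZ: "b i \<in> Zp p" for i using cb[of i] by (simp add: b_def Zp.zero_mem)
  let ?F = "F - {(0, 0)}"
  have D: "(\<Sum>i\<in>?F. cst (b i) * yc i) + d 0 z - cst (of_nat p) * f \<in> IZ 1"
    by (rule divide_coboundary[OF y pf df F(1,2) z yz _ bZ]) (use p0 in \<open>simp_all add: b_def\<close>)
  \<comment> \<open>The divided coboundary is now \<open>p f\<close>, hence 0 modulo
    \<open>p\<close>. Independence then makes every \<open>b i\<close> divisible by
    \<open>p\<close>, which leaves \<open>z\<close> itself invariant modulo
    \<open>p\<close>.\<close>
  have DJ: "(\<Sum>i\<in>?F. cst (b i) * yc i) + d 0 z \<in> JZ 1"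
    using JZ.iadd[OF IZ_J[OF D] p_J[OF Suc.prems(1)]] by simp
  have bp: "b i / of_nat p \<in> Zp p" if "i \<in> ?F" for i
    by (rule yc_independent[OF _ _ bZ z DJ that]) (use F(1) in auto)
  have bp': "b i / of_nat p \<in> Zp p" for i
  proof (cases "i \<in> ?F")
    case False
    then have "b i = 0" using F(3)[of i] by (auto simp: b_def)
    then show ?thesis by (simp add: Zp.zero_mem)
  qed (rule bp)
  have "(\<Sum>i\<in>?F. cst (b i) * yc i) = (\<Sum>i\<in>?F. cst (of_nat p) * (cst (b i / of_nat p) * yc i))"
    by (intro sum.cong[OF HOL.refl]) (use p0 in \<open>simp add: mult.assoc[symmetric] cst.hom_mult[symmetric]\<close>)
  also have "\<dots> \<in> JZ 1"
    by (intro JZ.isum p_J RZ.mult_mem cst_RZ bp polys_RZ[OF yc_G]) auto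
  finally have "d 0 z \<in> JZ 1" using JZ.idiff[OF DJ] by force
  from H0_mod_p[OF z this] obtain z'
    where z': "z' \<in> polys (Zp p) (G 0)" and r: "rep 0 lam (z - cst (of_nat p) * z')" by blast
  obtain F' c' where F': "finite F'" "\<And>i. c' i \<in> Zp p" "\<And>i. i \<notin> F' \<Longrightarrow> c' i = 0"
    and zz: "z - cst (of_nat p) * z' - (\<Sum>i\<in>F'. cst (c' i) * lam i) \<in> IZ 0"
    using rep_zero_off[OF r] by blast
  define e where "e i = c i + of_nat p ^ n * c' i" for i
  have PZ: "of_nat p ^ n \<in> Zp p" for n by (intro Zp.power_mem Zp.of_nat_mem)
  have "(\<Sum>i\<in>F. cst (c i) * lam i) = (\<Sum>i\<in>F \<union> F'. cst (c i) * lam i)"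
    by (rule sum.mono_neutral_left) (use F F' in \<open>auto simp: cst.hom_zero\<close>)
  moreover have "(\<Sum>i\<in>F'. cst (c' i) * lam i) = (\<Sum>i\<in>F \<union> F'. cst (c' i) * lam i)"
    by (rule sum.mono_neutral_left) (use F F' in \<open>auto simp: cst.hom_zero\<close>)
  ultimately have "y - (\<Sum>i\<in>F \<union> F'. cst (e i) * lam i) - cst (of_nat p ^ Suc n) * z' =
     (y - (\<Sum>i\<in>F. cst (c i) * lam i) - cst (of_nat p ^ n) * z) +
     cst (of_nat p ^ n) * (z - cst (of_nat p) * z' - (\<Sum>i\<in>F'. cst (c' i) * lam i))"
    by (simp add: e_def cst.hom_add cst.hom_mult distrib_left distrib_right sum.distrib sum_distrib_left right_diff_distrib mult_ac)
  also have "\<dots> \<in> IZ 0" by (intro IZ.iadd yz IZ.imult cst_RZ PZ zz)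
  finally have 1: "y - (\<Sum>i\<in>F \<union> F'. cst (e i) * lam i) - cst (of_nat p ^ Suc n) * z' \<in> IZ 0" .
  have 2: "e i * of_nat p ^ ex i / of_nat p ^ Suc n \<in> Zp p" if i: "i \<noteq> (0, 0)" for i
  proof -
    \<comment> \<open>Since \<open>ex i\<close> is at least 1, the new contribution
      \<open>p^n * c' i\<close> is admissible for every \<open>c' i\<close>.\<close>
    obtain k where k: "ex i = Suc k" using ex_ge_1[OF i] by (cases "ex i") auto
    have "e i * of_nat p ^ ex i / of_nat p ^ Suc n = b i / of_nat p + c' i * of_nat p ^ k"
      using p0 by (simp add: e_def b_def i k field_simps)
    also have "\<dots> \<in> Zp p" by (intro Zp.add_mem bp' Zp.mult_mem F' PZ)
    finally show ?thesis .
  qed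
  have 3: "e i \<in> Zp p" for i unfolding e_def by (intro Zp.add_mem Zp.mult_mem F F' PZ)
  have 4: "e i = 0" if "i \<notin> F \<union> F'" for i using F(3)[of i] F'(3)[of i] that by (simp add: e_def)
  show ?case
    by (rule exI[of _ "F \<union> F'"], rule exI[of _ e], rule exI[of _ z']) (use F(1) F'(1) 1 2 3 4 z' in blast)
qed

text \<open>An integral cocycle is rationally a coboundary; clearing denominators gives
  \<open>d y = p^n x\<close> up to relations, and \<open>bockstein\<close> followed by division
  expresses \<open>x\<close> by the \<open>yc i\<close>. A relation among the \<open>yc i\<close>
  integrates to a rational 0-cocycle, hence to a constant, and independence of the
  \<open>lam i\<close> gives the divisibility.\<close>

theorem presented_H1: "presented p ZZ BB {(a, b). (a, b) \<noteq> (0, 0)} yc ex"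
proof -
  let ?J = "{(a, b). (a, b) \<noteq> (0 :: int, 0 :: nat)}"
  have J: "i \<in> ?J \<longleftrightarrow> i \<noteq> (0, 0)" for i by (cases i) auto
  have p0: "(of_nat p :: rat) \<noteq> 0" using p_gt_0 by simp
  interpret Q: quot_module p ZZ BB by (rule quot_module_1)
  show ?thesis
  proof
    show "yc i \<in> ZZ" if "i \<in> ?J" for i using that unfolding J by (rule yc_cocycle)
    show "cst (of_nat p ^ ex i) * yc i \<in> BB" if "i \<in> ?J" for i
    proof -
      have i: "i \<noteq> (0, 0)" using that J by blast
      have "cst (of_nat p ^ ex i) * yc i = - (d 0 (lam i) - cst (of_nat p ^ ex i) * yc i) + d 0 (lam i)" by simp
      moreover have "- (d 0 (lam i) - cst (of_nat p ^ ex i) * yc i) \<in> IZ 1" by (rule IZ.iuminus[OF yc_d[OF i]])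
      moreover have "- (d 0 (lam i) - cst (of_nat p ^ ex i) * yc i) \<in> polys (Zp p) (G 1)"
        by (intro P1.uminus_mem P1.diff_mem P1.mult_mem cst_mem_polys yc_G[OF i] Zp.power_mem Zp.of_nat_mem)
          (use d_polys[OF lam_G] in simp)
      ultimately show ?thesis unfolding BB_def using lam_G[of i] by blast
    qed
    show "\<exists>F c. finite F \<and> F \<subseteq> ?J \<and> (\<forall>i. c i \<in> Zp p) \<and> x - (\<Sum>i\<in>F. cst (c i) * yc i) \<in> BB"
      if x: "x \<in> ZZ" for x
    proof -
      have xG: "x \<in> polys (Zp p) (G 1)" and dx: "d 1 x \<in> IQ 2" using x IZ_IQ by (auto simp: ZZ_def)
      obtain h where h: "h \<in> polys UNIV (G 0)" "x - d 0 h \<in> IQ 1"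
        using rational_H1[OF polys_Zp_UNIV[OF xG] dx] by blast
      obtain n where n: "cst (of_nat p ^ n) * h \<in> RZ" using clear_denominators by blast
      define y where "y = cst (of_nat p ^ n) * h"
      interpret U0: subring_on "polys UNIV (G 0)" by (rule subring_polys[OF subring_UNIV])
      have "y \<in> polys UNIV (G 0)" unfolding y_def by (intro U0.mult_mem h cst_mem_polys) auto
      then have y: "y \<in> polys (Zp p) (G 0)" using n unfolding y_def by (rule polys_Zp_RZ)
      have xR: "x \<in> RZ" by (rule polys_RZ[OF xG])
      have dy: "d 0 y - cst (of_nat p ^ n) * x \<in> IZ 1"
      proof (rule IQ_RZ)
        show "d 0 y - cst (of_nat p ^ n) * x \<in> RZ"
          by (intro RZ.diff_mem d_RZ y RZ.mult_mem cst_RZ xR Zp.power_mem Zp.of_nat_mem)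
        have "d 0 y - cst (of_nat p ^ n) * x = cst (of_nat p ^ n) * (- (x - d 0 h))"
          by (simp add: y_def d_smult[of 0] right_diff_distrib)
        also have "\<dots> \<in> IQ 1" by (intro IQ.imult IQ.iuminus h) simp
        finally show "d 0 y - cst (of_nat p ^ n) * x \<in> IQ 1" .
      qed
      obtain F c z where F: "finite F" "\<And>i. c i \<in> Zp p" and z: "z \<in> polys (Zp p) (G 0)"
        and yz: "y - (\<Sum>i\<in>F. cst (c i) * lam i) - cst (of_nat p ^ n) * z \<in> IZ 0"
        and cb: "\<And>i. i \<noteq> (0, 0) \<Longrightarrow> c i * of_nat p ^ ex i / of_nat p ^ n \<in> Zp p"
        using bockstein[OF y xR dy] by blast
      define b where "b i = (if i = (0, 0) then 0 else c i * of_nat p ^ ex i / of_nat p ^ n)" for i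
      have bZ: "b i \<in> Zp p" for i using cb[of i] by (simp add: b_def Zp.zero_mem)
      let ?F = "F - {(0, 0)}"
      let ?g = "(\<Sum>i\<in>?F. cst (b i) * yc i) + d 0 z - x"
      have g: "?g \<in> IZ 1"
        by (rule divide_coboundary[OF y xR dy F z yz _ bZ]) (use p0 in \<open>simp_all add: b_def\<close>)
      have gG: "?g \<in> polys (Zp p) (G 1)"
        by (intro P1.diff_mem P1.add_mem P1.sum_mem P1.mult_mem cst_mem_polys bZ xG yc_G)
          (use d_polys[OF z] in auto)
      have "x - (\<Sum>i\<in>?F. cst (b i) * yc i) = - ?g + d 0 z" by simp
      then have "x - (\<Sum>i\<in>?F. cst (b i) * yc i) \<in> BB"
        unfolding BB_def using IZ.iuminus[OF g] P1.uminus_mem[OF gG] z by blast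
      then show ?thesis using F(1) bZ by (intro exI[of _ ?F] exI[of _ b]) auto
    qed
    show "c i / of_nat p ^ ex i \<in> Zp p"
      if F: "finite F" "F \<subseteq> ?J" and "\<And>i. c i \<in> Zp p" and S: "(\<Sum>i\<in>F. cst (c i) * yc i) \<in> BB" and i: "i \<in> F" for F c i
    proof -
      have F0: "(0, 0) \<notin> F" using F(2) J by blast
      obtain g z where gz: "g \<in> IZ 1" "z \<in> polys (Zp p) (G 0)" "(\<Sum>i\<in>F. cst (c i) * yc i) = g + d 0 z"
        using S unfolding BB_def by blast
      define q where "q i = c i / of_nat p ^ ex i" for i
      interpret U0: subring_on "polys UNIV (G 0)" by (rule subring_polys[OF subring_UNIV])
      define Q where "Q = (\<Sum>i\<in>F. cst (q i) * lam i) - z"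
      have QG: "Q \<in> polys UNIV (G 0)"
        unfolding Q_def by (intro U0.diff_mem U0.sum_mem U0.mult_mem cst_mem_polys polys_Zp_UNIV gz lam_G) auto
      have "cst (q j) * (cst (of_nat p ^ ex j) * yc j) = cst (c j) * yc j" for j
        using p0 by (simp add: q_def mult.assoc[symmetric] cst.hom_mult[symmetric])
      then have "d 0 Q = (\<Sum>i\<in>F. cst (q i) * (d 0 (lam i) - cst (of_nat p ^ ex i) * yc i)) + g"
        unfolding right_diff_distrib sum_subtractf using gz(3) by (simp add: Q_def d_diff d_sum d_smult)
      also have "\<dots> \<in> IQ 1"
        by (intro IQ.iadd IQ.isum IQ.imult IZ_IQ gz yc_d) (use F0 in auto)
      finally obtain k where k: "Q - cst k \<in> IQ 0" using rational_H0[OF QG] by blast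
      \<comment> \<open>The constant is moved into the coefficient of \<open>lam (0, 0) = 1\<close>,
        an index absent from \<open>F\<close>.\<close>
      define q' where "q' i = (if i = (0, 0) then - k else q i)" for i
      have "(\<Sum>i\<in>insert (0, 0) F. cst (q' i) * lam i) = cst (- k) + (\<Sum>i\<in>F. cst (q' i) * lam i)"
        using F(1) F0 by (simp add: q'_def)
      also have "(\<Sum>i\<in>F. cst (q' i) * lam i) = (\<Sum>i\<in>F. cst (q i) * lam i)"
        by (intro sum.cong) (use F0 in \<open>auto simp: q'_def\<close>)
      finally have "(\<Sum>i\<in>insert (0, 0) F. cst (q' i) * lam i) - z = Q - cst k"
        by (simp add: Q_def cst.hom_uminus)
      with k have "(\<Sum>i\<in>insert (0, 0) F. cst (q' i) * lam i) - z \<in> IQ 0" by simp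
      from lam_independent[OF _ this polys_RZ[OF gz(2)]] F(1) i have "q' i \<in> Zp p" by simp
      then show ?thesis using F0 i by (auto simp: q'_def q_def split: if_splits)
    qed
  qed
qed

text \<open>A 0-cocycle is rationally a constant. The constant is integral because
  \<open>lam (0, 0) = 1\<close> belongs to the independent family, and it is unique because
  \<open>Phi\<close> keeps constants apart.\<close>

theorem Ext_0: "\<exists>f. f \<in> mod_iso (Zloc p) (Ext p N r m 0) (Zloc p)"
proof -
  define Z0 where "Z0 = {f \<in> polys (Zp p) (G 0). d 0 f \<in> IZ 1}"
  define B0 where "B0 = polys (Zp p) (G 0) \<inter> IZ 0"
  have E: "Ext p N r m 0 = quot Z0 B0"
  proof -
    have "{f \<in> cochains (Zp p) N r m 0. d 0 f \<in> null (Zp p) p N r m (0 + 1)} = Z0"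
      using d_polys[of _ 0] by (auto simp: Z0_def cochains_def null_Zp)
    then show ?thesis unfolding Ext_def cohomology_def B0_def by (simp add: null_Zp Int_def)
  qed
  have "Zp_submodule p Z0"
    by unfold_locales
      (auto simp: Z0_def prime_p P0.zero_mem IZ.izero d_add d_smult
        intro: P0.add_mem IZ.iadd P0.mult_mem cst_mem_polys IZ.imult cst_RZ)
  moreover have "Zp_submodule p B0"
    by unfold_locales
      (auto simp: B0_def prime_p P0.zero_mem IZ.izero
        intro: P0.add_mem IZ.iadd P0.mult_mem cst_mem_polys IZ.imult cst_RZ)
  ultimately interpret Q: quot_module p Z0 B0 by (rule quot_module.intro)
  have dc: "d 0 (cst c) = 0" for c by (simp add: d_0)
  have Zc: "cst c \<in> Z0" if "c \<in> Zp p" for c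
    using that by (simp add: Z0_def cst_mem_polys dc IZ.izero)
  have uniq: "c = 0" if "cst c \<in> B0" for c
  proof -
    have "Phi y0 c0 (cst c) = 0" by (rule Phi_IQ[OF IZ_IQ]) (use that in \<open>simp add: B0_def\<close>)
    then have "lau 0 c = 0" by simp
    then have "Poly_Mapping.lookup (lau 0 c) 0 = 0" by simp
    then show ?thesis by (simp add: lau_lookup)
  qed
  have ex: "\<exists>c\<in>Zp p. coset B0 f = coset B0 (cst c)" if f: "f \<in> Z0" for f
  proof -
    have fG: "f \<in> polys (Zp p) (G 0)" and df: "d 0 f \<in> IQ 1" using f IZ_IQ by (auto simp: Z0_def)
    obtain c where c: "f - cst c \<in> IQ 0" using rational_H0[OF polys_Zp_UNIV[OF fG] df] by blast
    have "(\<Sum>i\<in>{(0, 0)}. cst c * lam i) - f \<in> IQ 0" using IQ.iuminus[OF c] by simp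
    from lam_independent[OF _ this polys_RZ[OF fG]] have cZ: "c \<in> Zp p" by simp
    have "f - cst c \<in> IZ 0"
      by (rule IQ_RZ[OF _ c]) (intro RZ.diff_mem polys_RZ[OF fG] cst_RZ cZ)
    then have "f - cst c \<in> B0" using fG cZ by (simp add: B0_def P0.diff_mem cst_mem_polys)
    then show ?thesis using cZ by (auto simp: Q.coset_eq_iff)
  qed
  have carr: "carrier (quot Z0 B0) = (\<lambda>c. coset B0 (cst c)) ` Zp p"
    unfolding Q.carrier_M using ex Zc by (auto simp: image_iff)
  have inj: "coset B0 (cst c) = coset B0 (cst c') \<longleftrightarrow> c = c'" for c c'
    unfolding Q.coset_eq_iff cst.hom_diff[symmetric] using uniq[of "c - c'"] Q.B_zero by (auto simp: cst.hom_zero)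
  define \<phi> where "\<phi> S = (THE c. S = coset B0 (cst c))" for S
  have \<phi>: "\<phi> (coset B0 (cst c)) = c" for c unfolding \<phi>_def inj by simp
  have "\<phi> \<in> mod_iso (Zloc p) (quot Z0 B0) (Zloc p)"
    unfolding mod_iso_def
  proof (intro CollectI conjI ballI)
    show "\<phi> (a \<odot>\<^bsub>quot Z0 B0\<^esub> X) = a \<odot>\<^bsub>Zloc p\<^esub> \<phi> X" if "a \<in> carrier (Zloc p)" "X \<in> carrier (quot Z0 B0)" for a X
      using that unfolding carr by (auto simp: Q.smult_M cst.hom_mult[symmetric] \<phi>) (simp add: Zloc_def)
    show "\<phi> \<in> iso (add_monoid (quot Z0 B0)) (add_monoid (Zloc p))"
    proof (rule isoI)
      show "\<phi> \<in> hom (add_monoid (quot Z0 B0)) (add_monoid (Zloc p))"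
      proof (rule homI)
        show "\<phi> X \<in> carrier (add_monoid (Zloc p))" if "X \<in> carrier (add_monoid (quot Z0 B0))" for X
          using that by (auto simp: carr \<phi>)
        show "\<phi> (X \<otimes>\<^bsub>add_monoid (quot Z0 B0)\<^esub> Y) = \<phi> X \<otimes>\<^bsub>add_monoid (Zloc p)\<^esub> \<phi> Y"
          if "X \<in> carrier (add_monoid (quot Z0 B0))" "Y \<in> carrier (add_monoid (quot Z0 B0))" for X Y
          using that by (auto simp: carr Q.add_M cst.hom_add[symmetric] \<phi>) (simp add: Zloc_def)
      qed
      show "bij_betw \<phi> (carrier (add_monoid (quot Z0 B0))) (carrier (add_monoid (Zloc p)))"
        by (rule bij_betw_byWitness[of _ "\<lambda>c. coset B0 (cst c)"]) (auto simp: carr \<phi>)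
    qed
  qed
  then show ?thesis unfolding E by blast
qed

end

section \<open>The two cobar complexes\<close>

context prime_local begin

lemma ell_1_special: "v 1 = cst (of_nat p) * A \<Longrightarrow> ell p v 1 = A"
  unfolding ell_1_eq by (simp add: p_inv_p)

lemma p_ell_2: "cst (of_nat p) * ell p v 2 = v 2 + ell p v 1 * v 1 ^ p"
  using p_ell[of 2 v] by (simp add: numeral_2_eq_2)

lemma p_ell_3: "cst (of_nat p) * ell p v 3 = v 3 + ell p v 1 * v 2 ^ p + ell p v 2 * v 1 ^ p\<^sup>2"
  using p_ell[of 3 v] by (simp add: numeral_3_eq_3 numeral_2_eq_2)

text \<open>Writing \<open>v_1 = p A\<close> turns \<open>ell_1\<close> into \<open>A\<close> and
  makes all denominators disappear from the formulas for \<open>eta_R(v_2)\<close> and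
  \<open>eta_R(v_3)\<close>. The uses are \<open>A = 0\<close> for \<open>\<Sigma>(2,2)\<close> and
  \<open>A = - (t_1 + t_1')\<close> for \<open>T(1)/(v_1)\<close>.\<close>

lemma etaR_2_eq:
  assumes "t 0 = 1" "v 1 = cst (of_nat p) * A"
  shows "etaR p v t 2 = v 2 + cst (of_nat p) * t 2 + cst (of_nat p) * A * t 1 ^ p +
    cst (of_nat p) ^ p * (A ^ (p + 1) - (A + t 1) ^ (p + 1))"
proof -
  let ?P = "cst (of_nat p)"
  define C where "C = A + t 1"
  have l1: "ell p v 1 = A" by (rule ell_1_special) (rule assms(2))
  have w1: "etaR p v t 1 = ?P * (A + t 1)" by (simp add: etaR_1_eq[simplified] assms[simplified] distrib_left)
  have h1: "etaR_ell p v t 1 = A + t 1" using l1 by (simp add: etaR_ell_def assms(1))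
  have "etaR p v t 2 = ?P * etaR_ell p v t 2 - etaR_ell p v t 1 * etaR p v t 1 ^ p"
    using etaR.simps[of p v t 2] by (simp add: numeral_2_eq_2)
  also have "etaR_ell p v t 2 = t 2 + ell p v 1 * t 1 ^ p + ell p v 2"
    by (simp add: etaR_ell_def assms(1) numeral_2_eq_2)
  finally show ?thesis
    using p_ell_2[of v] unfolding w1 h1 l1 assms(2) C_def[symmetric] by (simp add: power_mult_distrib algebra_simps)
qed

lemma etaR_3_eq:
  assumes "t 0 = 1" "v 1 = cst (of_nat p) * A"
  defines "w2 \<equiv> etaR p v t 2" and "P \<equiv> cst (of_nat p)"
  shows "etaR p v t 3 = v 3 + A * v 2 ^ p + P ^ (p\<^sup>2 - 1) * (v 2 + P ^ p * A ^ (p + 1)) * A ^ p\<^sup>2 +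
    (v 2 + P ^ p * A ^ (p + 1)) * t 1 ^ p\<^sup>2 + P * A * t 2 ^ p + P * t 3 - (A + t 1) * w2 ^ p -
    P ^ (p\<^sup>2 - 1) * (w2 + P ^ p * (A + t 1) ^ (p + 1)) * (A + t 1) ^ p\<^sup>2"
proof -
  define C where "C = A + t 1"
  have l1: "ell p v 1 = A" by (rule ell_1_special) (rule assms(2))
  have w1: "etaR p v t 1 = P * (A + t 1)" by (simp add: P_def etaR_1_eq[simplified] assms[simplified] distrib_left)
  have h1: "etaR_ell p v t 1 = A + t 1" using l1 by (simp add: etaR_ell_def assms(1))
  have h2: "P * etaR_ell p v t 2 = w2 + (A + t 1) * (P * (A + t 1)) ^ p"
    using p_etaR_ell[where p = p and n = 2 and t = t and v = v] assms(1) w1 h1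
    by (simp add: P_def w2_def numeral_2_eq_2 etaR_ell_def add.commute)
  have l2: "P * ell p v 2 = v 2 + A * (P * A) ^ p" using p_ell_2[of v] unfolding l1 assms(2) P_def .
  have h3: "etaR_ell p v t 3 = t 3 + ell p v 1 * t 2 ^ p + ell p v 2 * t 1 ^ p\<^sup>2 + ell p v 3"
    by (simp add: etaR_ell_def assms(1) numeral_3_eq_3 numeral_2_eq_2)
  have l3: "P * ell p v 3 = v 3 + A * v 2 ^ p + ell p v 2 * (P * A) ^ p\<^sup>2"
    using p_ell_3[of v] unfolding l1 assms(2) P_def .
  have pp: "P ^ p\<^sup>2 = P ^ (p\<^sup>2 - 1) * P" using p_gt_0 by (simp add: power_Suc2[symmetric] del: power_Suc)
  have "etaR p v t 3 = P * etaR_ell p v t 3 - (etaR_ell p v t 1 * w2 ^ p + etaR_ell p v t 2 * etaR p v t 1 ^ p\<^sup>2)"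
    using etaR.simps[of p v t 3] by (simp add: P_def w2_def numeral_3_eq_3 numeral_2_eq_2)
  also have "\<dots> = P * t 3 + P * A * t 2 ^ p + (P * ell p v 2) * t 1 ^ p\<^sup>2 + P * ell p v 3 - (A + t 1) * w2 ^ p -
     etaR_ell p v t 2 * (P * (A + t 1)) ^ p\<^sup>2"
    unfolding h3 w1 h1 l1 by (simp add: algebra_simps)
  also have "etaR_ell p v t 2 * (P * (A + t 1)) ^ p\<^sup>2 = P ^ (p\<^sup>2 - 1) * (P * etaR_ell p v t 2) * (A + t 1) ^ p\<^sup>2"
    unfolding power_mult_distrib pp by (simp add: mult_ac)
  also have "P * ell p v 3 = v 3 + A * v 2 ^ p + P ^ (p\<^sup>2 - 1) * (P * ell p v 2) * A ^ p\<^sup>2"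
    unfolding l3 power_mult_distrib pp by (simp add: mult_ac)
  finally show ?thesis unfolding h2 l2 C_def[symmetric] by (simp add: power_mult_distrib algebra_simps)
qed

end

section \<open>The complex over \<Sigma>(2,2)\<close>

locale cobar_Sigma = cobar +
  assumes odd_p: "odd p" and r_pos: "0 < r"
begin

lemma params: "N = 3" "r = 1" "m = 0"
  using r_pos cases_Nrm by auto

lemma m_0: "\<not> 0 < m" by (simp add: params)

lemma V1_IZ: "Var (V 0 1) \<in> IZ 0"
  using rel_IZ[OF rel_M[of 0]] unfolding etaR_mg_1 Tlast_def using m_0 by simp

lemma V01_IQ: "Var (V 0 1) \<in> IQ 1"
proof -
  have "Var (V 0 1) - Var (V 1 1) \<in> IQ 1"
    using rel_IQ[OF rel_eta[of 0 1 1]] unfolding eta_1 using m_0 by (simp add: Tlast_def)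
  from IQ.iadd[OF this V1_IQ[OF m_0, of 1]] show ?thesis by simp
qed

definition v0 :: "nat \<Rightarrow> pol" where "v0 k = (if k = 1 then 0 else vg 0 k)"

lemma etaR_v0:
  assumes "2 \<le> k" "k \<le> 3" shows "Var (V 1 k) - etaR p v0 (tg 1) k \<in> IQ 1"
proof -
  define kill where "kill g = (if g = V 0 1 then 0 else Var g)" for g
  have "subst kill (vg 0 j) = v0 j" for j by (auto simp: vgen_def v0_def kill_def subst.hom_zero)
  moreover have "subst kill (tg 1 j) = tg 1 j" for j by (auto simp: tgen_def kill_def subst.hom_simps)
  ultimately have "subst kill (etaR p (vg 0) (tg 1) k) = etaR p v0 (tg 1) k" by (simp add: subst_etaR)
  moreover have "subst Var (etaR p (vg 0) (tg 1) k) - subst kill (etaR p (vg 0) (tg 1) k) \<in> IQ 1"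
    by (rule subst_eqv[OF IQ.ideal_on_axioms, of _ UNIV UNIV])
      (auto simp: kill_def IQ.izero V01_IQ[simplified] polys_def)
  ultimately have "etaR p (vg 0) (tg 1) k - etaR p v0 (tg 1) k \<in> IQ 1" by simp
  moreover have "etaR p (vg 0) (tg 1) k - Var (V 1 k) \<in> IQ 1"
    using rel_IQ[OF rel_eta[of 0 1 k]] assms params(1) by (simp add: vgen_def)
  ultimately show ?thesis using IQ.idiff by fastforce
qed

lemma v0_simps: "v0 1 = cst (of_nat p) * 0" "v0 2 = Var (V 0 2)" "v0 3 = Var (V 0 3)"
  unfolding v0_def by (simp_all add: vgen_def params(1))

lemma tg_simps: "tg 1 0 = 1" "tg 1 1 = 0" "tg 1 2 = Var (T 1 2)" "tg 1 3 = Var (T 1 3)"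
  using params(2) by (simp_all add: tgen_def)

lemma etaR_v0_2: "etaR p v0 (tg 1) 2 = Var (V 0 2) + cst (of_nat p) * Var (T 1 2)"
  by (subst etaR_2_eq[of "tg 1" v0 0, OF tg_simps(1) v0_simps(1)]) (use p_gt_0 in \<open>simp only: v0_simps tg_simps, simp add: zero_power\<close>)

lemma etaR_v0_3: "etaR p v0 (tg 1) 3 = Var (V 0 3) + cst (of_nat p) * Var (T 1 3)"
  by (subst etaR_3_eq[of "tg 1" v0 0, OF tg_simps(1) v0_simps(1)]) (use p_gt_0 in \<open>simp only: v0_simps tg_simps, simp add: zero_power\<close>)

text \<open>With \<open>v_1 = t_1 = 0\<close> the formulas collapse to
  \<open>eta_R(v_2) = v_2 + p t_2\<close> and \<open>eta_R(v_3) = v_3 + p t_3\<close>. Hence the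
  corrections \<open>\<alpha>2\<close> and \<open>\<alpha>3\<close> are 0, and
  \<open>\<Omega>\<close> is the indeterminate itself.\<close>

sublocale cobar_basis p N r m "Var (V 0 3)" "Var (T 1 2)" "Var (T 1 3)" "Var (V 0 3)" 0 0 "V 0 3" "V 0 3" 0 "[:0, 1:]" 0
proof
  show "odd p" by (rule odd_p)
  show "Var (V 0 3) \<in> polys (Zp p) (G 0)" by (intro Zp_Var V_gens) (simp_all add: params)
  show "Var (T 1 2) \<in> polys (Zp p) (G 1)" "Var (T 1 3) \<in> polys (Zp p) (G 1)" by (intro Zp_Var T_gens; simp add: params)+
  show "Var (V 1 2) - Var (V 0 2) - cst (of_nat p) * Var (T 1 2) \<in> IZ 1"
    by (rule IQ_RZ[OF _ etaR_v0[of 2, unfolded etaR_v0_2, folded diff_diff_eq]])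
      (auto intro!: RZ.diff_mem RZ.mult_mem Var_RZ cst_RZ Zp.of_nat_mem)
  have "Var (V 1 3) - Var (V 0 3) - cst (of_nat p) * Var (T 1 3) \<in> IZ 1"
    by (rule IQ_RZ[OF _ etaR_v0[of 3, unfolded etaR_v0_3, folded diff_diff_eq]])
      (auto intro!: RZ.diff_mem RZ.mult_mem Var_RZ cst_RZ Zp.of_nat_mem)
  then show "cf 0 0 (Var (V 0 3)) - cf 0 1 (Var (V 0 3)) - cst (of_nat p) * Var (T 1 3) \<in> IZ 1" by (simp add: cf_Var)
  have "mrel 0 = Var (V 0 1)"
    using etaR_mg_1[of 0] unfolding Tlast_def by (simp only: m_0 if_False mult_zero_right add_0_right)
  then show "Phi (V 0 3) 0 (mrel 0) = 0" by (simp only:) (simp add: Phi_Var)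
  show "(0 :: laurent poly) \<in> LZ" by (rule LZ.zero_mem)
  show "Phi (V 0 3) 0 (Var (V 0 3)) = [:0, 1:]" by (simp add: Phi_Var)
  show "[:0, 1:] \<in> LZ" by (auto simp: LZ_def coeff_pCons LZ1.zero_mem LZ1.one_mem split: nat.split)
  show "1 \<le> degree [:0, 1 :: laurent:]" "lead_coeff [:0, 1 :: laurent:] = lau 0 1" by (simp_all add: lau_one)
  show "Var (V 0 3) \<in> polys (Zp p) (U0 1)" by (intro Zp_Var) (auto simp: U0_def)
  show "cf 0 1 (Var (V 0 3)) - Var (V 0 3) \<in> JZ 1" by (simp add: cf_Var JZ.izero)
  show "Var (T 1 2) - (Var (T 1 2) + 0) \<in> JZ 1" "Var (T 1 3) - (Var (T 1 3) + 0) \<in> JZ 1" by (simp_all add: JZ.izero)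
  show "0 \<in> polys (Zp p) (U3 1 (1 - r))" "0 \<in> polys (Zp p) (U3 1 (2 - r))" by (simp_all add: polys_def)
qed

lemma lam_eq: "lam i = Pv 0 (fst i) * Var (V 0 3) ^ snd i"
  by (rule lam_def)

lemma rep_lam:
  assumes "z \<in> polys (Zp p) (G 0)" shows "rep 0 lam z"
proof (rule rep_all[OF assms])
  show "rep 0 lam 1" using rep_base[of 0 lam "(0, 0)"] by simp
  fix g i assume "g \<in> G 0"
  then consider "g = V 0 1" | "g = V 0 2" | "g = V 0 3" | "g = W 0"
  proof (cases g rule: gens_0_cases)
    case (1 k)
    then have "k = 1 \<or> k = 2 \<or> k = 3" unfolding params by auto
    then show ?thesis using 1 that by blast
  qed (use that m_0 in auto)
  then show "rep 0 lam (Var g * lam i)"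
  proof cases
    case 1
    then have "Var g * lam i - 0 \<in> IZ 0" using IZ.imult2[OF polys_RZ[OF lam_G] V1_IZ] by simp
    then show ?thesis by (rule rep_cong) (rule rep_zero)
  next
    case 2
    have "Var g * lam i - lam (fst i + 1, snd i) = (Var (V 0 2) * Pv 0 (fst i) - Pv 0 (fst i + 1)) * Var (V 0 3) ^ snd i"
      by (simp add: 2 lam_eq algebra_simps)
    also have "\<dots> \<in> IZ 0" using Pv_V[of 0 0] by (intro IZ.imult2 RZ.power_mem Var_RZ) (simp add: IZ.eqv_def)
    finally show ?thesis by (rule rep_cong) (rule rep_base)
  next
    case 3
    have "Var g * lam i = lam (fst i, Suc (snd i))" by (simp add: 3 lam_eq algebra_simps)
    then show ?thesis by (simp only: rep_base)
  next
    case 4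
    have "Var g * lam i - lam (fst i - 1, snd i) = (Var (W 0) * Pv 0 (fst i) - Pv 0 (fst i - 1)) * Var (V 0 3) ^ snd i"
      by (simp add: 4 lam_eq algebra_simps)
    also have "\<dots> \<in> IZ 0" using Pv_W[of 0 0] by (intro IZ.imult2 RZ.power_mem Var_RZ) (simp add: IZ.eqv_def)
    finally show ?thesis by (rule rep_cong) (rule rep_base)
  qed
qed

text \<open>The degree 0 ring is \<open>Z_(p)[v_2, 1/v_2, v_3]\<close>, so every cochain is a
  combination of the \<open>lam i\<close> and \<open>z' = 0\<close> serves.\<close>

sublocale cobar_basis_spanning p N r m "Var (V 0 3)" "Var (T 1 2)" "Var (T 1 3)" "Var (V 0 3)" 0 0 "V 0 3" "V 0 3" 0 "[:0, 1:]" 0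
proof
  show "\<exists>z'\<in>polys (Zp p) (G 0). rep 0 lam (z - cst (of_nat p) * z')" if "z \<in> polys (Zp p) (G 0)" for z
    using rep_lam[OF that] P0.zero_mem by (intro bexI[of _ 0]) auto
qed

end

section \<open>The complex of T(1)/(v_1): explicit structure formulas\<close>

locale cobar_T1 = cobar +
  assumes odd_p: "odd p" and m_pos: "0 < m"
begin

lemma params: "N = 2" "r = 0" "m = 1"
  using m_pos cases_Nrm by auto

abbreviation "P \<equiv> cst (of_nat p)"
abbreviation "t1 \<equiv> Var (T 1 1)"
abbreviation "t1' \<equiv> Var (T 2 1)"
abbreviation "v \<equiv> Var (V 0 2)"

lemma P_V11: "Var (V 1 1) + P * t1' \<in> IQ 1"
  using V1_T_IQ[OF m_pos, of 1] by (simp add: numeral_2_eq_2)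

lemma P_V01: "Var (V 0 1) + P * (t1 + t1') \<in> IQ 1"
proof -
  have "Var (V 0 1) - Var (V 1 1) + P * t1 \<in> IQ 1"
    using rel_IQ[OF rel_eta[of 0 1 1]] unfolding eta_1 using m_pos by (simp add: Tlast_def)
  from IQ.iadd[OF this P_V11] show ?thesis by (simp add: algebra_simps)
qed

definition v0 :: "nat \<Rightarrow> pol" where "v0 k = (if k = 1 then P * - (t1 + t1') else vg 0 k)"

lemma etaR_v0:
  assumes "2 \<le> k" shows "vg 1 k - etaR p v0 (tg 1) k \<in> IQ 1"
proof -
  define kill where "kill g = (if g = V 0 1 then P * - (t1 + t1') else Var g)" for g
  have "subst kill (vg 0 j) = v0 j" for j using N_ge by (auto simp: vgen_def v0_def kill_def subst.hom_zero)
  moreover have "subst kill (tg 1 j) = tg 1 j" for j by (auto simp: tgen_def kill_def subst.hom_simps)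
  ultimately have "subst kill (etaR p (vg 0) (tg 1) k) = etaR p v0 (tg 1) k" by (simp add: subst_etaR)
  moreover have "subst Var (etaR p (vg 0) (tg 1) k) - subst kill (etaR p (vg 0) (tg 1) k) \<in> IQ 1"
    by (rule subst_eqv[OF IQ.ideal_on_axioms, of _ UNIV UNIV])
      (use P_V01 in \<open>auto simp: kill_def IQ.izero polys_def algebra_simps\<close>)
  ultimately have "etaR p (vg 0) (tg 1) k - etaR p v0 (tg 1) k \<in> IQ 1" by simp
  moreover have "etaR p (vg 0) (tg 1) k - vg 1 k \<in> IQ 1"
    using rel_IQ[OF rel_eta[of 0 1 k]] assms by simp
  ultimately show ?thesis using IQ.idiff by fastforce
qed

lemma v0_simps: "v0 1 = P * - (t1 + t1')" "v0 2 = v" "v0 3 = 0"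
  unfolding v0_def by (simp_all add: vgen_def params(1))

lemma tg_simps: "tg 1 0 = 1" "tg 1 1 = t1" "tg 1 2 = Var (T 1 2)" "tg 1 3 = Var (T 1 3)"
  using params(2) by (simp_all add: tgen_def)

text \<open>
  Modulo the relations, \<open>v\<^sub>1 = - p (t\<^sub>1 + t\<^sub>1')\<close> in the left copy and \<open>- p t\<^sub>1'\<close> in the right one. The formula
  for \<open>\<tau>\<^sub>3\<close> is \<open>(d \<omega> + \<eta>\<^sub>R(v\<^sub>3)) / p\<close>, with \<open>\<eta>\<^sub>R(v\<^sub>3) = 0\<close>; the terms of \<open>\<eta>\<^sub>R(v\<^sub>3)\<close> and \<open>d \<omega>\<close> not divisible by \<open>p\<close> cancel.
\<close>

definition \<alpha>2 :: pol where
  "\<alpha>2 = - ((t1 + t1') * t1 ^ p) + P ^ (p - 1) * ((t1 + t1') ^ (p + 1) - t1' ^ (p + 1))"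
definition \<kappa> :: pol where "\<kappa> = cst (1 / of_nat p) * ((t1 + t1') ^ p\<^sup>2 - t1 ^ p\<^sup>2 - t1' ^ p\<^sup>2)"
definition \<tau>2 :: pol where "\<tau>2 = Var (T 1 2) + \<alpha>2"
definition \<alpha>3 :: pol where
  "\<alpha>3 = - ((t1 + t1') * Var (T 1 2) ^ p) + \<tau>2 * t1' ^ p\<^sup>2 - v * \<kappa> + P ^ (p - 1) * (t1 + t1') ^ (p + 1) * t1 ^ p\<^sup>2 +
    P ^ (p\<^sup>2 - 2) * ((v + P * \<tau>2 + P ^ p * t1' ^ (p + 1)) * t1' ^ p\<^sup>2 - (v + P ^ p * (t1 + t1') ^ (p + 1)) * (t1 + t1') ^ p\<^sup>2)"
definition \<tau>3 :: pol where "\<tau>3 = Var (T 1 3) + \<alpha>3"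
definition \<omega>T :: "pol \<Rightarrow> pol" where "\<omega>T x = v * x ^ p\<^sup>2 - v ^ p * x"

lemma P_power: "P * (P ^ (p - 1) * x) = P ^ p * x" "P * (P ^ (p\<^sup>2 - 2) * x) = P ^ (p\<^sup>2 - 1) * x"
proof -
  have "p\<^sup>2 \<ge> 2" using one_less_power[OF p_gt_1, of 2] by simp
  then have "Suc (p\<^sup>2 - 2) = p\<^sup>2 - 1" "Suc (p - 1) = p" using p_gt_0 by auto
  then show "P * (P ^ (p - 1) * x) = P ^ p * x" "P * (P ^ (p\<^sup>2 - 2) * x) = P ^ (p\<^sup>2 - 1) * x"
    by (simp_all add: mult.assoc[symmetric] power_Suc[symmetric] del: power_Suc)
qed

lemma even_p1: "even (p + 1)" and odd_p2: "odd (p\<^sup>2)" using odd_p by auto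

lemma minus_power: "(- x) ^ (p + 1) = x ^ (p + 1)" "(- x) ^ p\<^sup>2 = - (x ^ p\<^sup>2)" for x :: pol
  using even_p1 odd_p2 by (simp_all add: power_minus_odd)

lemma etaR_v0_2: "etaR p v0 (tg 1) 2 = v + P * \<tau>2"
proof -
  have t: "- (t1 + t1') + t1 = - t1'" by simp
  show ?thesis
    unfolding etaR_2_eq[of "tg 1" v0, OF tg_simps(1) v0_simps(1)] v0_simps tg_simps t minus_power
    unfolding \<tau>2_def \<alpha>2_def distrib_left P_power by (simp add: algebra_simps del: power_Suc)
qed

lemma P_\<kappa>: "P * \<kappa> = (t1 + t1') ^ p\<^sup>2 - t1 ^ p\<^sup>2 - t1' ^ p\<^sup>2"
  unfolding \<kappa>_def by (rule p_p_inv)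

text \<open>Rearranged: \<open>eta_R(v_3) = p \<tau>3 - d \<omega>\<close>, with the right copy of
  \<open>v_2\<close> written as \<open>eta_R(v_2)\<close>. Since \<open>v_3 = 0\<close> in
  \<open>E(2)_*\<close>, this yields \<open>d \<omega> = p \<tau>3\<close>.\<close>

lemma etaR_v0_3:
  "v * (t1 + t1') ^ p\<^sup>2 - v ^ p * (t1 + t1') + P * \<tau>3 + etaR p v0 (tg 1) 2 ^ p * t1' -
    etaR p v0 (tg 1) 2 * t1' ^ p\<^sup>2 = etaR p v0 (tg 1) 3"
proof -
  define \<sigma> where "\<sigma> = t1 + t1'"
  define w2 where "w2 = v + P * \<tau>2"
  have t: "- \<sigma> + t1 = - t1'" by (simp add: \<sigma>_def)
  have w3: "etaR p v0 (tg 1) 3 = - \<sigma> * v ^ p - P ^ (p\<^sup>2 - 1) * (v + P ^ p * \<sigma> ^ (p + 1)) * \<sigma> ^ p\<^sup>2 +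
    (v + P ^ p * \<sigma> ^ (p + 1)) * t1 ^ p\<^sup>2 - P * \<sigma> * Var (T 1 2) ^ p + P * Var (T 1 3) + t1' * w2 ^ p +
    P ^ (p\<^sup>2 - 1) * (w2 + P ^ p * t1' ^ (p + 1)) * t1' ^ p\<^sup>2"
    unfolding etaR_3_eq[of "tg 1" v0, OF tg_simps(1) v0_simps(1)] etaR_v0_2 v0_simps tg_simps
      \<sigma>_def[symmetric] w2_def[symmetric] t minus_power by simp
  have "P * \<tau>3 = P * Var (T 1 3) - P * \<sigma> * Var (T 1 2) ^ p + P * \<tau>2 * t1' ^ p\<^sup>2 - v * (P * \<kappa>) +
     P ^ p * (\<sigma> ^ (p + 1) * t1 ^ p\<^sup>2) +
     P ^ (p\<^sup>2 - 1) * ((w2 + P ^ p * t1' ^ (p + 1)) * t1' ^ p\<^sup>2 - (v + P ^ p * \<sigma> ^ (p + 1)) * \<sigma> ^ p\<^sup>2)"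
    unfolding P_power[symmetric] \<tau>3_def \<alpha>3_def \<sigma>_def[symmetric] w2_def[symmetric] by (simp add: algebra_simps)
  also have "v * (P * \<kappa>) = v * \<sigma> ^ p\<^sup>2 - v * t1 ^ p\<^sup>2 - v * t1' ^ p\<^sup>2"
    unfolding P_\<kappa> \<sigma>_def[symmetric] by (simp add: algebra_simps)
  also have "P * \<tau>2 * t1' ^ p\<^sup>2 = (w2 - v) * t1' ^ p\<^sup>2" by (simp add: w2_def)
  finally show ?thesis
    unfolding w3 etaR_v0_2 \<sigma>_def[symmetric] w2_def[symmetric] by (simp add: algebra_simps del: power_Suc)
qed

lemma T_G: "t1 \<in> polys (Zp p) (G 0)" "t1 \<in> polys (Zp p) (G 1)" "t1' \<in> polys (Zp p) (G 1)"
  "Var (T 1 2) \<in> polys (Zp p) (G 1)" "Var (T 1 3) \<in> polys (Zp p) (G 1)"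
  and v_G: "v \<in> polys (Zp p) (G 0)" "v \<in> polys (Zp p) (G 1)"
  using T_gens'[of 1 0] T_gens'[of 1 1] T_gens[of 1 1] V_gens[of 0 _ 2] N_ge
  by (auto intro!: Zp_Var simp: params(2,3) numeral_2_eq_2)

text \<open>The second iterate of \<open>frob\<close> is additive and agrees with the
  \<open>p^2\<close>-th power modulo \<open>p\<close>, which makes the numerator of
  \<open>\<kappa>\<close> divisible by \<open>p\<close>.\<close>

lemma \<kappa>_mem: "\<kappa> \<in> polys (Zp p) {T 1 1, T 2 1}"
proof (rule polys_Zp_RZ)
  interpret U: subring_on "polys UNIV {T 1 1, T 2 1}" by (rule subring_polys[OF subring_UNIV])
  show "\<kappa> \<in> polys UNIV {T 1 1, T 2 1}"
    unfolding \<kappa>_def by (intro U.mult_mem U.diff_mem U.power_mem U.add_mem cst_mem_polys UNIV_I Var_mem_polys subring_UNIV) auto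
  have "frobs 2 (t1 + t1') = t1 ^ p\<^sup>2 + t1' ^ p\<^sup>2"
    by (simp add: numeral_2_eq_2 frob.hom_add frob.hom_power power_mult[symmetric])
  then have "(t1 + t1') ^ p\<^sup>2 - t1 ^ p\<^sup>2 - t1' ^ p\<^sup>2 \<in> fil (- 1)"
    using frobs_cong[OF RZ.add_mem[OF Var_RZ Var_RZ], of "T 1 1" "T 2 1" 2] by (simp add: diff_diff_eq)
  then obtain y where "y \<in> RZ" "(t1 + t1') ^ p\<^sup>2 - t1 ^ p\<^sup>2 - t1' ^ p\<^sup>2 = P * y" unfolding fil_neg1_iff by blast
  then show "\<kappa> \<in> RZ" unfolding \<kappa>_def by (simp add: p_inv_p)
qed

lemma \<alpha>2_mem:
  assumes "T 1 1 \<in> H" "T 2 1 \<in> H" shows "\<alpha>2 \<in> polys (Zp p) H"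
proof -
  interpret H: subring_on "polys (Zp p) H" by (rule subring_polys[OF Zp.subring_on_axioms])
  show ?thesis unfolding \<alpha>2_def
    by (intro H.add_mem H.uminus_mem H.diff_mem H.mult_mem H.power_mem cst_mem_polys Zp.of_nat_mem Zp_Var assms)
qed

lemma \<alpha>3_mem:
  assumes "T 1 1 \<in> H" "T 2 1 \<in> H" "T 1 2 \<in> H" "V 0 2 \<in> H" shows "\<alpha>3 \<in> polys (Zp p) H"
proof -
  interpret H: subring_on "polys (Zp p) H" by (rule subring_polys[OF Zp.subring_on_axioms])
  have "\<kappa> \<in> polys (Zp p) H" using \<kappa>_mem polys_mono[OF order_refl, of "{T 1 1, T 2 1}" H "Zp p"] assms by auto
  then show ?thesis unfolding \<alpha>3_def \<tau>2_def
    by (intro H.add_mem H.uminus_mem H.diff_mem H.mult_mem H.power_mem cst_mem_polys Zp.of_nat_mem Zp_Var assms \<alpha>2_mem)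
qed

lemma T_genset: "T 1 1 \<in> G 1" "T 2 1 \<in> G 1" "T 1 2 \<in> G 1" "V 0 2 \<in> G 1"
  using T_gens'[of 1 1] T_gens[of 1 1] V_gens[of 0 1 2] N_ge by (auto simp: params(2,3) numeral_2_eq_2)

lemma \<tau>2_G: "\<tau>2 \<in> polys (Zp p) (G 1)" and \<tau>3_G: "\<tau>3 \<in> polys (Zp p) (G 1)"
  using subring_on.add_mem[OF subring_polys[OF Zp.subring_on_axioms]] T_G \<alpha>2_mem \<alpha>3_mem T_genset
  unfolding \<tau>2_def \<tau>3_def by blast+

lemma cf_\<omega>: "cf 0 1 (\<omega>T t1) = \<omega>T (t1 + t1')" "cf 0 0 (\<omega>T t1) = Var (V 1 2) * t1' ^ p\<^sup>2 - Var (V 1 2) ^ p * t1'"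
proof -
  have "cf 0 1 t1 = t1 + t1'" "cf 0 0 t1 = t1'" "cf 0 1 v = v" "cf 0 0 v = Var (V 1 2)"
    using cf_T_last[OF m_pos, of 0] by (simp_all add: cf_Var numeral_2_eq_2)
  then show "cf 0 1 (\<omega>T t1) = \<omega>T (t1 + t1')" "cf 0 0 (\<omega>T t1) = Var (V 1 2) * t1' ^ p\<^sup>2 - Var (V 1 2) ^ p * t1'"
    by (simp_all only: \<omega>T_def cf.hom_diff cf.hom_mult cf.hom_power)
qed

lemma dv_IZ: "Var (V 1 2) - v - P * \<tau>2 \<in> IZ 1"
proof (rule IQ_RZ)
  show "Var (V 1 2) - v - P * \<tau>2 \<in> RZ"
    by (intro RZ.diff_mem RZ.mult_mem Var_RZ cst_RZ Zp.of_nat_mem polys_RZ[OF \<tau>2_G])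
  show "Var (V 1 2) - v - P * \<tau>2 \<in> IQ 1"
    using etaR_v0[of 2] unfolding etaR_v0_2 vgen_2 by (simp add: diff_diff_eq)
qed

lemma dw_IZ: "cf 0 0 (\<omega>T t1) - cf 0 1 (\<omega>T t1) - P * \<tau>3 \<in> IZ 1"
proof (rule IQ_RZ)
  let ?V = "Var (V 1 2)" and ?w = "etaR p v0 (tg 1) 2"
  show "cf 0 0 (\<omega>T t1) - cf 0 1 (\<omega>T t1) - P * \<tau>3 \<in> RZ"
    unfolding cf_\<omega> unfolding \<omega>T_def
    by (intro RZ.diff_mem RZ.mult_mem RZ.power_mem RZ.add_mem Var_RZ cst_RZ Zp.of_nat_mem polys_RZ[OF \<tau>3_G])
  have 3: "- etaR p v0 (tg 1) 3 \<in> IQ 1" using etaR_v0[of 3] by (simp add: vgen_def params(1))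
  have 2: "IQ.eqv 1 ?V ?w" using etaR_v0[of 2] unfolding vgen_2 by (simp add: IQ.eqv_def)
  have "cf 0 0 (\<omega>T t1) - cf 0 1 (\<omega>T t1) - P * \<tau>3 =
    (?V * t1' ^ p\<^sup>2 - ?w * t1' ^ p\<^sup>2) - (?V ^ p * t1' - ?w ^ p * t1') + (- etaR p v0 (tg 1) 3)"
    unfolding cf_\<omega> etaR_v0_3[symmetric] by (simp add: \<omega>T_def algebra_simps)
  also have "\<dots> \<in> IQ 1"
  proof (rule IQ.iadd[OF IQ.idiff 3])
    show "?V * t1' ^ p\<^sup>2 - ?w * t1' ^ p\<^sup>2 \<in> IQ 1"
      using IQ.eqv_mult'[OF 2 IQ.eqv_refl] by (simp add: IQ.eqv_def)
    show "?V ^ p * t1' - ?w ^ p * t1' \<in> IQ 1"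
      using IQ.eqv_mult'[OF IQ.eqv_power'[OF 2] IQ.eqv_refl] by (simp add: IQ.eqv_def)
  qed
  finally show "cf 0 0 (\<omega>T t1) - cf 0 1 (\<omega>T t1) - P * \<tau>3 \<in> IQ 1" .
qed

definition \<Omega> :: "laurent poly" where "\<Omega> = monom (lau 1 1) (p\<^sup>2) - monom (lau (int p) 1) 1"

lemma lau_nz: "lau a 1 \<noteq> 0"
proof
  assume "lau a 1 = 0"
  then have "Poly_Mapping.lookup (lau a 1) a = 0" by simp
  then show False by (simp add: lau_lookup)
qed

lemma degree_\<Omega>: "degree \<Omega> = p\<^sup>2" "lead_coeff \<Omega> = lau 1 1"
proof -
  have "degree (monom (lau (int p) 1) 1) < degree (monom (lau 1 1) (p\<^sup>2))"
    using one_less_power[OF p_gt_1, of 2] lau_nz by (simp add: degree_monom_eq)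
  then show d: "degree \<Omega> = p\<^sup>2"
    unfolding \<Omega>_def using degree_add_eq_left[of "- monom (lau (int p) 1) 1" "monom (lau 1 1) (p\<^sup>2)"] lau_nz
    by (simp add: degree_monom_eq)
  show "lead_coeff \<Omega> = lau 1 1"
    unfolding d using one_less_power[OF p_gt_1, of 2] by (simp add: \<Omega>_def)
qed

lemma Phi_\<omega>T: "Phi y c (Var g) = [:0, 1:] \<Longrightarrow> Phi y c (\<omega>T (Var g)) = \<Omega>"
  unfolding \<omega>T_def \<Omega>_def
  by (simp add: Phi.hom_diff Phi.hom_mult Phi.hom_power Phi_Var[of _ _ "V 0 2"] poly_const_pow lau_power monom_altdef)

sublocale cobar_basis p N r m "\<omega>T t1" \<tau>2 \<tau>3 "\<omega>T t1'" \<alpha>2 \<alpha>3 "T 1 1" "T 2 1" "[:0, lau 0 (- of_nat p):]" \<Omega> 1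
proof
  interpret P0: subring_on "polys (Zp p) (G 0)" by (rule subring_polys[OF Zp.subring_on_axioms])
  interpret U0: subring_on "polys (Zp p) (U0 1)" by (rule subring_polys[OF Zp.subring_on_axioms])
  show "odd p" by (rule odd_p)
  show "\<omega>T t1 \<in> polys (Zp p) (G 0)" unfolding \<omega>T_def by (intro P0.diff_mem P0.mult_mem P0.power_mem v_G T_G)
  show "\<tau>2 \<in> polys (Zp p) (G 1)" "\<tau>3 \<in> polys (Zp p) (G 1)" by (rule \<tau>2_G, rule \<tau>3_G)
  show "Var (V 1 2) - v - P * \<tau>2 \<in> IZ 1" by (rule dv_IZ)
  show "cf 0 0 (\<omega>T t1) - cf 0 1 (\<omega>T t1) - P * \<tau>3 \<in> IZ 1" by (rule dw_IZ)
  \<comment> \<open>The value \<open>- p y\<close> for \<open>v_1\<close> is dictated by the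
    relation \<open>v_1 + p t_1 = 0\<close>, as \<open>t_1\<close> is sent to the indeterminate
    \<open>y\<close>.\<close>
  have "mrel 0 = Var (V 0 1) + P * t1"
    using etaR_mg_1[of 0] unfolding Tlast_def using m_pos by simp
  then show "Phi (T 1 1) [:0, lau 0 (- of_nat p):] (mrel 0) = 0"
    by (simp only:) (simp add: Phi.hom_add Phi.hom_mult Phi_Var lau_def single_uminus)
  have nn: "- of_nat p \<in> Zp p" by (intro Zp.uminus_mem Zp.of_nat_mem)
  show "[:0, lau 0 (- of_nat p):] \<in> LZ"
    using lau_LZ1[OF nn, of 0] by (auto simp: LZ_def coeff_pCons LZ1.zero_mem split: nat.split)
  show "Phi (T 1 1) [:0, lau 0 (- of_nat p):] (\<omega>T t1) = \<Omega>" by (rule Phi_\<omega>T) (simp add: Phi_Var)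
  show "Phi (T 2 1) 0 (\<omega>T t1') = \<Omega>" by (rule Phi_\<omega>T) (simp add: Phi_Var)
  show "\<Omega> \<in> LZ"
    by (auto simp: \<Omega>_def LZ_def intro!: LZ1.diff_mem LZ1.uminus_mem LZ1.zero_mem lau_LZ1 Zp.one_mem Zp.zero_mem)
  show "1 \<le> degree \<Omega>" using p_gt_0 by (simp add: degree_\<Omega>(1) Suc_le_eq)
  show "lead_coeff \<Omega> = lau 1 1" by (rule degree_\<Omega>(2))
  show "\<omega>T t1' \<in> polys (Zp p) (U0 1)"
    unfolding \<omega>T_def by (intro U0.diff_mem U0.mult_mem U0.power_mem Zp_Var) (auto simp: U0_def numeral_2_eq_2)
  have \<alpha>R: "\<tau>2 \<in> RZ" "\<tau>3 \<in> RZ" using polys_RZ \<tau>2_G \<tau>3_G by blast+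
  \<comment> \<open>The left coface of \<open>\<omega>\<close> contains \<open>t_1 + t_1'\<close>.
    Invariance of \<open>\<omega>\<close> and \<open>v_2\<close> modulo \<open>p\<close> replaces it
    by the same expression in \<open>t_1'\<close>, a variable that is not eliminated.\<close>
  show "cf 0 1 (\<omega>T t1) - \<omega>T t1' \<in> JZ 1"
  proof -
    have "Var (V 1 2) - v \<in> JZ 1" using JZ.iadd[OF IZ_J[OF dv_IZ] p_J[OF \<alpha>R(1)]] by simp
    then have V: "JZ.eqv 1 (Var (V 1 2)) v" by (simp add: JZ.eqv_def)
    have "cf 0 0 (\<omega>T t1) - cf 0 1 (\<omega>T t1) \<in> JZ 1" using JZ.iadd[OF IZ_J[OF dw_IZ] p_J[OF \<alpha>R(2)]] by simp
    then have "JZ.eqv 1 (cf 0 0 (\<omega>T t1)) (cf 0 1 (\<omega>T t1))" by (simp add: JZ.eqv_def)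
    then have "JZ.eqv 1 (cf 0 1 (\<omega>T t1)) (cf 0 0 (\<omega>T t1))" by (rule JZ.eqv_sym)
    also have "JZ.eqv 1 (cf 0 0 (\<omega>T t1)) (\<omega>T t1')"
      unfolding cf_\<omega> unfolding \<omega>T_def by (intro JZ.eqv_diff JZ.eqv_mult JZ.eqv_power V JZ.eqv_refl RZ.power_mem Var_RZ)
    finally show ?thesis by (simp add: JZ.eqv_def)
  qed
  show "\<tau>2 - (Var (T 1 2) + \<alpha>2) \<in> JZ 1" "\<tau>3 - (Var (T 1 3) + \<alpha>3) \<in> JZ 1"
    by (simp_all add: \<tau>2_def \<tau>3_def JZ.izero)
  show "\<alpha>2 \<in> polys (Zp p) (U3 1 (1 - r))"
    by (rule \<alpha>2_mem; unfold U3_def U2_def U1_def U0_def; unfold params(2); auto simp: numeral_2_eq_2)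
  show "\<alpha>3 \<in> polys (Zp p) (U3 1 (2 - r))"
    by (rule \<alpha>3_mem; unfold U3_def U2_def U1_def U0_def; unfold params(2); auto simp: numeral_2_eq_2)
qed

end

lemma coeff_linear_power:
  fixes a :: "'a :: comm_ring_1"
  shows "degree ([:a, 1:] ^ k) \<le> k" "coeff ([:a, 1:] ^ k) k = 1"
proof -
  have "degree ([:a, 1:] ^ k) \<le> k \<and> coeff ([:a, 1:] ^ k) k = 1"
  proof (induction k)
    case (Suc k)
    have "degree ([:a, 1:] ^ Suc k) \<le> degree [:a, 1:] + degree ([:a, 1:] ^ k)"
      unfolding power_Suc by (rule degree_mult_le)
    also have "\<dots> \<le> Suc k" using Suc by simp
    finally show ?case using Suc by (simp add: coeff_eq_0 le_imp_less_Suc)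
  qed simp
  then show "degree ([:a, 1:] ^ k) \<le> k" "coeff ([:a, 1:] ^ k) k = 1" by auto
qed

section \<open>Invariants modulo p for T(1)/(v_1)\<close>

context cobar_T1 begin

abbreviation "\<omega> \<equiv> \<omega>T t1"

text \<open>
  The ring in degree \<open>0\<close> is free on \<open>v\<^sub>2^a t\<^sub>1^k \<omega>^j\<close> with \<open>k < p\<^sup>2\<close>, since \<open>\<omega>\<close> is a unit times a monic polynomial in
  \<open>t\<^sub>1\<close>; the value \<open>0\<close> for other \<open>k\<close> only serves to make \<open>bas\<close> total.
\<close>

definition bas :: "int \<times> nat \<times> nat \<Rightarrow> pol" where
  "bas i = (case i of (a, k, j) \<Rightarrow> if k < p\<^sup>2 then Pv 0 a * t1 ^ k * \<omega> ^ j else 0)"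

lemma bas_G: "bas i \<in> polys (Zp p) (G 0)"
  unfolding bas_def by (cases i) (auto intro!: P0.mult_mem P0.power_mem Pv0_G T_G(1)[simplified] \<omega>_G[simplified] P0.zero_mem)

lemma p2: "1 < p\<^sup>2" using one_less_power[OF p_gt_1, of 2] by simp

lemma rep_bas_v: "rep 0 bas (v * bas i)" and rep_bas_w: "rep 0 bas (Var (W 0) * bas i)"
proof -
  obtain a k j where i: "i = (a, k, j)" by (cases i)
  have R: "t1 ^ k * \<omega> ^ j \<in> RZ" by (intro RZ.mult_mem RZ.power_mem Var_RZ polys_RZ[OF \<omega>_G])
  show "rep 0 bas (v * bas i)"
  proof (rule rep_cong[OF _ rep_base])
    have "v * bas i - bas (a + 1, k, j) = (if k < p\<^sup>2 then (v * Pv 0 a - Pv 0 (a + 1)) * (t1 ^ k * \<omega> ^ j) else 0)"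
      by (simp add: i bas_def algebra_simps)
    also have "\<dots> \<in> IZ 0" using IZ.imult2[OF R] Pv_V[of 0 0 a] IZ.izero by (simp add: IZ.eqv_def)
    finally show "v * bas i - bas (a + 1, k, j) \<in> IZ 0" .
  qed
  show "rep 0 bas (Var (W 0) * bas i)"
  proof (rule rep_cong[OF _ rep_base])
    have "Var (W 0) * bas i - bas (a - 1, k, j) =
        (if k < p\<^sup>2 then (Var (W 0) * Pv 0 a - Pv 0 (a - 1)) * (t1 ^ k * \<omega> ^ j) else 0)"
      by (simp add: i bas_def algebra_simps)
    also have "\<dots> \<in> IZ 0" using IZ.imult2[OF R] Pv_W[of 0 0 a] IZ.izero by (simp add: IZ.eqv_def)
    finally show "Var (W 0) * bas i - bas (a - 1, k, j) \<in> IZ 0" .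
  qed
qed

lemma rep_bas_v_power: "rep 0 bas h \<Longrightarrow> rep 0 bas (v ^ n * h)"
  by (induction n) (auto simp: mult.assoc intro: rep_mult[OF Var_RZ rep_bas_v])

lemma rep_bas_t: "rep 0 bas (t1 * bas i)"
proof -
  obtain a k j where i: "i = (a, k, j)" by (cases i)
  consider "k + 1 < p\<^sup>2" | "k + 1 = p\<^sup>2" | "p\<^sup>2 \<le> k" by linarith
  then show ?thesis
  proof cases
    case 1
    then have "t1 * bas i = bas (a, k + 1, j)" by (simp add: i bas_def algebra_simps)
    then show ?thesis by (simp only: rep_base)
  next
    case 2
    \<comment> \<open>At the boundary, \<open>t_1^(p^2)\<close> is rewritten as
      \<open>v_2^(-1) * (\<omega> + v_2^p t_1)\<close>.\<close>
    have "rep 0 bas (Var (W 0) * bas (a, 0, j + 1))" by (rule rep_bas_w)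
    moreover have "rep 0 bas (Var (W 0) * (v ^ p * bas (a, 1, j)))"
      by (intro rep_mult[OF Var_RZ rep_bas_w] rep_bas_v_power rep_base)
    ultimately have "rep 0 bas (Var (W 0) * bas (a, 0, j + 1) + Var (W 0) * (v ^ p * bas (a, 1, j)))" by (rule rep_add)
    moreover have "t1 * bas i - (Var (W 0) * bas (a, 0, j + 1) + Var (W 0) * (v ^ p * bas (a, 1, j))) \<in> IZ 0"
    proof -
      have tt: "t1 * t1 ^ k = t1 ^ p\<^sup>2" unfolding 2[symmetric] by simp
      have "bas (a, 0, j + 1) = Pv 0 a * \<omega> ^ j * \<omega>" "bas (a, 1, j) = Pv 0 a * t1 * \<omega> ^ j"
        using p2 p_gt_0 by (simp_all add: bas_def)
      moreover have "t1 * bas i = Pv 0 a * t1 ^ p\<^sup>2 * \<omega> ^ j"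
        using 2 unfolding tt[symmetric] by (simp add: i bas_def mult_ac)
      ultimately have "t1 * bas i - (Var (W 0) * bas (a, 0, j + 1) + Var (W 0) * (v ^ p * bas (a, 1, j))) =
         - (wrel 0 * (Pv 0 a * t1 ^ p\<^sup>2 * \<omega> ^ j)) + Var (W 0) * Pv 0 a * \<omega> ^ j * (v * t1 ^ p\<^sup>2 - v ^ p * t1 - \<omega>)"
        by (simp add: algebra_simps)
      also have "v * t1 ^ p\<^sup>2 - v ^ p * t1 - \<omega> = 0" by (simp add: \<omega>T_def)
      also have "- (wrel 0 * (Pv 0 a * t1 ^ p\<^sup>2 * \<omega> ^ j)) + Var (W 0) * Pv 0 a * \<omega> ^ j * 0 \<in> IZ 0"
        by (simp only: mult_zero_right add_0_right)
          (intro IZ.iuminus IZ.imult2 wrel_IZ RZ.mult_mem RZ.power_mem Pv_RZ Var_RZ polys_RZ[OF \<omega>_G] order_refl)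
      finally show ?thesis .
    qed
    ultimately show ?thesis by (rule rep_cong[rotated])
  next
    case 3
    then show ?thesis by (simp add: i bas_def rep_zero)
  qed
qed

lemma rep_bas:
  assumes "z \<in> polys (Zp p) (G 0)" shows "rep 0 bas z"
proof (rule rep_all[OF assms])
  have "bas (0, 0, 0) = 1" using p_gt_0 by (simp add: bas_def)
  then show "rep 0 bas 1" using rep_base[of 0 bas "(0, 0, 0)"] by simp
  fix g i assume "g \<in> G 0"
  then consider "g = V 0 1" | "g = V 0 2" | "g = W 0" | "g = T 1 1"
  proof (cases g rule: gens_0_cases)
    case (1 k)
    then have "k = 1 \<or> k = 2" unfolding params by auto
    then show ?thesis using 1 that by blast
  qed (use that in auto)
  then show "rep 0 bas (Var g * bas i)"
  proof cases
    case 1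
    have "rep 0 bas (cst (- of_nat p) * (t1 * bas i))"
      by (intro rep_smult Zp.uminus_mem Zp.of_nat_mem rep_bas_t)
    moreover have "Var g * bas i - cst (- of_nat p) * (t1 * bas i) = (Var (V 0 1) + P * t1) * bas i"
      by (simp add: 1 cst.hom_uminus algebra_simps)
    moreover have "Var (V 0 1) + P * t1 \<in> IZ 0"
      using rel_IZ[OF rel_M[of 0]] unfolding etaR_mg_1 Tlast_def using m_pos by simp
    ultimately show ?thesis using rep_cong IZ.imult2[OF polys_RZ[OF bas_G]] by metis
  qed (use rep_bas_v rep_bas_w rep_bas_t in simp_all)
qed

text \<open>The coboundary of \<open>bas i\<close> modulo \<open>p\<close> when
  \<open>k < p^2\<close>: \<open>v_2\<close> and \<open>\<omega>\<close> are invariant there, so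
  only \<open>t_1^k\<close> contributes.\<close>

definition dbas :: "int \<times> nat \<times> nat \<Rightarrow> pol" where
  "dbas i = (case i of (a, k, j) \<Rightarrow> Pv 0 a * \<omega>T t1' ^ j * (t1' ^ k - (t1 + t1') ^ k))"

lemma T_RZ: "\<tau>2 \<in> RZ" "\<tau>3 \<in> RZ" "\<omega>0 \<in> RZ" "\<omega>1 \<in> RZ" "\<omega>T t1' \<in> RZ"
  using polys_RZ[OF \<tau>2_G] polys_RZ[OF \<tau>3_G] polys_RZ[OF \<omega>0_G] polys_RZ[OF \<omega>1_G] polys_RZ[OF \<omega>'_U] by auto

lemma d_bas:
  assumes "k < p\<^sup>2" shows "d 0 (bas (a, k, j)) - dbas (a, k, j) \<in> JZ 1"
proof -
  have cft: "cf 0 1 t1 = t1 + t1'" "cf 0 0 t1 = t1'"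
    using cf_T_last[OF m_pos, of 0] by (simp_all add: cf_Var numeral_2_eq_2)
  have cP: "cf 0 0 (Pv 0 a) = Pv 1 a" "cf 0 1 (Pv 0 a) = Pv 0 a"
    by (auto simp: Pv_def cf.hom_power cf_Var)
  have P: "JZ.eqv 1 (Pv 1 a) (Pv 0 a)"
  proof -
    obtain A where A: "A \<in> polys (Zp p) (G 1)" "Pv 1 a - Pv 0 a - cst (of_int a * of_nat p) * A \<in> IZ 1"
      using Pv_diff by blast
    have "cst (of_int a * of_nat p) * A = P * (cst (of_int a) * A)" by (simp add: cst.hom_mult mult_ac)
    also have "\<dots> \<in> JZ 1" by (intro p_J RZ.mult_mem cst_RZ Zp.of_int_mem polys_RZ[OF A(1)])
    finally show ?thesis using JZ.iadd[OF IZ_J[OF A(2)]] by (fastforce simp: JZ.eqv_def)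
  qed
  have w0: "JZ.eqv 1 \<omega>0 (\<omega>T t1')" using \<omega>'_J by (simp add: JZ.eqv_def)
  have "\<omega>1 - \<omega>0 \<in> JZ 1" using JZ.iadd[OF IZ_J[OF dw] p_J[OF T_RZ(2)]] by simp
  then have "JZ.eqv 1 \<omega>1 \<omega>0" by (simp add: JZ.eqv_def)
  then have w1: "JZ.eqv 1 \<omega>1 (\<omega>T t1')" using w0 by (rule JZ.eqv_trans)
  have "JZ.eqv 1 (Pv 1 a * t1' ^ k * \<omega>1 ^ j - Pv 0 a * (t1 + t1') ^ k * \<omega>0 ^ j)
     (Pv 0 a * t1' ^ k * \<omega>T t1' ^ j - Pv 0 a * (t1 + t1') ^ k * \<omega>T t1' ^ j)"
    by (intro JZ.eqv_diff JZ.eqv_mult[OF JZ.eqv_mult] JZ.eqv_power w0 w1 P JZ.eqv_refl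
        RZ.mult_mem RZ.power_mem RZ.add_mem Var_RZ Pv_RZ T_RZ)
  then show ?thesis
    using assms by (simp add: d_0 bas_def dbas_def cf.hom_mult cf.hom_power cft[simplified] cP[simplified] JZ.eqv_def algebra_simps)
qed

lemma dbas_U: "dbas i \<in> polys (Zp p) (U3 1 1)" and dbas_RZ: "dbas i \<in> RZ"
proof -
  interpret U: subring_on "polys (Zp p) (U3 1 1)" by (rule subring_polys[OF Zp.subring_on_axioms])
  have "T 1 1 \<in> U3 1 1" unfolding U3_def unfolding params(2) by auto
  moreover have "U0 1 \<subseteq> U3 1 1" by (auto simp: U3_def U2_def U1_def)
  moreover have "T 2 1 \<in> U0 1" "V 0 2 \<in> U0 1" "W 0 \<in> U0 1" by (auto simp: U0_def numeral_2_eq_2)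
  moreover have "\<omega>T t1' \<in> polys (Zp p) (U3 1 1)" using \<omega>'_U polys_mono[OF order_refl \<open>U0 1 \<subseteq> U3 1 1\<close>] by blast
  ultimately show "dbas i \<in> polys (Zp p) (U3 1 1)"
    unfolding dbas_def case_prod_unfold
    by (intro U.mult_mem U.diff_mem U.power_mem U.add_mem Pv_polys Zp_Var) auto
  then show "dbas i \<in> RZ" by (rule polys_RZ)
qed

lemma coeffs_dbas:
  "coeffs_in (T 1 1) (dbas (a, k, j)) = smult (Pv 0 a * \<omega>T t1' ^ j) ([:t1' ^ k:] - [:t1', 1:] ^ k)"
proof -
  have U: "Pv 0 a * \<omega>T t1' ^ j \<in> polys (Zp p) (U0 1)" "t1' \<in> polys (Zp p) (U0 1)"
  proof -
    interpret U: subring_on "polys (Zp p) (U0 1)" by (rule subring_polys[OF Zp.subring_on_axioms])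
    show "Pv 0 a * \<omega>T t1' ^ j \<in> polys (Zp p) (U0 1)"
      by (intro U.mult_mem U.power_mem \<omega>'_U Pv_polys) (auto simp: U0_def)
    show "t1' \<in> polys (Zp p) (U0 1)" by (intro Zp_Var) (auto simp: U0_def numeral_2_eq_2)
  qed
  have "T 1 1 \<notin> U0 1" by (simp add: U0_def)
  note free = coeffs_in_free[OF U(1) this] coeffs_in_free[OF U(2) this]
  show ?thesis
    unfolding dbas_def prod.case coeffs_in.hom_mult[of _ "Pv 0 a * \<omega>T t1' ^ j"] coeffs_in.hom_diff
      coeffs_in.hom_power coeffs_in.hom_add free coeffs_in_Var[of _ "T 1 1"]
    by (simp add: poly_const_pow)
qed

text \<open>In degree \<open>k\<close> of \<open>t_1\<close> only the terms with exactly that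
  exponent survive, with leading part \<open>- v_2^a \<omega>'^j\<close>. As \<open>k < p^2\<close>,
  this coefficient can be read off, and the base case of independence applies.\<close>

lemma dbas_detect:
  assumes F: "finite F" "\<And>i. i \<in> F \<Longrightarrow> fst (snd i) \<le> k" and k: "1 \<le> k" "k < p\<^sup>2" and c: "\<And>i. c i \<in> Zp p"
    and J: "(\<Sum>i\<in>F. cst (c i) * dbas i) \<in> JZ 1" and i: "i \<in> F" "fst (snd i) = k"
  shows "c i / of_nat p \<in> Zp p"
proof -
  define D where "D = (\<Sum>i\<in>F. cst (c i) * dbas i)"
  interpret U: subring_on "polys (Zp p) (U3 1 1)" by (rule subring_polys[OF Zp.subring_on_axioms])
  interpret V: subring_on "polys (Zp p) (U0 1)" by (rule subring_polys[OF Zp.subring_on_axioms])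
  define Fk where "Fk = (\<lambda>i. (fst i, snd (snd i))) ` {i\<in>F. fst (snd i) = k}"
  define \<beta> where "\<beta> j = c (fst j, k, snd j)" for j
  let ?t = "\<lambda>i. smult (cst (c i) * (Pv 0 (fst i) * \<omega>T t1' ^ snd (snd i))) ([:t1' ^ fst (snd i):] - [:t1', 1:] ^ fst (snd i))"
  have cD: "coeffs_in (T 1 1) D = (\<Sum>i\<in>F. ?t i)"
    unfolding D_def coeffs_in.hom_sum
  proof (rule sum.cong[OF HOL.refl])
    fix i show "coeffs_in (T 1 1) (cst (c i) * dbas i) = ?t i"
      using coeffs_dbas[of "fst i" "fst (snd i)" "snd (snd i)"] by (simp add: coeffs_in.hom_mult mult_ac)
  qed
  have dt: "degree (?t i) \<le> k" if "i \<in> F" for i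
  proof -
    have "degree ([:t1' ^ fst (snd i):] - [:t1', 1:] ^ fst (snd i)) \<le> k"
      using F(2)[OF that] order_trans[OF coeff_linear_power(1)] by (intro degree_diff_le) auto
    then show ?thesis using degree_smult_le order_trans by blast
  qed
  have "degree (coeffs_in (T 1 1) D) \<le> k" unfolding cD by (intro degree_sum_le F(1) dt)
  then have deg: "degree (coeffs_in (T 1 1) D) < p\<^sup>2" using k(2) by simp
  have "D \<in> polys (Zp p) (U3 1 1)" unfolding D_def by (intro U.sum_mem U.mult_mem cst_mem_polys c dbas_U)
  with J have "D \<in> Jid (S3 1 (Suc 0))" unfolding D_def[symmetric] using JZ_S3[of D 1 1] by simp
  moreover have T: "T 1 (r + 0 + 1) = T 1 1" by (simp add: params(2))
  ultimately have co: "coeff (coeffs_in (T 1 1) D) k \<in> Jid (S3 1 0)"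
    using S3_1_coeff[of D 0 k] deg unfolding T by blast
  have ct: "coeff (?t i) k = (if fst (snd i) = k then - (cst (c i) * (Pv 0 (fst i) * \<omega>T t1' ^ snd (snd i))) else 0)"
    if "i \<in> F" for i
  proof -
    have "coeff [:t1' ^ fst (snd i):] k = 0" using k(1) by (simp add: coeff_pCons split: nat.split)
    moreover have "coeff ([:t1', 1:] ^ fst (snd i)) k = (if fst (snd i) = k then 1 else 0)"
    proof (cases "fst (snd i) = k")
      case True
      then show ?thesis using coeff_linear_power(2)[of t1' k] by simp
    next
      case False
      then have "degree ([:t1', 1:] ^ fst (snd i)) < k"
        using F(2)[OF that] by (intro le_less_trans[OF coeff_linear_power(1)]) simp
      then show ?thesis using False by (simp add: coeff_eq_0)
    qed
    ultimately show ?thesis by simp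
  qed
  have "coeff (coeffs_in (T 1 1) D) k = - (\<Sum>i\<in>{i\<in>F. fst (snd i) = k}. cst (c i) * (Pv 0 (fst i) * \<omega>T t1' ^ snd (snd i)))"
    unfolding cD coeff_sum using ct F(1) by (simp add: sum.inter_filter[symmetric] sum_negf[symmetric])
  also have "(\<Sum>i\<in>{i\<in>F. fst (snd i) = k}. cst (c i) * (Pv 0 (fst i) * \<omega>T t1' ^ snd (snd i))) = lc' Fk \<beta> (\<omega>T t1')"
    unfolding lc'_def Fk_def
    by (subst sum.reindex) (auto simp: inj_on_def prod_eq_iff \<beta>_def intro!: sum.cong)
  finally have "- lc' Fk \<beta> (\<omega>T t1') \<in> Jid (S3 1 0)" using co by simp
  then have "lc' Fk \<beta> (\<omega>T t1') \<in> Jid (S3 1 0)" using J.iuminus by fastforce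
  moreover have "lc' Fk \<beta> (\<omega>T t1') \<in> polys (Zp p) (U0 1)"
    unfolding lc'_def \<beta>_def
    by (intro V.sum_mem V.mult_mem V.power_mem \<omega>'_U cst_mem_polys c Pv_polys) (auto simp: U0_def)
  ultimately have "lc' Fk \<beta> (\<omega>T t1') \<in> Jid {wrel 0}" by (rule S3_detect)
  moreover have "(fst i, snd (snd i)) \<in> Fk" using i by (auto simp: Fk_def)
  moreover have "finite Fk" using F(1) by (simp add: Fk_def)
  ultimately have "\<beta> (fst i, snd (snd i)) / of_nat p \<in> Zp p" by (intro lc'_base_detect)
  moreover have "i = (fst i, k, snd (snd i))" using i(2) by (simp add: prod_eq_iff)
  ultimately show ?thesis by (simp add: \<beta>_def)
qed

text \<open>The binomials of larger exponents also reach degree \<open>k\<close>, so the exponents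
  are treated in descending order: terms already known to be multiples of \<open>p\<close> are
  subtracted before \<open>k\<close> becomes the top one.\<close>

lemma dbas_descend:
  assumes F: "finite F" "\<And>i. i \<in> F \<Longrightarrow> fst (snd i) < p\<^sup>2" and c: "\<And>i. c i \<in> Zp p"
    and J: "(\<Sum>i\<in>F. cst (c i) * dbas i) \<in> JZ 1"
  shows "1 \<le> k \<Longrightarrow> i \<in> F \<Longrightarrow> fst (snd i) = k \<Longrightarrow> c i / of_nat p \<in> Zp p"
proof (induction "p\<^sup>2 - k" arbitrary: k i rule: less_induct)
  case less
  define F' where "F' = {i\<in>F. fst (snd i) \<le> k}"
  have k: "k < p\<^sup>2" using F(2)[OF less.prems(2)] less.prems(3) by simp
  have big: "c j / of_nat p \<in> Zp p" if "j \<in> F - F'" for j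
  proof -
    have j: "j \<in> F" "k < fst (snd j)" using that by (auto simp: F'_def)
    show ?thesis using less.hyps[of "fst (snd j)" j] j F(2)[OF j(1)] less.prems(1) by auto
  qed
  have "(\<Sum>i\<in>F'. cst (c i) * dbas i) = (\<Sum>i\<in>F. cst (c i) * dbas i) - (\<Sum>i\<in>F - F'. cst (c i) * dbas i)"
    using F(1) by (simp add: F'_def sum_diff)
  also have "(\<Sum>i\<in>F - F'. cst (c i) * dbas i) = (\<Sum>i\<in>F - F'. P * (cst (c i / of_nat p) * dbas i))"
    using p_gt_0 by (intro sum.cong) (simp_all add: mult.assoc[symmetric] cst.hom_mult[symmetric])
  also have "(\<Sum>i\<in>F. cst (c i) * dbas i) - \<dots> \<in> JZ 1"
    by (intro JZ.idiff J JZ.isum p_J RZ.mult_mem cst_RZ big dbas_RZ)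
  finally have "(\<Sum>i\<in>F'. cst (c i) * dbas i) \<in> JZ 1" .
  moreover have "finite F'" "i \<in> F'" "\<And>i. i \<in> F' \<Longrightarrow> fst (snd i) \<le> k"
    using F(1) less.prems(2,3) by (auto simp: F'_def)
  ultimately show ?case using dbas_detect less.prems(1,3) k c by blast
qed

text \<open>In the basis \<open>bas\<close>, the terms with a positive power of \<open>t_1\<close>
  outside \<open>\<omega>\<close> have coefficients divisible by \<open>p\<close> and make up
  \<open>p z'\<close>. The others are of the form \<open>lam\<close>.\<close>

sublocale cobar_basis_spanning p N r m \<omega> \<tau>2 \<tau>3 "\<omega>T t1'" \<alpha>2 \<alpha>3 "T 1 1" "T 2 1" "[:0, lau 0 (- of_nat p):]" \<Omega> 1
proof
  fix z assume z: "z \<in> polys (Zp p) (G 0)" "d 0 z \<in> JZ 1"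
  obtain F0 c where F0: "finite F0" "\<And>i. c i \<in> Zp p" "z - (\<Sum>i\<in>F0. cst (c i) * bas i) \<in> IZ 0"
    using rep_bas[OF z(1)] unfolding rep_def by blast
  define F where "F = {i\<in>F0. fst (snd i) < p\<^sup>2}"
  have F: "finite F" "\<And>i. i \<in> F \<Longrightarrow> fst (snd i) < p\<^sup>2" using F0(1) by (auto simp: F_def)
  have "(\<Sum>i\<in>F0. cst (c i) * bas i) = (\<Sum>i\<in>F. cst (c i) * bas i)"
    unfolding F_def by (rule sum.mono_neutral_right[OF F0(1)]) (auto simp: bas_def split: if_splits)
  then have zF: "z - (\<Sum>i\<in>F. cst (c i) * bas i) \<in> IZ 0" using F0(3) by simp
  have SG: "(\<Sum>i\<in>F. cst (c i) * bas i) \<in> polys (Zp p) (G 0)"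
    by (intro P0.sum_mem P0.mult_mem cst_mem_polys F0 bas_G)
  have "d 0 z - (\<Sum>i\<in>F. cst (c i) * d 0 (bas i)) \<in> IZ 1"
    using d_IZ[OF P0.diff_mem[OF z(1) SG] zF] by (simp add: d_diff d_sum d_smult)
  then have "(\<Sum>i\<in>F. cst (c i) * d 0 (bas i)) \<in> JZ 1" using JZ.idiff[OF z(2) IZ_J] by force
  moreover have "(\<Sum>i\<in>F. cst (c i) * (d 0 (bas i) - dbas i)) \<in> JZ 1"
  proof (intro JZ.isum JZ.imult cst_RZ F0)
    fix i assume "i \<in> F"
    then show "d 0 (bas i) - dbas i \<in> JZ 1"
      using d_bas[of "fst (snd i)" "fst i" "snd (snd i)"] F(2) by simp
  qed
  ultimately have "(\<Sum>i\<in>F. cst (c i) * d 0 (bas i)) - (\<Sum>i\<in>F. cst (c i) * (d 0 (bas i) - dbas i)) \<in> JZ 1"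
    by (rule JZ.idiff)
  then have J: "(\<Sum>i\<in>F. cst (c i) * dbas i) \<in> JZ 1" by (simp add: right_diff_distrib sum_subtractf)
  have cp: "c i / of_nat p \<in> Zp p" if "i \<in> F - {i\<in>F. fst (snd i) = 0}" for i
    using dbas_descend[OF F F0(2) J, of "fst (snd i)" i] that by auto
  let ?F0 = "{i\<in>F. fst (snd i) = 0}"
  define z' where "z' = (\<Sum>i\<in>F - ?F0. cst (c i / of_nat p) * bas i)"
  have "z' \<in> polys (Zp p) (G 0)"
    unfolding z'_def by (intro P0.sum_mem P0.mult_mem cst_mem_polys cp bas_G)
  moreover have "rep 0 lam (z - P * z')"
  proof (rule rep_cong)
    have "P * z' = (\<Sum>i\<in>F - ?F0. cst (c i) * bas i)"
      unfolding z'_def sum_distrib_left using p_gt_0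
      by (intro sum.cong) (simp_all add: mult.assoc[symmetric] cst.hom_mult[symmetric])
    also have "\<dots> = (\<Sum>i\<in>F. cst (c i) * bas i) - (\<Sum>i\<in>?F0. cst (c i) * bas i)"
      using F(1) by (simp add: sum_diff)
    finally have e: "z - P * z' - (\<Sum>i\<in>?F0. cst (c i) * bas i) = z - (\<Sum>i\<in>F. cst (c i) * bas i)" by simp
    show "z - P * z' - (\<Sum>i\<in>?F0. cst (c i) * bas i) \<in> IZ 0" unfolding e by (rule zF)
    show "rep 0 lam (\<Sum>i\<in>?F0. cst (c i) * bas i)"
    proof (intro rep_sum rep_smult F0)
      fix i assume "i \<in> ?F0"
      then have "bas i = lam (fst i, snd (snd i))"
        unfolding lam_def bas_def case_prod_unfold using p_gt_0 by simp
      then show "rep 0 lam (bas i)" by (simp only: rep_base)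
    qed
  qed
  ultimately show "\<exists>z'\<in>polys (Zp p) (G 0). rep 0 lam (z - cst (of_nat p) * z')" by blast
qed

end

section \<open>The connecting homomorphism\<close>

lemma is_direct_sum_cong:
  assumes "\<And>i. i \<in> I \<Longrightarrow> H i = H' i" "is_direct_sum R M I H"
  shows "is_direct_sum R M I H'"
proof -
  have "PiE I H = PiE I H'" by (intro PiE_cong) (use assms(1) in simp)
  then show ?thesis using assms unfolding is_direct_sum_def by simp
qed

context cobar_basis_spanning begin

definition vf :: "int \<times> nat \<Rightarrow> pol" where "vf i = cst (1 / of_nat p ^ ex i) * lam i"

sublocale Q0: subring_on "polys UNIV (G 0)" by (rule subring_polys[OF subring_UNIV])
sublocale Q1: subring_on "polys UNIV (G 1)" by (rule subring_polys[OF subring_UNIV])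

lemma vf_G: "vf i \<in> polys UNIV (G 0)"
  unfolding vf_def by (intro Q0.mult_mem cst_mem_polys UNIV_I polys_Zp_UNIV lam_G)

lemma d_lam_G: "d 0 (lam i) \<in> polys UNIV (G 1)"
  using polys_Zp_UNIV[OF d_polys[OF lam_G]] by simp

lemma d_vf_G: "d 0 (vf i) \<in> polys UNIV (G 1)"
  unfolding vf_def d_smult by (intro Q1.mult_mem cst_mem_polys UNIV_I d_lam_G)

lemma d_vf: "i \<noteq> (0, 0) \<Longrightarrow> d 0 (vf i) - yc i \<in> IQ 1"
proof -
  assume i: "i \<noteq> (0, 0)"
  have "d 0 (vf i) - yc i = cst (1 / of_nat p ^ ex i) * (d 0 (lam i) - cst (of_nat p ^ ex i) * yc i)"
    using p_gt_0 by (simp add: vf_def d_smult right_diff_distrib mult.assoc[symmetric] cst.hom_mult[symmetric] cst.hom_one)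
  also have "\<dots> \<in> IQ 1" by (intro IQ.imult UNIV_I IZ_IQ yc_d[OF i])
  finally show ?thesis .
qed

definition B_pinf :: "pol set" where
  "B_pinf = {f + g |f g. f \<in> polys UNIV (G 0) \<and> f \<in> IQ 0 \<and> g \<in> polys (Zp p) (G 0)}"

lemma Ext_pinf_0:
  "Ext_pinf p N r m 0 = quot {f \<in> polys UNIV (G 0). d 0 f \<in>
     {f + g |f g. f \<in> polys UNIV (G 1) \<inter> IQ 1 \<and> g \<in> polys (Zp p) (G 1)}} B_pinf"
  unfolding Ext_pinf_def cohomology_def B_pinf_def by (simp add: null_UNIV cochains_def)

lemma zero_Ext_pinf_0: "zero (Ext_pinf p N r m 0) = B_pinf"
  unfolding Ext_pinf_0 quot_def by simp

lemma vf_class_mem: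
  assumes "i \<noteq> (0, 0)" shows "coset B_pinf (vf i) \<in> carrier (Ext_pinf p N r m 0)"
proof -
  have "d 0 (vf i) = (d 0 (vf i) - yc i) + yc i" by simp
  moreover have "d 0 (vf i) - yc i \<in> polys UNIV (G 1)"
    by (intro Q1.diff_mem d_vf_G polys_Zp_UNIV yc_G assms)
  ultimately have "d 0 (vf i) \<in> {f + g |f g. f \<in> polys UNIV (G 1) \<inter> IQ 1 \<and> g \<in> polys (Zp p) (G 1)}"
    using d_vf[OF assms] yc_G[OF assms] by blast
  then show ?thesis unfolding Ext_pinf_0 quot_def using vf_G by simp
qed

text \<open>Dividing \<open>d (lam i) = p^e yc i\<close> by \<open>p^e\<close> shows that the
  fraction has coboundary \<open>yc i\<close> rationally. Changing the representative by a null
  element and an integral cochain changes the result by a relation and an integral coboundary, which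
  is exactly the ambiguity \<open>BB\<close>.\<close>

lemma connecting_vf:
  assumes i: "i \<noteq> (0, 0)"
  shows "connecting p N r m 0 (coset B_pinf (vf i)) = coset BB (yc i)"
proof (intro equalityI subsetI)
  fix y assume "y \<in> connecting p N r m 0 (coset B_pinf (vf i))"
  then obtain f g where y: "y \<in> polys (Zp p) (G 1)" and f: "f \<in> IQ 0" and g: "g \<in> polys (Zp p) (G 0)"
    and fg: "d 0 (vf i + (f + g)) - y \<in> IQ 1"
    unfolding connecting_def coset_def B_pinf_def by (auto simp: null_UNIV cochains_def)
  have df: "d 0 f \<in> IQ 1" using d_IQ[OF f] by simp
  have dg: "d 0 g \<in> polys (Zp p) (G 1)" using d_polys[OF g] by simp
  let ?h = "y - yc i - d 0 g"
  have "?h = (d 0 (vf i) - yc i) + d 0 f - (d 0 (vf i + (f + g)) - y)" by (simp add: d_add)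
  also have "\<dots> \<in> IQ 1" by (intro IQ.iadd IQ.idiff d_vf[OF i] df fg)
  finally have "?h \<in> IQ 1" .
  moreover have h: "?h \<in> polys (Zp p) (G 1)" by (intro P1.diff_mem y yc_G[OF i] dg)
  ultimately have "?h \<in> IZ 1" using IQ_RZ polys_RZ by blast
  then have "?h + d 0 g \<in> BB" unfolding BB_def using h g by blast
  moreover have "y = yc i + (?h + d 0 g)" by simp
  ultimately show "y \<in> coset BB (yc i)" unfolding coset_def by blast
next
  fix y assume "y \<in> coset BB (yc i)"
  then obtain g z where gz: "g \<in> polys (Zp p) (G 1)" "g \<in> IZ 1" "z \<in> polys (Zp p) (G 0)" "y = yc i + (g + d 0 z)"
    unfolding coset_def BB_def by blast
  have dz: "d 0 z \<in> polys (Zp p) (G 1)" using d_polys[OF gz(3)] by simp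
  have y: "y \<in> polys (Zp p) (G 1)" unfolding gz(4) by (intro P1.add_mem yc_G[OF i] gz(1) dz)
  have "0 + z \<in> B_pinf" unfolding B_pinf_def using Q0.zero_mem IQ.izero gz(3) by blast
  then have x: "vf i + (0 + z) \<in> coset B_pinf (vf i)" unfolding coset_def by blast
  have e: "d 0 (vf i + (0 + z)) - y = (d 0 (vf i) - yc i) - g" by (simp add: gz(4) d_add)
  have "d 0 (vf i + (0 + z)) - y \<in> polys UNIV (G 1) \<inter> IQ 1"
    unfolding e
    by (intro IntI IQ.idiff d_vf[OF i] IZ_IQ[OF gz(2)] Q1.diff_mem d_vf_G polys_Zp_UNIV yc_G[OF i] gz(1))
  then show "y \<in> connecting p N r m 0 (coset B_pinf (vf i))"
    unfolding connecting_def using x y by (auto simp: null_UNIV cochains_def)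
qed

end

text \<open>The isomorphism \<open>\<phi>\<close> is the one obtained from the common presentation,
  matching the divided coboundaries on the two sides. Orders are recorded as cardinalities: a cyclic
  \<open>Z_(p)\<close>-module with \<open>p^e\<close> elements is \<open>Z_(p)/p^e\<close>.\<close>

theorem proposition1p2:
  fixes p :: nat
  assumes "prime p" and "odd p"
  defines "J \<equiv> {(a :: int, b :: nat). (a, b) \<noteq> (0, 0)}"
  shows "(\<exists>f. f \<in> mod_iso (Zloc p) (E2_term p 0) (Zloc p)) \<and>
    (\<forall>(a, b)\<in>J. vfrac p a b \<in> carrier (Ext_Sigma_pinf p 0) \<and>
                 delta_Sigma p (vfrac p a b) \<in> carrier (Ext_Sigma p 1)) \<and>
    (\<exists>\<phi>\<in>mod_iso (Zloc p) (Ext_Sigma p 1) (E2_term p 1).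
       (\<forall>(a, b)\<in>J. card (cyclic_submodule (Zloc p) (E2_term p 1) (\<phi> (delta_Sigma p (vfrac p a b))))
                    = p ^ expo p a b) \<and>
       is_direct_sum (Zloc p) (E2_term p 1) J
         (\<lambda>(a, b). cyclic_submodule (Zloc p) (E2_term p 1) (\<phi> (delta_Sigma p (vfrac p a b)))))"
proof -
  interpret A: cobar_T1 p 2 0 1 by unfold_locales (use assms(1,2) in auto)
  interpret B: cobar_Sigma p 3 1 0 by unfold_locales (use assms(1,2) in auto)
  have J: "i \<in> J \<longleftrightarrow> i \<noteq> (0, 0)" for i unfolding J_def by (cases i) auto
  have vfrac: "vfrac p a b = coset B.B_pinf (B.vf (a, b))" for a b
    unfolding vfrac_def Ext_Sigma_pinf_def B.zero_Ext_pinf_0 B.vf_def B.lam_eq B.Pv_def B.ex_def fst_conv snd_conv mult.assoc ..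
  have delta: "delta_Sigma p (vfrac p a b) = coset B.BB (B.yc (a, b))" if "(a, b) \<in> J" for a b
    unfolding delta_Sigma_def vfrac by (rule B.connecting_vf) (use that J in blast)
  note A = A.presented_H1[folded J_def] and B = B.presented_H1[folded J_def]
  interpret A1: presented p A.ZZ A.BB J A.yc A.ex by (rule A)
  interpret B1: presented p B.ZZ B.BB J B.yc B.ex by (rule B)
  obtain \<phi> where \<phi>: "\<phi> \<in> mod_iso (Zloc p) (Ext_Sigma p 1) (E2_term p 1)"
    "\<And>i. i \<in> J \<Longrightarrow> \<phi> (coset B.BB (B.yc i)) = coset A.BB (A.yc i)"
    using presented_iso[OF B A] unfolding Ext_Sigma_def E2_term_def A.Ext_1 B.Ext_1
    by blast
  have cyc: "cyclic_submodule (Zloc p) (E2_term p 1) (\<phi> (delta_Sigma p (vfrac p a b))) = A1.cyc (a, b)"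
    if "(a, b) \<in> J" for a b
    unfolding delta[OF that] \<phi>(2)[OF that] E2_term_def A.Ext_1 A1.cyc_def ..
  have 1: "\<exists>f. f \<in> mod_iso (Zloc p) (E2_term p 0) (Zloc p)" unfolding E2_term_def by (rule A.Ext_0)
  have 2: "vfrac p a b \<in> carrier (Ext_Sigma_pinf p 0) \<and> delta_Sigma p (vfrac p a b) \<in> carrier (Ext_Sigma p 1)"
    if "(a, b) \<in> J" for a b
  proof
    show "vfrac p a b \<in> carrier (Ext_Sigma_pinf p 0)"
      unfolding vfrac Ext_Sigma_pinf_def by (rule B.vf_class_mem) (use that J in blast)
    show "delta_Sigma p (vfrac p a b) \<in> carrier (Ext_Sigma p 1)"
      unfolding delta[OF that] Ext_Sigma_def B.Ext_1 B1.carrier_M by (intro imageI B1.g_mem that)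
  qed
  have 3: "card (cyclic_submodule (Zloc p) (E2_term p 1) (\<phi> (delta_Sigma p (vfrac p a b)))) = p ^ expo p a b"
    if "(a, b) \<in> J" for a b
    unfolding cyc[OF that] A1.card_cyc[OF that] A.ex_def by simp
  have "is_direct_sum (Zloc p) (E2_term p 1) J A1.cyc"
    using A1.direct_sum unfolding E2_term_def A.Ext_1 .
  then have 4: "is_direct_sum (Zloc p) (E2_term p 1) J
      (\<lambda>(a, b). cyclic_submodule (Zloc p) (E2_term p 1) (\<phi> (delta_Sigma p (vfrac p a b))))"
  proof (rule is_direct_sum_cong[rotated])
    fix i assume "i \<in> J"
    then show "A1.cyc i = (case i of (a, b) \<Rightarrow> cyclic_submodule (Zloc p) (E2_term p 1) (\<phi> (delta_Sigma p (vfrac p a b))))"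
      using cyc[of "fst i" "snd i"] by (simp only: case_prod_unfold prod.collapse)
  qed
  show ?thesis
  proof (intro conjI bexI[of _ \<phi>] 1 4 \<phi>(1); rule ballI; unfold case_prod_unfold)
    fix i assume "i \<in> J"
    then have i: "(fst i, snd i) \<in> J" by simp
    show "vfrac p (fst i) (snd i) \<in> carrier (Ext_Sigma_pinf p 0) \<and>
        delta_Sigma p (vfrac p (fst i) (snd i)) \<in> carrier (Ext_Sigma p 1)" by (rule 2[OF i])
    show "card (cyclic_submodule (Zloc p) (E2_term p 1) (\<phi> (delta_Sigma p (vfrac p (fst i) (snd i))))) =
        p ^ expo p (fst i) (snd i)" by (rule 3[OF i])
  qed
qed

end
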